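(* Let $m>0$ and let $V\in L^1(\mathbb{R},\mathbb{C}^{2\times2};d\nu_2)$. For $z\in\mathbb{C}$ let $$\Upsilon_z=\frac{1}{2(4|z|^2+m^2)}\begin{pmatrix}-(2z+m)^2 & i(4z^2-m^2)\\ i(4z^2-m^2) & (2z-m)^2\end{pmatrix}\in\mathbb{C}^{2\times2}.$$ Then, in the regime $|\epsilon|\to0$ ($\epsilon\in\mathbb{C}$), $$\mathrm{Spec}_{\mathrm{dis}}(\mathscr{L}_{m,\epsilon V})\subset\left\{z\in\mathbb{C}:|\mathrm{Im}\,z|<1,\ \mathrm{Re}\,z\ne0,\ \frac{4m}{4|z|^2+m^2}=W_z(\epsilon)\right\},$$ where $$W_z(\epsilon)=\epsilon\int_{\mathbb{R}}e^{-2\left(|x|+i\left(z-\frac{m^2}{2\,\mathrm{Re}\,z}\right)x\right)}\langle V(x),\overline{\Upsilon_z}\rangle_{\mathrm F}\,dx+\mathcal{O}(\epsilon^2).$$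
   Context: $d\nu_2(x)=(1+x^2)\,dx$, and $V\in L^1(\mathbb{R},\mathbb{C}^{2\times2};d\nu_2)$ means $\int_{\mathbb{R}}|V(x)|_{\mathbb{C}^{2\times2}}(1+x^2)\,dx<\infty$. $\langle X,Y\rangle_{\mathrm F}=\sum_{i,j}X_{ij}\overline{Y_{ij}}$ is the Frobenius inner product, so $\langle V(x),\overline{\Upsilon_z}\rangle_{\mathrm F}=\sum_{i,j}V_{ij}(x)(\Upsilon_z)_{ij}$. The $\mathcal{O}(\epsilon^2)$ is uniform in $z$: that is, the assertion means that there are constants $K,\epsilon_0>0$ (depending on $m$ and $V$) such that, if $0<|\epsilon|<\epsilon_0$, every $z\in\mathrm{Spec}_{\mathrm{dis}}(\mathscr{L}_{m,\epsilon V})$ lies in the displayed set with the difference between $W_z(\epsilon)$ and the displayed integral term bounded in modulus by $K|\epsilon|^2$. $\mathrm{Spec}_{\mathrm{dis}}(\mathscr{L})$ is the set of isolated eigenvalues of $\mathscr{L}$ whose Riesz projector has finite-dimensional range. $\mathscr{L}_m:H^1(\mathbb{R},\mathbb{C}^2)\to L^2(\mathbb{R},\mathbb{C}^2)$ is $(\mathscr{L}_m f)(x)=\begin{pmatrix} m & -\partial_x\\ \partial_x & -m\end{pmatrix}f(x)+i\,\mathrm{sgn}(x)f(x)$. For a matrix potential $W\in L^1$ with $\|W\|_{L^1}<1$ (here $W=\epsilon V$), $\mathscr{L}_{m,W}$ is the following closed densely defined extension of $\mathscr{L}_m+W$ (defined on $H^1(\mathbb{R},\mathbb{C}^2)\cap\mathrm{Dom}(W)$):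 write $W(x)=U(x)|W(x)|$ (polar decomposition), $A(x)=|W(x)|^{1/2}$, $B(x)=U(x)|W(x)|^{1/2}$ (maximal multiplication operators), $R_0(z)=(\mathscr{L}_m-z)^{-1}$, $Q(z)=\overline{AR_0(z)B}$ for $z\in\rho(\mathscr{L}_m)$; $\mathscr{L}_{m,W}$ is the closed operator whose resolvent is $R_0(z)-\overline{R_0(z)B}\,(I+Q(z))^{-1}AR_0(z)$ for every $z\in\rho(\mathscr{L}_m)$ with $-1\in\rho(Q(z))$ (a non-empty set). *)

theory Defs
  imports "HOL-Complex_Analysis.Complex_Analysis"
begin

definition square_integrable :: "(real \<Rightarrow> complex^2) \<Rightarrow> bool" where
  "square_integrable f \<longleftrightarrow>
     f \<in> borel_measurable lborel \<and> integrable lborel (\<lambda>x. (norm (f x))\<^sup>2)"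

lemma square_integrable_zero: "square_integrable (\<lambda>_. 0)"
  by (simp add: square_integrable_def)

lemma square_integrable_add:
  assumes "square_integrable f" "square_integrable g"
  shows "square_integrable (\<lambda>x. f x + g x)"
proof -
  have [measurable]: "f \<in> borel_measurable lborel" "g \<in> borel_measurable lborel"
    using assms by (auto simp: square_integrable_def)
  have le: "(norm (a + b))\<^sup>2 \<le> 2 * (norm a)\<^sup>2 + 2 * (norm b)\<^sup>2" for a b :: "complex^2"
  proof -
    have "(norm (a + b))\<^sup>2 \<le> (norm a + norm b)\<^sup>2"
      by (intro power_mono norm_triangle_ineq) auto
    also have "\<dots> \<le> 2 * (norm a)\<^sup>2 + 2 * (norm b)\<^sup>2"
      using zero_le_power2[of "norm a - norm b"] by (simp add: power2_sum power2_diff)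
    finally show ?thesis .
  qed
  have "integrable lborel (\<lambda>x. 2 * (norm (f x))\<^sup>2 + 2 * (norm (g x))\<^sup>2)"
    using assms by (auto simp: square_integrable_def)
  then have "integrable lborel (\<lambda>x. (norm (f x + g x))\<^sup>2)"
    by (rule Bochner_Integration.integrable_bound) (use le in auto)
  then show ?thesis
    by (simp add: square_integrable_def)
qed

lemma borel_measurable_smult_vec:
  assumes "f \<in> borel_measurable M"
  shows "(\<lambda>x. (c::complex) *s (f x :: complex^2)) \<in> borel_measurable M"
proof -
  have "linear (\<lambda>v::complex^2. c *s v)"
    by (intro linearI) (simp_all add: vec_eq_iff algebra_simps)
  then have "continuous_on UNIV (\<lambda>v::complex^2. c *s v)"
    by (rule linear_continuous_on[OF linear_linear[THEN iffD2]])
  then show ?thesis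
    using assms by (rule borel_measurable_continuous_on)
qed

lemma norm_smult_vec: "norm ((c::complex) *s (v::complex^2)) = norm c * norm v"
  by (simp add: norm_vec_def norm_mult L2_set_right_distrib)

lemma square_integrable_smult:
  assumes "square_integrable f"
  shows "square_integrable (\<lambda>x. c *s f x)"
  using assms borel_measurable_smult_vec[of f lborel c]
  by (auto simp: square_integrable_def norm_smult_vec power_mult_distrib)

lemma scaleR_eq_smult_vec: "r *\<^sub>R (v::complex^2) = complex_of_real r *s v"
  by (simp only: vec_eq_iff vector_scaleR_component vector_smult_component) (simp add: scaleR_conv_of_real)

lemma square_integrable_scaleR:
  assumes "square_integrable f"
  shows "square_integrable (\<lambda>x. r *\<^sub>R f x)"
  using square_integrable_smult[OF assms] by (simp add: scaleR_eq_smult_vec)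

lemma integrable_inner_square_integrable:
  assumes "square_integrable f" "square_integrable g"
  shows "integrable lborel (\<lambda>x. f x \<bullet> g x)"
proof -
  have [measurable]: "f \<in> borel_measurable lborel" "g \<in> borel_measurable lborel"
    using assms by (auto simp: square_integrable_def)
  have le: "\<bar>a \<bullet> b\<bar> \<le> (norm a)\<^sup>2 + (norm b)\<^sup>2" for a b :: "complex^2"
  proof -
    have "\<bar>a \<bullet> b\<bar> \<le> norm a * norm b"
      by (rule Cauchy_Schwarz_ineq2)
    also have "\<dots> \<le> (norm a)\<^sup>2 + (norm b)\<^sup>2"
      using sum_squares_bound[of "norm a" "norm b"] mult_nonneg_nonneg[OF norm_ge_zero norm_ge_zero, of a b]
      unfolding mult.assoc by linarith
    finally show ?thesis .
  qed
  have "integrable lborel (\<lambda>x. (norm (f x))\<^sup>2 + (norm (g x))\<^sup>2)"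
    using assms by (auto simp: square_integrable_def)
  then show ?thesis
    by (rule Bochner_Integration.integrable_bound) (use le in auto)
qed

quotient_type l2 = "real \<Rightarrow> complex^2" /
  partial: "\<lambda>f g. square_integrable f \<and> square_integrable g \<and> (AE x in lborel. f x = g x)"
proof (rule part_equivpI)
  show "\<exists>f. square_integrable f \<and> square_integrable f \<and> (AE x in lborel. f x = f x)"
    using square_integrable_zero by auto
  show "symp (\<lambda>f g. square_integrable f \<and> square_integrable g \<and> (AE x in lborel. f x = g x))"
    by (auto intro!: sympI elim: eventually_mono)
  show "transp (\<lambda>f g. square_integrable f \<and> square_integrable g \<and> (AE x in lborel. f x = g x))"
    by (auto intro!: transpI elim: eventually_elim2)
qed

text \<open>The inner product of class \<^class>\<open>real_inner\<close> is the real part of the usual complex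
  one; the norm it induces is the usual norm of \<open>L\<^sup>2(\<real>, \<complex>\<^sup>2)\<close>.\<close>

instantiation l2 :: real_inner
begin

lift_definition zero_l2 :: l2 is "\<lambda>_. 0"
  by (simp add: square_integrable_zero)

lift_definition plus_l2 :: "l2 \<Rightarrow> l2 \<Rightarrow> l2" is "\<lambda>f g x. f x + g x"
  by (auto intro: square_integrable_add)

lift_definition scaleR_l2 :: "real \<Rightarrow> l2 \<Rightarrow> l2" is "\<lambda>r f x. r *\<^sub>R f x"
  by (auto intro: square_integrable_scaleR)

lift_definition uminus_l2 :: "l2 \<Rightarrow> l2" is "\<lambda>f x. - f x"
  using square_integrable_scaleR[of _ "-1"] by auto

lift_definition minus_l2 :: "l2 \<Rightarrow> l2 \<Rightarrow> l2" is "\<lambda>f g x. f x - g x"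
  using square_integrable_add[OF _ square_integrable_scaleR[of _ "-1"]] by auto

lift_definition inner_l2 :: "l2 \<Rightarrow> l2 \<Rightarrow> real" is "\<lambda>f g. LINT x|lborel. f x \<bullet> g x"
proof -
  fix f f' g g' :: "real \<Rightarrow> complex^2"
  assume f: "square_integrable f \<and> square_integrable f' \<and> (AE x in lborel. f x = f' x)"
    and g: "square_integrable g \<and> square_integrable g' \<and> (AE x in lborel. g x = g' x)"
  from f g have "AE x in lborel. f x = f' x" "AE x in lborel. g x = g' x"
    by auto
  then have "AE x in lborel. f x \<bullet> g x = f' x \<bullet> g' x"
    by eventually_elim simp
  with f g show "(LINT x|lborel. f x \<bullet> g x) = (LINT x|lborel. f' x \<bullet> g' x)"
    by (intro integral_cong_AE borel_measurable_inner) (auto simp: square_integrable_def)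
qed

definition norm_l2 :: "l2 \<Rightarrow> real" where "norm_l2 f = sqrt (inner f f)"
definition sgn_l2 :: "l2 \<Rightarrow> l2" where "sgn_l2 f = inverse (norm f) *\<^sub>R f"
definition dist_l2 :: "l2 \<Rightarrow> l2 \<Rightarrow> real" where "dist_l2 f g = norm (f - g)"
definition uniformity_l2 :: "(l2 \<times> l2) filter" where
  "uniformity_l2 = (INF e\<in>{0<..}. principal {(x, y). dist x y < e})"
definition open_l2 :: "l2 set \<Rightarrow> bool" where
  "open_l2 U \<longleftrightarrow> (\<forall>x\<in>U. \<forall>\<^sub>F (x', y) in uniformity. x' = x \<longrightarrow> y \<in> U)"

instance
proof
  fix f g h :: l2 and r s :: real and U :: "l2 set"
  note si = square_integrable_add square_integrable_scaleR square_integrable_zero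
  have neg: "square_integrable (\<lambda>x. - u x)" if "square_integrable u" for u
    using square_integrable_scaleR[OF that, of "-1"] by simp
  have diff: "square_integrable (\<lambda>x. u x - v x)"
    if "square_integrable u" "square_integrable v" for u v
    using square_integrable_add[OF that(1) neg[OF that(2)]] by simp
  show "f + g + h = f + (g + h)"
    by transfer (simp add: si add.assoc)
  show "f + g = g + f"
    by transfer (simp add: si add.commute)
  show "0 + f = f"
    by transfer (simp add: si)
  show "- f + f = 0"
    by transfer (simp add: si)
  show "f - g = f + - g"
    by transfer (simp add: si neg diff)
  show "r *\<^sub>R (f + g) = r *\<^sub>R f + r *\<^sub>R g"
    by transfer (simp add: si scaleR_add_right)
  show "(r + s) *\<^sub>R f = r *\<^sub>R f + s *\<^sub>R f"
    by transfer (simp add: si scaleR_add_left)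
  show "r *\<^sub>R s *\<^sub>R f = (r * s) *\<^sub>R f"
    by transfer (simp add: si)
  show "1 *\<^sub>R f = f"
    by transfer simp
  show "inner f g = inner g f"
    by transfer (simp add: inner_commute)
  show "inner (f + g) h = inner f h + inner g h"
    by transfer (simp add: inner_add_left integrable_inner_square_integrable)
  show "inner (r *\<^sub>R f) g = r * inner f g"
    by transfer simp
  show "0 \<le> inner f f"
    by transfer simp
  show "inner f f = 0 \<longleftrightarrow> f = 0"
    by transfer
      (simp add: integral_nonneg_eq_0_iff_AE integrable_inner_square_integrable si)
  show "norm f = sqrt (inner f f)" "sgn f = inverse (norm f) *\<^sub>R f" "dist f g = norm (f - g)"
    "uniformity = (INF e\<in>{0<..}. principal {(x, y :: l2). dist x y < e})"
    "open U \<longleftrightarrow> (\<forall>x\<in>U. \<forall>\<^sub>F (x', y) in uniformity. x' = x \<longrightarrow> y \<in> U)"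
    by (simp_all add: norm_l2_def sgn_l2_def dist_l2_def uniformity_l2_def open_l2_def)
qed

end

lift_definition scaleC :: "complex \<Rightarrow> l2 \<Rightarrow> l2" (infixr \<open>*\<^sub>C\<close> 75) is "\<lambda>c f x. c *s f x"
  by (auto intro: square_integrable_smult)

text \<open>An operator in \<open>L\<^sup>2(\<real>, \<complex>\<^sup>2)\<close> is represented by its graph, a set of pairs \<open>(f, T f)\<close>.
  Sums and products of operators have their natural domains; note that \<^term>\<open>S O T\<close> is the
  product \<open>T S\<close> (first \<open>S\<close>, then \<open>T\<close>).\<close>

type_synonym op_graph = "(l2 \<times> l2) set"

definition linear_op :: "op_graph \<Rightarrow> bool" where
  "linear_op T \<longleftrightarrow> single_valued T \<and> (0, 0) \<in> T \<and>
     (\<forall>f g f' g'. (f, g) \<in> T \<longrightarrow> (f', g') \<in> T \<longrightarrow> (f + f', g + g') \<in> T) \<and>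
     (\<forall>c f g. (f, g) \<in> T \<longrightarrow> (c *\<^sub>C f, c *\<^sub>C g) \<in> T)"

definition closed_op :: "op_graph \<Rightarrow> bool" where
  "closed_op T \<longleftrightarrow> linear_op T \<and> closed T"

definition op_diff :: "op_graph \<Rightarrow> op_graph \<Rightarrow> op_graph" where
  "op_diff S T = {(f, g - h) | f g h. (f, g) \<in> S \<and> (f, h) \<in> T}"

definition scalar_op :: "complex \<Rightarrow> op_graph" where
  "scalar_op z = {(f, z *\<^sub>C f) | f. True}"

definition graph_of :: "(l2 \<Rightarrow>\<^sub>L l2) \<Rightarrow> op_graph" where
  "graph_of F = {(f, blinfun_apply F f) | f. True}"

definition resolvent :: "op_graph \<Rightarrow> complex \<Rightarrow> op_graph" where
  "resolvent T z = (op_diff T (scalar_op z))\<inverse>"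

definition resolvent_set :: "op_graph \<Rightarrow> complex set" where
  "resolvent_set T = {z. \<exists>F. resolvent T z = graph_of F}"

definition spectrum :: "op_graph \<Rightarrow> complex set" where
  "spectrum T = - resolvent_set T"

definition eigenvalue :: "op_graph \<Rightarrow> complex \<Rightarrow> bool" where
  "eigenvalue T z \<longleftrightarrow> (\<exists>f. f \<noteq> 0 \<and> (f, z *\<^sub>C f) \<in> T)"

definition resolvent_fun :: "op_graph \<Rightarrow> complex \<Rightarrow> l2 \<Rightarrow> l2" where
  "resolvent_fun T z f = (THE u. (f, u) \<in> resolvent T z)"

text \<open>\<open>- 1 / (2 \<pi> \<i>) \<ointegral> (T - w)\<^sup>-\<^sup>1 f dw\<close> over the circle of radius \<open>r\<close> around \<open>z\<close>; the integral is
  written out because \<^const>\<open>contour_integral\<close> is restricted to complex-valued integrands.\<close>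
definition riesz_projector :: "op_graph \<Rightarrow> complex \<Rightarrow> real \<Rightarrow> l2 \<Rightarrow> l2" where
  "riesz_projector T z r f =
     (- 1 / (2 * of_real pi * \<i>)) *\<^sub>C
       integral {0..1} (\<lambda>t. vector_derivative (circlepath z r) (at t within {0..1}) *\<^sub>C
                            resolvent_fun T (circlepath z r t) f)"

text \<open>The Riesz projector is the same for every circle that isolates \<open>z\<close> from the rest of the
  spectrum. The real \<^const>\<open>span\<close> suffices: a complex subspace has finite complex dimension
  iff it has finite real dimension.\<close>
definition discrete_spectrum :: "op_graph \<Rightarrow> complex set" where
  "discrete_spectrum T =
     {z. eigenvalue T z \<and>
         (\<exists>r>0. cball z r \<inter> spectrum T = {z} \<and>
                (\<exists>B. finite B \<and> range (riesz_projector T z r) \<subseteq> span B))}"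

definition test_function :: "(real \<Rightarrow> real) \<Rightarrow> bool" where
  "test_function \<phi> \<longleftrightarrow> (\<forall>k x. (deriv ^^ k) \<phi> field_differentiable at x) \<and>
     compact (closure {x. \<phi> x \<noteq> 0})"

text \<open>\<^const>\<open>rep_l2\<close> chooses a representative of the class; integrals and statements holding
  almost everywhere do not depend on this choice. The Sobolev space \<open>H\<^sup>1(\<real>, \<complex>\<^sup>2)\<close> consists of
  the \<open>f\<close> that have a weak derivative \<open>f'\<close> in \<open>L\<^sup>2\<close>.\<close>
definition weak_deriv :: "l2 \<Rightarrow> l2 \<Rightarrow> bool" where
  "weak_deriv f f' \<longleftrightarrow> (\<forall>\<phi>. test_function \<phi> \<longrightarrow>
     (LINT x|lborel. deriv \<phi> x *\<^sub>R rep_l2 f x) = - (LINT x|lborel. \<phi> x *\<^sub>R rep_l2 f' x))"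

definition L_op :: "real \<Rightarrow> op_graph" where
  "L_op m = {(f, g). \<exists>f'. weak_deriv f f' \<and>
     (AE x in lborel. rep_l2 g x =
        vector [of_real m * rep_l2 f x $ 1 - rep_l2 f' x $ 2,
                rep_l2 f' x $ 1 - of_real m * rep_l2 f x $ 2]
        + (\<i> * of_real (sgn x)) *s rep_l2 f x)}"

definition adj :: "complex^2^2 \<Rightarrow> complex^2^2" where
  "adj M = transpose (map_matrix cnj M)"

text \<open>On \<^typ>\<open>complex^2\<close> the inner product \<open>v \<bullet> w\<close> is the real part of the complex one.\<close>
definition psd :: "complex^2^2 \<Rightarrow> bool" where
  "psd M \<longleftrightarrow> adj M = M \<and> (\<forall>v. 0 \<le> (M *v v) \<bullet> v)"

definition msqrt :: "complex^2^2 \<Rightarrow> complex^2^2" where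
  "msqrt M = (THE S. psd S \<and> S ** S = M)"

definition mabs :: "complex^2^2 \<Rightarrow> complex^2^2" where
  "mabs M = msqrt (adj M ** M)"

text \<open>The kernel condition makes the partial isometry unique. A different convention for it
  (unitary, say) would not change \<open>U |W|\<^sup>1\<^sup>/\<^sup>2\<close>, the only place where it enters.\<close>
definition polar_isometry :: "complex^2^2 \<Rightarrow> complex^2^2" where
  "polar_isometry M = (THE U. M = U ** mabs M \<and> U ** adj U ** U = U \<and>
                              (\<forall>v. U *v v = 0 \<longleftrightarrow> M *v v = 0))"

definition mult_op :: "(real \<Rightarrow> complex^2^2) \<Rightarrow> op_graph" where
  "mult_op M = {(f, g). AE x in lborel. rep_l2 g x = M x *v rep_l2 f x}"

definition A_op :: "(real \<Rightarrow> complex^2^2) \<Rightarrow> op_graph" where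
  "A_op W = mult_op (\<lambda>x. msqrt (mabs (W x)))"

definition B_op :: "(real \<Rightarrow> complex^2^2) \<Rightarrow> op_graph" where
  "B_op W = mult_op (\<lambda>x. polar_isometry (W x) ** msqrt (mabs (W x)))"

abbreviation R0 :: "real \<Rightarrow> complex \<Rightarrow> op_graph" where
  "R0 m z \<equiv> resolvent (L_op m) z"

definition Q_op :: "real \<Rightarrow> (real \<Rightarrow> complex^2^2) \<Rightarrow> complex \<Rightarrow> op_graph" where
  "Q_op m W z = closure (B_op W O R0 m z O A_op W)"

text \<open>In operator order: \<open>R\<^sub>0(z) - closure (R\<^sub>0(z) B) (I + Q(z))\<^sup>-\<^sup>1 A R\<^sub>0(z)\<close>.\<close>
definition perturbed_resolvent ::
    "real \<Rightarrow> (real \<Rightarrow> complex^2^2) \<Rightarrow> complex \<Rightarrow> op_graph" where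
  "perturbed_resolvent m W z =
     op_diff (R0 m z)
       ((R0 m z O A_op W) O resolvent (Q_op m W z) (- 1) O closure (B_op W O R0 m z))"

text \<open>For \<open>W \<in> L\<^sup>1\<close> with small norm, some \<open>z\<close> is admissible, so that the resolvent formula
  determines \<open>T\<close>.\<close>
definition L_pert :: "real \<Rightarrow> (real \<Rightarrow> complex^2^2) \<Rightarrow> op_graph" where
  "L_pert m W = (THE T. closed_op T \<and>
     (\<forall>z \<in> resolvent_set (L_op m). - 1 \<in> resolvent_set (Q_op m W z) \<longrightarrow>
        z \<in> resolvent_set T \<and> resolvent T z = perturbed_resolvent m W z))"

definition nu2 :: "real measure" where
  "nu2 = density lborel (\<lambda>x. ennreal (1 + x\<^sup>2))"

definition frobenius_inner :: "complex^2^2 \<Rightarrow> complex^2^2 \<Rightarrow> complex" where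
  "frobenius_inner X Y = (\<Sum>i\<in>UNIV. \<Sum>j\<in>UNIV. X $ i $ j * cnj (Y $ i $ j))"

definition Upsilon :: "real \<Rightarrow> complex \<Rightarrow> complex^2^2" where
  "Upsilon m z = map_matrix (\<lambda>a. a / of_real (2 * (4 * (cmod z)\<^sup>2 + m\<^sup>2)))
     (vector [vector [- (2 * z + of_real m)\<^sup>2, \<i> * (4 * z\<^sup>2 - of_real (m\<^sup>2))],
              vector [\<i> * (4 * z\<^sup>2 - of_real (m\<^sup>2)), (2 * z - of_real m)\<^sup>2]])"

definition W_integral :: "real \<Rightarrow> (real \<Rightarrow> complex^2^2) \<Rightarrow> complex \<Rightarrow> complex" where
  "W_integral m V z =
     (LINT x|lborel.
        exp (- 2 * (of_real \<bar>x\<bar> + \<i> * (z - of_real (m\<^sup>2 / (2 * Re z))) * of_real x))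
        * frobenius_inner (V x) (map_matrix cnj (Upsilon m z)))"

end

theory Submission
  imports Defs
begin

text \<open>This is an application of the Birman--Schwinger principle. Write \<open>W = \<epsilon> V = B A\<close> with
  \<open>A = \<bar>W\<bar>\<^sup>1\<^sup>/\<^sup>2\<close>. The lines \<open>Im z = \<plusminus> 1\<close>, \<open>\<bar>Re z\<bar> \<ge> m\<close> are the spectrum of the unperturbed operator. Off
  these lines, \<open>z\<close> belongs to the spectrum of the perturbed operator only if \<open>1 + Q(z)\<close> is not
  invertible, where \<open>Q(z)\<close> has the kernel \<open>A(x) G(x, y) B(y)\<close> and \<open>G\<close> is the Green kernel. So the
  question is how large \<open>G\<close> is, uniformly in \<open>z\<close>.

  On each half line the coefficients are constant, and \<open>G\<close> is explicit (\<open>green\<close>). Away from the region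
  \<open>\<bar>Im z\<bar> < 1\<close>, \<open>\<bar>Re z\<bar> \<ge> m + 1\<close> its entries are bounded by \<open>C (1 + \<bar>x\<bar>) (1 + \<bar>y\<bar>)\<close>, the growth being
  due to the branch points \<open>\<plusminus> m \<plusminus> \<i>\<close> (\<open>green_bounded\<close>); this is why the weight \<open>1 + x\<^sup>2\<close> is required of
  \<open>V\<close>. For small \<open>\<epsilon>\<close>, \<open>1 + Q(z)\<close> is then invertible by a Neumann series (\<open>invertible_away_from_strip\<close>).
  In the strip the kernel is of size \<open>\<bar>z\<bar>\<^sup>2\<close>, but all of the growth is in a rank one term: up to an
  error bounded as before, \<open>G(x, y)\<close> equals \<open>- (8 m)\<^sup>-\<^sup>1 u u\<^sup>T e(x) e(y)\<close> with \<open>u = (\<i> (2 z + m), 2 z - m)\<close>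
  and \<open>e(x) = exp (- \<bar>x\<bar> - \<i> (z - m\<^sup>2 / (2 Re z)) x)\<close> (\<open>green_strip\<close>). Since \<open>u u\<^sup>T\<close> is a multiple of
  \<open>\<Upsilon>\<^sub>z\<close>, the Sherman--Morrison formula turns the failure of invertibility into the asserted equation,
  with a remainder of second order in \<open>\<epsilon>\<close> (\<open>strip_equation\<close>).

  The points of the two lines themselves are excluded because they all stay in the spectrum, and so
  none of them is isolated (\<open>lines_in_spectrum\<close>): wave packets that move to infinity along a half line
  do not feel the perturbation.

  The operators are given by closures, polar decompositions and a definite description, so they have
  to be identified first. The square root and the polar decomposition of a two-by-two matrix have
  closed forms (\<open>polar_isometry_eq\<close>), which are measurable in the matrix. The integral operator with
  kernel \<open>G\<close> is the resolvent of the unperturbed operator (\<open>resolvent_L_op\<close>): it solves the equation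
  weakly, and solutions are unique because an \<open>H\<^sup>1\<close> function has an absolutely continuous
  representative, to which the theory of ordinary differential equations applies. The perturbed
  resolvents satisfy the resolvent equation, so they belong to exactly one closed operator
  (\<open>L_pert_properties\<close>).\<close>

no_notation fps_nth (infixl \<open>$\<close> 75)

section \<open>The Hilbert space of square-integrable functions\<close>

lemma square_integrable_rep: "square_integrable (rep_l2 f)"
  using Quotient_rep_reflp[OF Quotient_l2, of f] by auto

lemma borel_measurable_rep [measurable]: "rep_l2 f \<in> borel_measurable borel"
  using square_integrable_rep[of f] by (simp add: square_integrable_def)

lemma integrable_norm_rep_sq: "integrable lborel (\<lambda>x. (norm (rep_l2 f x))\<^sup>2)"
  using square_integrable_rep[of f] by (simp add: square_integrable_def)

lemma rep_abs_l2:
  assumes "square_integrable f"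
  shows "AE x in lborel. rep_l2 (abs_l2 f) x = f x"
proof -
  show ?thesis
    using Quotient_rep_abs[OF Quotient_l2, of f] assms by auto
qed

lemma l2_eqI:
  assumes "AE x in lborel. rep_l2 f x = rep_l2 g x"
  shows "f = g"
  using Quotient_rel_rep[OF Quotient_l2, of f g] square_integrable_rep assms by auto

lemma abs_rep_l2 [simp]: "abs_l2 (rep_l2 f) = f"
  using Quotient_abs_rep[OF Quotient_l2] .

lemma rep_zero: "AE x in lborel. rep_l2 0 x = 0"
  unfolding zero_l2_def by (rule rep_abs_l2[OF square_integrable_zero])

lemma rep_add: "AE x in lborel. rep_l2 (f + g) x = rep_l2 f x + rep_l2 g x"
proof -
  have "f + g = abs_l2 (\<lambda>x. rep_l2 f x + rep_l2 g x)"
    using plus_l2.abs_eq[of "rep_l2 f" "rep_l2 g"] square_integrable_rep by simp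
  then show ?thesis
    using rep_abs_l2[OF square_integrable_add[OF square_integrable_rep square_integrable_rep]] by simp
qed

lemma rep_scaleR: "AE x in lborel. rep_l2 (r *\<^sub>R f) x = r *\<^sub>R rep_l2 f x"
proof -
  have "r *\<^sub>R f = abs_l2 (\<lambda>x. r *\<^sub>R rep_l2 f x)"
    using scaleR_l2.abs_eq[of "rep_l2 f" r] square_integrable_rep by simp
  then show ?thesis
    using rep_abs_l2[OF square_integrable_scaleR[OF square_integrable_rep]] by simp
qed

lemma rep_scaleC: "AE x in lborel. rep_l2 (c *\<^sub>C f) x = c *s rep_l2 f x"
proof -
  have "c *\<^sub>C f = abs_l2 (\<lambda>x. c *s rep_l2 f x)"
    using scaleC.abs_eq[of "rep_l2 f" c] square_integrable_rep by simp
  then show ?thesis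
    using rep_abs_l2[OF square_integrable_smult[OF square_integrable_rep]] by simp
qed

lemma rep_diff: "AE x in lborel. rep_l2 (f - g) x = rep_l2 f x - rep_l2 g x"
proof -
  have "f - g = f + (-1) *\<^sub>R g" by simp
  then show ?thesis
    using rep_add[of f "(-1) *\<^sub>R g"] rep_scaleR[of "-1" g] by (auto elim: eventually_elim2)
qed

lemma norm_l2_sq: "(norm f)\<^sup>2 = (LINT x|lborel. (norm (rep_l2 f x))\<^sup>2)"
proof -
  have "inner f f = (LINT x|lborel. rep_l2 f x \<bullet> rep_l2 f x)"
    using inner_l2.abs_eq[of "rep_l2 f" "rep_l2 f"] square_integrable_rep by simp
  then show ?thesis by (simp add: power2_norm_eq_inner)
qed

lemma norm_abs_l2_sq:
  assumes "square_integrable f"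
  shows "(norm (abs_l2 f))\<^sup>2 = (LINT x|lborel. (norm (f x))\<^sup>2)"
proof -
  have "AE x in lborel. (norm (rep_l2 (abs_l2 f) x))\<^sup>2 = (norm (f x))\<^sup>2"
    using rep_abs_l2[OF assms] by eventually_elim simp
  then show ?thesis
    unfolding norm_l2_sq using assms square_integrable_rep[of "abs_l2 f"]
    by (intro integral_cong_AE) (auto simp: square_integrable_def)
qed

lemma scaleC_add_right: "c *\<^sub>C (f + g) = c *\<^sub>C f + c *\<^sub>C g"
  by transfer (simp add: square_integrable_add square_integrable_smult vector_add_ldistrib)

lemma scaleC_add_left: "(c + d) *\<^sub>C f = c *\<^sub>C f + d *\<^sub>C f"
  by transfer (simp add: square_integrable_add square_integrable_smult vector_sadd_rdistrib)

lemma scaleC_scaleC [simp]: "c *\<^sub>C d *\<^sub>C f = (c * d) *\<^sub>C f"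
  by transfer (simp add: square_integrable_smult vector_smult_assoc)

lemma scaleC_of_real: "of_real r *\<^sub>C f = r *\<^sub>R f"
  by transfer (simp add: square_integrable_smult scaleR_eq_smult_vec)

lemma scaleC_zero_left [simp]: "0 *\<^sub>C f = 0"
  using scaleC_of_real[of 0 f] by simp

lemma scaleC_minus_one: "(-1) *\<^sub>C f = - f"
  using scaleC_of_real[of "-1" f] by simp

lemma scaleC_minus_left: "(- c) *\<^sub>C f = - (c *\<^sub>C f)"
  by (metis mult_minus1 scaleC_minus_one scaleC_scaleC)

lemma scaleC_minus_right: "c *\<^sub>C (- f) = - (c *\<^sub>C f)"
  by (metis mult_minus1_right mult_minus1 scaleC_minus_one scaleC_scaleC)

lemma scaleC_zero_right [simp]: "c *\<^sub>C 0 = 0"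
  by (metis scaleC_zero_left scaleC_scaleC mult_zero_right)

lemma scaleC_diff_right: "c *\<^sub>C (f - g) = c *\<^sub>C f - c *\<^sub>C g"
  by (metis (no_types) diff_conv_add_uminus scaleC_add_right scaleC_minus_right)

lemma scaleC_diff_left: "(c - d) *\<^sub>C f = c *\<^sub>C f - d *\<^sub>C f"
  by (metis (no_types) diff_conv_add_uminus scaleC_add_left scaleC_minus_left)

lemma norm_scaleC: "norm (c *\<^sub>C f) = cmod c * norm f"
proof -
  have "AE x in lborel. (norm (rep_l2 (c *\<^sub>C f) x))\<^sup>2 = (cmod c)\<^sup>2 * (norm (rep_l2 f x))\<^sup>2"
    using rep_scaleC[of c f] by eventually_elim (simp add: norm_smult_vec power_mult_distrib)
  then have "(norm (c *\<^sub>C f))\<^sup>2 = (LINT x|lborel. (cmod c)\<^sup>2 * (norm (rep_l2 f x))\<^sup>2)"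
    unfolding norm_l2_sq by (intro integral_cong_AE) auto
  then have "(norm (c *\<^sub>C f))\<^sup>2 = (cmod c * norm f)\<^sup>2"
    by (simp add: norm_l2_sq power_mult_distrib)
  then show ?thesis by (simp add: power2_eq_iff_nonneg)
qed

lemma bounded_linear_scaleC: "bounded_linear (\<lambda>f. c *\<^sub>C f)"
  by (rule bounded_linear_intro[of _ "cmod c"])
    (simp_all add: scaleC_add_right norm_scaleC mult.commute flip: scaleC_of_real)

lemma nn_integral_norm_l2_sq:
  "(\<integral>\<^sup>+x. ennreal ((norm (rep_l2 f x))\<^sup>2) \<partial>lborel) = ennreal ((norm f)\<^sup>2)"
  by (simp add: nn_integral_eq_integral integrable_norm_rep_sq norm_l2_sq)

lemma square_integrableI_nn:
  assumes [measurable]: "f \<in> borel_measurable borel"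
    and "(\<integral>\<^sup>+x. ennreal ((norm (f x))\<^sup>2) \<partial>lborel) < \<infinity>"
  shows "square_integrable f"
  using assms by (auto simp: square_integrable_def integrable_iff_bounded)

lemma norm_abs_l2_le:
  assumes [measurable]: "f \<in> borel_measurable borel" and "C \<ge> 0"
    and le: "(\<integral>\<^sup>+x. ennreal ((norm (f x))\<^sup>2) \<partial>lborel) \<le> ennreal (C\<^sup>2)"
  shows "square_integrable f" "norm (abs_l2 f) \<le> C"
proof -
  show si: "square_integrable f"
    using le by (intro square_integrableI_nn) (auto simp: le_less_trans)
  have "ennreal ((norm (abs_l2 f))\<^sup>2) = (\<integral>\<^sup>+x. ennreal ((norm (f x))\<^sup>2) \<partial>lborel)"
    using si by (subst norm_abs_l2_sq)
      (auto simp: nn_integral_eq_integral square_integrable_def)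
  also note le
  finally show "norm (abs_l2 f) \<le> C"
    using \<open>C \<ge> 0\<close> by (simp add: power2_le_iff_abs_le)
qed

text \<open>The first half of Riesz--Fischer. Increments that decay geometrically in norm have an almost
  everywhere finite sum of weighted squares, and \<open>2t \<le> 2\<^sup>k t\<^sup>2 + 2\<^sup>-\<^sup>k\<close> turns this into
  absolute convergence of the telescoping series.\<close>

lemma convergent_AE_of_fast_increments:
  fixes X :: "nat \<Rightarrow> l2"
  assumes inc: "\<And>k. norm (X (Suc k) - X k) \<le> (1/4)^k"
  shows "AE x in lborel. convergent (\<lambda>k. rep_l2 (X k) x)"
proof -
  have sum: "(\<integral>\<^sup>+x. (\<Sum>k. ennreal (2^k * (norm (rep_l2 (X (Suc k) - X k) x))\<^sup>2)) \<partial>lborel) < \<infinity>"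
  proof -
    have "(\<integral>\<^sup>+x. (\<Sum>k. ennreal (2^k * (norm (rep_l2 (X (Suc k) - X k) x))\<^sup>2)) \<partial>lborel)
      = (\<Sum>k. ennreal (2^k) * ennreal ((norm (X (Suc k) - X k))\<^sup>2))"
      by (subst nn_integral_suminf)
        (auto simp: ennreal_mult' nn_integral_cmult nn_integral_norm_l2_sq)
    also have "\<dots> \<le> (\<Sum>k. ennreal ((1/2)^k))"
    proof (intro suminf_le)
      fix k
      have "(norm (X (Suc k) - X k))\<^sup>2 \<le> ((1/4)^k)\<^sup>2"
        using inc[of k] by (intro power_mono) auto
      also have "\<dots> \<le> (1/4)^k"
        by (simp add: power2_eq_square mult_left_le power_le_one)
      finally have "2^k * (norm (X (Suc k) - X k))\<^sup>2 \<le> 2^k * (1/4)^k"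
        by (intro mult_left_mono) auto
      also have "\<dots> = (1/2)^k" by (simp add: power_mult_distrib[symmetric])
      finally show "ennreal (2^k) * ennreal ((norm (X (Suc k) - X k))\<^sup>2) \<le> ennreal ((1/2)^k)"
        by (simp add: ennreal_mult'[symmetric] ennreal_leI)
    qed auto
    also have "\<dots> < \<infinity>"
      by (subst suminf_ennreal2) (auto simp: ennreal_less_top)
    finally show ?thesis .
  qed
  have "AE x in lborel. (\<Sum>k. ennreal (2^k * (norm (rep_l2 (X (Suc k) - X k) x))\<^sup>2)) \<noteq> \<infinity>"
    using sum by (intro nn_integral_noteq_infinite) auto
  moreover have "AE x in lborel. \<forall>k. rep_l2 (X (Suc k) - X k) x = rep_l2 (X (Suc k)) x - rep_l2 (X k) x"
    unfolding AE_all_countable using rep_diff by blast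
  ultimately show ?thesis
  proof eventually_elim
    case (elim x)
    let ?d = "\<lambda>k. rep_l2 (X (Suc k)) x - rep_l2 (X k) x"
    have s: "summable (\<lambda>k. 2^k * (norm (?d k))\<^sup>2)"
      using elim by (intro summable_suminf_not_top) auto
    have "summable (\<lambda>k. norm (?d k))"
    proof (rule summable_comparison_test)
      show "\<exists>N. \<forall>k\<ge>N. norm (norm (?d k)) \<le> 2^k * (norm (?d k))\<^sup>2 + (1/2)^k"
      proof (intro exI allI impI)
        fix k
        have "0 \<le> (2^k * norm (?d k) - 1)\<^sup>2 * (1/2)^k" by simp
        also have "\<dots> = 2^k * (norm (?d k))\<^sup>2 - 2 * norm (?d k) + (1/2)^k"
          by (simp add: power2_diff power_mult_distrib field_simps power2_eq_square)
        finally show "norm (norm (?d k)) \<le> 2^k * (norm (?d k))\<^sup>2 + (1/2)^k"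
          using norm_ge_zero[of "?d k"] unfolding real_norm_def abs_norm_cancel by linarith
      qed
      show "summable (\<lambda>k. 2^k * (norm (?d k))\<^sup>2 + (1/2::real)^k)"
        by (intro summable_add s) simp
    qed
    then have "summable ?d" by (rule summable_norm_cancel)
    then have "convergent (\<lambda>n. \<Sum>k<n. ?d k)" by (simp add: summable_iff_convergent)
    then have "convergent (\<lambda>n. rep_l2 (X n) x - rep_l2 (X 0) x)"
      by (simp add: sum_lessThan_telescope[of "\<lambda>n. rep_l2 (X n) x"])
    then have "convergent (\<lambda>n. (rep_l2 (X n) x - rep_l2 (X 0) x) + rep_l2 (X 0) x)"
      by (intro convergent_add convergent_const)
    then show ?case by simp
  qed
qed

text \<open>Completeness is what Banach's fixed point theorem needs below. The almost everywhere limit of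
  a fast subsequence is the limit in norm of the whole sequence, by Fatou's lemma.\<close>

instance l2 :: banach
proof
  fix X :: "nat \<Rightarrow> l2"
  assume "Cauchy X"
  have "\<exists>M. \<forall>m\<ge>M. \<forall>n\<ge>M. norm (X m - X n) < (1/4)^k" for k :: nat
    using \<open>Cauchy X\<close> by (simp add: Cauchy_iff)
  then obtain M where M: "norm (X m - X n) < (1/4)^k" if "m \<ge> M k" "n \<ge> M k" for k m n
    by metis
  define N where "N = (\<lambda>k. (\<Sum>j\<le>k. M j) + k)"
  have NM: "N k \<ge> M k" for k
    using member_le_sum[of k "{..k}" M] by (auto simp: N_def)
  have Nk: "N k \<ge> k" for k by (simp add: N_def)
  have Nmono: "N (Suc k) \<ge> N k" for k by (simp add: N_def)
  have fast: "norm (X (N (Suc k)) - X (N k)) \<le> (1/4)^k" for k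
    using M[of k "N (Suc k)" "N k"] NM[of k] Nmono[of k] by simp
  have conv: "AE x in lborel. convergent (\<lambda>k. rep_l2 (X (N k)) x)"
    by (rule convergent_AE_of_fast_increments[of "\<lambda>k. X (N k)", OF fast])
  define F where "F = (\<lambda>x. lim (\<lambda>k. rep_l2 (X (N k)) x))"
  have [measurable]: "F \<in> borel_measurable borel"
    unfolding F_def by (rule borel_measurable_lim_metric) simp
  have lim: "AE x in lborel. (\<lambda>k. rep_l2 (X (N k)) x) \<longlonglongrightarrow> F x"
    using conv by eventually_elim (simp add: F_def convergent_LIMSEQ_iff)
  have fatou: "(\<integral>\<^sup>+x. ennreal ((norm (F x - rep_l2 (X n) x))\<^sup>2) \<partial>lborel) \<le> ennreal (((1/4)^k)\<^sup>2)"
    if n: "n \<ge> M k" for n k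
  proof -
    have "AE x in lborel. \<forall>j. rep_l2 (X (N j) - X n) x = rep_l2 (X (N j)) x - rep_l2 (X n) x"
      unfolding AE_all_countable using rep_diff by blast
    with lim have "AE x in lborel. ennreal ((norm (F x - rep_l2 (X n) x))\<^sup>2)
        = liminf (\<lambda>j. ennreal ((norm (rep_l2 (X (N j) - X n) x))\<^sup>2))"
    proof eventually_elim
      case (elim x)
      have "(\<lambda>j. ennreal ((norm (rep_l2 (X (N j) - X n) x))\<^sup>2)) \<longlonglongrightarrow> ennreal ((norm (F x - rep_l2 (X n) x))\<^sup>2)"
        using elim by (auto intro!: tendsto_intros simp del: tendsto_ennreal_iff)
      then show ?case
        by (rule lim_imp_Liminf[OF sequentially_bot, symmetric])
    qed
    then have "(\<integral>\<^sup>+x. ennreal ((norm (F x - rep_l2 (X n) x))\<^sup>2) \<partial>lborel)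
      = (\<integral>\<^sup>+x. liminf (\<lambda>j. ennreal ((norm (rep_l2 (X (N j) - X n) x))\<^sup>2)) \<partial>lborel)"
      by (rule nn_integral_cong_AE)
    also have "\<dots> \<le> liminf (\<lambda>j. (\<integral>\<^sup>+x. ennreal ((norm (rep_l2 (X (N j) - X n) x))\<^sup>2) \<partial>lborel))"
      by (rule nn_integral_liminf) auto
    also have "\<dots> = liminf (\<lambda>j. ennreal ((norm (X (N j) - X n))\<^sup>2))"
      by (simp add: nn_integral_norm_l2_sq)
    also have "\<dots> \<le> limsup (\<lambda>j. ennreal ((norm (X (N j) - X n))\<^sup>2))"
      by (rule Liminf_le_Limsup) simp
    also have "\<dots> \<le> ennreal (((1/4)^k)\<^sup>2)"
    proof (rule Limsup_bounded, rule eventually_sequentiallyI)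
      fix j assume "j \<ge> M k"
      then have "norm (X (N j) - X n) \<le> (1/4)^k"
        using M[of k "N j" n] n Nk[of j] by simp
      then show "ennreal ((norm (X (N j) - X n))\<^sup>2) \<le> ennreal (((1/4)^k)\<^sup>2)"
        by (intro ennreal_leI power_mono) auto
    qed
    finally show ?thesis .
  qed
  have Fsi: "square_integrable F"
  proof -
    have "square_integrable (\<lambda>x. F x - rep_l2 (X (M 0)) x)"
      using norm_abs_l2_le(1)[of "\<lambda>x. F x - rep_l2 (X (M 0)) x" "(1/4)^0"] fatou[of 0 "M 0"]
      by simp
    from square_integrable_add[OF this square_integrable_rep[of "X (M 0)"]] show ?thesis by simp
  qed
  have close: "norm (abs_l2 F - X n) \<le> (1/4)^k" if "n \<ge> M k" for n k
  proof -
    have *: "square_integrable (\<lambda>x. F x - rep_l2 (X n) x)"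
      "norm (abs_l2 (\<lambda>x. F x - rep_l2 (X n) x)) \<le> (1/4)^k"
      using norm_abs_l2_le[of "\<lambda>x. F x - rep_l2 (X n) x" "(1/4)^k"] fatou[OF that] by simp_all
    have "abs_l2 (\<lambda>x. F x - rep_l2 (X n) x) = abs_l2 F - X n"
      using minus_l2.abs_eq[of F "rep_l2 (X n)"] Fsi square_integrable_rep by simp
    with * show ?thesis by simp
  qed
  have "X \<longlonglongrightarrow> abs_l2 F"
  proof (rule LIMSEQ_I)
    fix r :: real assume "r > 0"
    then obtain k where "(1/4::real)^k < r" using real_arch_pow_inv[of r "1/4"] by auto
    then show "\<exists>no. \<forall>n\<ge>no. norm (X n - abs_l2 F) < r"
      using close[of k] by (intro exI[of _ "M k"]) (auto simp: norm_minus_commute intro: le_less_trans)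
  qed
  then show "convergent X" by (auto simp: convergent_def)
qed

section \<open>Square root and polar decomposition of two-by-two matrices\<close>

lemma cmod_sq: "(complex_of_real (cmod z))\<^sup>2 = z * cnj z"
  using complex_norm_square[of z] by simp

definition mat2 :: "complex \<Rightarrow> complex \<Rightarrow> complex \<Rightarrow> complex \<Rightarrow> complex^2^2" where
  "mat2 a b c d = vector [vector [a, b], vector [c, d]]"

lemma mat2_nth [simp]:
  "mat2 a b c d $ 1 $ 1 = a" "mat2 a b c d $ 1 $ 2 = b"
  "mat2 a b c d $ 2 $ 1 = c" "mat2 a b c d $ 2 $ 2 = d"
  by (simp_all add: mat2_def)

lemma mat2_eq_iff: "M = N \<longleftrightarrow> M$1$1 = N$1$1 \<and> M$1$2 = N$1$2 \<and> M$2$1 = N$2$1 \<and> M$2$2 = N$2$2"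
  for M N :: "complex^2^2"
  by (auto simp: vec_eq_iff forall_2)

lemma vec2_eq_iff: "v = w \<longleftrightarrow> v$1 = w$1 \<and> v$2 = w$2"
  for v w :: "complex^2"
  by (auto simp: vec_eq_iff forall_2)

lemma mult2_nth: "(M ** N) $ i $ j = M$i$1 * N$1$j + M$i$2 * N$2$j"
  for M N :: "complex^2^2"
  by (simp add: matrix_matrix_mult_def sum_2)

lemma mult_vec2_nth: "(M *v v) $ i = M$i$1 * v$1 + M$i$2 * v$2"
  for M :: "complex^2^2"
  by (simp add: matrix_vector_mult_def sum_2)

lemma adj_nth [simp]: "adj M $ i $ j = cnj (M $ j $ i)"
  by (simp add: adj_def transpose_def map_matrix_def)

lemma map_matrix_nth [simp]: "map_matrix f A $ i $ j = f (A $ i $ j)"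
  by (simp add: map_matrix_def)

lemma mat_one_nth: "(mat 1 :: complex^2^2) $ i $ j = (if i = j then 1 else 0)"
  by (simp add: mat_def)

lemma mult_scalar_matrix: "X ** map_matrix ((*) c) (mat 1) = map_matrix ((*) c) X"
  for X :: "complex^2^2"
  unfolding mat2_eq_iff[of "X ** _"] by (simp add: mult2_nth mat_one_nth mult.commute)

lemma norm_vec2_sq: "(norm v)\<^sup>2 = (cmod (v$1))\<^sup>2 + (cmod (v$2))\<^sup>2"
  for v :: "complex^2"
  by (simp add: norm_vec_def L2_set_def sum_2)

lemma norm_mat2_sq: "(norm M)\<^sup>2 = (cmod (M$1$1))\<^sup>2 + (cmod (M$1$2))\<^sup>2 + (cmod (M$2$1))\<^sup>2 + (cmod (M$2$2))\<^sup>2"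
  for M :: "complex^2^2"
proof -
  have "(norm M)\<^sup>2 = (norm (M$1))\<^sup>2 + (norm (M$2))\<^sup>2"
    unfolding norm_vec_def[of M] L2_set_def by (simp add: sum_2)
  then show ?thesis by (simp add: norm_vec2_sq)
qed

lemma norm_matrix_vector_le: "norm (M *v v) \<le> norm M * norm v"
  for M :: "complex^2^2"
proof -
  have row: "(cmod (a * x + b * y))\<^sup>2 \<le> ((cmod a)\<^sup>2 + (cmod b)\<^sup>2) * ((cmod x)\<^sup>2 + (cmod y)\<^sup>2)"
    for a b x y :: complex
  proof -
    have "cmod (a * x + b * y) \<le> cmod a * cmod x + cmod b * cmod y"
      unfolding norm_mult[symmetric] by (rule norm_triangle_ineq)
    then have "(cmod (a * x + b * y))\<^sup>2 \<le> (cmod a * cmod x + cmod b * cmod y)\<^sup>2"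
      by (intro power_mono) auto
    also have "\<dots> \<le> (cmod a * cmod x + cmod b * cmod y)\<^sup>2 + (cmod a * cmod y - cmod b * cmod x)\<^sup>2"
      by simp
    also have "\<dots> = ((cmod a)\<^sup>2 + (cmod b)\<^sup>2) * ((cmod x)\<^sup>2 + (cmod y)\<^sup>2)"
      by (simp add: power2_eq_square algebra_simps)
    finally show ?thesis .
  qed
  have "(norm (M *v v))\<^sup>2 \<le> (norm M * norm v)\<^sup>2"
    unfolding power_mult_distrib norm_vec2_sq norm_mat2_sq mult_vec2_nth
    using row[of "M$1$1" "v$1" "M$1$2" "v$2"] row[of "M$2$1" "v$1" "M$2$2" "v$2"]
    by (simp add: algebra_simps)
  then show ?thesis by (rule power2_le_imp_le) simp
qed

lemma norm_matrix_mult_le: "norm (M ** N) \<le> norm M * norm N"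
  for M N :: "complex^2^2"
proof -
  define c where "c = (\<lambda>j. (\<chi> i. N $ i $ j) :: complex^2)"
  have col: "(M *v c j) $ i = (M ** N) $ i $ j" for i j
    by (simp add: mult_vec2_nth mult2_nth c_def)
  have "(norm (M ** N))\<^sup>2 = (norm (M *v c 1))\<^sup>2 + (norm (M *v c 2))\<^sup>2"
    by (simp add: norm_mat2_sq norm_vec2_sq col)
  also have "\<dots> \<le> (norm M * norm (c 1))\<^sup>2 + (norm M * norm (c 2))\<^sup>2"
    by (intro add_mono power_mono norm_matrix_vector_le) auto
  also have "\<dots> = (norm M * norm N)\<^sup>2"
    by (simp add: power_mult_distrib norm_mat2_sq[of N] norm_vec2_sq c_def algebra_simps)
  finally show ?thesis by (rule power2_le_imp_le) simp
qed

lemma norm_mat2_le_sum: "norm M \<le> cmod (M$1$1) + cmod (M$1$2) + cmod (M$2$1) + cmod (M$2$2)"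
  for M :: "complex^2^2"
proof -
  have "(norm M)\<^sup>2 \<le> (cmod (M$1$1) + cmod (M$1$2) + cmod (M$2$1) + cmod (M$2$2))\<^sup>2"
    unfolding norm_mat2_sq by (simp add: power2_eq_square algebra_simps)
  then show ?thesis by (rule power2_le_imp_le) simp
qed

lemma continuous_on_mat2 [continuous_intros]:
  assumes "continuous_on S a" "continuous_on S b" "continuous_on S c" "continuous_on S d"
  shows "continuous_on S (\<lambda>x. mat2 (a x) (b x) (c x) (d x))"
proof -
  have "mat2 (a x) (b x) (c x) (d x) =
     (\<chi> i j. if i = 1 then if j = 1 then a x else b x else if j = 1 then c x else d x)" for x
    by (simp add: mat2_eq_iff)
  moreover have "continuous_on S (\<lambda>x. if i = 1 then if j = 1 then a x else b x else if j = 1 then c x else d x)"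
    for i j :: 2
    using assms by (cases "i = 1"; cases "j = 1") simp_all
  ultimately show ?thesis
    by (auto intro!: continuous_on_vec_lambda)
qed

lemma borel_measurable_mat2 [measurable]:
  assumes [measurable]: "a \<in> borel_measurable M" "b \<in> borel_measurable M"
    "c \<in> borel_measurable M" "d \<in> borel_measurable M"
  shows "(\<lambda>x. mat2 (a x) (b x) (c x) (d x)) \<in> borel_measurable M"
proof -
  have "(\<lambda>x. (\<lambda>p. mat2 (fst p) (fst (snd p)) (fst (snd (snd p))) (snd (snd (snd p))))
      (a x, b x, c x, d x)) \<in> borel_measurable M"
    by (rule borel_measurable_continuous_on[where f = "\<lambda>p. mat2 (fst p) (fst (snd p)) (fst (snd (snd p))) (snd (snd (snd p)))"])
      (auto intro!: continuous_intros borel_measurable_Pair)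
  then show ?thesis by simp
qed

lemma borel_measurable_vec_nth [measurable (raw)]:
  fixes f :: "'a \<Rightarrow> ('b::{second_countable_topology, topological_space})^2"
  assumes "f \<in> borel_measurable M"
  shows "(\<lambda>x. f x $ i) \<in> borel_measurable M"
  by (rule borel_measurable_continuous_on[OF _ assms]) (auto intro!: continuous_intros)

definition herm2 :: "real \<Rightarrow> complex \<Rightarrow> real \<Rightarrow> complex^2^2" where
  "herm2 a b d = mat2 (of_real a) b (cnj b) (of_real d)"

lemma inner_herm2:
  "(herm2 a b d *v v) \<bullet> v = a * (cmod (v$1))\<^sup>2 + d * (cmod (v$2))\<^sup>2 + 2 * Re (b * v$2 * cnj (v$1))"
  by (simp add: inner_vec_def sum_2 mult_vec2_nth herm2_def inner_complex_def cmod_def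
      power2_eq_square algebra_simps)

text \<open>The vectors that test positivity are \<open>(- b, a)\<close> if \<open>a \<noteq> 0\<close>, and \<open>(- s b, 1)\<close> with a large \<open>s\<close> if
  \<open>a = 0\<close>, which forces \<open>b = 0\<close>. Conversely, complete the square.\<close>

lemma psd_herm2_iff: "psd M \<longleftrightarrow> (\<exists>a b d. M = herm2 a b d \<and> 0 \<le> a \<and> 0 \<le> d \<and> (cmod b)\<^sup>2 \<le> a * d)"
proof
  assume M: "psd M"
  then have adj: "adj M = M" and nn: "\<And>v. 0 \<le> (M *v v) \<bullet> v" by (auto simp: psd_def)
  define a b d where "a = Re (M$1$1)" and "b = M$1$2" and "d = Re (M$2$2)"
  have "M$1$1 = cnj (M$1$1)" "M$2$2 = cnj (M$2$2)" "M$2$1 = cnj (M$1$2)"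
    using adj by (metis adj_nth)+
  then have eq: "M = herm2 a b d"
    by (auto simp: mat2_eq_iff herm2_def a_def b_def d_def complex_eq_iff)
  have q: "0 \<le> a * (cmod x)\<^sup>2 + d * (cmod y)\<^sup>2 + 2 * Re (b * y * cnj x)" for x y
    using nn[of "vector [x, y]"] unfolding eq inner_herm2 by simp
  have a: "0 \<le> a" and d: "0 \<le> d" using q[of 1 0] q[of 0 1] by auto
  have bb: "Re (b * (of_real r) * cnj (b * of_real s)) = r * s * (cmod b)\<^sup>2" for r s
    by (simp add: cmod_def power2_eq_square algebra_simps)
  have "(cmod b)\<^sup>2 \<le> a * d"
  proof (cases "a = 0")
    case False
    have "0 \<le> a * (cmod (b * of_real (-1)))\<^sup>2 + d * (cmod (of_real a))\<^sup>2
        + 2 * Re (b * of_real a * cnj (b * of_real (-1)))"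
      by (rule q)
    then have "0 \<le> a * (a * d - (cmod b)\<^sup>2)"
      unfolding bb by (simp add: power2_eq_square algebra_simps norm_mult)
    then show ?thesis using False a by (simp add: zero_le_mult_iff)
  next
    case True
    have "b = 0"
    proof (rule ccontr)
      assume "b \<noteq> 0"
      have "0 \<le> a * (cmod (b * of_real (-(d+1)/(2*(cmod b)\<^sup>2))))\<^sup>2 + d * (cmod (of_real 1))\<^sup>2
          + 2 * Re (b * of_real 1 * cnj (b * of_real (-(d+1)/(2*(cmod b)\<^sup>2))))"
        by (rule q)
      then show False
        unfolding bb using True \<open>b \<noteq> 0\<close> by (simp add: field_simps)
    qed
    then show ?thesis using True by simp
  qed
  with eq a d show "\<exists>a b d. M = herm2 a b d \<and> 0 \<le> a \<and> 0 \<le> d \<and> (cmod b)\<^sup>2 \<le> a * d" by blast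
next
  assume "\<exists>a b d. M = herm2 a b d \<and> 0 \<le> a \<and> 0 \<le> d \<and> (cmod b)\<^sup>2 \<le> a * d"
  then obtain a b d where M: "M = herm2 a b d" and ad: "0 \<le> a" "0 \<le> d" "(cmod b)\<^sup>2 \<le> a * d" by blast
  have "0 \<le> (M *v v) \<bullet> v" for v
  proof -
    let ?x = "cmod (v$1)" and ?y = "cmod (v$2)"
    have "cmod b \<le> sqrt a * sqrt d"
      using ad by (metis real_le_rsqrt real_sqrt_mult)
    then have "cmod b * ?y * ?x \<le> sqrt a * sqrt d * ?y * ?x"
      by (intro mult_right_mono) auto
    moreover have "- Re (b * v$2 * cnj (v$1)) \<le> cmod b * ?y * ?x"
      using abs_Re_le_cmod[of "b * v$2 * cnj (v$1)"] by (simp add: norm_mult)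
    moreover have "0 \<le> (sqrt a * ?x - sqrt d * ?y)\<^sup>2" by simp
    moreover have "(sqrt a * ?x - sqrt d * ?y)\<^sup>2 = a * ?x\<^sup>2 + d * ?y\<^sup>2 - 2 * (sqrt a * sqrt d * ?y * ?x)"
      using ad by (simp add: power2_diff power_mult_distrib algebra_simps)
    ultimately show ?thesis unfolding M inner_herm2 by linarith
  qed
  moreover have "adj M = M" by (simp add: M mat2_eq_iff herm2_def)
  ultimately show "psd M" by (simp add: psd_def)
qed

lemma herm2_square:
  "herm2 a b d ** herm2 a b d = herm2 (a\<^sup>2 + (cmod b)\<^sup>2) (b * of_real (a + d)) (d\<^sup>2 + (cmod b)\<^sup>2)"
  using complex_norm_square[of b]
  by (simp add: mat2_eq_iff herm2_def mult2_nth power2_eq_square algebra_simps)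

lemma herm2_eq_iff: "herm2 a b d = herm2 a' b' d' \<longleftrightarrow> a = a' \<and> b = b' \<and> d = d'"
  by (auto simp: mat2_eq_iff herm2_def)

text \<open>By Cayley--Hamilton, the positive root \<^term>\<open>S\<close> of \<^term>\<open>P\<close> satisfies
  \<open>tr S \<cdot> S = P + det S\<close>, where \<open>det S = (det P)\<^sup>1\<^sup>/\<^sup>2\<close> and \<open>(tr S)\<^sup>2 = tr P + 2 det S\<close>.\<close>

definition root2 :: "complex^2^2 \<Rightarrow> complex^2^2" where
  "root2 P = (let s = sqrt (Re (P$1$1) * Re (P$2$2) - (cmod (P$1$2))\<^sup>2);
                  t = sqrt (Re (P$1$1) + Re (P$2$2) + 2 * s)
              in herm2 ((Re (P$1$1) + s) / t) (P$1$2 / of_real t) ((Re (P$2$2) + s) / t))"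

lemma root2_unique:
  assumes "psd S" "S ** S = P"
  shows "S = root2 P"
proof -
  obtain x \<beta> y where S: "S = herm2 x \<beta> y" and xy: "0 \<le> x" "0 \<le> y" "(cmod \<beta>)\<^sup>2 \<le> x * y"
    using assms(1) psd_herm2_iff by blast
  have P: "Re (P$1$1) = x\<^sup>2 + (cmod \<beta>)\<^sup>2" "Re (P$2$2) = y\<^sup>2 + (cmod \<beta>)\<^sup>2" "P$1$2 = \<beta> * of_real (x + y)"
    using assms(2) unfolding S herm2_square by (auto simp: herm2_def)
  have s: "sqrt (Re (P$1$1) * Re (P$2$2) - (cmod (P$1$2))\<^sup>2) = x * y - (cmod \<beta>)\<^sup>2"
  proof -
    have "Re (P$1$1) * Re (P$2$2) - (cmod (P$1$2))\<^sup>2 = (x * y - (cmod \<beta>)\<^sup>2)\<^sup>2"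
      unfolding P using xy by (simp add: norm_mult power2_eq_square algebra_simps del: of_real_add)
    then show ?thesis using xy by simp
  qed
  have t: "sqrt (Re (P$1$1) + Re (P$2$2) + 2 * (x * y - (cmod \<beta>)\<^sup>2)) = x + y"
  proof -
    have "Re (P$1$1) + Re (P$2$2) + 2 * (x * y - (cmod \<beta>)\<^sup>2) = (x + y)\<^sup>2"
      unfolding P by (simp add: power2_eq_square algebra_simps)
    then show ?thesis using xy by simp
  qed
  show ?thesis
  proof (cases "x + y = 0")
    case True
    then have "x = 0" "y = 0" using xy by auto
    then have "\<beta> = 0" using xy by simp
    then show ?thesis
      using \<open>x = 0\<close> \<open>y = 0\<close> unfolding S root2_def Let_def s t True herm2_eq_iff by simp
  next
    case False
    then show ?thesis
      unfolding S root2_def Let_def s t herm2_eq_iff unfolding P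
      by (auto simp: field_simps power2_eq_square simp flip: of_real_add)
  qed
qed

lemma root2_psd:
  assumes "psd P"
  shows "psd (root2 P)" "root2 P ** root2 P = P"
proof -
  obtain a b d where P: "P = herm2 a b d" and ad: "0 \<le> a" "0 \<le> d" "(cmod b)\<^sup>2 \<le> a * d"
    using assms psd_herm2_iff by blast
  define s where "s = sqrt (a * d - (cmod b)\<^sup>2)"
  define t where "t = sqrt (a + d + 2 * s)"
  have r: "root2 P = herm2 ((a + s) / t) (b / of_real t) ((d + s) / t)"
    by (simp add: root2_def P herm2_def Let_def s_def t_def)
  have s0: "0 \<le> s" and s2: "s\<^sup>2 = a * d - (cmod b)\<^sup>2" using ad by (auto simp: s_def)
  have t0: "0 \<le> t" and t2: "t\<^sup>2 = a + d + 2 * s" using ad s0 by (auto simp: t_def)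
  have "psd (root2 P) \<and> root2 P ** root2 P = P"
  proof (cases "t = 0")
    case True
    then have "a = 0" "d = 0" using t2 ad s0 by auto
    then have "b = 0" using ad by auto
    have "s = 0" using \<open>a = 0\<close> \<open>d = 0\<close> True t2 by simp
    have r0: "root2 P = herm2 0 0 0" unfolding r using True by simp
    have "psd (herm2 0 0 0)" unfolding psd_herm2_iff by (intro exI conjI) (rule refl, simp_all)
    then show ?thesis
      unfolding r0 herm2_square by (simp add: P \<open>a = 0\<close> \<open>b = 0\<close> \<open>d = 0\<close>)
  next
    case False
    have *: "(cmod (b / of_real t))\<^sup>2 \<le> (a + s) / t * ((d + s) / t)"
    proof -
      have "(cmod b)\<^sup>2 \<le> (a + s) * (d + s)"
        using ad s0 by (simp add: algebra_simps add_increasing2)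
      then show ?thesis
        using False by (simp add: norm_divide power_divide power2_eq_square divide_right_mono)
    qed
    have psd: "psd (root2 P)"
      unfolding r psd_herm2_iff using * ad s0 t0 by (intro exI conjI) (rule refl, simp_all)
    have b1: "((a + s) / t)\<^sup>2 + (cmod (b / of_real t))\<^sup>2 = a"
    proof -
      have "(a + s)\<^sup>2 + (cmod b)\<^sup>2 = a * t\<^sup>2"
        using s2 t2 by (simp add: power2_sum algebra_simps power2_eq_square)
      then show ?thesis using False
        by (simp add: norm_divide power_divide field_simps)
    qed
    have b2: "((d + s) / t)\<^sup>2 + (cmod (b / of_real t))\<^sup>2 = d"
    proof -
      have "(d + s)\<^sup>2 + (cmod b)\<^sup>2 = d * t\<^sup>2"
        using s2 t2 by (simp add: power2_sum algebra_simps power2_eq_square)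
      then show ?thesis using False
        by (simp add: norm_divide power_divide field_simps)
    qed
    have b3: "b / of_real t * of_real ((a + s) / t + (d + s) / t) = b"
    proof -
      have "(a + s) / t + (d + s) / t = t"
      proof -
        have "(a + s) / t + (d + s) / t = t\<^sup>2 / t" unfolding t2 by (simp add: add_divide_distrib)
        then show ?thesis by (simp add: power2_eq_square)
      qed
      then show ?thesis using False by (simp del: of_real_divide of_real_add)
    qed
    show ?thesis using psd unfolding r herm2_square b1 b2 b3 by (simp add: P)
  qed
  then show "psd (root2 P)" "root2 P ** root2 P = P" by auto
qed

lemma msqrt_eq_root2: "psd P \<Longrightarrow> msqrt P = root2 P"
  unfolding msqrt_def using root2_psd root2_unique by (intro the_equality) auto

lemma psd_msqrt: "psd P \<Longrightarrow> psd (msqrt P)"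
  and msqrt_square: "psd P \<Longrightarrow> msqrt P ** msqrt P = P"
  by (simp_all add: msqrt_eq_root2 root2_psd)

lemma adj_mult_self: "adj M ** M = herm2 ((cmod (M$1$1))\<^sup>2 + (cmod (M$2$1))\<^sup>2)
    (cnj (M$1$1) * M$1$2 + cnj (M$2$1) * M$2$2) ((cmod (M$1$2))\<^sup>2 + (cmod (M$2$2))\<^sup>2)"
  by (simp add: mat2_eq_iff herm2_def mult2_nth cmod_sq mult.commute)

definition det2 :: "complex^2^2 \<Rightarrow> complex" where
  "det2 M = M$1$1 * M$2$2 - M$1$2 * M$2$1"

lemma det_adj_mult_self:
  "((cmod (M$1$1))\<^sup>2 + (cmod (M$2$1))\<^sup>2) * ((cmod (M$1$2))\<^sup>2 + (cmod (M$2$2))\<^sup>2)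
    - (cmod (cnj (M$1$1) * M$1$2 + cnj (M$2$1) * M$2$2))\<^sup>2 = (cmod (det2 M))\<^sup>2"
proof -
  have "complex_of_real (((cmod (M$1$1))\<^sup>2 + (cmod (M$2$1))\<^sup>2) * ((cmod (M$1$2))\<^sup>2 + (cmod (M$2$2))\<^sup>2)
    - (cmod (cnj (M$1$1) * M$1$2 + cnj (M$2$1) * M$2$2))\<^sup>2) = of_real ((cmod (det2 M))\<^sup>2)"
    unfolding of_real_diff of_real_mult of_real_add complex_norm_square det2_def
    by (simp add: algebra_simps)
  then show ?thesis using of_real_eq_iff by blast
qed

lemma psd_adj_mult_self: "psd (adj M ** M)"
  unfolding psd_herm2_iff adj_mult_self
proof (intro exI conjI)
  show "(cmod (cnj (M$1$1) * M$1$2 + cnj (M$2$1) * M$2$2))\<^sup>2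
    \<le> ((cmod (M$1$1))\<^sup>2 + (cmod (M$2$1))\<^sup>2) * ((cmod (M$1$2))\<^sup>2 + (cmod (M$2$2))\<^sup>2)"
    using det_adj_mult_self[of M] zero_le_power2[of "cmod (det2 M)"] by linarith
qed (rule refl, simp_all)

lemma psd_mabs: "psd (mabs M)"
  and mabs_square: "mabs M ** mabs M = adj M ** M"
  unfolding mabs_def by (simp_all add: psd_msqrt msqrt_square psd_adj_mult_self)

text \<open>The trace of \<open>\<bar>M\<bar>\<close>, that is, the trace norm of \<open>M\<close>: the singular values satisfy
  \<open>(s\<^sub>1 + s\<^sub>2)\<^sup>2 = s\<^sub>1\<^sup>2 + s\<^sub>2\<^sup>2 + 2 s\<^sub>1 s\<^sub>2\<close>.\<close>

definition tau2 :: "complex^2^2 \<Rightarrow> real" where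
  "tau2 M = sqrt ((norm M)\<^sup>2 + 2 * cmod (det2 M))"

lemma tau2_nonneg: "0 \<le> tau2 M" by (simp add: tau2_def)

lemma tau2_sq: "(tau2 M)\<^sup>2 = (norm M)\<^sup>2 + 2 * cmod (det2 M)" by (simp add: tau2_def)

lemma tau2_zero_iff: "tau2 M = 0 \<longleftrightarrow> M = 0"
proof
  assume "tau2 M = 0"
  then have "(norm M)\<^sup>2 + 2 * cmod (det2 M) = 0" using tau2_sq[of M] by simp
  then have "(norm M)\<^sup>2 = 0" using zero_le_power2[of "norm M"] norm_ge_zero[of "det2 M"] by linarith
  then show "M = 0" by simp
qed (simp add: tau2_def det2_def)

lemma mabs_eq: "mabs M = herm2 (((cmod (M$1$1))\<^sup>2 + (cmod (M$2$1))\<^sup>2 + cmod (det2 M)) / tau2 M)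
    ((cnj (M$1$1) * M$1$2 + cnj (M$2$1) * M$2$2) / of_real (tau2 M))
    (((cmod (M$1$2))\<^sup>2 + (cmod (M$2$2))\<^sup>2 + cmod (det2 M)) / tau2 M)"
proof -
  have t: "sqrt ((cmod (M$1$1))\<^sup>2 + (cmod (M$2$1))\<^sup>2 + ((cmod (M$1$2))\<^sup>2 + (cmod (M$2$2))\<^sup>2)
      + 2 * cmod (det2 M)) = tau2 M"
    by (simp add: tau2_def norm_mat2_sq algebra_simps)
  show ?thesis
    unfolding mabs_def msqrt_eq_root2[OF psd_adj_mult_self] root2_def Let_def
    unfolding adj_mult_self
    by (simp add: herm2_def det_adj_mult_self[simplified] t[simplified] del: of_real_add)
qed

text \<open>With \<open>\<sigma> = det M / \<bar>det M\<bar>\<close>, this is \<open>(M + \<sigma> N) / (s\<^sub>1 + s\<^sub>2)\<close>, where \<open>N\<close> is the conjugate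
  transpose of the adjugate of \<open>M\<close>. In the coordinates of a singular value decomposition both summands
  are diagonal, with the singular values exchanged, so the sum is \<open>s\<^sub>1 + s\<^sub>2\<close> times a unitary. For singular \<open>M\<close> the
  default \<open>x / 0 = 0\<close> makes \<open>\<sigma>\<close> vanish, and what remains is the partial isometry \<open>M / s\<^sub>1\<close>.\<close>

definition polar2 :: "complex^2^2 \<Rightarrow> complex^2^2" where
  "polar2 M = (let \<sigma> = det2 M / of_real (cmod (det2 M)); t = of_real (tau2 M) in
     mat2 ((M$1$1 + \<sigma> * cnj (M$2$2)) / t) ((M$1$2 - \<sigma> * cnj (M$2$1)) / t)
          ((M$2$1 - \<sigma> * cnj (M$1$2)) / t) ((M$2$2 + \<sigma> * cnj (M$1$1)) / t))"

lemma polar2_mult_mabs: "polar2 M ** mabs M = M"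
proof (cases "M = 0")
  case True
  then show ?thesis by (simp add: mat2_eq_iff mult2_nth mabs_eq herm2_def tau2_def det2_def)
next
  case False
  define p q r s where pqrs: "p = M$1$1" "q = M$1$2" "r = M$2$1" "s = M$2$2"
  define P Q R S where PQRS: "P = cnj p" "Q = cnj q" "R = cnj r" "S = cnj s"
  define D where "D = complex_of_real (cmod (det2 M))"
  define \<sigma> where "\<sigma> = det2 M / D"
  define t where "t = complex_of_real (tau2 M)"
  have t0: "t \<noteq> 0" using False tau2_zero_iff by (simp add: t_def)
  have t2: "t * t = p * P + q * Q + r * R + s * S + 2 * D"
  proof -
    have "t * t = of_real ((tau2 M)\<^sup>2)" by (simp add: t_def power2_eq_square)
    also have "\<dots> = p * P + q * Q + r * R + s * S + 2 * D"
      unfolding tau2_sq norm_mat2_sq of_real_add complex_norm_square by (simp add: D_def pqrs PQRS)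
    finally show ?thesis .
  qed
  have D1: "\<sigma> * D = p * s - q * r"
    unfolding \<sigma>_def D_def by (auto simp: det2_def pqrs)
  have DD: "D * D = (p * s - q * r) * (P * S - Q * R)"
    unfolding D_def using complex_norm_square[of "det2 M"]
    by (simp add: power2_eq_square det2_def pqrs PQRS)
  have D2: "\<sigma> * (P * S - Q * R) = D"
  proof (cases "D = 0")
    case False
    have "D * (\<sigma> * (P * S - Q * R)) = D * D"
      unfolding DD using D1 by (simp add: mult.assoc[symmetric] mult.commute[of D])
    with False show ?thesis by simp
  qed (simp add: \<sigma>_def)
  have mab: "mabs M = mat2 ((p * P + r * R + D) / t) ((P * q + R * s) / t) ((p * Q + r * S) / t) ((q * Q + s * S + D) / t)"
    unfolding mabs_eq herm2_def D_def t_def pqrs PQRS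
    by (simp add: mat2_eq_iff cmod_sq)
  have pol: "polar2 M = mat2 ((p + \<sigma> * S) / t) ((q - \<sigma> * R) / t) ((r - \<sigma> * Q) / t) ((s + \<sigma> * P) / t)"
    unfolding polar2_def Let_def \<sigma>_def D_def t_def pqrs PQRS by simp
  have D: "\<sigma> * (P * S - Q * R) - D = 0" "\<sigma> * D - (p * s - q * r) = 0" using D1 D2 by auto
  have e1: "(p + \<sigma> * S) * (p * P + r * R + D) + (q - \<sigma> * R) * (p * Q + r * S) = p * (t * t)"
  proof -
    have "(p + \<sigma> * S) * (p * P + r * R + D) + (q - \<sigma> * R) * (p * Q + r * S) = p * (t * t)
      + p * (\<sigma> * (P * S - Q * R) - D) + S * (\<sigma> * D - (p * s - q * r))"
      unfolding t2 by (simp add: algebra_simps)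
    then show ?thesis unfolding D by simp
  qed
  have e2: "(p + \<sigma> * S) * (P * q + R * s) + (q - \<sigma> * R) * (q * Q + s * S + D) = q * (t * t)"
  proof -
    have "(p + \<sigma> * S) * (P * q + R * s) + (q - \<sigma> * R) * (q * Q + s * S + D) = q * (t * t)
      + q * (\<sigma> * (P * S - Q * R) - D) - R * (\<sigma> * D - (p * s - q * r))"
      unfolding t2 by (simp add: algebra_simps)
    then show ?thesis unfolding D by simp
  qed
  have e3: "(r - \<sigma> * Q) * (p * P + r * R + D) + (s + \<sigma> * P) * (p * Q + r * S) = r * (t * t)"
  proof -
    have "(r - \<sigma> * Q) * (p * P + r * R + D) + (s + \<sigma> * P) * (p * Q + r * S) = r * (t * t)
      + r * (\<sigma> * (P * S - Q * R) - D) - Q * (\<sigma> * D - (p * s - q * r))"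
      unfolding t2 by (simp add: algebra_simps)
    then show ?thesis unfolding D by simp
  qed
  have e4: "(r - \<sigma> * Q) * (P * q + R * s) + (s + \<sigma> * P) * (q * Q + s * S + D) = s * (t * t)"
  proof -
    have "(r - \<sigma> * Q) * (P * q + R * s) + (s + \<sigma> * P) * (q * Q + s * S + D) = s * (t * t)
      + s * (\<sigma> * (P * S - Q * R) - D) + P * (\<sigma> * D - (p * s - q * r))"
      unfolding t2 by (simp add: algebra_simps)
    then show ?thesis unfolding D by simp
  qed
  have quo: "x / t * (y / t) + z / t * (w / t) = c" if "x * y + z * w = c * (t * t)" for x y z w c
    using that t0 by (simp add: add_divide_distrib[symmetric])
  show ?thesis
    unfolding mab pol mat2_eq_iff mult2_nth mat2_nth
    using quo[OF e1] quo[OF e2] quo[OF e3] quo[OF e4] by (simp add: pqrs)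
qed

lemma mult_adj_mult_self_singular:
  assumes "det2 M = 0"
  shows "M ** adj M ** M = map_matrix ((*) (of_real ((tau2 M)\<^sup>2))) M"
proof -
  have t: "complex_of_real ((tau2 M)\<^sup>2) = M$1$1 * cnj (M$1$1) + M$1$2 * cnj (M$1$2)
      + M$2$1 * cnj (M$2$1) + M$2$2 * cnj (M$2$2)"
    unfolding tau2_sq assms norm_mat2_sq of_real_add by (simp add: cmod_sq)
  define Z where "Z = M$1$1 * cnj (M$1$1) + M$1$2 * cnj (M$1$2)
      + M$2$1 * cnj (M$2$1) + M$2$2 * cnj (M$2$2)"
  have e: "(M ** adj M ** M)$1$1 = Z * M$1$1 - cnj (M$2$2) * det2 M"
    "(M ** adj M ** M)$1$2 = Z * M$1$2 + cnj (M$2$1) * det2 M"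
    "(M ** adj M ** M)$2$1 = Z * M$2$1 + cnj (M$1$2) * det2 M"
    "(M ** adj M ** M)$2$2 = Z * M$2$2 - cnj (M$1$1) * det2 M"
    by (simp_all add: mult2_nth Z_def det2_def algebra_simps)
  show ?thesis
    unfolding mat2_eq_iff e t[folded Z_def] assms by (simp add: map_matrix_def)
qed

lemma polar2_singular: "det2 M = 0 \<Longrightarrow> polar2 M = map_matrix ((*) (inverse (of_real (tau2 M)))) M"
  by (simp add: polar2_def mat2_eq_iff map_matrix_def divide_inverse mult.commute Let_def)

lemma polar2_unitary:
  assumes "det2 M \<noteq> 0"
  shows "polar2 M ** adj (polar2 M) = mat 1"
proof -
  define \<sigma> where "\<sigma> = det2 M / of_real (cmod (det2 M))"
  define t where "t = complex_of_real (tau2 M)"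
  define a b where ab: "a = M$1$1 + \<sigma> * cnj (M$2$2)" "b = M$1$2 - \<sigma> * cnj (M$2$1)"
  have "M \<noteq> 0" using assms by (auto simp: det2_def)
  then have t0: "t \<noteq> 0" using tau2_zero_iff by (simp add: t_def)
  have \<sigma>: "\<sigma> * cnj \<sigma> = 1"
    using assms complex_norm_square[of "det2 M"] by (simp add: \<sigma>_def power2_eq_square)
  have \<sigma>D: "cnj \<sigma> * det2 M = of_real (cmod (det2 M))" "\<sigma> * cnj (det2 M) = of_real (cmod (det2 M))"
    using assms complex_norm_square[of "det2 M"] by (simp_all add: \<sigma>_def power2_eq_square field_simps)
  have tt: "t * t = M$1$1 * cnj (M$1$1) + M$1$2 * cnj (M$1$2)
      + M$2$1 * cnj (M$2$1) + M$2$2 * cnj (M$2$2) + cnj \<sigma> * det2 M + \<sigma> * cnj (det2 M)"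
  proof -
    have "t * t = of_real ((tau2 M)\<^sup>2)" by (simp add: t_def power2_eq_square)
    then show ?thesis
      unfolding tau2_sq norm_mat2_sq of_real_add complex_norm_square by (simp add: \<sigma>D)
  qed
  have t2: "a * cnj a + b * cnj b = t * t"
  proof -
    have "a * cnj a + b * cnj b = t * t + (\<sigma> * cnj \<sigma> - 1) * (M$2$2 * cnj (M$2$2) + M$2$1 * cnj (M$2$1))"
      unfolding tt ab det2_def by (simp add: algebra_simps)
    then show ?thesis using \<sigma> by simp
  qed
  have cd: "M$2$1 - \<sigma> * cnj (M$1$2) = - \<sigma> * cnj b" "M$2$2 + \<sigma> * cnj (M$1$1) = \<sigma> * cnj a"
    unfolding ab using \<sigma> by (simp_all add: algebra_simps flip: mult.assoc)
  have pol: "polar2 M = mat2 (a / t) (b / t) (- \<sigma> * cnj b / t) (\<sigma> * cnj a / t)"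
    unfolding polar2_def Let_def \<sigma>_def[symmetric] t_def[symmetric] cd unfolding ab ..
  have ct: "cnj t = t" by (simp add: t_def)
  have q1: "x / t * (y / t) + z / t * (w / t) = (x * y + z * w) / (t * t)" for x y z w
    by (simp add: add_divide_distrib)
  have z: "a * (- cnj \<sigma> * b) + b * (cnj \<sigma> * a) = 0" "- \<sigma> * cnj b * cnj a + \<sigma> * cnj a * cnj b = 0"
    by (simp_all add: algebra_simps)
  have o: "- \<sigma> * cnj b * (- cnj \<sigma> * b) + \<sigma> * cnj a * (cnj \<sigma> * a) = t * t"
  proof -
    have "- \<sigma> * cnj b * (- cnj \<sigma> * b) + \<sigma> * cnj a * (cnj \<sigma> * a) = (\<sigma> * cnj \<sigma>) * (a * cnj a + b * cnj b)"
      by (simp add: algebra_simps)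
    then show ?thesis unfolding \<sigma> t2 by simp
  qed
  show ?thesis
    unfolding pol mat2_eq_iff mult2_nth adj_nth mat2_nth complex_cnj_divide complex_cnj_mult
      complex_cnj_minus complex_cnj_cnj ct q1 z o t2
    using t0 by (simp add: mat_def)
qed

lemma polar2_partial_isometry: "polar2 M ** adj (polar2 M) ** polar2 M = polar2 M"
proof (cases "det2 M = 0")
  case False
  then show ?thesis by (simp add: polar2_unitary)
next
  case True
  show ?thesis
  proof (cases "M = 0")
    case True
    then show ?thesis by (simp add: polar2_def mat2_eq_iff mult2_nth)
  next
    case False
    then have t0: "tau2 M \<noteq> 0" by (simp add: tau2_zero_iff)
    define c where "c = inverse (complex_of_real (tau2 M))"
    have c: "cnj c = c" by (simp add: c_def)
    have cc: "c * c * of_real ((tau2 M)\<^sup>2) = 1" using t0 by (simp add: c_def power2_eq_square field_simps)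
    have m: "(M ** adj M ** M) $ i $ j = of_real ((tau2 M)\<^sup>2) * M $ i $ j" for i j
      using mult_adj_mult_self_singular[OF True] by (simp add: map_matrix_def)
    have "(polar2 M ** adj (polar2 M) ** polar2 M) $ i $ j = c * c * c * (M ** adj M ** M) $ i $ j" for i j
      unfolding polar2_singular[OF True] c_def[symmetric]
      by (simp add: mult2_nth map_matrix_def c algebra_simps)
    also have "\<dots> i j = c * M $ i $ j" for i j
    proof -
      have "c * c * c * (of_real ((tau2 M)\<^sup>2) * M $ i $ j) = (c * c * of_real ((tau2 M)\<^sup>2)) * (c * M $ i $ j)"
        by (simp only: mult_ac)
      then show ?thesis unfolding m cc by simp
    qed
    finally show ?thesis
      by (simp add: vec_eq_iff polar2_singular[OF True] c_def[symmetric] map_matrix_def)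
  qed
qed

lemma polar2_kernel: "polar2 M *v v = 0 \<longleftrightarrow> M *v v = 0"
proof (cases "det2 M = 0")
  case True
  have "polar2 M *v v = inverse (of_real (tau2 M)) *s (M *v v)"
    unfolding polar2_singular[OF True] by (simp add: vec2_eq_iff mult_vec2_nth map_matrix_def algebra_simps)
  then show ?thesis
    by (cases "M = 0") (auto simp: vector_mul_eq_0 tau2_zero_iff)
next
  case False
  have "v = 0" if "M *v v = 0"
  proof -
    have e: "M$1$1 * v$1 + M$1$2 * v$2 = 0" "M$2$1 * v$1 + M$2$2 * v$2 = 0"
      using that by (auto simp: vec2_eq_iff mult_vec2_nth)
    have "det2 M * v$1 = 0" "det2 M * v$2 = 0"
      unfolding det2_def using e by algebra+
    with False show ?thesis by (simp add: vec2_eq_iff)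
  qed
  moreover have "v = 0" if "polar2 M *v v = 0"
  proof -
    have "adj (polar2 M) ** polar2 M = mat 1"
      using polar2_unitary[OF False] by (simp add: matrix_left_right_inverse)
    then have "v = adj (polar2 M) *v (polar2 M *v v)"
      by (simp add: matrix_vector_mul_assoc)
    with that show ?thesis by simp
  qed
  ultimately show ?thesis by auto
qed

text \<open>For the uniqueness: an invertible \<open>\<bar>M\<bar>\<close> can be cancelled from \<open>U \<bar>M\<bar> = M\<close>. If \<open>M\<close> is singular and
  nonzero, then \<open>M M\<^sup>* M = s\<^sup>2 M\<close> shows that \<open>s\<^sup>2 v - M\<^sup>* M v\<close> lies in the kernel, so \<open>s\<^sup>2 U v\<close> is
  determined by \<open>U \<bar>M\<bar>\<close>.\<close>

lemma polar_isometry_eq: "polar_isometry M = polar2 M"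
  unfolding polar_isometry_def
proof (rule the_equality)
  show "M = polar2 M ** mabs M \<and> polar2 M ** adj (polar2 M) ** polar2 M = polar2 M \<and>
    (\<forall>v. (polar2 M *v v = 0) = (M *v v = 0))"
    by (simp add: polar2_mult_mabs polar2_partial_isometry polar2_kernel)
next
  fix U assume U: "M = U ** mabs M \<and> U ** adj U ** U = U \<and> (\<forall>v. (U *v v = 0) = (M *v v = 0))"
  then have eq: "U ** mabs M = polar2 M ** mabs M" by (simp add: polar2_mult_mabs)
  have "U *v v = polar2 M *v v" for v
  proof (cases "M = 0")
    case True
    then show ?thesis using U polar2_kernel[of M v] by simp
  next
    case False
    then have t0: "tau2 M \<noteq> 0" by (simp add: tau2_zero_iff)
    show ?thesis
    proof (cases "det2 M = 0")
      case True
      define w where "w = of_real ((tau2 M)\<^sup>2) *s v - (adj M ** M) *v v"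
      have "M *v w = of_real ((tau2 M)\<^sup>2) *s (M *v v) - (M ** adj M ** M) *v v"
        by (simp add: w_def matrix_vector_mult_diff_distrib matrix_vector_mul_assoc matrix_mul_assoc
            vec2_eq_iff mult_vec2_nth algebra_simps)
      also have "\<dots> = 0"
        unfolding mult_adj_mult_self_singular[OF True]
        by (simp add: vec2_eq_iff mult_vec2_nth map_matrix_def algebra_simps)
      finally have w: "M *v w = 0" .
      have "X *v v = inverse (of_real ((tau2 M)\<^sup>2)) *s ((X ** mabs M) *v (mabs M *v v))"
        if "X *v w = 0" for X
      proof -
        have "of_real ((tau2 M)\<^sup>2) *s (X *v v) = X *v ((adj M ** M) *v v)"
        proof -
          have "X *v w = of_real ((tau2 M)\<^sup>2) *s (X *v v) - X *v ((adj M ** M) *v v)"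
            by (simp add: w_def matrix_vector_mult_diff_distrib vector_scalar_commute del: of_real_power)
          with that show ?thesis by (metis eq_iff_diff_eq_0)
        qed
        also have "\<dots> = (X ** mabs M) *v (mabs M *v v)"
          by (simp add: mabs_square[symmetric] matrix_vector_mul_assoc matrix_mul_assoc)
        finally have "of_real ((tau2 M)\<^sup>2) *s (X *v v) = (X ** mabs M) *v (mabs M *v v)" .
        moreover have "complex_of_real ((tau2 M)\<^sup>2) \<noteq> 0" using t0 by simp
        ultimately show ?thesis
          by (metis left_inverse vector_smult_assoc vector_smult_lid)
      qed
      then show ?thesis using U w polar2_kernel eq by metis
    next
      case False
      obtain a b d where ab: "mabs M = herm2 a b d" by (metis mabs_eq)
      have "of_real (a * d - (cmod b)\<^sup>2) \<noteq> (0::complex)"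
      proof
        assume z: "complex_of_real (a * d - (cmod b)\<^sup>2) = 0"
        have "det2 (mabs M ** mabs M) = det2 (mabs M) * det2 (mabs M)"
          by (simp add: det2_def mult2_nth algebra_simps)
        moreover have "det2 (mabs M) = 0"
          using z unfolding ab of_real_diff complex_norm_square by (simp add: det2_def herm2_def)
        moreover have "det2 (adj M ** M) = cnj (det2 M) * det2 M"
          by (simp add: det2_def mult2_nth algebra_simps)
        ultimately show False using False by (simp add: mabs_square)
      qed
      then have nz: "a * d - (cmod b)\<^sup>2 \<noteq> 0" by (metis of_real_0)
      have inv: "mabs M ** herm2 d (-b) a = map_matrix ((*) (of_real (a * d - (cmod b)\<^sup>2))) (mat 1)"
        unfolding ab of_real_diff complex_norm_square
        by (simp add: mat2_eq_iff mult2_nth herm2_def map_matrix_def mat_def algebra_simps)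
      have X: "(X ** mabs M) ** herm2 d (-b) a = map_matrix ((*) (of_real (a * d - (cmod b)\<^sup>2))) X" for X :: "complex^2^2"
        unfolding matrix_mul_assoc[symmetric] inv
        by (rule mult_scalar_matrix)
      have e: "map_matrix ((*) (of_real (a * d - (cmod b)\<^sup>2))) U
          = map_matrix ((*) (of_real (a * d - (cmod b)\<^sup>2))) (polar2 M)"
        using X[of U] X[of "polar2 M"] unfolding eq by (rule trans[OF sym])
      have "U $ i $ j = polar2 M $ i $ j" for i j
      proof -
        have "of_real (a * d - (cmod b)\<^sup>2) * U $ i $ j = of_real (a * d - (cmod b)\<^sup>2) * polar2 M $ i $ j"
          using e by (metis map_matrix_nth)
        then show ?thesis using nz by (simp only: mult_left_cancel of_real_eq_0_iff not_False_eq_True)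
      qed
      then have "U = polar2 M" by (simp add: vec_eq_iff)
      then show ?thesis by simp
    qed
  qed
  then show "U = polar2 M" by (simp add: matrix_eq)
qed

definition Amat :: "complex^2^2 \<Rightarrow> complex^2^2" where "Amat M = msqrt (mabs M)"
definition Bmat :: "complex^2^2 \<Rightarrow> complex^2^2" where "Bmat M = polar_isometry M ** msqrt (mabs M)"

lemma Bmat_mult_Amat: "Bmat M ** Amat M = M"
proof -
  have "Bmat M ** Amat M = polar2 M ** (Amat M ** Amat M)"
    by (simp add: Bmat_def Amat_def polar_isometry_eq matrix_mul_assoc)
  then show ?thesis by (simp add: Amat_def msqrt_square psd_mabs polar2_mult_mabs)
qed

lemma det2_le: "2 * cmod (det2 M) \<le> (norm M)\<^sup>2"
proof -
  have "cmod (det2 M) \<le> cmod (M$1$1) * cmod (M$2$2) + cmod (M$1$2) * cmod (M$2$1)"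
    unfolding det2_def norm_mult[symmetric] by (rule norm_triangle_ineq4)
  moreover have "2 * x \<le> a\<^sup>2 + b\<^sup>2 + c\<^sup>2 + d\<^sup>2" if "x \<le> a * d + b * c" for x a b c d :: real
    using that sum_squares_bound[of a d] sum_squares_bound[of b c] by simp
  ultimately show ?thesis unfolding norm_mat2_sq by blast
qed

lemma tau2_le: "tau2 M \<le> 3/2 * norm M"
proof -
  have "(tau2 M)\<^sup>2 \<le> (3/2 * norm M)\<^sup>2"
  proof -
    have "(3/2 * norm M)\<^sup>2 = 9/4 * (norm M)\<^sup>2" by (simp add: power2_eq_square)
    then show ?thesis
      using det2_le[of M] zero_le_power2[of "norm M"] unfolding tau2_sq by linarith
  qed
  then show ?thesis by (rule power2_le_imp_le) simp
qed

lemma norm_Amat_sq: "(norm (Amat M))\<^sup>2 \<le> 3/2 * norm M"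
proof -
  obtain a b d where A: "Amat M = herm2 a b d"
    using psd_msqrt[OF psd_mabs] psd_herm2_iff unfolding Amat_def by metis
  have "Amat M ** Amat M = mabs M" by (simp add: Amat_def msqrt_square psd_mabs)
  then have eq: "a\<^sup>2 + (cmod b)\<^sup>2 = ((cmod (M$1$1))\<^sup>2 + (cmod (M$2$1))\<^sup>2 + cmod (det2 M)) / tau2 M"
    "d\<^sup>2 + (cmod b)\<^sup>2 = ((cmod (M$1$2))\<^sup>2 + (cmod (M$2$2))\<^sup>2 + cmod (det2 M)) / tau2 M"
    unfolding A herm2_square mabs_eq herm2_eq_iff by auto
  have "(norm (Amat M))\<^sup>2 = (a\<^sup>2 + (cmod b)\<^sup>2) + (d\<^sup>2 + (cmod b)\<^sup>2)"
    by (simp add: A norm_mat2_sq herm2_def)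
  also have "\<dots> = (tau2 M)\<^sup>2 / tau2 M"
    unfolding eq tau2_sq norm_mat2_sq by (simp add: add_divide_distrib)
  also have "\<dots> = tau2 M" by (simp add: power2_eq_square)
  finally show ?thesis using tau2_le by simp
qed

lemma norm_polar2_le: "norm (polar2 M) \<le> 8"
proof -
  define \<sigma> where "\<sigma> = det2 M / of_real (cmod (det2 M))"
  have \<sigma>: "cmod \<sigma> \<le> 1" unfolding \<sigma>_def by (cases "det2 M = 0") (auto simp: norm_divide)
  have nt: "norm M \<le> tau2 M"
    by (rule power2_le_imp_le) (simp_all add: tau2_sq tau2_nonneg)
  have ent: "cmod (M$i$j) \<le> tau2 M" for i j
    using Finite_Cartesian_Product.norm_nth_le[of "M$i" j] Finite_Cartesian_Product.norm_nth_le[of M i] nt by linarith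
  have bd: "cmod ((M$i$j + s * (\<sigma> * cnj (M$k$l))) / of_real (tau2 M)) \<le> 2" if "cmod s = 1" for i j k l s
  proof (cases "tau2 M = 0")
    case False
    have "cmod (M$i$j + s * (\<sigma> * cnj (M$k$l))) \<le> cmod (M$i$j) + cmod \<sigma> * cmod (M$k$l)"
      using norm_triangle_ineq[of "M$i$j" "s * (\<sigma> * cnj (M$k$l))"] that by (simp add: norm_mult)
    also have "\<dots> \<le> tau2 M + 1 * tau2 M"
      by (intro add_mono mult_mono \<sigma> ent) auto
    finally show ?thesis using False tau2_nonneg[of M] by (simp add: norm_divide field_simps)
  qed simp
  have "norm (polar2 M) \<le> 2 + 2 + 2 + 2"
    unfolding polar2_def Let_def \<sigma>_def[symmetric]
    using bd[of 1 1 1 2 2] bd[of "-1" 1 2 2 1] bd[of "-1" 2 1 1 2] bd[of 1 2 2 1 1]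
    by (intro norm_mat2_le_sum[THEN order_trans] add_mono) simp_all
  then show ?thesis by simp
qed

lemma norm_Bmat_sq: "(norm (Bmat M))\<^sup>2 \<le> 96 * norm M"
proof -
  have "norm (Bmat M) \<le> norm (polar2 M) * norm (Amat M)"
    unfolding Bmat_def Amat_def polar_isometry_eq by (rule norm_matrix_mult_le)
  also have "\<dots> \<le> 8 * norm (Amat M)"
    by (intro mult_right_mono norm_polar2_le) auto
  finally have "(norm (Bmat M))\<^sup>2 \<le> (8 * norm (Amat M))\<^sup>2" by (intro power_mono) auto
  also have "\<dots> \<le> 64 * (3/2 * norm M)"
    using norm_Amat_sq[of M] by (simp add: power_mult_distrib)
  finally show ?thesis by simp
qed

lemma borel_measurable_det2 [measurable (raw)]:
  assumes "F \<in> borel_measurable M"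
  shows "(\<lambda>x. det2 (F x)) \<in> borel_measurable M"
  unfolding det2_def
  by (intro borel_measurable_diff borel_measurable_times borel_measurable_vec_nth assms)

lemma borel_measurable_tau2 [measurable (raw)]:
  assumes [measurable]: "F \<in> borel_measurable M"
  shows "(\<lambda>x. tau2 (F x)) \<in> borel_measurable M"
  unfolding tau2_def by measurable

lemma borel_measurable_herm2 [measurable (raw)]:
  assumes [measurable]: "a \<in> borel_measurable M" "b \<in> borel_measurable M" "d \<in> borel_measurable M"
  shows "(\<lambda>x. herm2 (a x) (b x) (d x)) \<in> borel_measurable M"
proof -
  have "(\<lambda>x. cnj (b x)) \<in> borel_measurable M"
    by (rule borel_measurable_continuous_on[where f = cnj]) (auto intro!: continuous_intros)
  then show ?thesis unfolding herm2_def by measurable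
qed

lemma borel_measurable_entries:
  fixes F :: "'a \<Rightarrow> complex^2^2"
  assumes "F \<in> borel_measurable M"
  shows "(\<lambda>x. F x $ i $ j) \<in> borel_measurable M" "(\<lambda>x. cnj (F x $ i $ j)) \<in> borel_measurable M"
proof -
  show *: "(\<lambda>x. F x $ i $ j) \<in> borel_measurable M"
    by (intro borel_measurable_vec_nth assms)
  show "(\<lambda>x. cnj (F x $ i $ j)) \<in> borel_measurable M"
    by (rule borel_measurable_continuous_on[OF _ *]) (auto intro!: continuous_intros)
qed

lemma borel_measurable_mabs [measurable (raw)]:
  assumes [measurable]: "F \<in> borel_measurable M"
  shows "(\<lambda>x. mabs (F x)) \<in> borel_measurable M"
proof -
  note [measurable] = borel_measurable_entries[OF assms]
  show ?thesis unfolding mabs_eq by (intro borel_measurable_herm2) measurable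
qed

lemma borel_measurable_root2 [measurable (raw)]:
  assumes [measurable]: "F \<in> borel_measurable M"
  shows "(\<lambda>x. root2 (F x)) \<in> borel_measurable M"
proof -
  define s where "s = (\<lambda>x. sqrt (Re (F x$1$1) * Re (F x$2$2) - (cmod (F x$1$2))\<^sup>2))"
  define t where "t = (\<lambda>x. sqrt (Re (F x$1$1) + Re (F x$2$2) + 2 * s x))"
  note [measurable] = borel_measurable_entries[OF assms]
  have [measurable]: "s \<in> borel_measurable M" unfolding s_def by measurable
  have [measurable]: "t \<in> borel_measurable M" unfolding t_def by measurable
  have "root2 (F x) = herm2 ((Re (F x$1$1) + s x) / t x) (F x$1$2 / of_real (t x)) ((Re (F x$2$2) + s x) / t x)" for x
    by (simp add: root2_def s_def t_def Let_def)
  then show ?thesis by simp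
qed

lemma borel_measurable_Amat [measurable (raw)]:
  assumes [measurable]: "F \<in> borel_measurable M"
  shows "(\<lambda>x. Amat (F x)) \<in> borel_measurable M"
  unfolding Amat_def msqrt_eq_root2[OF psd_mabs] by measurable

lemma borel_measurable_matrix_mult [measurable (raw)]:
  fixes F G :: "'a \<Rightarrow> complex^2^2"
  assumes "F \<in> borel_measurable M" "G \<in> borel_measurable M"
  shows "(\<lambda>x. F x ** G x) \<in> borel_measurable M"
proof -
  note [measurable] = borel_measurable_entries[OF assms(1)] borel_measurable_entries[OF assms(2)]
  have eq: "F x ** G x = mat2 (F x$1$1 * G x$1$1 + F x$1$2 * G x$2$1) (F x$1$1 * G x$1$2 + F x$1$2 * G x$2$2)
      (F x$2$1 * G x$1$1 + F x$2$2 * G x$2$1) (F x$2$1 * G x$1$2 + F x$2$2 * G x$2$2)" for x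
    by (simp add: mat2_eq_iff mult2_nth)
  show ?thesis unfolding eq by measurable
qed

lemma borel_measurable_polar2 [measurable (raw)]:
  assumes [measurable]: "F \<in> borel_measurable M"
  shows "(\<lambda>x. polar2 (F x)) \<in> borel_measurable M"
proof -
  define \<sigma> where "\<sigma> = (\<lambda>x. det2 (F x) / of_real (cmod (det2 (F x))))"
  note [measurable] = borel_measurable_entries[OF assms]
  have [measurable]: "\<sigma> \<in> borel_measurable M" unfolding \<sigma>_def by measurable
  show ?thesis unfolding polar2_def Let_def \<sigma>_def[symmetric, THEN fun_cong] by measurable
qed

lemma borel_measurable_Bmat [measurable (raw)]:
  assumes [measurable]: "F \<in> borel_measurable M"
  shows "(\<lambda>x. Bmat (F x)) \<in> borel_measurable M"
  unfolding Bmat_def polar_isometry_eq Amat_def[symmetric] by measurable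

section \<open>Smooth functions and test functions\<close>

text \<open>Smoothness is set up by recursion on the order, because the derivative of a product is a sum of
  products of lower order.\<close>

primrec smooth_upto :: "nat \<Rightarrow> (real \<Rightarrow> real) \<Rightarrow> bool" where
  "smooth_upto 0 f \<longleftrightarrow> (\<forall>x. f field_differentiable at x)"
| "smooth_upto (Suc k) f \<longleftrightarrow> (\<forall>x. f field_differentiable at x) \<and> smooth_upto k (deriv f)"

lemma smooth_upto_differentiable: "smooth_upto k f \<Longrightarrow> f field_differentiable at x"
  by (cases k) auto

lemma smooth_upto_iff: "smooth_upto k f \<longleftrightarrow> (\<forall>j\<le>k. \<forall>x. (deriv ^^ j) f field_differentiable at x)"
proof (induction k arbitrary: f)
  case (Suc k)
  have "(\<forall>j\<le>Suc k. P j) \<longleftrightarrow> P 0 \<and> (\<forall>j\<le>k. P (Suc j))" for P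
    by (metis Suc_le_mono not0_implies_Suc le0)
  then show ?case
    by (simp add: Suc.IH funpow_Suc_right del: funpow.simps)
qed simp

definition smooth :: "(real \<Rightarrow> real) \<Rightarrow> bool" where "smooth f \<longleftrightarrow> (\<forall>k. smooth_upto k f)"

lemma smooth_iff: "smooth f \<longleftrightarrow> (\<forall>k x. (deriv ^^ k) f field_differentiable at x)"
  unfolding smooth_def smooth_upto_iff by blast

lemma smooth_rec: "smooth f \<longleftrightarrow> (\<forall>x. f field_differentiable at x) \<and> smooth (deriv f)"
proof safe
  assume f: "smooth f"
  show "f field_differentiable at x" for x
    using f smooth_upto_differentiable[of 0 f] unfolding smooth_def by blast
  have "smooth_upto k (deriv f)" for k
    using f[unfolded smooth_def, rule_format, of "Suc k"] by simp
  then show "smooth (deriv f)" by (simp add: smooth_def)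
next
  assume f: "\<forall>x. f field_differentiable at x" "smooth (deriv f)"
  have "smooth_upto k f" for k
    using f by (cases k) (auto simp: smooth_def)
  then show "smooth f" by (simp add: smooth_def)
qed

lemma smooth_upto_Suc_imp: "smooth_upto (Suc k) f \<Longrightarrow> smooth_upto k f"
  unfolding smooth_upto_iff by simp

lemma smooth_upto_add: "smooth_upto k f \<Longrightarrow> smooth_upto k g \<Longrightarrow> smooth_upto k (\<lambda>x. f x + g x)"
proof (induction k arbitrary: f g)
  case (Suc k)
  then have "deriv (\<lambda>x. f x + g x) = (\<lambda>x. deriv f x + deriv g x)"
    by (auto intro!: deriv_add)
  with Suc show ?case by (auto intro!: field_differentiable_add)
qed (auto intro!: field_differentiable_add)

lemma smooth_upto_mult: "smooth_upto k f \<Longrightarrow> smooth_upto k g \<Longrightarrow> smooth_upto k (\<lambda>x. f x * g x)"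
proof (induction k arbitrary: f g)
  case (Suc k)
  then have "deriv (\<lambda>x. f x * g x) = (\<lambda>x. f x * deriv g x + deriv f x * g x)"
    by (auto intro!: deriv_mult)
  moreover have "smooth_upto k (\<lambda>x. f x * deriv g x)" "smooth_upto k (\<lambda>x. deriv f x * g x)"
    using Suc smooth_upto_Suc_imp[of k f] smooth_upto_Suc_imp[of k g] by auto
  ultimately show ?case using Suc.prems smooth_upto_add by (auto intro!: field_differentiable_mult)
qed (auto intro!: field_differentiable_mult)

lemma smooth_upto_const: "smooth_upto k (\<lambda>x. c)"
  by (induction k arbitrary: c) auto

lemma DERIV_affine:
  assumes "\<And>x. f field_differentiable at x"
  shows "((\<lambda>x. f (a * x + b)) has_field_derivative deriv f (a * x + b) * a) (at x)"
  by (intro DERIV_chain2[of f] field_differentiable_derivI assms) (auto intro!: derivative_eq_intros)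

lemma smooth_upto_affine: "smooth_upto k f \<Longrightarrow> smooth_upto k (\<lambda>x. f (a * x + b))"
proof (induction k arbitrary: f)
  case 0
  then show ?case using DERIV_affine[of f a b] by (auto simp: field_differentiable_def)
next
  case (Suc k)
  then have d: "((\<lambda>x. f (a * x + b)) has_field_derivative deriv f (a * x + b) * a) (at x)" for x
    by (intro DERIV_affine) auto
  then have "deriv (\<lambda>x. f (a * x + b)) = (\<lambda>x. deriv f (a * x + b) * a)"
    by (auto intro!: DERIV_imp_deriv)
  moreover have "smooth_upto k (\<lambda>x. deriv f (a * x + b) * a)"
    using Suc by (intro smooth_upto_mult smooth_upto_const) auto
  ultimately show ?case using d by (auto simp: field_differentiable_def)
qed

lemma smooth_add: "smooth f \<Longrightarrow> smooth g \<Longrightarrow> smooth (\<lambda>x. f x + g x)"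
  and smooth_mult: "smooth f \<Longrightarrow> smooth g \<Longrightarrow> smooth (\<lambda>x. f x * g x)"
  and smooth_const: "smooth (\<lambda>x. c)"
  and smooth_affine: "smooth f \<Longrightarrow> smooth (\<lambda>x. f (a * x + b))"
  by (auto simp: smooth_def smooth_upto_add smooth_upto_mult smooth_upto_const smooth_upto_affine)

text \<open>The functions \<open>p (1/x) e\<^sup>-\<^sup>1\<^sup>/\<^sup>x\<close>, extended by \<open>0\<close> to the left half line. Their derivatives are of the
  same form, which makes all of them smooth.\<close>

definition flat_exp :: "real poly \<Rightarrow> real \<Rightarrow> real" where
  "flat_exp p x = (if x > 0 then poly p (1 / x) * exp (- (1 / x)) else 0)"

lemma tendsto_poly_exp: "((\<lambda>t. poly p t * exp (- t)) \<longlongrightarrow> (0::real)) at_top"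
proof -
  have "((\<lambda>t. \<Sum>i\<le>degree p. coeff p i * (t ^ i / exp t)) \<longlongrightarrow> (\<Sum>i\<le>degree p. coeff p i * (0::real))) at_top"
    by (intro tendsto_sum tendsto_mult tendsto_const tendsto_power_div_exp_0)
  moreover have "(\<Sum>i\<le>degree p. coeff p i * (t ^ i / exp t)) = poly p t * exp (- t)" for t :: real
    by (simp add: poly_altdef sum_distrib_right exp_minus divide_inverse mult.assoc)
  ultimately show ?thesis by simp
qed

lemma DERIV_flat_exp:
  "(flat_exp p has_field_derivative flat_exp (monom 1 2 * (p - pderiv p)) x) (at x)"
proof (cases rule: linorder_cases[of x 0])
  case less
  have "((\<lambda>_. 0) has_field_derivative 0) (at x)" by simp
  then have "(flat_exp p has_field_derivative 0) (at x)"
    by (rule DERIV_cong_ev[OF refl _ refl, THEN iffD1, rotated])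
      (use less in \<open>auto simp: flat_exp_def intro!: eventually_mono[OF eventually_nhds_in_open[of "{..<0}"]]\<close>)
  with less show ?thesis by (simp add: flat_exp_def)
next
  case greater
  have "((\<lambda>x. poly p (1 / x) * exp (- (1 / x))) has_field_derivative
      poly (monom 1 2 * (p - pderiv p)) (1 / x) * exp (- (1 / x))) (at x)"
    using greater
    by (auto intro!: derivative_eq_intros simp: poly_monom field_simps power2_eq_square)
  then have "(flat_exp p has_field_derivative
      poly (monom 1 2 * (p - pderiv p)) (1 / x) * exp (- (1 / x))) (at x)"
    by (rule DERIV_cong_ev[OF refl _ refl, THEN iffD1, rotated])
      (use greater in \<open>auto simp: flat_exp_def intro!: eventually_mono[OF eventually_nhds_in_open[of "{0<..}"]]\<close>)
  with greater show ?thesis by (simp add: flat_exp_def)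
next
  case equal
  have "((\<lambda>h. (flat_exp p h - flat_exp p 0) / (h - 0)) \<longlongrightarrow> 0) (at 0)"
  proof (rule filterlim_split_at)
    show "((\<lambda>h. (flat_exp p h - flat_exp p 0) / (h - 0)) \<longlongrightarrow> 0) (at_left 0)"
      by (rule tendsto_eventually) (auto simp: flat_exp_def eventually_at_filter)
    have "((\<lambda>h. poly (pCons 0 p) (inverse h) * exp (- inverse h)) \<longlongrightarrow> 0) (at_right 0)"
      by (rule filterlim_compose[OF tendsto_poly_exp filterlim_inverse_at_top_right])
    then show "((\<lambda>h. (flat_exp p h - flat_exp p 0) / (h - 0)) \<longlongrightarrow> 0) (at_right 0)"
      by (rule Lim_transform_eventually)
        (auto simp: flat_exp_def eventually_at_filter field_simps)
  qed
  then have "(flat_exp p has_field_derivative 0) (at 0)"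
    by (simp add: has_field_derivative_iff)
  with equal show ?thesis by (simp add: flat_exp_def)
qed

lemma smooth_flat_exp: "smooth (flat_exp p)"
proof -
  have "smooth_upto k (flat_exp p)" for k
  proof (induction k arbitrary: p)
    case (Suc k)
    have "deriv (flat_exp p) = flat_exp (monom 1 2 * (p - pderiv p))"
      by (intro ext DERIV_imp_deriv DERIV_flat_exp)
    with Suc show ?case using DERIV_flat_exp by (auto simp: field_differentiable_def)
  qed (use DERIV_flat_exp in \<open>auto simp: field_differentiable_def\<close>)
  then show ?thesis by (simp add: smooth_def)
qed

lemma test_function_iff: "test_function \<phi> \<longleftrightarrow> smooth \<phi> \<and> (\<exists>N>0. \<forall>x. N \<le> \<bar>x\<bar> \<longrightarrow> \<phi> x = 0)"
proof -
  have "compact (closure {x. \<phi> x \<noteq> 0}) \<longleftrightarrow> (\<exists>N>0. \<forall>x. N \<le> \<bar>x\<bar> \<longrightarrow> \<phi> x = 0)"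
  proof
    assume "compact (closure {x. \<phi> x \<noteq> 0})"
    then have "bounded {x. \<phi> x \<noteq> 0}"
      using compact_imp_bounded bounded_subset closure_subset by blast
    then obtain B where "\<forall>x. \<phi> x \<noteq> 0 \<longrightarrow> \<bar>x\<bar> \<le> B" by (auto simp: bounded_iff)
    then show "\<exists>N>0. \<forall>x. N \<le> \<bar>x\<bar> \<longrightarrow> \<phi> x = 0"
      by (intro exI[of _ "\<bar>B\<bar> + 1"]) fastforce
  next
    assume "\<exists>N>0. \<forall>x. N \<le> \<bar>x\<bar> \<longrightarrow> \<phi> x = 0"
    then obtain N where "\<forall>x. N \<le> \<bar>x\<bar> \<longrightarrow> \<phi> x = 0" by blast
    then have "bounded {x. \<phi> x \<noteq> 0}"
      unfolding bounded_iff by (metis linorder_linear mem_Collect_eq real_norm_def)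
    then show "compact (closure {x. \<phi> x \<noteq> 0})" by (simp add: compact_closure)
  qed
  then show ?thesis by (simp add: test_function_def smooth_iff)
qed

lemma test_function_derivative:
  assumes "test_function \<phi>"
  shows "(\<phi> has_field_derivative deriv \<phi> x) (at x)" "continuous_on UNIV \<phi>" "continuous_on UNIV (deriv \<phi>)"
proof -
  have "smooth \<phi>" using assms by (simp add: test_function_iff)
  then have s: "\<phi> field_differentiable at x" "deriv \<phi> field_differentiable at x" for x
    by (metis smooth_rec)+
  then show "(\<phi> has_field_derivative deriv \<phi> x) (at x)"
    by (simp add: field_differentiable_derivI)
  show "continuous_on UNIV \<phi>" "continuous_on UNIV (deriv \<phi>)"
    using s by (auto intro!: continuous_at_imp_continuous_on field_differentiable_imp_continuous_at)
qed

lemma test_function_support: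
  assumes "test_function \<phi>"
  obtains N where "N > 0" "\<And>x. N \<le> \<bar>x\<bar> \<Longrightarrow> \<phi> x = 0" "\<And>x. N \<le> \<bar>x\<bar> \<Longrightarrow> deriv \<phi> x = 0"
proof -
  obtain N where N: "N > 0" "\<And>x. N \<le> \<bar>x\<bar> \<Longrightarrow> \<phi> x = 0"
    using assms by (auto simp: test_function_iff)
  have "deriv \<phi> x = 0" if "N + 1 \<le> \<bar>x\<bar>" for x
  proof -
    have "((\<lambda>_. 0) has_field_derivative 0) (at x)" by simp
    then have "(\<phi> has_field_derivative 0) (at x)"
    proof (rule DERIV_cong_ev[OF refl _ refl, THEN iffD1, rotated])
      have "eventually (\<lambda>y. y \<in> - cball 0 N) (nhds x)"
        using that by (intro eventually_nhds_in_open) auto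
      then show "eventually (\<lambda>y. 0 = \<phi> y) (nhds x)"
        by eventually_elim (use N in auto)
    qed
    then show ?thesis by (rule DERIV_imp_deriv)
  qed
  with N show thesis by (intro that[of "N + 1"]) auto
qed

lemma integrable_compact_support:
  fixes f :: "real \<Rightarrow> 'a :: euclidean_space"
  assumes "continuous_on UNIV f" "\<And>x. N \<le> \<bar>x\<bar> \<Longrightarrow> f x = 0"
  shows "integrable lborel f"
proof -
  have "integrable lborel (\<lambda>x. indicator {-N..N} x *\<^sub>R f x)"
    by (intro borel_integrable_compact continuous_on_subset[OF assms(1)]) auto
  moreover have "indicator {-N..N} x *\<^sub>R f x = f x" for x
    using assms(2)[of x] by (auto simp: indicator_def)
  ultimately show ?thesis by simp
qed

lemma test_function_integrable:
  assumes "test_function \<phi>"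
  shows "integrable lborel \<phi>" "integrable lborel (deriv \<phi>)"
  using test_function_derivative[OF assms] test_function_support[OF assms]
  by (metis integrable_compact_support)+

lemma test_function_lincomb:
  assumes "test_function \<phi>" "test_function \<psi>"
  shows "test_function (\<lambda>x. a * \<phi> x + b * \<psi> x)"
proof -
  obtain N M where "N > 0" "\<And>x. N \<le> \<bar>x\<bar> \<Longrightarrow> \<phi> x = 0" "M > 0" "\<And>x. M \<le> \<bar>x\<bar> \<Longrightarrow> \<psi> x = 0"
    using assms by (auto simp: test_function_iff)
  then have "\<exists>N>0. \<forall>x. N \<le> \<bar>x\<bar> \<longrightarrow> a * \<phi> x + b * \<psi> x = 0"
    by (intro exI[of _ "max N M"]) auto
  then show ?thesis
    using assms by (auto simp: test_function_iff intro!: smooth_add smooth_mult smooth_const)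
qed

lemma integral_FTC_compact_support:
  fixes F :: "real \<Rightarrow> 'a :: euclidean_space"
  assumes d: "\<And>x. (F has_vector_derivative f x) (at x)" and c: "continuous_on UNIV f"
    and s: "\<And>x. N \<le> \<bar>x\<bar> \<Longrightarrow> F x = 0" "\<And>x. N \<le> \<bar>x\<bar> \<Longrightarrow> f x = 0" and N: "N > 0"
  shows "(LINT x|lborel. indicator {y<..} x *\<^sub>R f x) = - F y"
    "(LINT x|lborel. indicator {..<y} x *\<^sub>R f x) = F y"
    "(LINT x|lborel. f x) = 0"
proof -
  define M where "M = max N \<bar>y\<bar>"
  have M: "F M = 0" "F (-M) = 0" "-M \<le> y" "y \<le> M" "\<And>x. M < x \<Longrightarrow> f x = 0" "\<And>x. x < -M \<Longrightarrow> f x = 0"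
    by (auto simp: M_def intro!: s)
  have ne: "AE x in lborel. x \<noteq> y" by (rule AE_lborel_singleton)
  have fm [measurable]: "f \<in> borel_measurable borel"
    using c by (rule borel_measurable_continuous_onI)
  have FTC: "(LINT x|lborel. indicator {a..b} x *\<^sub>R f x) = F b - F a" if "a \<le> b" for a b
    by (rule integral_FTC_atLeastAtMost[OF that])
      (auto intro: has_vector_derivative_at_within d continuous_on_subset[OF c])
  have "(LINT x|lborel. indicator {y<..} x *\<^sub>R f x) = (LINT x|lborel. indicator {y..M} x *\<^sub>R f x)"
    using ne by (intro integral_cong_AE) (auto elim!: eventually_mono simp: indicator_def M)
  then show "(LINT x|lborel. indicator {y<..} x *\<^sub>R f x) = - F y"
    using FTC[of y M] M by simp
  have "(LINT x|lborel. indicator {..<y} x *\<^sub>R f x) = (LINT x|lborel. indicator {-M..y} x *\<^sub>R f x)"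
    using ne by (intro integral_cong_AE) (auto elim!: eventually_mono simp: indicator_def M)
  then show "(LINT x|lborel. indicator {..<y} x *\<^sub>R f x) = F y"
    using FTC[of "-M" y] M by simp
  have "(LINT x|lborel. f x) = (LINT x|lborel. indicator {-M..M} x *\<^sub>R f x)"
    by (intro Bochner_Integration.integral_cong) (auto simp: indicator_def M not_le)
  then show "(LINT x|lborel. f x) = 0"
    using FTC[of "-M" M] M by simp
qed

lemma test_function_antiderivative:
  assumes \<theta>: "test_function \<theta>" and zero: "(LINT x|lborel. \<theta> x) = 0"
  obtains \<phi> where "test_function \<phi>" "deriv \<phi> = \<theta>"
proof -
  obtain N where N: "N > 0" "\<And>x. N \<le> \<bar>x\<bar> \<Longrightarrow> \<theta> x = 0"
    using test_function_support[OF \<theta>] by metis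
  define \<phi> where "\<phi> = (\<lambda>x. LINT t|lborel. indicator {..x} t *\<^sub>R \<theta> t)"
  have [measurable]: "\<theta> \<in> borel_measurable borel"
    using test_function_derivative(2)[OF \<theta>] by (rule borel_measurable_continuous_onI)
  have out: "\<phi> x = 0" if "N \<le> \<bar>x\<bar>" for x
  proof (cases "x < 0")
    case True
    then have "(\<lambda>t. indicator {..x} t *\<^sub>R \<theta> t) = (\<lambda>t. 0)"
      using that N(2) by (auto simp: indicator_def fun_eq_iff)
    then show ?thesis unfolding \<phi>_def by (simp del: real_scaleR_def)
  next
    case False
    then have "\<phi> x = (LINT t|lborel. \<theta> t)"
      unfolding \<phi>_def using that N(2) by (auto intro!: Bochner_Integration.integral_cong simp: indicator_def)
    then show ?thesis using zero by simp
  qed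
  have eq: "\<phi> x = integral {-M..x} \<theta>" if "-M \<le> x" "N \<le> M" for x M
  proof -
    have "\<phi> x = (LINT t:{-M..x}|lborel. \<theta> t)"
      unfolding \<phi>_def set_lebesgue_integral_def using that N
      by (intro Bochner_Integration.integral_cong) (auto simp: indicator_def)
    then show ?thesis
      using set_borel_integral_eq_integral(2)[OF borel_integrable_atLeastAtMost'[OF
        continuous_on_subset[OF test_function_derivative(2)[OF \<theta>] subset_UNIV]], of "-M" x] by simp
  qed
  have der: "(\<phi> has_field_derivative \<theta> x) (at x)" for x
  proof -
    define M where "M = max N \<bar>x\<bar> + 1"
    have "((\<lambda>u. integral {-M..u} \<theta>) has_real_derivative \<theta> x) (at x within {-M..M})"
      by (rule integral_has_real_derivative)
        (auto intro: continuous_on_subset[OF test_function_derivative(2)[OF \<theta>]] simp: M_def)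
    moreover have "at x within {-M..M} = at x"
      by (rule at_within_interior) (auto simp: M_def)
    ultimately have "((\<lambda>u. integral {-M..u} \<theta>) has_real_derivative \<theta> x) (at x)" by simp
    then show ?thesis
    proof (rule DERIV_cong_ev[OF refl _ refl, THEN iffD1, rotated])
      have "eventually (\<lambda>u. u \<in> {-M<..<M}) (nhds x)"
        by (intro eventually_nhds_in_open) (auto simp: M_def)
      then show "eventually (\<lambda>u. integral {-M..u} \<theta> = \<phi> u) (nhds x)"
      proof eventually_elim
        case (elim u)
        have "N \<le> M" by (simp add: M_def)
        with elim eq[of M u] show ?case by simp
      qed
    qed
  qed
  then have deriv: "deriv \<phi> = \<theta>" by (intro ext DERIV_imp_deriv)
  have "smooth \<phi>"
    using der deriv \<theta> smooth_rec[of \<phi>] by (auto simp: test_function_iff field_differentiable_def)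
  then have "test_function \<phi>" using out N(1) by (auto simp: test_function_iff)
  with deriv show thesis by (rule that[rotated])
qed

text \<open>Smooth approximations of the indicator function of an interval, from below.\<close>

definition smooth_window :: "real \<Rightarrow> real \<Rightarrow> nat \<Rightarrow> real \<Rightarrow> real" where
  "smooth_window a b n x = flat_exp 1 (real n * x + (- real n * a)) * flat_exp 1 (- real n * x + real n * b)"

lemma smooth_window_bounds: "0 \<le> smooth_window a b n x" "smooth_window a b n x \<le> 1"
  by (auto simp: smooth_window_def flat_exp_def intro!: mult_le_one)

lemma smooth_window_outside: "x \<notin> {a<..<b} \<Longrightarrow> smooth_window a b n x = 0"
  by (auto simp: smooth_window_def flat_exp_def zero_less_mult_iff simp flip: right_diff_distrib)

lemma test_function_smooth_window: "test_function (smooth_window a b n)"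
proof -
  have "smooth (smooth_window a b n)"
    unfolding smooth_window_def[abs_def] by (intro smooth_mult smooth_affine smooth_flat_exp)
  moreover have "\<exists>N>0. \<forall>x. N \<le> \<bar>x\<bar> \<longrightarrow> smooth_window a b n x = 0"
    by (intro exI[of _ "\<bar>a\<bar> + \<bar>b\<bar> + 1"]) (auto intro!: smooth_window_outside)
  ultimately show ?thesis by (simp add: test_function_iff)
qed

lemma smooth_window_tendsto: "(\<lambda>n. smooth_window a b n x) \<longlonglongrightarrow> indicator {a<..<b} x"
proof (cases "x \<in> {a<..<b}")
  case True
  have lim: "(\<lambda>n. flat_exp 1 (real n * c)) \<longlonglongrightarrow> 1" if "c > 0" for c
  proof -
    have "(\<lambda>n. exp (- (inverse c * inverse (real n)))) \<longlonglongrightarrow> exp (- (inverse c * 0))"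
      by (intro tendsto_intros lim_inverse_n)
    then have "(\<lambda>n. exp (- (inverse c * inverse (real n)))) \<longlonglongrightarrow> 1" by simp
    moreover have "eventually (\<lambda>n. exp (- (inverse c * inverse (real n))) = flat_exp 1 (real n * c)) sequentially"
      using eventually_gt_at_top[of 0] by eventually_elim (use that in \<open>auto simp: flat_exp_def field_simps\<close>)
    ultimately show ?thesis by (rule Lim_transform_eventually)
  qed
  have "(\<lambda>n. flat_exp 1 (real n * (x - a)) * flat_exp 1 (real n * (b - x))) \<longlonglongrightarrow> 1 * 1"
    using True by (intro tendsto_mult lim) auto
  then show ?thesis using True by (simp add: smooth_window_def algebra_simps)
qed (simp add: smooth_window_outside)

lemma smooth_window_pos:
  assumes "a < x" "x < b" "n > 0"
  shows "0 < smooth_window a b n x"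
proof -
  have "0 < real n * (x - a)" "0 < real n * (b - x)" using assms by auto
  then have "0 < real n * x + (- real n * a)" "0 < - real n * x + real n * b"
    by (simp_all add: algebra_simps)
  then show ?thesis by (simp add: smooth_window_def flat_exp_def)
qed

section \<open>Weak derivatives\<close>

lemma integrable_product_bound:
  fixes K :: "real \<Rightarrow> real \<Rightarrow> 'a :: {banach, second_countable_topology}"
  assumes [measurable]: "case_prod K \<in> borel_measurable (lborel \<Otimes>\<^sub>M lborel)"
    and a: "integrable lborel a" and b: "integrable lborel b"
    and le: "\<And>x y. norm (K x y) \<le> a x * b y"
  shows "integrable (lborel \<Otimes>\<^sub>M lborel) (case_prod K)"
proof (rule lborel_pair.Fubini_integrable)
  have [measurable]: "a \<in> borel_measurable lborel" "b \<in> borel_measurable lborel" using a b by auto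
  have int: "integrable lborel (\<lambda>y. K x y)" for x
    by (rule Bochner_Integration.integrable_bound[of _ "\<lambda>y. a x * b y"])
      (auto intro!: integrable_mult_right b order_trans[OF le])
  then show "AE x in lborel. integrable lborel (\<lambda>y. case_prod K (x, y))" by simp
  show "integrable lborel (\<lambda>x. LINT y|lborel. norm (case_prod K (x, y)))"
  proof (rule Bochner_Integration.integrable_bound[of _ "\<lambda>x. a x * (LINT y|lborel. b y)"])
    show "integrable lborel (\<lambda>x. a x * (LINT y|lborel. b y))" using a by simp
    show "AE x in lborel. norm (LINT y|lborel. norm (case_prod K (x, y))) \<le> norm (a x * (LINT y|lborel. b y))"
    proof (rule AE_I2)
      fix x
      have "(LINT y|lborel. norm (K x y)) \<le> (LINT y|lborel. a x * b y)"
        by (intro integral_mono integrable_norm int integrable_mult_right b le)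
      then show "norm (LINT y|lborel. norm (case_prod K (x, y))) \<le> norm (a x * (LINT y|lborel. b y))"
        by simp
    qed
  qed simp
qed simp

lemma integrable_indicator_Icc: "integrable lborel (indicator {a..b} :: real \<Rightarrow> real)"
  using borel_integrable_compact[OF compact_Icc continuous_on_const, of a b "1::real"] by simp

lemma locally_integrable_l2:
  assumes "square_integrable u"
  shows "integrable lborel (\<lambda>x. indicator {-N..N} x *\<^sub>R u x)"
proof (rule Bochner_Integration.integrable_bound[of _ "\<lambda>x. indicator {-N..N} x + (norm (u x))\<^sup>2"])
  show "integrable lborel (\<lambda>x. indicator {-N..N} x + (norm (u x))\<^sup>2)"
    using assms integrable_indicator_Icc by (intro Bochner_Integration.integrable_add) (auto simp: square_integrable_def)
  have "norm (u x) \<le> 1 + (norm (u x))\<^sup>2" for x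
    using sum_squares_bound[of 1 "norm (u x)"] norm_ge_zero[of "u x"]
    by (simp only: power_one mult_1_right)
  then show "AE x in lborel. norm (indicator {-N..N} x *\<^sub>R u x) \<le> norm (indicator {-N..N} x + (norm (u x))\<^sup>2)"
    by (auto simp: indicator_def)
qed (use assms in \<open>auto simp: square_integrable_def\<close>)

lemma locally_integrable_measurable:
  fixes g :: "real \<Rightarrow> 'a :: euclidean_space"
  assumes g: "\<And>N. integrable lborel (\<lambda>x. indicator {-N..N} x *\<^sub>R g x)"
  shows "g \<in> borel_measurable borel"
proof (rule borel_measurable_LIMSEQ_metric)
  fix n :: nat show "(\<lambda>x. indicator {-real n..real n} x *\<^sub>R g x) \<in> borel_measurable borel"
    using borel_measurable_integrable[OF g[of "real n"]] by simp
next
  fix x :: real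
  obtain n :: nat where "\<bar>x\<bar> \<le> real n" using real_arch_simple by blast
  then have "eventually (\<lambda>m. indicator {-real m..real m} x *\<^sub>R g x = g x) sequentially"
    by (intro eventually_sequentiallyI[of n]) (auto simp: indicator_def)
  then show "(\<lambda>m. indicator {-real m..real m} x *\<^sub>R g x) \<longlonglongrightarrow> g x"
    by (rule tendsto_eventually)
qed

lemma integrable_bounded_mult:
  fixes u :: "real \<Rightarrow> 'a :: euclidean_space"
  assumes u: "\<And>N. integrable lborel (\<lambda>x. indicator {-N..N} x *\<^sub>R u x)"
    and [measurable]: "\<phi> \<in> borel_measurable lborel"
    and B: "\<And>x. \<bar>\<phi> x\<bar> \<le> B" and N: "\<And>x. N \<le> \<bar>x\<bar> \<Longrightarrow> \<phi> x = 0"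
  shows "integrable lborel (\<lambda>x. \<phi> x *\<^sub>R u x)"
proof -
  have "integrable lborel (\<lambda>x. \<phi> x *\<^sub>R (indicator {-N..N} x *\<^sub>R u x))"
  proof (rule Bochner_Integration.integrable_bound[OF integrable_scaleR_right[OF u[of N], of B]])
    show "(\<lambda>x. \<phi> x *\<^sub>R (indicator {-N..N} x *\<^sub>R u x)) \<in> borel_measurable lborel"
      by (intro borel_measurable_scaleR borel_measurable_integrable[OF u[of N]]) fact
    have "\<bar>\<phi> x\<bar> \<le> \<bar>B\<bar>" for x using B[of x] by simp
    then show "AE x in lborel. norm (\<phi> x *\<^sub>R (indicator {-N..N} x *\<^sub>R u x))
        \<le> norm (B *\<^sub>R (indicator {-N..N} x *\<^sub>R u x))"
      by (intro AE_I2) (auto intro!: mult_right_mono simp: indicator_def)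
  qed
  moreover have "\<phi> x *\<^sub>R (indicator {-N..N} x *\<^sub>R u x) = \<phi> x *\<^sub>R u x" for x
    using N[of x] by (cases "N \<le> \<bar>x\<bar>") (auto simp: indicator_def)
  ultimately show ?thesis by (simp only:)
qed

lemma test_function_bounded:
  assumes "test_function \<phi>"
  obtains B where "\<And>x. \<bar>\<phi> x\<bar> \<le> B" "\<And>x. \<bar>deriv \<phi> x\<bar> \<le> B" "B \<ge> 0"
proof -
  obtain N where N: "N > 0" "\<And>x. N \<le> \<bar>x\<bar> \<Longrightarrow> \<phi> x = 0" "\<And>x. N \<le> \<bar>x\<bar> \<Longrightarrow> deriv \<phi> x = 0"
    using test_function_support[OF assms] by blast
  have "\<exists>B. \<forall>x. \<bar>f x\<bar> \<le> B" if "continuous_on UNIV f" "\<And>x. N \<le> \<bar>x\<bar> \<Longrightarrow> f x = 0" for f :: "real \<Rightarrow> real"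
  proof -
    have "compact (f ` {-N..N})"
      by (intro compact_continuous_image continuous_on_subset[OF that(1)]) auto
    then obtain B where "\<forall>y\<in>f ` {-N..N}. \<bar>y\<bar> \<le> B"
      using compact_imp_bounded by (metis bounded_iff real_norm_def)
    then have "\<forall>x. \<bar>f x\<bar> \<le> \<bar>B\<bar>"
      using that(2) by (metis abs_ge_self abs_ge_zero abs_le_iff abs_zero atLeastAtMost_iff imageI linear minus_le_iff order_trans)
    then show ?thesis by blast
  qed
  then obtain B B' where "\<forall>x. \<bar>\<phi> x\<bar> \<le> B" "\<forall>x. \<bar>deriv \<phi> x\<bar> \<le> B'"
    using test_function_derivative[OF assms] N by metis
  then show thesis by (intro that[of "max B B'"]) (auto simp: le_max_iff_disj intro: order_trans[OF abs_ge_zero])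
qed

text \<open>The kernel of the integral from \<open>0\<close> to \<open>x\<close>, for both signs of \<open>x\<close>.\<close>

definition primitive_sign :: "real \<Rightarrow> real \<Rightarrow> real" where
  "primitive_sign x y = indicator {0<..<x} y - indicator {x<..<0} y"

definition primitive :: "(real \<Rightarrow> complex^2) \<Rightarrow> real \<Rightarrow> complex^2" where
  "primitive g x = (LINT y|lborel. primitive_sign x y *\<^sub>R g y)"

lemma measurable_primitive_sign [measurable]:
  "(\<lambda>(x, y). primitive_sign x y) \<in> borel_measurable (lborel \<Otimes>\<^sub>M lborel)"
proof -
  have "(\<lambda>(x, y). primitive_sign x y) = (\<lambda>p. (if 0 < snd p \<and> snd p < fst p then 1 else 0)
      - (if fst p < snd p \<and> snd p < 0 then 1 else 0))"
    by (auto simp: primitive_sign_def fun_eq_iff indicator_def)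
  then show ?thesis by simp
qed

lemma primitive_sign_bound: "\<bar>primitive_sign x y\<bar> \<le> 1" "\<bar>x\<bar> \<le> \<bar>y\<bar> \<Longrightarrow> primitive_sign x y = 0"
  by (auto simp: primitive_sign_def indicator_def)

lemma primitive_diff:
  assumes g: "\<And>N. integrable lborel (\<lambda>x. indicator {-N..N} x *\<^sub>R g x)" and "a \<le> b"
  shows "primitive g b - primitive g a = (LINT y|lborel. indicator {a..b} y *\<^sub>R g y)"
proof -
  have int: "integrable lborel (\<lambda>y. primitive_sign x y *\<^sub>R g y)" for x
  proof (rule integrable_bounded_mult[OF g, of _ 1 "\<bar>x\<bar>"])
    show "primitive_sign x \<in> borel_measurable lborel" by (simp add: primitive_sign_def[abs_def])
  qed (simp_all add: primitive_sign_bound)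
  have gm [measurable]: "g \<in> borel_measurable borel" by (rule locally_integrable_measurable[OF g])
  have "primitive g b - primitive g a = (LINT y|lborel. primitive_sign b y *\<^sub>R g y - primitive_sign a y *\<^sub>R g y)"
    unfolding primitive_def using int by simp
  also have "\<dots> = (LINT y|lborel. indicator {a..b} y *\<^sub>R g y)"
  proof (rule integral_cong_AE)
    show "AE y in lborel. primitive_sign b y *\<^sub>R g y - primitive_sign a y *\<^sub>R g y = indicator {a..b} y *\<^sub>R g y"
      using AE_lborel_singleton[of 0] AE_lborel_singleton[of a] AE_lborel_singleton[of b]
      by eventually_elim (use \<open>a \<le> b\<close> in \<open>auto simp: primitive_sign_def indicator_def\<close>)
  qed (simp_all add: primitive_sign_def)
  finally show ?thesis .
qed

text \<open>Fubini for \<open>\<phi>'(x) g(y)\<close> on the region between \<open>0\<close> and \<open>x\<close>.\<close>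

lemma integral_by_parts_primitive:
  assumes \<phi>: "test_function \<phi>" and g: "\<And>N. integrable lborel (\<lambda>x. indicator {-N..N} x *\<^sub>R g x)"
  shows "integrable lborel (\<lambda>x. deriv \<phi> x *\<^sub>R primitive g x)"
    "(LINT x|lborel. deriv \<phi> x *\<^sub>R primitive g x) = - (LINT x|lborel. \<phi> x *\<^sub>R g x)"
proof -
  obtain N where N: "N > 0" "\<And>x. N \<le> \<bar>x\<bar> \<Longrightarrow> \<phi> x = 0" "\<And>x. N \<le> \<bar>x\<bar> \<Longrightarrow> deriv \<phi> x = 0"
    using test_function_support[OF \<phi>] by blast
  define gN where "gN = (\<lambda>y. indicator {-N..N} y *\<^sub>R g y)"
  have gN: "integrable lborel gN" unfolding gN_def by (rule g)
  have [measurable]: "gN \<in> borel_measurable borel" using gN by simp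
  have dm [measurable]: "deriv \<phi> \<in> borel_measurable borel"
    using test_function_derivative(3)[OF \<phi>] by (rule borel_measurable_continuous_onI)
  define K where "K = (\<lambda>x y. (deriv \<phi> x * primitive_sign x y) *\<^sub>R gN y)"
  have [measurable]: "(\<lambda>p. primitive_sign (fst p) (snd p)) \<in> borel_measurable (lborel \<Otimes>\<^sub>M lborel)"
    using measurable_primitive_sign by (simp add: case_prod_unfold)
  have Kint: "integrable (lborel \<Otimes>\<^sub>M lborel) (case_prod K)"
  proof (rule integrable_product_bound)
    show "case_prod K \<in> borel_measurable (lborel \<Otimes>\<^sub>M lborel)"
      unfolding K_def case_prod_unfold by measurable
    show "integrable lborel (\<lambda>x. \<bar>deriv \<phi> x\<bar>)" "integrable lborel (\<lambda>y. norm (gN y))"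
      using test_function_integrable[OF \<phi>] gN by auto
    show "norm (K x y) \<le> \<bar>deriv \<phi> x\<bar> * norm (gN y)" for x y
      using primitive_sign_bound(1)[of x y]
      by (auto simp: K_def abs_mult intro!: mult_right_mono mult_left_le)
  qed
  have Kx: "(LINT y|lborel. K x y) = deriv \<phi> x *\<^sub>R primitive g x" for x
  proof -
    have "K x y = deriv \<phi> x *\<^sub>R (primitive_sign x y *\<^sub>R g y)" for y
      using N(3)[of x] primitive_sign_bound(2)[of x y]
      by (cases "y \<in> {-N..N}"; cases "N \<le> \<bar>x\<bar>") (auto simp: K_def gN_def indicator_def)
    then show ?thesis by (simp add: primitive_def del: scaleR_scaleR)
  qed
  have Ky: "(LINT x|lborel. K x y) = - (\<phi> y *\<^sub>R g y)" if "y \<noteq> 0" for y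
  proof -
    note FTC = integral_FTC_compact_support[of \<phi> "deriv \<phi>" N,
      OF test_function_derivative(1)[OF \<phi>, unfolded has_real_derivative_iff_has_vector_derivative]
      test_function_derivative(3)[OF \<phi>] N(2,3,1)]
    have "(LINT x|lborel. deriv \<phi> x * primitive_sign x y) = - \<phi> y"
    proof (cases "y > 0")
      case True
      then have "deriv \<phi> x * primitive_sign x y = indicator {y<..} x *\<^sub>R deriv \<phi> x" for x
        by (auto simp: primitive_sign_def indicator_def)
      then show ?thesis using FTC(1)[of y] by (simp only:)
    next
      case False
      with that have "deriv \<phi> x * primitive_sign x y = - (indicator {..<y} x *\<^sub>R deriv \<phi> x)" for x
        by (auto simp: primitive_sign_def indicator_def)
      then show ?thesis using FTC(2)[of y] by (simp only: Bochner_Integration.integral_minus)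
    qed
    moreover have "integrable lborel (\<lambda>x. deriv \<phi> x * primitive_sign x y)"
      by (rule Bochner_Integration.integrable_bound[OF test_function_integrable(2)[OF \<phi>]])
        (auto simp: primitive_sign_def[abs_def] abs_mult indicator_def)
    ultimately have "(LINT x|lborel. K x y) = (- \<phi> y) *\<^sub>R gN y"
      by (simp add: K_def)
    moreover have "\<phi> y *\<^sub>R gN y = \<phi> y *\<^sub>R g y"
      using N(2)[of y] by (cases "N \<le> \<bar>y\<bar>") (auto simp: gN_def indicator_def)
    ultimately show ?thesis by simp
  qed
  have "integrable lborel (\<lambda>x. LINT y|lborel. K x y)"
    using lborel_pair.integrable_fst[OF Kint] .
  then show "integrable lborel (\<lambda>x. deriv \<phi> x *\<^sub>R primitive g x)" by (simp add: Kx)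
  have "(LINT x|lborel. deriv \<phi> x *\<^sub>R primitive g x) = (LINT x|lborel. LINT y|lborel. K x y)"
    by (simp add: Kx)
  also have "\<dots> = (LINT y|lborel. LINT x|lborel. K x y)"
    using lborel_pair.Fubini_integral[OF Kint] by simp
  also have "\<dots> = (LINT y|lborel. - (\<phi> y *\<^sub>R g y))"
  proof (rule integral_cong_AE)
    show "(\<lambda>y. LINT x|lborel. K x y) \<in> borel_measurable lborel"
      using lborel_pair.integrable_snd[OF Kint] by (rule borel_measurable_integrable)
    have [measurable]: "\<phi> \<in> borel_measurable borel"
      using test_function_derivative(2)[OF \<phi>] by (rule borel_measurable_continuous_onI)
    have "(\<lambda>y. - (\<phi> y *\<^sub>R gN y)) \<in> borel_measurable lborel" by measurable
    moreover have "\<phi> y *\<^sub>R gN y = \<phi> y *\<^sub>R g y" for y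
      using N(2)[of y] by (cases "N \<le> \<bar>y\<bar>") (auto simp: gN_def indicator_def)
    ultimately show "(\<lambda>y. - (\<phi> y *\<^sub>R g y)) \<in> borel_measurable lborel" by simp
    show "AE y in lborel. (LINT x|lborel. K x y) = - (\<phi> y *\<^sub>R g y)"
      using AE_lborel_singleton[of 0] by eventually_elim (rule Ky)
  qed
  finally show "(LINT x|lborel. deriv \<phi> x *\<^sub>R primitive g x) = - (LINT x|lborel. \<phi> x *\<^sub>R g x)" by simp
qed

text \<open>The intervals generate the Borel sets and are stable under intersection, so all integrals over
  Borel sets vanish as well.\<close>

lemma AE_zero_of_interval_integrals:
  fixes k :: "real \<Rightarrow> 'a :: euclidean_space"
  assumes k: "\<And>N. integrable lborel (\<lambda>x. indicator {-N..N} x *\<^sub>R k x)"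
    and zero: "\<And>a b. a < b \<Longrightarrow> (LINT x|lborel. indicator {a<..<b} x *\<^sub>R k x) = 0"
  shows "AE x in lborel. k x = 0"
proof -
  have "AE x in lborel. indicator {-real n<..<real n} x *\<^sub>R k x = 0" for n :: nat
  proof -
    define N where "N = real n"
    define kN where "kN = (\<lambda>x. indicator {-N<..<N} x *\<^sub>R k x)"
    have kN: "integrable lborel kN"
    proof -
      have "integrable lborel (\<lambda>x. indicator {-N<..<N} x *\<^sub>R (indicator {-N..N} x *\<^sub>R k x))"
        by (rule integrable_mult_indicator[OF _ k]) simp
      moreover have "(\<lambda>x. indicator {-N<..<N} x *\<^sub>R (indicator {-N..N} x *\<^sub>R k x)) = kN"
        by (auto simp: kN_def indicator_def fun_eq_iff)
      ultimately show ?thesis by simp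
    qed
    have iv: "(LINT x|lborel. indicator {a<..<b} x *\<^sub>R kN x) = 0" for a b
    proof -
      have "indicator {a<..<b} x *\<^sub>R kN x = indicator {max a (-N)<..<min b N} x *\<^sub>R k x" for x
        by (auto simp: kN_def indicator_def)
      moreover have "(LINT x|lborel. indicator {c<..<d} x *\<^sub>R k x) = 0" for c d
        using zero[of c d] by (cases "c < d") auto
      ultimately show ?thesis by simp
    qed
    have all: "(LINT x|lborel. indicator UNIV x *\<^sub>R kN x) = 0"
    proof -
      have "indicator UNIV x *\<^sub>R kN x = indicator {-N<..<N} x *\<^sub>R kN x" for x
        by (auto simp: kN_def indicator_def)
      then show ?thesis using iv[of "-N" N] by simp
    qed
    have "set_lebesgue_integral lborel A kN = 0" if "A \<in> sets borel" for A
    proof -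
      have box_eq: "(\<lambda>(a, b). box a b) = (\<lambda>(a, b). {a<..<b::real})" by (auto simp: fun_eq_iff)
      have gen: "sets (borel :: real measure) = sigma_sets UNIV (range (\<lambda>(a, b). {a<..<b::real}))"
        by (subst borel_eq_box) (simp add: box_eq)
      have "Int_stable (range (\<lambda>(a, b). {a<..<b::real}))"
      proof (rule Int_stableI)
        fix A B :: "real set" assume "A \<in> range (\<lambda>(a, b). {a<..<b})" "B \<in> range (\<lambda>(a, b). {a<..<b})"
        then obtain a b c d where "A = {a<..<b}" "B = {c<..<d}" by auto
        then have "A \<inter> B = (\<lambda>(a, b). {a<..<b}) (max a c, min b d)" by auto
        then show "A \<inter> B \<in> range (\<lambda>(a, b). {a<..<b})" by blast
      qed
      moreover have sub: "range (\<lambda>(a, b). {a<..<b::real}) \<subseteq> Pow UNIV" by simp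
      moreover have "A \<in> sigma_sets UNIV (range (\<lambda>(a, b). {a<..<b::real}))" using that gen by simp
      ultimately show ?thesis
      proof (rule sigma_sets_induct_disjoint)
        fix A assume "A \<in> range (\<lambda>(a, b). {a<..<b::real})"
        then show "set_lebesgue_integral lborel A kN = 0"
          using iv by (auto simp: set_lebesgue_integral_def)
      next
        show "set_lebesgue_integral lborel {} kN = 0" by (simp add: set_lebesgue_integral_def)
      next
        fix A assume "A \<in> sigma_sets UNIV (range (\<lambda>(a, b). {a<..<b::real}))"
          and A0: "set_lebesgue_integral lborel A kN = 0"
        then have A: "A \<in> sets borel" using gen by simp
        have "(LINT x:UNIV - A|lborel. kN x) = (LINT x|lborel. indicator UNIV x *\<^sub>R kN x - indicator A x *\<^sub>R kN x)"
          unfolding set_lebesgue_integral_def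
          by (intro Bochner_Integration.integral_cong) (auto simp: indicator_def)
        also have "\<dots> = (LINT x|lborel. indicator UNIV x *\<^sub>R kN x) - (LINT x|lborel. indicator A x *\<^sub>R kN x)"
          using A kN by (intro Bochner_Integration.integral_diff integrable_mult_indicator) auto
        finally show "set_lebesgue_integral lborel (UNIV - A) kN = 0"
          using A0 all by (simp only: set_lebesgue_integral_def diff_self)
      next
        fix A :: "nat \<Rightarrow> real set"
        assume disj: "disjoint_family A" and "range A \<subseteq> sigma_sets UNIV (range (\<lambda>(a, b). {a<..<b::real}))"
          and A0: "\<And>i. set_lebesgue_integral lborel (A i) kN = 0"
        then have A: "A i \<in> sets borel" for i using gen by auto
        have "(LINT x:(\<Union>i. A i)|lborel. kN x) = (\<Sum>i. LINT x:A i|lborel. kN x)"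
        proof (rule lebesgue_integral_countable_add)
          show "A i \<inter> A j = {}" if "i \<noteq> j" for i j using disj that by (auto simp: disjoint_family_on_def)
          show "set_integrable lborel (\<Union>i. A i) kN"
            unfolding set_integrable_def using A kN by (intro integrable_mult_indicator) auto
        qed (use A in auto)
        then show "set_lebesgue_integral lborel (\<Union> (range A)) kN = 0" using A0 by simp
      qed
    qed
    then have "AE x in lborel. kN x = 0"
      by (intro sigma_finite_measure.density_zero[OF sigma_finite_lborel kN]) simp
    then show ?thesis by (simp add: kN_def N_def)
  qed
  then have "AE x in lborel. \<forall>n::nat. indicator {-real n<..<real n} x *\<^sub>R k x = 0"
    unfolding AE_all_countable by blast
  then show ?thesis
  proof eventually_elim
    case (elim x)
    obtain n :: nat where "\<bar>x\<bar> < real n" using reals_Archimedean2 by blast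
    then show ?case using elim[rule_format, of n] by (auto simp: indicator_def abs_less_iff)
  qed
qed

text \<open>The lemma of du Bois-Reymond. A function all of whose integrals against derivatives of test
  functions vanish integrates every test function \<open>\<theta>\<close> to a multiple of \<open>\<integral> \<theta>\<close>, and test functions
  approximate indicator functions of intervals.\<close>

lemma du_Bois_Reymond:
  fixes h :: "real \<Rightarrow> 'a :: euclidean_space"
  assumes h: "\<And>N. integrable lborel (\<lambda>x. indicator {-N..N} x *\<^sub>R h x)"
    and zero: "\<And>\<phi>. test_function \<phi> \<Longrightarrow> (LINT x|lborel. deriv \<phi> x *\<^sub>R h x) = 0"
  shows "\<exists>c. AE x in lborel. h x = c"
proof -
  have hm [measurable]: "h \<in> borel_measurable borel" by (rule locally_integrable_measurable[OF h])
  have int: "integrable lborel (\<lambda>x. \<theta> x *\<^sub>R h x)" if \<theta>: "test_function \<theta>" for \<theta>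
  proof -
    obtain B where "\<And>x. \<bar>\<theta> x\<bar> \<le> B" using test_function_bounded[OF \<theta>] by metis
    moreover obtain N where "\<And>x. N \<le> \<bar>x\<bar> \<Longrightarrow> \<theta> x = 0" using test_function_support[OF \<theta>] by metis
    moreover have "\<theta> \<in> borel_measurable borel"
      using test_function_derivative(2)[OF \<theta>] by (rule borel_measurable_continuous_onI)
    ultimately show ?thesis by (intro integrable_bounded_mult[OF h, of \<theta> B N]) auto
  qed
  define \<theta>0 where "\<theta>0 = smooth_window 0 1 1"
  have \<theta>0: "test_function \<theta>0" by (simp add: \<theta>0_def test_function_smooth_window)
  define I0 where "I0 = (LINT x|lborel. \<theta>0 x)"
  have I0: "I0 \<noteq> 0"
  proof
    assume "I0 = 0"
    then have "AE x in lborel. \<theta>0 x = 0"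
      using integral_nonneg_eq_0_iff_AE[OF test_function_integrable(1)[OF \<theta>0]] smooth_window_bounds
      by (auto simp: I0_def \<theta>0_def)
    then have "AE x in lborel. x \<notin> {0<..<1::real}"
      by eventually_elim (use smooth_window_pos[of 0 _ 1 1] in \<open>force simp: \<theta>0_def\<close>)
    then have "{0<..<1::real} \<in> null_sets lborel" by (subst AE_iff_null_sets) auto
    then show False by (simp add: null_sets_def)
  qed
  define C where "C = (1 / I0) *\<^sub>R (LINT x|lborel. \<theta>0 x *\<^sub>R h x)"
  have multiple: "(LINT x|lborel. \<theta> x *\<^sub>R h x) = (LINT x|lborel. \<theta> x) *\<^sub>R C" if \<theta>: "test_function \<theta>" for \<theta>
  proof -
    let ?I = "LINT x|lborel. \<theta> x"
    have t: "test_function (\<lambda>x. 1 * \<theta> x + (- ?I / I0) * \<theta>0 x)"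
      by (rule test_function_lincomb[OF \<theta> \<theta>0])
    have "(LINT x|lborel. 1 * \<theta> x + (- ?I / I0) * \<theta>0 x) = 0"
      using test_function_integrable(1)[OF \<theta>] test_function_integrable(1)[OF \<theta>0] I0
      by (simp add: I0_def)
    then obtain \<phi> where "test_function \<phi>" "deriv \<phi> = (\<lambda>x. 1 * \<theta> x + (- ?I / I0) * \<theta>0 x)"
      using test_function_antiderivative[OF t] by blast
    then have "0 = (LINT x|lborel. (\<theta> x + (- ?I / I0) * \<theta>0 x) *\<^sub>R h x)"
      using zero[of \<phi>] by simp
    also have "\<dots> = (LINT x|lborel. \<theta> x *\<^sub>R h x + (- ?I / I0) *\<^sub>R (\<theta>0 x *\<^sub>R h x))"
      by (simp only: scaleR_add_left scaleR_scaleR)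
    also have "\<dots> = (LINT x|lborel. \<theta> x *\<^sub>R h x) + (- ?I / I0) *\<^sub>R (LINT x|lborel. \<theta>0 x *\<^sub>R h x)"
      using int[OF \<theta>] int[OF \<theta>0]
      by (simp only: Bochner_Integration.integral_add integrable_scaleR_right Bochner_Integration.integral_scaleR_right)
    finally show ?thesis by (simp add: C_def)
  qed
  have iv: "(LINT x|lborel. indicator {a<..<b} x *\<^sub>R h x) = (LINT x|lborel. indicator {a<..<b} x) *\<^sub>R C" for a b
  proof -
    define N where "N = \<bar>a\<bar> + \<bar>b\<bar> + 1"
    have bd: "\<bar>smooth_window a b n x\<bar> \<le> indicator {-N..N} x" for n x
      using smooth_window_bounds[of a b n x] smooth_window_outside[of x a b n]
      by (cases "a < x \<and> x < b") (auto simp: indicator_def N_def)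
    have [measurable]: "smooth_window a b n \<in> borel_measurable borel" for n
      using test_function_derivative(2)[OF test_function_smooth_window] by (rule borel_measurable_continuous_onI)
    have "(\<lambda>n. LINT x|lborel. smooth_window a b n x *\<^sub>R h x) \<longlonglongrightarrow> (LINT x|lborel. indicator {a<..<b} x *\<^sub>R h x)"
    proof (rule integral_dominated_convergence)
      show "integrable lborel (\<lambda>x. norm (indicator {-N..N} x *\<^sub>R h x))" by (intro integrable_norm h)
      show "AE x in lborel. (\<lambda>n. smooth_window a b n x *\<^sub>R h x) \<longlonglongrightarrow> indicator {a<..<b} x *\<^sub>R h x"
        by (intro AE_I2 tendsto_scaleR smooth_window_tendsto tendsto_const)
      show "AE x in lborel. norm (smooth_window a b n x *\<^sub>R h x) \<le> norm (indicator {-N..N} x *\<^sub>R h x)" for n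
        using bd by (auto intro!: mult_right_mono)
    qed auto
    moreover have "(\<lambda>n. (LINT x|lborel. smooth_window a b n x) *\<^sub>R C) \<longlonglongrightarrow> (LINT x|lborel. indicator {a<..<b} x) *\<^sub>R C"
    proof (intro tendsto_scaleR tendsto_const integral_dominated_convergence)
      show "integrable lborel (indicator {-N..N} :: real \<Rightarrow> real)" by (rule integrable_indicator_Icc)
      show "AE x in lborel. (\<lambda>n. smooth_window a b n x) \<longlonglongrightarrow> indicator {a<..<b} x"
        by (intro AE_I2 smooth_window_tendsto)
      show "AE x in lborel. norm (smooth_window a b n x) \<le> indicator {-N..N} x" for n
        using bd by auto
    qed auto
    ultimately show ?thesis
      using multiple[OF test_function_smooth_window] LIMSEQ_unique by simp
  qed
  have "AE x in lborel. h x - C = 0"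
  proof (rule AE_zero_of_interval_integrals)
    have "integrable lborel (\<lambda>x. indicator {-N..N} x *\<^sub>R C)" for N :: real
      by (rule integrable_scaleR_left) (rule integrable_indicator_Icc)
    then show "integrable lborel (\<lambda>x. indicator {-N..N} x *\<^sub>R (h x - C))" for N
      using h[of N] by (simp only: scaleR_diff_right Bochner_Integration.integrable_diff)
    fix a b :: real
    have ii: "integrable lborel (indicator {a<..<b} :: real \<Rightarrow> real)"
      by (rule Bochner_Integration.integrable_bound[OF integrable_indicator_Icc[of a b]]) (auto simp: indicator_def)
    have "integrable lborel (\<lambda>x. indicator {a<..<b} x *\<^sub>R h x)"
      by (rule integrable_bounded_mult[OF h, of _ 1 "\<bar>a\<bar> + \<bar>b\<bar> + 1"]) (auto simp: indicator_def)
    moreover have "integrable lborel (\<lambda>x. indicator {a<..<b} x *\<^sub>R C)"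
      by (rule integrable_scaleR_left) (rule ii)
    moreover have "(LINT x|lborel. indicator {a<..<b} x *\<^sub>R C) = (LINT x|lborel. indicator {a<..<b} x) *\<^sub>R C"
      by (rule Bochner_Integration.integral_scaleR_left) (rule ii)
    ultimately show "(LINT x|lborel. indicator {a<..<b} x *\<^sub>R (h x - C)) = 0"
      unfolding scaleR_diff_right using iv[of a b] by (simp only: Bochner_Integration.integral_diff diff_self)
  qed
  then show ?thesis by (intro exI[of _ C]) simp
qed

lemma primitive_continuous:
  assumes g: "\<And>N. integrable lborel (\<lambda>x. indicator {-N..N} x *\<^sub>R g x)"
  shows "continuous_on UNIV (primitive g)"
proof -
  have "continuous_on {-N<..<N} (primitive g)" for N
  proof (cases "N > 0")
    case True
    have si: "set_integrable lborel {-N..N} g" using g[of N] by (simp add: set_integrable_def)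
    then have io: "g integrable_on {-N..N}" by (rule set_borel_integral_eq_integral)
    have eq: "primitive g (-N) + integral {-N..x} g = primitive g x" if "x \<in> {-N..N}" for x
    proof -
      have "integrable lborel (\<lambda>y. indicator {-N..x} y *\<^sub>R (indicator {-N..N} y *\<^sub>R g y))"
        by (rule integrable_mult_indicator[OF _ g]) simp
      moreover have "(\<lambda>y. indicator {-N..x} y *\<^sub>R (indicator {-N..N} y *\<^sub>R g y)) = (\<lambda>y. indicator {-N..x} y *\<^sub>R g y)"
        using that by (auto simp: indicator_def fun_eq_iff)
      ultimately have "set_integrable lborel {-N..x} g" by (simp add: set_integrable_def)
      from set_borel_integral_eq_integral(2)[OF this] primitive_diff[OF g, of "-N" x]
      show ?thesis using that by (simp add: set_lebesgue_integral_def algebra_simps)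
    qed
    have "continuous_on {-N..N} (\<lambda>x. primitive g (-N) + integral {-N..x} g)"
      by (intro continuous_intros indefinite_integral_continuous_1 io)
    then have "continuous_on {-N..N} (primitive g)"
      by (rule continuous_on_eq) (rule eq)
    then show ?thesis by (rule continuous_on_subset) auto
  qed auto
  then have "isCont (primitive g) x" for x
    by (rule continuous_on_interior[of "{-(\<bar>x\<bar>+1)<..<\<bar>x\<bar>+1}"]) (auto simp: interior_open)
  then show ?thesis by (simp add: continuous_at_imp_continuous_on)
qed

text \<open>The function minus the primitive of its weak derivative is orthogonal to all derivatives of
  test functions, hence constant.\<close>

lemma weak_deriv_continuous_rep:
  assumes "weak_deriv f f'"
  obtains u where "continuous_on UNIV u" "AE x in lborel. rep_l2 f x = u x"
    "\<And>a b. a \<le> b \<Longrightarrow> u b - u a = (LINT y|lborel. indicator {a..b} y *\<^sub>R rep_l2 f' y)"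
proof -
  let ?U = "primitive (rep_l2 f')"
  have g: "integrable lborel (\<lambda>x. indicator {-N..N} x *\<^sub>R rep_l2 f' x)" for N
    by (rule locally_integrable_l2[OF square_integrable_rep])
  have f: "integrable lborel (\<lambda>x. indicator {-N..N} x *\<^sub>R rep_l2 f x)" for N
    by (rule locally_integrable_l2[OF square_integrable_rep])
  have U: "integrable lborel (\<lambda>x. indicator {-N..N} x *\<^sub>R ?U x)" for N
    by (intro borel_integrable_compact compact_Icc continuous_on_subset[OF primitive_continuous[OF g]]) auto
  have "\<exists>c. AE x in lborel. rep_l2 f x - ?U x = c"
  proof (rule du_Bois_Reymond)
    show "integrable lborel (\<lambda>x. indicator {-N..N} x *\<^sub>R (rep_l2 f x - ?U x))" for N
      using f U by (simp add: scaleR_diff_right)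
    fix \<phi> assume \<phi>: "test_function \<phi>"
    obtain B where "\<And>x. \<bar>deriv \<phi> x\<bar> \<le> B" using test_function_bounded[OF \<phi>] by metis
    moreover obtain N where "\<And>x. N \<le> \<bar>x\<bar> \<Longrightarrow> deriv \<phi> x = 0" using test_function_support[OF \<phi>] by metis
    moreover have "deriv \<phi> \<in> borel_measurable borel"
      using test_function_derivative(3)[OF \<phi>] by (rule borel_measurable_continuous_onI)
    ultimately have "integrable lborel (\<lambda>x. deriv \<phi> x *\<^sub>R rep_l2 f x)"
      by (intro integrable_bounded_mult[OF f, of _ B N]) auto
    then have "(LINT x|lborel. deriv \<phi> x *\<^sub>R (rep_l2 f x - ?U x))
        = (LINT x|lborel. deriv \<phi> x *\<^sub>R rep_l2 f x) - (LINT x|lborel. deriv \<phi> x *\<^sub>R ?U x)"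
      using integral_by_parts_primitive(1)[OF \<phi> g] by (simp add: scaleR_diff_right)
    also have "\<dots> = 0"
      using assms \<phi> integral_by_parts_primitive(2)[OF \<phi> g] by (simp add: weak_deriv_def)
    finally show "(LINT x|lborel. deriv \<phi> x *\<^sub>R (rep_l2 f x - ?U x)) = 0" .
  qed
  then obtain c where c: "AE x in lborel. rep_l2 f x - ?U x = c" by blast
  show thesis
  proof
    show "continuous_on UNIV (\<lambda>x. c + ?U x)"
      by (intro continuous_intros primitive_continuous g)
    show "AE x in lborel. rep_l2 f x = c + ?U x" using c by eventually_elim (simp add: algebra_simps)
    show "(c + ?U b) - (c + ?U a) = (LINT y|lborel. indicator {a..b} y *\<^sub>R rep_l2 f' y)" if "a \<le> b" for a b
      using primitive_diff[OF g that] by simp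
  qed
qed

lemma weak_derivI_smooth:
  assumes d: "\<And>x. (u has_vector_derivative u' x) (at x)" and c: "continuous_on UNIV u'"
    and s: "\<And>x. N \<le> \<bar>x\<bar> \<Longrightarrow> u x = 0" "\<And>x. N \<le> \<bar>x\<bar> \<Longrightarrow> u' x = 0" and N: "N > 0"
    and f: "AE x in lborel. rep_l2 f x = u x" and f': "AE x in lborel. rep_l2 f' x = u' x"
  shows "weak_deriv f f'"
  unfolding weak_deriv_def
proof (intro allI impI)
  fix \<phi> assume \<phi>: "test_function \<phi>"
  have cu: "continuous_on UNIV u"
    using d by (meson continuous_at_imp_continuous_on has_vector_derivative_continuous)
  have [measurable]: "u \<in> borel_measurable borel" "u' \<in> borel_measurable borel"
    "\<phi> \<in> borel_measurable borel" "deriv \<phi> \<in> borel_measurable borel"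
    using cu c test_function_derivative[OF \<phi>] by (auto intro: borel_measurable_continuous_onI)
  have "((\<lambda>x. \<phi> x *\<^sub>R u x) has_vector_derivative (\<phi> x *\<^sub>R u' x + deriv \<phi> x *\<^sub>R u x)) (at x)" for x
    using has_vector_derivative_scaleR[OF test_function_derivative(1)[OF \<phi>] d] .
  then have "(LINT x|lborel. \<phi> x *\<^sub>R u' x + deriv \<phi> x *\<^sub>R u x) = 0"
    by (rule integral_FTC_compact_support(3)[of _ _ N])
      (use s N in \<open>auto intro!: continuous_intros test_function_derivative[OF \<phi>] c cu\<close>)
  moreover have "integrable lborel (\<lambda>x. \<phi> x *\<^sub>R u' x)" "integrable lborel (\<lambda>x. deriv \<phi> x *\<^sub>R u x)"
    using s by (auto intro!: integrable_compact_support[of _ N] continuous_intros test_function_derivative[OF \<phi>] c cu)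
  moreover have "(LINT x|lborel. \<phi> x *\<^sub>R rep_l2 f' x) = (LINT x|lborel. \<phi> x *\<^sub>R u' x)"
    using f' by (intro integral_cong_AE) (auto elim: eventually_mono)
  moreover have "(LINT x|lborel. deriv \<phi> x *\<^sub>R rep_l2 f x) = (LINT x|lborel. deriv \<phi> x *\<^sub>R u x)"
    using f by (intro integral_cong_AE) (auto elim: eventually_mono)
  ultimately show "(LINT x|lborel. deriv \<phi> x *\<^sub>R rep_l2 f x) = - (LINT x|lborel. \<phi> x *\<^sub>R rep_l2 f' x)"
    by (simp add: eq_neg_iff_add_eq_0 add.commute)
qed

section \<open>The Green kernel of the unperturbed operator\<close>

text \<open>On each half line the homogeneous equation \<open>(L - z) f = 0\<close> reads
  \<open>f\<^sub>1' = (m + w) f\<^sub>2\<close>, \<open>f\<^sub>2' = (m - w) f\<^sub>1\<close> with \<open>w = z \<mp> \<i>\<close>, and its solutions are combinations of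
  \<open>e\<^sup>\<plusminus>\<^sup>\<mu>\<^sup>x (1, \<plusminus> \<mu> / (m + w))\<close>, where \<open>\<mu>\<^sup>2 = m\<^sup>2 - w\<^sup>2\<close>.\<close>

definition wp :: "complex \<Rightarrow> complex" where "wp z = z - \<i>"
definition wm :: "complex \<Rightarrow> complex" where "wm z = z + \<i>"
definition mup :: "real \<Rightarrow> complex \<Rightarrow> complex" where "mup m z = csqrt (of_real (m\<^sup>2) - (wp z)\<^sup>2)"
definition mum :: "real \<Rightarrow> complex \<Rightarrow> complex" where "mum m z = csqrt (of_real (m\<^sup>2) - (wm z)\<^sup>2)"

text \<open>Off the lines \<open>Im z = \<plusminus> 1\<close>, \<open>\<bar>Re z\<bar> \<ge> m\<close> both principal square roots have positive real part, and
  on each side one solution decays.\<close>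

definition off_cuts :: "real \<Rightarrow> complex \<Rightarrow> bool" where
  "off_cuts m z \<longleftrightarrow> 0 < Re (mup m z) \<and> 0 < Re (mum m z)"

definition ratio_p :: "real \<Rightarrow> complex \<Rightarrow> complex" where "ratio_p m z = - mup m z / (of_real m + wp z)"
definition ratio_m :: "real \<Rightarrow> complex \<Rightarrow> complex" where "ratio_m m z = mum m z / (of_real m + wm z)"

definition g11 :: "real \<Rightarrow> complex \<Rightarrow> complex" where
  "g11 m z = \<i> / of_real (4 * m) * (mum m z * (of_real m + wp z) - mup m z * (of_real m + wm z))"
definition gp :: "real \<Rightarrow> complex \<Rightarrow> complex" where
  "gp m z = \<i> / of_real (4 * m) * ((of_real m - wp z) * (of_real m + wm z) - mup m z * mum m z)"
definition gm :: "real \<Rightarrow> complex \<Rightarrow> complex" where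
  "gm m z = \<i> / of_real (4 * m) * ((of_real m + wp z) * (of_real m - wm z) - mup m z * mum m z)"
definition g22 :: "real \<Rightarrow> complex \<Rightarrow> complex" where
  "g22 m z = \<i> / of_real (4 * m) * ((of_real m - wp z) * mum m z - mup m z * (of_real m - wm z))"

lemma mup_sq: "mup m z * mup m z = (of_real m + wp z) * (of_real m - wp z)"
  and mum_sq: "mum m z * mum m z = (of_real m + wm z) * (of_real m - wm z)"
  unfolding mup_def mum_def power2_eq_square[symmetric] power2_csqrt
  by (simp_all add: power2_eq_square algebra_simps)

lemma Re_csqrt_zero:
  assumes "Re (csqrt s) = 0"
  shows "Im s = 0" "Re s \<le> 0"
proof -
  define c where "c = csqrt s"
  have s: "s = c * c" by (simp add: c_def flip: power2_eq_square)
  have "Re c = 0" using assms by (simp add: c_def)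
  then show "Im s = 0" "Re s \<le> 0" unfolding s by auto
qed

lemma csqrt_cut:
  assumes "m > 0" "\<not> 0 < Re (csqrt (of_real (m\<^sup>2) - w\<^sup>2))"
  shows "Im w = 0 \<and> m \<le> \<bar>Re w\<bar>"
proof -
  have "Re (csqrt (of_real (m\<^sup>2) - w\<^sup>2)) = 0"
    using assms csqrt_principal[of "of_real (m\<^sup>2) - w\<^sup>2"] by auto
  from Re_csqrt_zero[OF this] have *: "Re w * Im w = 0" "m\<^sup>2 \<le> (Re w)\<^sup>2 - (Im w)\<^sup>2"
    by (auto simp: power2_eq_square)
  have "0 < m\<^sup>2" using assms by simp
  then have "Re w \<noteq> 0" using *(2) by (smt (verit) zero_le_power2 zero_power2)
  then have "Im w = 0" using *(1) by simp
  moreover have "m \<le> \<bar>Re w\<bar>"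
    using * \<open>Im w = 0\<close> assms(1) by (metis abs_le_square_iff abs_of_pos diff_zero power_zero_numeral)
  ultimately show ?thesis by simp
qed

lemma not_off_cuts:
  assumes "m > 0" "\<not> off_cuts m z"
  shows "(Im z = 1 \<or> Im z = -1) \<and> m \<le> \<bar>Re z\<bar>"
  using assms csqrt_cut[OF assms(1), of "wp z"] csqrt_cut[OF assms(1), of "wm z"]
  unfolding off_cuts_def mup_def mum_def by (auto simp: wp_def wm_def)

lemma off_cuts_nonzero:
  assumes "off_cuts m z"
  shows "mup m z \<noteq> 0" "mum m z \<noteq> 0" "of_real m + wp z \<noteq> 0" "of_real m + wm z \<noteq> 0"
    "of_real m - wp z \<noteq> 0" "of_real m - wm z \<noteq> 0" "ratio_p m z \<noteq> 0" "ratio_m m z \<noteq> 0"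
proof -
  show mu: "mup m z \<noteq> 0" "mum m z \<noteq> 0" using assms by (auto simp: off_cuts_def)
  then show a: "of_real m + wp z \<noteq> 0" "of_real m + wm z \<noteq> 0" "of_real m - wp z \<noteq> 0" "of_real m - wm z \<noteq> 0"
    using mup_sq[of m z] mum_sq[of m z] by auto
  show "ratio_p m z \<noteq> 0" "ratio_m m z \<noteq> 0" using mu a by (auto simp: ratio_p_def ratio_m_def)
qed

lemma ratio_p_mult: "off_cuts m z \<Longrightarrow> ratio_p m z * (of_real m + wp z) = - mup m z"
  and ratio_m_mult: "off_cuts m z \<Longrightarrow> ratio_m m z * (of_real m + wm z) = mum m z"
  and ratio_p_mult_mup: "off_cuts m z \<Longrightarrow> ratio_p m z * mup m z = - (of_real m - wp z)"
  and ratio_m_mult_mum: "off_cuts m z \<Longrightarrow> ratio_m m z * mum m z = of_real m - wm z"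
  using off_cuts_nonzero[of m z] mup_sq[of m z] mum_sq[of m z]
  by (simp_all add: ratio_p_def ratio_m_def field_simps)

text \<open>The inverse Wronskian \<open>1 / (q - p)\<close> and its products with the ratios \<open>p\<close>, \<open>q\<close> are polynomials in
  the square roots, because \<open>w\<^sub>- - w\<^sub>+ = 2\<i>\<close> lets the denominator be rationalised. So they stay
  bounded at the branch points, where \<open>p\<close> or \<open>q\<close> degenerates.\<close>

lemma coefficients:
  assumes "off_cuts m z" "m > 0"
  shows "g11 m z * (ratio_m m z - ratio_p m z) = 1" "ratio_p m z * g11 m z = gp m z"
    "ratio_m m z * g11 m z = gm m z" "ratio_p m z * gm m z = g22 m z" "ratio_m m z * gp m z = g22 m z"
    "gm m z - gp m z = 1"
proof -
  note r = ratio_p_mult[OF assms(1)] ratio_m_mult[OF assms(1)] ratio_p_mult_mup[OF assms(1)]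
    ratio_m_mult_mum[OF assms(1)]
  have d: "gm m z - gp m z = 1"
    using assms(2) by (simp add: gm_def gp_def wp_def wm_def field_simps power2_eq_square)
  have lin: "x * (c * (y - w)) = c * (x * y - x * w)" for x c y w :: complex by (simp add: algebra_simps)
  have p: "ratio_p m z * g11 m z = gp m z"
  proof -
    have "ratio_p m z * (mum m z * (of_real m + wp z)) = mum m z * (- mup m z)"
      using r(1) by (metis mult.assoc mult.commute)
    moreover have "ratio_p m z * (mup m z * (of_real m + wm z)) = - (of_real m - wp z) * (of_real m + wm z)"
      using r(3) by (metis mult.assoc)
    ultimately show ?thesis unfolding g11_def gp_def lin by (simp only:) (simp add: algebra_simps)
  qed
  have q: "ratio_m m z * g11 m z = gm m z"
  proof -
    have "ratio_m m z * (mum m z * (of_real m + wp z)) = (of_real m - wm z) * (of_real m + wp z)"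
      using r(4) by (metis mult.assoc)
    moreover have "ratio_m m z * (mup m z * (of_real m + wm z)) = mup m z * mum m z"
      using r(2) by (metis mult.assoc mult.commute)
    ultimately show ?thesis unfolding g11_def gm_def lin by (simp only:) (simp add: algebra_simps)
  qed
  have s: "ratio_p m z * gm m z = g22 m z"
  proof -
    have "ratio_p m z * ((of_real m + wp z) * (of_real m - wm z)) = - mup m z * (of_real m - wm z)"
      using r(1) by (metis mult.assoc)
    moreover have "ratio_p m z * (mup m z * mum m z) = - (of_real m - wp z) * mum m z"
      using r(3) by (metis mult.assoc)
    ultimately show ?thesis unfolding g22_def gm_def lin by (simp only:) (simp add: algebra_simps)
  qed
  show "ratio_p m z * g11 m z = gp m z" "ratio_m m z * g11 m z = gm m z"
    "ratio_p m z * gm m z = g22 m z" "gm m z - gp m z = 1" by fact+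
  show "ratio_m m z * gp m z = g22 m z"
    unfolding s[symmetric] p[symmetric] q[symmetric] by (simp add: mult.left_commute)
  show "g11 m z * (ratio_m m z - ratio_p m z) = 1"
    using p q d by (simp add: algebra_simps)
qed

definition decay :: "real \<Rightarrow> complex \<Rightarrow> real \<Rightarrow> complex" where
  "decay m z x = (if 0 \<le> x then exp (- mup m z * of_real x) else exp (mum m z * of_real x))"

lemma norm_decay_le: "off_cuts m z \<Longrightarrow> cmod (decay m z x) \<le> 1"
  by (auto simp: decay_def off_cuts_def mult_nonneg_nonpos)

text \<open>The solutions that decay at \<open>+\<infinity>\<close> and at \<open>-\<infinity>\<close>, continued continuously across \<open>0\<close> by the two
  exponentials of the other half line.\<close>

definition sol_p :: "real \<Rightarrow> complex \<Rightarrow> real \<Rightarrow> complex^2" where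
  "sol_p m z x = (let p = ratio_p m z; q = ratio_m m z; e = exp (mum m z * of_real x); e' = exp (- mum m z * of_real x) in
     if 0 \<le> x then vector [exp (- mup m z * of_real x), p * exp (- mup m z * of_real x)]
     else vector [(1 + p / q) / 2 * e + (1 - p / q) / 2 * e', q * ((1 + p / q) / 2 * e - (1 - p / q) / 2 * e')])"

definition sol_m :: "real \<Rightarrow> complex \<Rightarrow> real \<Rightarrow> complex^2" where
  "sol_m m z x = (let p = ratio_p m z; q = ratio_m m z; e = exp (- mup m z * of_real x); e' = exp (mup m z * of_real x) in
     if 0 \<le> x then vector [(1 + q / p) / 2 * e + (1 - q / p) / 2 * e', p * ((1 + q / p) / 2 * e - (1 - q / p) / 2 * e')]
     else vector [exp (mum m z * of_real x), q * exp (mum m z * of_real x)])"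

definition outer2 :: "complex^2 \<Rightarrow> complex^2 \<Rightarrow> complex^2^2" where
  "outer2 u v = mat2 (u$1 * v$1) (u$1 * v$2) (u$2 * v$1) (u$2 * v$2)"

definition green :: "real \<Rightarrow> complex \<Rightarrow> real \<Rightarrow> real \<Rightarrow> complex^2^2" where
  "green m z x y = map_matrix ((*) (g11 m z))
     (if y \<le> x then outer2 (sol_p m z x) (sol_m m z y) else outer2 (sol_m m z x) (sol_p m z y))"

lemma green_nth: "green m z x y $ i $ j = g11 m z *
    (if y \<le> x then sol_p m z x $ i * sol_m m z y $ j else sol_m m z x $ i * sol_p m z y $ j)"
proof -
  have "outer2 u v $ i $ j = u $ i * v $ j" for u v
    using exhaust_2[of i] exhaust_2[of j] by (auto simp: outer2_def)
  then show ?thesis by (simp add: green_def)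
qed

definition coef :: "real \<Rightarrow> complex \<Rightarrow> 2 \<Rightarrow> 2 \<Rightarrow> complex" where
  "coef m z i j = (if i = 1 then if j = 1 then g11 m z else gp m z else if j = 1 then gp m z else g22 m z)"

definition local_bound :: "real \<Rightarrow> real" where "local_bound m = 6 * m + 4"

lemma norm_exp_minus_diff_le:
  assumes "0 \<le> Re u" "0 \<le> Re v"
  shows "cmod (exp (- u) - exp (- v)) \<le> cmod (u - v)"
proof -
  have "convex {z. 0 \<le> Re z}" by (rule convex_halfspace_Re_ge)
  then have "cmod (exp (- u) - exp (- v)) \<le> 1 * cmod (u - v)"
    by (rule field_differentiable_bound[where f' = "\<lambda>z. - exp (- z)"])
      (use assms in \<open>auto intro!: derivative_eq_intros\<close>)
  then show ?thesis by simp
qed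

text \<open>Near the branch points the factor \<open>1 / \<mu>\<close> is absorbed by the difference of the exponentials,
  which is at most \<open>2 y \<bar>\<mu>\<bar>\<close>; this costs the linear growth in \<open>y\<close>. For large \<open>w\<close> the quotients
  \<open>a / \<mu>\<close> and \<open>b / \<mu>\<close> are bounded.\<close>

lemma local_term_bound:
  fixes a b w :: complex
  assumes m: "m > 0" and ab: "a = of_real m + w" "b = of_real m - w" "\<mu> * \<mu> = a * b"
    and \<mu>: "0 < Re \<mu>" and y: "0 \<le> y" "y \<le> x"
  shows "cmod (exp (- (\<mu> * of_real (x - y))) - exp (- (\<mu> * of_real (x + y)))) * cmod (a / \<mu>) \<le> local_bound m * (1 + y)"
    "cmod (exp (- (\<mu> * of_real (x - y))) - exp (- (\<mu> * of_real (x + y)))) * cmod (b / \<mu>) \<le> local_bound m * (1 + y)"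
proof -
  define D where "D = cmod (exp (- (\<mu> * of_real (x - y))) - exp (- (\<mu> * of_real (x + y))))"
  have nz: "cmod \<mu> > 0" using \<mu> by auto
  have Re: "0 \<le> Re (\<mu> * of_real (x - y))" "0 \<le> Re (\<mu> * of_real (x + y))" using \<mu> y by auto
  have "D \<le> cmod (\<mu> * of_real (x - y) - \<mu> * of_real (x + y))"
    unfolding D_def by (rule norm_exp_minus_diff_le[OF Re])
  also have "\<mu> * of_real (x - y) - \<mu> * of_real (x + y) = - (of_real (2 * y) * \<mu>)" by (simp add: algebra_simps)
  also have "cmod \<dots> = 2 * y * cmod \<mu>" unfolding norm_minus_cancel norm_mult norm_of_real using y by simp
  finally have D1: "D \<le> 2 * y * cmod \<mu>" .
  have "D \<le> cmod (exp (- (\<mu> * of_real (x - y)))) + cmod (exp (- (\<mu> * of_real (x + y))))"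
    unfolding D_def by (rule norm_triangle_ineq4)
  also have "\<dots> \<le> 1 + 1" using Re by (intro add_mono) auto
  finally have D2: "D \<le> 2" by simp
  have D0: "0 \<le> D" by (simp add: D_def)
  have mu: "cmod \<mu> * cmod \<mu> = cmod a * cmod b" using ab(3) by (metis norm_mult)
  have main: "D * cmod (c / \<mu>) \<le> local_bound m * (1 + y)"
    if c: "cmod c \<le> m + cmod w" and cd: "cmod c * cmod d = cmod \<mu> * cmod \<mu>" "cmod w - m \<le> cmod d" for c d
  proof (cases "cmod w \<le> 2 * m")
    case True
    have "D * cmod (c / \<mu>) \<le> 2 * y * cmod \<mu> * (cmod c / cmod \<mu>)"
      unfolding norm_divide using D1 by (intro mult_right_mono) auto
    also have "\<dots> = 2 * y * cmod c" using nz by simp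
    also have "\<dots> \<le> 2 * y * (3 * m)" using True c y by (intro mult_left_mono) auto
    also have "\<dots> \<le> local_bound m * (1 + y)" using m y by (simp add: local_bound_def algebra_simps)
    finally show ?thesis .
  next
    case False
    have "cmod c \<le> 4 * cmod d" using False c cd(2) m by simp
    then have "cmod c * cmod c \<le> (2 * cmod \<mu>) * (2 * cmod \<mu>)"
      using cd(1) mult_left_mono[of "cmod c" "4 * cmod d" "cmod c"] by simp
    then have "cmod c \<le> 2 * cmod \<mu>" by (metis abs_le_square_iff abs_norm_cancel abs_of_nonneg
        mult_nonneg_nonneg norm_ge_zero power2_eq_square zero_le_numeral)
    then have "cmod (c / \<mu>) \<le> 2" using nz by (simp add: norm_divide field_simps)
    then have "D * cmod (c / \<mu>) \<le> 2 * 2" using D2 D0 by (intro mult_mono) auto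
    also have "\<dots> \<le> local_bound m * (1 + y)" using m y by (simp add: local_bound_def algebra_simps)
    finally show ?thesis .
  qed
  have na: "cmod a \<le> m + cmod w" "cmod b \<le> m + cmod w" "cmod w - m \<le> cmod a" "cmod w - m \<le> cmod b"
    using norm_triangle_ineq[of "of_real m" w] norm_triangle_ineq4[of "of_real m" w]
      norm_triangle_ineq2[of w "- of_real m"] norm_triangle_ineq3[of "of_real m" w] m
    unfolding ab by (auto simp: add.commute norm_minus_commute abs_le_iff)
  show "cmod (exp (- (\<mu> * of_real (x - y))) - exp (- (\<mu> * of_real (x + y)))) * cmod (a / \<mu>) \<le> local_bound m * (1 + y)"
    unfolding D_def[symmetric] using main[of a b] na mu by simp
  show "cmod (exp (- (\<mu> * of_real (x - y))) - exp (- (\<mu> * of_real (x + y)))) * cmod (b / \<mu>) \<le> local_bound m * (1 + y)"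
    unfolding D_def[symmetric] using main[of b a] na mu by (simp add: mult.commute)
qed

text \<open>If \<open>x\<close> and \<open>y\<close> lie on the same half line, the kernel is the rank one part, in which the wave is
  reflected at \<open>0\<close>, plus the Green kernel of that half line with the boundary condition
  \<open>f\<^sub>1(0) = 0\<close>, which the previous lemma bounds. If \<open>0\<close> separates them, only the off-diagonal entry
  that carries the jump at \<open>x = y\<close> differs from the rank one part, by a product of decaying factors.\<close>

lemma green_local_ordered:
  assumes oc: "off_cuts m z" and m: "m > 0" and yx: "y \<le> x"
  shows "cmod (green m z x y $ i $ j - coef m z i j * decay m z x * decay m z y)
    \<le> (local_bound m + 1) * ((1 + \<bar>x\<bar>) * (1 + \<bar>y\<bar>))"
proof -
  define p q where pq: "p = ratio_p m z" "q = ratio_m m z"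
  note nz = off_cuts_nonzero[OF oc, folded pq]
  note c = coefficients[OF oc m, folded pq]
  have Re: "0 < Re (mup m z)" "0 < Re (mum m z)" using oc by (auto simp: off_cuts_def)
  have lb: "local_bound m \<ge> 0" using m by (simp add: local_bound_def)
  have ij: "i = 1 \<or> i = 2" "j = 1 \<or> j = 2" using exhaust_2 by auto
  have W: "1 \<le> (1 + \<bar>x\<bar>) * (1 + \<bar>y\<bar>)" "1 + \<bar>x\<bar> \<le> (1 + \<bar>x\<bar>) * (1 + \<bar>y\<bar>)" "1 + \<bar>y\<bar> \<le> (1 + \<bar>x\<bar>) * (1 + \<bar>y\<bar>)"
    by (auto simp: algebra_simps)
  have W1: "1 \<le> (local_bound m + 1) * ((1 + \<bar>x\<bar>) * (1 + \<bar>y\<bar>))"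
    using mult_mono[of 1 "local_bound m + 1" 1] W lb by simp
  have half_le: "t / 2 \<le> b" if "0 \<le> t" "t \<le> b" for t b :: real using that by simp
  consider (A) "0 \<le> y" | (B) "0 \<le> x" "y < 0" | (C) "x < 0" by linarith
  then show ?thesis
  proof cases
    case A
    define em ep where e: "em = exp (- (mup m z * of_real (x - y)))" "ep = exp (- (mup m z * of_real (x + y)))"
    have ex: "exp (- mup m z * of_real x) * exp (- mup m z * of_real y) = ep"
      "exp (- mup m z * of_real x) * exp (mup m z * of_real y) = em"
      by (simp_all add: e exp_add[symmetric] algebra_simps)
    have dd: "decay m z x * decay m z y = ep" using A yx ex by (simp add: decay_def)
    have nb: "cmod em \<le> 1" "cmod ep \<le> 1" using Re A yx by (auto simp: e)
    have \<alpha>: "g11 m z * ((1 + q / p) / 2) = g11 m z + 1 / (2 * p)" "g11 m z * ((1 - q / p) / 2) = - (1 / (2 * p))"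
      using nz c(1) by (simp_all add: field_simps)
    have S: "sol_p m z x $ 1 = exp (- mup m z * of_real x)" "sol_p m z x $ 2 = p * exp (- mup m z * of_real x)"
      "sol_m m z y $ 1 = (1 + q / p) / 2 * exp (- mup m z * of_real y) + (1 - q / p) / 2 * exp (mup m z * of_real y)"
      "sol_m m z y $ 2 = p * ((1 + q / p) / 2 * exp (- mup m z * of_real y) - (1 - q / p) / 2 * exp (mup m z * of_real y))"
      using A yx by (simp_all add: sol_p_def sol_m_def Let_def pq)
    have R1: "g11 m z * (exp (- mup m z * of_real x) * sol_m m z y $ 1) = g11 m z * ep + (ep - em) / (2 * p)"
    proof -
      have "g11 m z * (exp (- mup m z * of_real x) * sol_m m z y $ 1)
        = (g11 m z * ((1 + q / p) / 2)) * (exp (- mup m z * of_real x) * exp (- mup m z * of_real y))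
        + (g11 m z * ((1 - q / p) / 2)) * (exp (- mup m z * of_real x) * exp (mup m z * of_real y))"
        unfolding S by (simp only: ring_distribs mult_ac)
      then show ?thesis unfolding ex \<alpha> by (simp add: algebra_simps diff_divide_distrib)
    qed
    have R2: "g11 m z * (exp (- mup m z * of_real x) * sol_m m z y $ 2) = gp m z * ep + (ep + em) / 2"
    proof -
      have "g11 m z * (exp (- mup m z * of_real x) * sol_m m z y $ 2)
        = p * ((g11 m z * ((1 + q / p) / 2)) * (exp (- mup m z * of_real x) * exp (- mup m z * of_real y))
        - (g11 m z * ((1 - q / p) / 2)) * (exp (- mup m z * of_real x) * exp (mup m z * of_real y)))"
        unfolding S by (simp only: ring_distribs mult_ac right_diff_distrib)
      note TR = trans[OF this[unfolded ex \<alpha>]]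
      show ?thesis by (rule TR) (use nz in \<open>simp add: field_simps c(2)[symmetric]\<close>)
    qed
    have G: "green m z x y $ 1 $ 1 = g11 m z * ep + (ep - em) / (2 * p)"
      "green m z x y $ 1 $ 2 = gp m z * ep + (ep + em) / 2"
      "green m z x y $ 2 $ 1 = gp m z * ep + (ep - em) / 2"
      "green m z x y $ 2 $ 2 = g22 m z * ep + p * (em - ep) / 2"
    proof -
      show "green m z x y $ 1 $ 1 = g11 m z * ep + (ep - em) / (2 * p)"
        unfolding green_nth using yx R1 by (simp add: S(1))
      show "green m z x y $ 1 $ 2 = gp m z * ep + (ep + em) / 2"
        unfolding green_nth using yx R2 by (simp add: S(1))
      have "green m z x y $ 2 $ 1 = p * (g11 m z * (exp (- mup m z * of_real x) * sol_m m z y $ 1))"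
        unfolding green_nth S(2) using yx by (simp add: mult_ac)
      also have "\<dots> = gp m z * ep + (ep - em) / 2"
        unfolding R1 c(2)[symmetric] using nz by (simp add: field_simps)
      finally show "green m z x y $ 2 $ 1 = gp m z * ep + (ep - em) / 2" .
      have "green m z x y $ 2 $ 2 = p * (g11 m z * (exp (- mup m z * of_real x) * sol_m m z y $ 2))"
        unfolding green_nth S(2) using yx by (simp add: mult_ac)
      also have "\<dots> = (p * gm m z) * ep + p * (em - ep) / 2"
        unfolding R2 using c(6) by (simp add: field_simps)
      finally show "green m z x y $ 2 $ 2 = g22 m z * ep + p * (em - ep) / 2" unfolding c(4) .
    qed
    have pinv: "1 / p = - ((of_real m + wp z) / mup m z)" "p = - ((of_real m - wp z) / mup m z)"
      using nz ratio_p_mult_mup[OF oc] unfolding pq by (simp_all add: ratio_p_def field_simps)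
    note L = local_term_bound[OF m refl refl mup_sq Re(1) A yx, folded e]
    have L1: "cmod ((ep - em) / (2 * p)) \<le> local_bound m * (1 + y)"
    proof -
      have "cmod ((ep - em) / (2 * p)) = cmod (em - ep) * cmod (1 / p) / 2"
        by (simp add: norm_divide norm_mult norm_minus_commute)
      also have "\<dots> \<le> local_bound m * (1 + y)"
        unfolding pinv(1) norm_minus_cancel using half_le[OF _ L(1)] by simp
      finally show ?thesis .
    qed
    have L2: "cmod (p * (em - ep) / 2) \<le> local_bound m * (1 + y)"
    proof -
      have "cmod (p * (em - ep) / 2) = cmod (em - ep) * cmod p / 2"
        by (simp add: norm_divide norm_mult mult.commute)
      also have "\<dots> \<le> local_bound m * (1 + y)"
        unfolding pinv(2) norm_minus_cancel using half_le[OF _ L(2)] by simp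
      finally show ?thesis .
    qed
    have L3: "cmod ((ep + em) / 2) \<le> 1" "cmod ((ep - em) / 2) \<le> 1"
      using nb norm_triangle_ineq[of ep em] norm_triangle_ineq4[of ep em] by (simp_all add: norm_divide)
    have big: "local_bound m * (1 + y) \<le> (local_bound m + 1) * ((1 + \<bar>x\<bar>) * (1 + \<bar>y\<bar>))"
      using W lb A by (intro mult_mono) auto
    show ?thesis
      using ij unfolding mult.assoc[of "coef m z i j"] dd
      using L1 L2 L3 big W1 by (auto simp: G coef_def)
  next
    case B
    have S: "sol_p m z x $ 1 = decay m z x" "sol_p m z x $ 2 = p * decay m z x"
      "sol_m m z y $ 1 = decay m z y" "sol_m m z y $ 2 = q * decay m z y"
      using B by (simp_all add: sol_p_def sol_m_def Let_def pq decay_def)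
    have nd: "cmod (decay m z x * decay m z y) \<le> 1"
      using norm_decay_le[OF oc] by (simp add: norm_mult mult_le_one)
    have G: "green m z x y $ 1 $ 1 = g11 m z * (decay m z x * decay m z y)"
      "green m z x y $ 1 $ 2 = (gp m z + 1) * (decay m z x * decay m z y)"
      "green m z x y $ 2 $ 1 = gp m z * (decay m z x * decay m z y)"
      "green m z x y $ 2 $ 2 = g22 m z * (decay m z x * decay m z y)"
    proof -
      have gm: "gp m z + 1 = q * g11 m z" unfolding c(3) using c(6) by (simp add: algebra_simps)
      show "green m z x y $ 1 $ 2 = (gp m z + 1) * (decay m z x * decay m z y)"
        using yx unfolding green_nth S gm by (simp add: mult_ac)
      show "green m z x y $ 1 $ 1 = g11 m z * (decay m z x * decay m z y)"
        "green m z x y $ 2 $ 1 = gp m z * (decay m z x * decay m z y)"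
        "green m z x y $ 2 $ 2 = g22 m z * (decay m z x * decay m z y)"
        unfolding green_nth S c(4)[symmetric] c(3)[symmetric] c(2)[symmetric] using yx
        by (simp_all add: mult_ac)
    qed
    show ?thesis
      using ij unfolding mult.assoc[of "coef m z i j"]
      using nd W1 by (auto simp: G coef_def algebra_simps)
  next
    case C
    then have y0: "y < 0" using yx by simp
    define em ep where e: "em = exp (- (mum m z * of_real (- y - (- x))))" "ep = exp (- (mum m z * of_real (- y + (- x))))"
    have ex: "exp (mum m z * of_real x) * exp (mum m z * of_real y) = ep"
      "exp (- mum m z * of_real x) * exp (mum m z * of_real y) = em"
      by (simp_all add: e exp_add[symmetric] algebra_simps)
    have dd: "decay m z x * decay m z y = ep" using C y0 ex by (simp add: decay_def)
    have nb: "cmod em \<le> 1" "cmod ep \<le> 1" using Re C yx y0 by (auto simp: e mult_nonneg_nonpos)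
    have \<alpha>: "g11 m z * ((1 + p / q) / 2) = g11 m z - 1 / (2 * q)" "g11 m z * ((1 - p / q) / 2) = 1 / (2 * q)"
    proof -
      have gq: "g11 m z * p = g11 m z * q - 1" using c(1) by (simp add: algebra_simps)
      have "g11 m z * ((1 + p / q) / 2) = (g11 m z * q + g11 m z * p) / (2 * q)"
        "g11 m z * ((1 - p / q) / 2) = (g11 m z * q - g11 m z * p) / (2 * q)"
        using nz by (simp_all add: field_simps)
      then show "g11 m z * ((1 + p / q) / 2) = g11 m z - 1 / (2 * q)" "g11 m z * ((1 - p / q) / 2) = 1 / (2 * q)"
        unfolding gq using nz by (simp_all add: field_simps)
    qed
    have S: "sol_m m z y $ 1 = exp (mum m z * of_real y)" "sol_m m z y $ 2 = q * exp (mum m z * of_real y)"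
      "sol_p m z x $ 1 = (1 + p / q) / 2 * exp (mum m z * of_real x) + (1 - p / q) / 2 * exp (- mum m z * of_real x)"
      "sol_p m z x $ 2 = q * ((1 + p / q) / 2 * exp (mum m z * of_real x) - (1 - p / q) / 2 * exp (- mum m z * of_real x))"
      using C y0 by (simp_all add: sol_p_def sol_m_def Let_def pq)
    have R1: "g11 m z * (sol_p m z x $ 1 * exp (mum m z * of_real y)) = g11 m z * ep + (em - ep) / (2 * q)"
    proof -
      have "g11 m z * (sol_p m z x $ 1 * exp (mum m z * of_real y))
        = (g11 m z * ((1 + p / q) / 2)) * (exp (mum m z * of_real x) * exp (mum m z * of_real y))
        + (g11 m z * ((1 - p / q) / 2)) * (exp (- mum m z * of_real x) * exp (mum m z * of_real y))"
        unfolding S by (simp only: ring_distribs mult_ac)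
      then show ?thesis unfolding ex \<alpha> by (simp add: algebra_simps diff_divide_distrib)
    qed
    have R2: "g11 m z * (sol_p m z x $ 2 * exp (mum m z * of_real y)) = gm m z * ep - (ep + em) / 2"
    proof -
      have "g11 m z * (sol_p m z x $ 2 * exp (mum m z * of_real y))
        = q * ((g11 m z * ((1 + p / q) / 2)) * (exp (mum m z * of_real x) * exp (mum m z * of_real y))
        - (g11 m z * ((1 - p / q) / 2)) * (exp (- mum m z * of_real x) * exp (mum m z * of_real y)))"
        unfolding S by (simp only: ring_distribs mult_ac right_diff_distrib)
      note TR = trans[OF this[unfolded ex \<alpha>]]
      show ?thesis by (rule TR) (use nz in \<open>simp add: field_simps c(3)[symmetric]\<close>)
    qed
    have gm: "gm m z = gp m z + 1" using c(6) by (simp add: algebra_simps)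
    have G: "green m z x y $ 1 $ 1 = g11 m z * ep + (em - ep) / (2 * q)"
      "green m z x y $ 1 $ 2 = gp m z * ep + (ep + em) / 2"
      "green m z x y $ 2 $ 1 = gp m z * ep + (ep - em) / 2"
      "green m z x y $ 2 $ 2 = g22 m z * ep + q * (ep - em) / 2"
    proof -
      show "green m z x y $ 1 $ 1 = g11 m z * ep + (em - ep) / (2 * q)"
        unfolding green_nth using yx R1 by (simp add: S(1))
      have "green m z x y $ 1 $ 2 = q * (g11 m z * (sol_p m z x $ 1 * exp (mum m z * of_real y)))"
        unfolding green_nth S(2) using yx by (simp add: mult_ac)
      also have "\<dots> = gm m z * ep + (em - ep) / 2"
        unfolding R1 c(3)[symmetric] using nz by (simp add: field_simps)
      finally show "green m z x y $ 1 $ 2 = gp m z * ep + (ep + em) / 2"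
        unfolding gm by (simp add: field_simps)
      have "green m z x y $ 2 $ 1 = gm m z * ep - (ep + em) / 2"
        unfolding green_nth using yx R2 by (simp add: S(1))
      then show "green m z x y $ 2 $ 1 = gp m z * ep + (ep - em) / 2"
        unfolding gm by (simp add: field_simps)
      have "green m z x y $ 2 $ 2 = q * (g11 m z * (sol_p m z x $ 2 * exp (mum m z * of_real y)))"
        unfolding green_nth S(2) using yx by (simp add: mult_ac)
      also have "\<dots> = (q * gp m z) * ep + q * (ep - em) / 2"
        unfolding R2 gm by (simp add: field_simps)
      finally show "green m z x y $ 2 $ 2 = g22 m z * ep + q * (ep - em) / 2" unfolding c(5) .
    qed
    have qinv: "1 / q = (of_real m + wm z) / mum m z" "q = (of_real m - wm z) / mum m z"
      using nz ratio_m_mult_mum[OF oc] unfolding pq by (simp_all add: ratio_m_def field_simps)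
    have "0 \<le> - x" "- x \<le> - y" using C yx by auto
    note L = local_term_bound[OF m refl refl mum_sq Re(2) this, folded e]
    have L1: "cmod ((em - ep) / (2 * q)) \<le> local_bound m * (1 + \<bar>x\<bar>)"
    proof -
      have "cmod ((em - ep) / (2 * q)) = cmod (em - ep) * cmod (1 / q) / 2"
        by (simp add: norm_divide norm_mult)
      also have "\<dots> \<le> local_bound m * (1 + (- x))"
        unfolding qinv(1) using half_le[OF _ L(1)] by simp
      finally show ?thesis using C by simp
    qed
    have L2: "cmod (q * (ep - em) / 2) \<le> local_bound m * (1 + \<bar>x\<bar>)"
    proof -
      have "cmod (q * (ep - em) / 2) = cmod (em - ep) * cmod q / 2"
        by (simp add: norm_divide norm_mult mult.commute norm_minus_commute)
      also have "\<dots> \<le> local_bound m * (1 + (- x))"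
        unfolding qinv(2) using half_le[OF _ L(2)] by simp
      finally show ?thesis using C by simp
    qed
    have L3: "cmod ((ep + em) / 2) \<le> 1" "cmod ((ep - em) / 2) \<le> 1"
      using nb norm_triangle_ineq[of ep em] norm_triangle_ineq4[of ep em] by (simp_all add: norm_divide)
    have big: "local_bound m * (1 + \<bar>x\<bar>) \<le> (local_bound m + 1) * ((1 + \<bar>x\<bar>) * (1 + \<bar>y\<bar>))"
      using W lb by (intro mult_mono) auto
    show ?thesis
      using ij unfolding mult.assoc[of "coef m z i j"] dd
      using L1 L2 L3 big W1 by (auto simp: G coef_def)
  qed
qed

lemma coef_sym: "coef m z i j = coef m z j i" by (simp add: coef_def)

lemma green_sym:
  assumes "off_cuts m z" "m > 0" "x \<noteq> y"
  shows "green m z x y $ i $ j = green m z y x $ j $ i"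
  using assms by (auto simp: green_nth mult_ac)

lemma sol_wronskian:
  assumes "off_cuts m z"
  shows "sol_p m z x $ 1 * sol_m m z x $ 2 - sol_p m z x $ 2 * sol_m m z x $ 1 = ratio_m m z - ratio_p m z"
proof -
  define p q where pq: "p = ratio_p m z" "q = ratio_m m z"
  note nz = off_cuts_nonzero[OF assms, folded pq]
  show ?thesis
  proof (cases "0 \<le> x")
    case True
    have e: "exp (- mup m z * of_real x) * exp (mup m z * of_real x) = 1"
      by (simp add: exp_add[symmetric])
    have "sol_p m z x $ 1 * sol_m m z x $ 2 - sol_p m z x $ 2 * sol_m m z x $ 1
      = (- 2 * p) * ((1 - q / p) / 2) * (exp (- mup m z * of_real x) * exp (mup m z * of_real x))"
      using True unfolding sol_p_def sol_m_def Let_def pq[symmetric] by (simp add: algebra_simps)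
    note TR = trans[OF this[unfolded e]]
    show ?thesis by (rule TR) (use nz in \<open>simp add: field_simps pq[symmetric]\<close>)
  next
    case False
    have e: "exp (- mum m z * of_real x) * exp (mum m z * of_real x) = 1"
      by (simp add: exp_add[symmetric])
    have "sol_p m z x $ 1 * sol_m m z x $ 2 - sol_p m z x $ 2 * sol_m m z x $ 1
      = (2 * q) * ((1 - p / q) / 2) * (exp (- mum m z * of_real x) * exp (mum m z * of_real x))"
      using False unfolding sol_p_def sol_m_def Let_def pq[symmetric] by (simp add: algebra_simps)
    note TR = trans[OF this[unfolded e]]
    show ?thesis by (rule TR) (use nz in \<open>simp add: field_simps pq[symmetric]\<close>)
  qed
qed

lemma green_local:
  assumes oc: "off_cuts m z" and m: "m > 0"
  shows "cmod (green m z x y $ i $ j - coef m z i j * decay m z x * decay m z y)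
    \<le> (local_bound m + 1) * ((1 + \<bar>x\<bar>) * (1 + \<bar>y\<bar>))"
proof (cases "y \<le> x")
  case False
  then show ?thesis
    using green_local_ordered[OF oc m, of x y j i] green_sym[OF oc m, of x y i j] coef_sym[of m z i j]
    by (simp add: mult_ac)
qed (rule green_local_ordered[OF oc m])

text \<open>Replacing the decaying exponentials by other functions \<open>e\<close> of modulus at most \<open>1\<close>.\<close>

lemma green_compare:
  assumes oc: "off_cuts m z" and m: "m > 0"
    and D: "cmod (coef m z i j - t) \<le> D" and e: "\<And>x. cmod (e x) \<le> 1"
    and L: "\<And>x. cmod t * cmod (decay m z x - e x) \<le> L * \<bar>x\<bar>"
  shows "cmod (green m z x y $ i $ j - t * e x * e y) \<le> (local_bound m + 1 + D + L) * ((1 + \<bar>x\<bar>) * (1 + \<bar>y\<bar>))"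
proof -
  let ?W = "(1 + \<bar>x\<bar>) * (1 + \<bar>y\<bar>)"
  have W: "1 \<le> ?W" "\<bar>x\<bar> + \<bar>y\<bar> \<le> ?W" by (auto simp: algebra_simps)
  have D0: "0 \<le> D" using D norm_ge_zero by (rule order_trans[rotated])
  have L0: "0 \<le> L" using order_trans[OF mult_nonneg_nonneg[OF norm_ge_zero norm_ge_zero] L[of 1]] by simp
  have eq: "green m z x y $ i $ j - t * e x * e y = (green m z x y $ i $ j - coef m z i j * decay m z x * decay m z y)
    + (coef m z i j - t) * (decay m z x * decay m z y) + t * (decay m z x - e x) * decay m z y
    + t * (decay m z y - e y) * e x"
    by (simp add: algebra_simps)
  have "cmod (green m z x y $ i $ j - t * e x * e y) \<le> cmod (green m z x y $ i $ j - coef m z i j * decay m z x * decay m z y)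
    + cmod ((coef m z i j - t) * (decay m z x * decay m z y)) + cmod (t * (decay m z x - e x) * decay m z y)
    + cmod (t * (decay m z y - e y) * e x)"
    unfolding eq by (intro norm_triangle_mono order_refl)
  also have "\<dots> \<le> (local_bound m + 1) * ?W + D * ?W + L * \<bar>x\<bar> + L * \<bar>y\<bar>"
  proof (intro add_mono green_local[OF oc m])
    have "cmod ((coef m z i j - t) * (decay m z x * decay m z y)) \<le> D * (1 * 1)"
      unfolding norm_mult using D norm_decay_le[OF oc] D0 by (intro mult_mono) auto
    also have "\<dots> \<le> D * ?W" using W D0 by (intro mult_left_mono) auto
    finally show "cmod ((coef m z i j - t) * (decay m z x * decay m z y)) \<le> D * ?W" .
    have "cmod (t * (decay m z x - e x) * decay m z y) \<le> L * \<bar>x\<bar> * 1"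
      unfolding norm_mult[of "t * _"] norm_mult[of t] by (rule mult_mono[OF L norm_decay_le[OF oc]]) (use L0 in auto)
    then show "cmod (t * (decay m z x - e x) * decay m z y) \<le> L * \<bar>x\<bar>" by simp
    have "cmod (t * (decay m z y - e y) * e x) \<le> L * \<bar>y\<bar> * 1"
      unfolding norm_mult[of "t * _"] norm_mult[of t] by (rule mult_mono[OF L e]) (use L0 in auto)
    then show "cmod (t * (decay m z y - e y) * e x) \<le> L * \<bar>y\<bar>" by simp
  qed
  also have "\<dots> \<le> (local_bound m + 1) * ?W + D * ?W + L * ?W"
    using mult_left_mono[OF W(2) L0] by (simp add: algebra_simps)
  finally show ?thesis by (simp add: algebra_simps)
qed

section \<open>Uniform estimates for the Green kernel\<close>

text \<open>If \<open>\<mu>\<close> and \<open>v\<close> lie in the same quadrant of the right half plane, then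
  \<open>\<bar>\<mu> + v\<bar>\<close> dominates both of them, and \<open>(\<mu> - v)(\<mu> + v) = m\<^sup>2\<close> makes \<open>\<mu> - v\<close> small.\<close>

lemma branch_defect:
  assumes m: "m > 0" and mu: "0 < Re \<mu>" "\<mu> * \<mu> = of_real (m\<^sup>2) + v * v" and v: "0 \<le> Re v"
  shows "cmod (\<mu> - v) \<le> m" "cmod (\<mu> - v) * cmod v \<le> m\<^sup>2" "(\<mu> - v) * (\<mu> - v + 2 * v) = of_real (m\<^sup>2)"
proof -
  show eq: "(\<mu> - v) * (\<mu> - v + 2 * v) = of_real (m\<^sup>2)" using mu(2) by (simp add: algebra_simps)
  have "Im (\<mu> * \<mu>) = Im (of_real (m\<^sup>2) + v * v)" using mu(2) by (rule arg_cong)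
  then have im: "Re \<mu> * Im \<mu> = Re v * Im v" by (simp add: mult.commute)
  have "0 \<le> Re v * (Im v)\<^sup>2" using v by simp
  also have "\<dots> = Re \<mu> * (Im \<mu> * Im v)" using im by (simp add: power2_eq_square mult.assoc[symmetric])
  finally have q: "0 \<le> Im \<mu> * Im v" using mu(1) by (simp add: zero_le_mult_iff)
  have r: "0 \<le> Re \<mu> * Re v" using mu(1) v by simp
  have s: "(cmod (\<mu> + v))\<^sup>2 = (cmod \<mu>)\<^sup>2 + (cmod v)\<^sup>2 + 2 * (Re \<mu> * Re v + Im \<mu> * Im v)"
    "(cmod (\<mu> - v))\<^sup>2 = (cmod \<mu>)\<^sup>2 + (cmod v)\<^sup>2 - 2 * (Re \<mu> * Re v + Im \<mu> * Im v)"
    unfolding cmod_power2 by (simp_all add: power2_eq_square algebra_simps)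
  have prod: "cmod (\<mu> - v) * cmod (\<mu> + v) = m\<^sup>2"
  proof -
    have "(\<mu> - v) * (\<mu> + v) = of_real (m\<^sup>2)" using eq by (simp add: algebra_simps)
    then show ?thesis using norm_mult[of "\<mu> - v" "\<mu> + v"] by (simp only: norm_of_real) simp
  qed
  have "(cmod v)\<^sup>2 \<le> (cmod (\<mu> + v))\<^sup>2" unfolding s using q r by simp
  then have vle: "cmod v \<le> cmod (\<mu> + v)" by (rule power2_le_imp_le) simp
  then have "cmod (\<mu> - v) * cmod v \<le> cmod (\<mu> - v) * cmod (\<mu> + v)" by (intro mult_left_mono) auto
  then show "cmod (\<mu> - v) * cmod v \<le> m\<^sup>2" unfolding prod .
  have "(cmod (\<mu> - v))\<^sup>2 \<le> (cmod (\<mu> + v))\<^sup>2" unfolding s using q r by simp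
  then have "cmod (\<mu> - v) \<le> cmod (\<mu> + v)" by (rule power2_le_imp_le) simp
  then have "cmod (\<mu> - v) * cmod (\<mu> - v) \<le> m\<^sup>2"
    unfolding prod[symmetric] by (intro mult_left_mono) auto
  then show "cmod (\<mu> - v) \<le> m" using m by (metis less_imp_le power2_eq_square power2_le_imp_le)
qed

lemma mup_eq_plus_square: "mup m z * mup m z = of_real (m\<^sup>2) + (s * \<i> * wp z) * (s * \<i> * wp z)"
  and mum_eq_plus_square: "mum m z * mum m z = of_real (m\<^sup>2) + (s * \<i> * wm z) * (s * \<i> * wm z)"
  if "s = 1 \<or> s = -1"
  using that unfolding mup_sq mum_sq by (auto simp: algebra_simps power2_eq_square)

text \<open>In each half plane bounded by the lines \<open>Im z = \<plusminus> 1\<close>, the square roots are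
  \<open>s \<i> (z \<mp> \<i>)\<close> up to an error that is \<open>O(1/z)\<close>.\<close>

lemma coefficient_expansion:
  assumes oc: "off_cuts m z" and m: "m > 0" and s: "s = 1 \<or> s = -1" "t = 1 \<or> t = -1"
    and sw: "0 \<le> Re (s * \<i> * wp z)" "0 \<le> Re (t * \<i> * wm z)"
  shows
    "cmod (g11 m z - \<i> / of_real (4 * m) * (t * \<i> * wm z * (of_real m + wp z) - s * \<i> * wp z * (of_real m + wm z)))
      \<le> 5 * (m + 1)\<^sup>2 / (2 * m)" (is ?A)
    "cmod (gp m z - \<i> / of_real (4 * m) * ((of_real m - wp z) * (of_real m + wm z) + s * t * wp z * wm z))
      \<le> 5 * (m + 1)\<^sup>2 / (2 * m)" (is ?B)
    "cmod (g22 m z - \<i> / of_real (4 * m) * ((of_real m - wp z) * (t * \<i> * wm z) - s * \<i> * wp z * (of_real m - wm z)))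
      \<le> 5 * (m + 1)\<^sup>2 / (2 * m)" (is ?C)
proof -
  define v v' where v: "v = s * \<i> * wp z" "v' = t * \<i> * wm z"
  define d d' where d: "d = mup m z - v" "d' = mum m z - v'"
  have Re: "0 < Re (mup m z)" "0 < Re (mum m z)" using oc by (auto simp: off_cuts_def)
  have nv: "cmod v = cmod (wp z)" "cmod v' = cmod (wm z)" using s by (auto simp: v norm_mult)
  note b = branch_defect[OF m Re(1) mup_eq_plus_square[OF s(1)] sw(1), folded v, folded d, unfolded nv]
  note b' = branch_defect[OF m Re(2) mum_eq_plus_square[OF s(2)] sw(2), folded v, folded d, unfolded nv]
  have pm: "cmod (wp z) \<le> cmod (wm z) + 2" "cmod (wm z) \<le> cmod (wp z) + 2"
  proof -
    have "cmod (wm z - wp z) = 2" by (simp add: wp_def wm_def)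
    then show "cmod (wp z) \<le> cmod (wm z) + 2" "cmod (wm z) \<le> cmod (wp z) + 2"
      using norm_triangle_ineq3[of "wm z" "wp z"] by (auto simp: abs_le_iff)
  qed
  have cross: "cmod (x * y) \<le> m\<^sup>2 + m * (m + 2)"
    if "cmod x \<le> m" "cmod x * w \<le> m\<^sup>2" "cmod y \<le> m + (w + 2)" for x y and w :: real
  proof -
    have "cmod (x * y) \<le> cmod x * (m + (w + 2))" unfolding norm_mult using that by (intro mult_left_mono) auto
    also have "\<dots> = cmod x * w + cmod x * (m + 2)" by (simp add: algebra_simps)
    also have "\<dots> \<le> m\<^sup>2 + m * (m + 2)" using that m by (intro add_mono mult_right_mono) auto
    finally show ?thesis .
  qed
  have tri: "cmod (of_real m + x) \<le> m + cmod x" "cmod (of_real m - x) \<le> m + cmod x" for x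
    using norm_triangle_ineq[of "of_real m" x] norm_triangle_ineq4[of "of_real m" x] m by auto
  have scale: "cmod (\<i> / of_real (4 * m) * x) \<le> 5 * (m + 1)\<^sup>2 / (2 * m)" if "cmod x \<le> 3 * (m\<^sup>2 + m * (m + 2))" for x
  proof -
    have "cmod (\<i> / of_real (4 * m) * x) = cmod x / (4 * m)" using m by (simp add: norm_mult norm_divide)
    also have "\<dots> \<le> (10 * (m + 1)\<^sup>2) / (4 * m)"
    proof (intro divide_right_mono)
      have "10 * (m + 1)\<^sup>2 = 3 * (m\<^sup>2 + m * (m + 2)) + (4 * m\<^sup>2 + 14 * m + 10)"
        by (simp add: power2_eq_square algebra_simps)
      moreover have "0 \<le> 4 * m\<^sup>2 + 14 * m + 10" using m by simp
      ultimately show "cmod x \<le> 10 * (m + 1)\<^sup>2" using that by linarith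
    qed (use m in simp)
    finally show ?thesis by simp
  qed
  have nn: "0 \<le> m\<^sup>2 + m * (m + 2)" using m by simp
  have three: "n \<le> 3 * c" if "n \<le> a + b" "a \<le> c" "b \<le> c" "0 \<le> c" for n a b c :: real
    using that by simp
  have factor: "c * x - c * y = c * (x - y)" for c x y :: complex by (simp add: algebra_simps)
  show ?A
  proof -
    have "g11 m z - \<i> / of_real (4 * m) * (v' * (of_real m + wp z) - v * (of_real m + wm z))
      = \<i> / of_real (4 * m) * (d' * (of_real m + wp z) - d * (of_real m + wm z))"
      unfolding g11_def d factor by (simp add: algebra_simps)
    moreover have "cmod (d' * (of_real m + wp z) - d * (of_real m + wm z)) \<le> 3 * (m\<^sup>2 + m * (m + 2))"
      by (rule three[OF norm_triangle_ineq4
        cross[OF b'(1,2) order_trans[OF tri(1) add_left_mono[OF pm(1)]]]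
        cross[OF b(1,2) order_trans[OF tri(1) add_left_mono[OF pm(2)]]] nn])
    ultimately show ?thesis unfolding v[symmetric] by (simp only: scale)
  qed
  show ?C
  proof -
    have "g22 m z - \<i> / of_real (4 * m) * ((of_real m - wp z) * v' - v * (of_real m - wm z))
      = \<i> / of_real (4 * m) * (d' * (of_real m - wp z) - d * (of_real m - wm z))"
      unfolding g22_def d factor by (simp add: algebra_simps)
    moreover have "cmod (d' * (of_real m - wp z) - d * (of_real m - wm z)) \<le> 3 * (m\<^sup>2 + m * (m + 2))"
      by (rule three[OF norm_triangle_ineq4
        cross[OF b'(1,2) order_trans[OF tri(2) add_left_mono[OF pm(1)]]]
        cross[OF b(1,2) order_trans[OF tri(2) add_left_mono[OF pm(2)]]] nn])
    ultimately show ?thesis unfolding v[symmetric] by (simp only: scale)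
  qed
  show ?B
  proof -
    have vv2: "s * t * wp z * wm z = - (v * v')" by (simp add: v algebra_simps)
    have "gp m z - \<i> / of_real (4 * m) * ((of_real m - wp z) * (of_real m + wm z) + s * t * wp z * wm z)
      = \<i> / of_real (4 * m) * (- (d' * v) - d * v' - d * d')"
    proof -
      have "mup m z * mum m z = v * v' + d' * v + d * v' + d * d'" unfolding d by (simp add: algebra_simps)
      then show ?thesis unfolding gp_def factor
        unfolding vv2
        by (intro arg_cong[where f = "(*) (\<i> / of_real (4 * m))"]) (simp add: algebra_simps)
    qed
    moreover have "cmod (- (d' * v) - d * v' - d * d') \<le> 3 * (m\<^sup>2 + m * (m + 2))"
    proof -
      have "cmod (d' * v) \<le> m\<^sup>2 + m * (m + 2)" "cmod (d * v') \<le> m\<^sup>2 + m * (m + 2)"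
        using cross[OF b'(1,2), of v] cross[OF b(1,2), of v'] pm m nv by auto
      moreover have "cmod (d * d') \<le> m\<^sup>2 + m * (m + 2)"
      proof -
        have "cmod (d * d') \<le> m * m" unfolding norm_mult using b(1) b'(1) m by (intro mult_mono) auto
        also have "\<dots> \<le> m\<^sup>2 + m * (m + 2)" using m by (simp add: power2_eq_square)
        finally show ?thesis .
      qed
      moreover have "cmod (- (d' * v) - d * v' - d * d') \<le> cmod (d' * v) + cmod (d * v') + cmod (d * d')"
        using norm_triangle_ineq4[of "- (d' * v) - d * v'" "d * d'"] norm_triangle_ineq4[of "- (d' * v)" "d * v'"]
        by simp
      moreover have "n \<le> 3 * c" if "a \<le> c" "b \<le> c" "e \<le> c" "n \<le> a + b + e" for n a b c e :: real
        using that by simp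
      ultimately show ?thesis by blast
    qed
    ultimately show ?thesis by (simp only: scale)
  qed
qed

lemma coef_bounded_compact:
  assumes m: "m > 0" and z: "cmod z \<le> \<rho>"
  shows "cmod (coef m z i j) \<le> (m + \<rho> + 1)\<^sup>2 / (2 * m)"
proof -
  define s where "s = m + \<rho> + 1"
  have s0: "0 \<le> s" using m order_trans[OF norm_ge_zero z] by (simp add: s_def)
  have w: "cmod (wp z) \<le> \<rho> + 1" "cmod (wm z) \<le> \<rho> + 1"
    using norm_triangle_ineq4[of z \<i>] norm_triangle_ineq[of z \<i>] z by (auto simp: wp_def wm_def)
  have tri: "cmod (of_real m + x) \<le> s" "cmod (of_real m - x) \<le> s" if "cmod x \<le> \<rho> + 1" for x
    using norm_triangle_ineq[of "of_real m" x] norm_triangle_ineq4[of "of_real m" x] m that by (auto simp: s_def)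
  have sq: "cmod x \<le> s" if "x * x = a * b" "cmod a \<le> s" "cmod b \<le> s" for x a b
  proof -
    have "cmod x * cmod x = cmod a * cmod b" using that(1) by (metis norm_mult)
    also have "\<dots> \<le> s * s" using that s0 by (intro mult_mono) auto
    finally show ?thesis using s0 by (metis power2_eq_square power2_le_imp_le)
  qed
  have mu: "cmod (mup m z) \<le> s" "cmod (mum m z) \<le> s"
    using sq[OF mup_sq] sq[OF mum_sq] tri w by auto
  have two: "cmod (\<i> / of_real (4 * m) * (a * b - c * d)) \<le> s\<^sup>2 / (2 * m)"
    if "cmod a \<le> s" "cmod b \<le> s" "cmod c \<le> s" "cmod d \<le> s" for a b c d
  proof -
    have "cmod (a * b - c * d) \<le> s * s + s * s"
      using norm_triangle_ineq4[of "a * b" "c * d"] mult_mono[OF that(1,2) s0] mult_mono[OF that(3,4) s0]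
      by (simp add: norm_mult)
    then have "cmod (a * b - c * d) / (4 * m) \<le> (2 * s\<^sup>2) / (4 * m)"
      using m by (intro divide_right_mono) (auto simp: power2_eq_square)
    then show ?thesis using m by (simp add: norm_mult norm_divide)
  qed
  show ?thesis
    unfolding coef_def s_def[symmetric] g11_def gp_def g22_def
    using two mu tri w by auto
qed

text \<open>Outside the strip both square roots carry the same sign in their expansion, and the quadratic
  terms in \<open>z\<close> cancel.\<close>

lemma coef_bounded_outside:
  assumes oc: "off_cuts m z" and m: "m > 0" and z: "1 < \<bar>Im z\<bar>"
  shows "cmod (coef m z i j) \<le> 5 * (m + 1)\<^sup>2 / (2 * m) + (m + 2)"
proof -
  define s :: complex where "s = (if Im z > 0 then -1 else 1)"
  have s: "s = 1 \<or> s = -1" by (simp add: s_def)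
  have ss: "s * s = 1" using s by auto
  have sw: "0 \<le> Re (s * \<i> * wp z)" "0 \<le> Re (s * \<i> * wm z)" using z by (auto simp: s_def wp_def wm_def)
  note e = coefficient_expansion[OF oc m s s sw]
  have t: "cmod x \<le> B + C" if "cmod (x - y) \<le> B" "cmod y \<le> C" for x y :: complex and B C
    using norm_triangle_ineq[of "x - y" y] that by simp
  have cs: "cmod s = 1" using s by auto
  have nice: "cmod (\<i> / of_real (4 * m) * (of_real m * x)) \<le> m + 2" if "cmod x \<le> m + 2" for x
    using that m by (simp add: norm_mult norm_divide)
  have "s * \<i> * wm z * (of_real m + wp z) - s * \<i> * wp z * (of_real m + wm z) = of_real m * (- 2 * s)"
    by (simp add: wp_def wm_def algebra_simps)
  then have 1: "cmod (g11 m z) \<le> 5 * (m + 1)\<^sup>2 / (2 * m) + (m + 2)"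
    using t[OF e(1)] nice[of "- 2 * s"] cs m by (simp add: norm_mult)
  have "(of_real m - wp z) * (of_real m + wm z) + s * s * wp z * wm z = of_real m * (of_real m + 2 * \<i>)"
    unfolding ss by (simp add: wp_def wm_def algebra_simps)
  then have 2: "cmod (gp m z) \<le> 5 * (m + 1)\<^sup>2 / (2 * m) + (m + 2)"
    using t[OF e(2)] nice[of "of_real m + 2 * \<i>"] norm_triangle_ineq[of "of_real m" "2 * \<i>"] m by (simp add: norm_mult)
  have "(of_real m - wp z) * (s * \<i> * wm z) - s * \<i> * wp z * (of_real m - wm z) = of_real m * (- 2 * s)"
    by (simp add: wp_def wm_def algebra_simps)
  then have 3: "cmod (g22 m z) \<le> 5 * (m + 1)\<^sup>2 / (2 * m) + (m + 2)"
    using t[OF e(3)] nice[of "- 2 * s"] cs m by (simp add: norm_mult)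
  show ?thesis using 1 2 3 by (simp add: coef_def)
qed

text \<open>Either \<open>\<bar>Im z\<bar> > 1\<close>, or \<open>z\<close> is bounded: on the lines \<open>Im z = \<plusminus> 1\<close> a point off the cuts has
  \<open>\<bar>Re z\<bar> < m\<close>.\<close>

theorem green_bounded:
  assumes m: "m > 0"
  obtains C where "C > 0" "\<And>z x y i j. off_cuts m z \<Longrightarrow> \<not> (\<bar>Im z\<bar> < 1 \<and> m + 1 \<le> \<bar>Re z\<bar>) \<Longrightarrow>
    cmod (green m z x y $ i $ j) \<le> C * ((1 + \<bar>x\<bar>) * (1 + \<bar>y\<bar>))"
proof -
  define D where "D = 5 * (m + 1)\<^sup>2 / (2 * m) + (m + 2) + (m + (m + 2) + 1)\<^sup>2 / (2 * m)"
  have nn: "0 \<le> 5 * (m + 1)\<^sup>2 / (2 * m) + (m + 2)" "0 \<le> (m + (m + 2) + 1)\<^sup>2 / (2 * m)" using m by auto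
  show thesis
  proof
    show "local_bound m + 1 + D + 0 > 0" using m nn by (simp add: local_bound_def D_def add_pos_nonneg)
    fix z x y i j assume oc: "off_cuts m z" and z: "\<not> (\<bar>Im z\<bar> < 1 \<and> m + 1 \<le> \<bar>Re z\<bar>)"
    have "cmod (coef m z i j - 0) \<le> D"
    proof (cases "1 < \<bar>Im z\<bar>")
      case True
      then show ?thesis using coef_bounded_outside[OF oc m True, of i j] nn by (simp add: D_def)
    next
      case False
      have "\<bar>Re z\<bar> \<le> m + 1"
      proof (cases "\<bar>Im z\<bar> = 1")
        case True
        have "\<bar>Re z\<bar> < m"
        proof (rule ccontr)
          assume R: "\<not> \<bar>Re z\<bar> < m"
          have "\<exists>w. Im w = 0 \<and> m \<le> \<bar>Re w\<bar> \<and> (w = wp z \<or> w = wm z)"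
          proof (cases "Im z = 1")
            case True
            then show ?thesis using R by (intro exI[of _ "wp z"]) (auto simp: wp_def)
          next
            case False
            then have "Im z = -1" using \<open>\<bar>Im z\<bar> = 1\<close> by auto
            then show ?thesis using R by (intro exI[of _ "wm z"]) (auto simp: wm_def)
          qed
          then obtain w where w: "Im w = 0" "m \<le> \<bar>Re w\<bar>" "w = wp z \<or> w = wm z" by blast
          have "m\<^sup>2 \<le> (Re w)\<^sup>2" using w(2) m by (simp add: abs_le_square_iff[symmetric])
          then have "Re (csqrt (of_real (m\<^sup>2) - w\<^sup>2)) = 0"
          proof -
            have "w = of_real (Re w)" using w(1) by (simp add: complex_eq_iff)
            then have "of_real (m\<^sup>2) - w\<^sup>2 = of_real (m\<^sup>2 - (Re w)\<^sup>2)" by (metis of_real_diff of_real_power)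
            then show ?thesis using \<open>m\<^sup>2 \<le> (Re w)\<^sup>2\<close> by (simp only: csqrt_of_real_nonpos) simp
          qed
          then show False using oc w(3) by (auto simp: off_cuts_def mup_def mum_def)
        qed
        then show ?thesis by simp
      next
        case F: False
        then show ?thesis using False z by auto
      qed
      then have "cmod z \<le> m + 2" using False cmod_le[of z] by simp
      then show ?thesis using coef_bounded_compact[OF m, of z "m + 2" i j] nn by (simp add: D_def)
    qed
    from green_compare[OF oc m this, of "\<lambda>_. 0" 0 x y]
    show "cmod (green m z x y $ i $ j) \<le> (local_bound m + 1 + D + 0) * ((1 + \<bar>x\<bar>) * (1 + \<bar>y\<bar>))"
      by simp
  qed
qed

text \<open>Up to a scalar, the limiting polarisation of both decaying solutions for large \<open>\<bar>Re z\<bar>\<close> in the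
  strip. The matrix \<open>lead lead\<^sup>T\<close> is a multiple of \<^const>\<open>Upsilon\<close>.\<close>

definition lead :: "real \<Rightarrow> complex \<Rightarrow> complex^2" where
  "lead m z = vector [\<i> * (2 * z + of_real m), 2 * z - of_real m]"

text \<open>The square root of the exponential weight in \<^const>\<open>W_integral\<close>. The correction \<open>m\<^sup>2 / (2 Re z)\<close> is
  the next term in the expansion of the square roots \<open>\<mu>\<close>; without it the error would be of order
  \<open>1 / \<bar>z\<bar>\<close>, too large against the factor \<open>\<bar>z\<bar>\<^sup>2\<close> of the rank one part.\<close>

definition wave :: "real \<Rightarrow> complex \<Rightarrow> real \<Rightarrow> complex" where
  "wave m z x = exp (- (of_real \<bar>x\<bar> + \<i> * (z - of_real (m\<^sup>2 / (2 * Re z))) * of_real x))"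

text \<open>In the strip the two square roots carry opposite signs. The quadratic terms then add up, to
  \<open>- lead lead\<^sup>T / (8 m)\<close> up to a bounded error.\<close>

lemma coef_strip:
  assumes oc: "off_cuts m z" and m: "m > 0" and z: "\<bar>Im z\<bar> < 1"
  shows "cmod (coef m z i j - (- (lead m z $ i * lead m z $ j) / of_real (8 * m)))
    \<le> 5 * (m + 1)\<^sup>2 / (2 * m) + (m\<^sup>2 / 2 + 2 * m + 2) / (4 * m)"
proof -
  have sw: "0 \<le> Re (1 * \<i> * wp z)" "0 \<le> Re ((-1) * \<i> * wm z)" using z by (auto simp: wp_def wm_def)
  note e = coefficient_expansion[OF oc m disjI1[OF refl] disjI2[OF refl] sw]
  have t: "cmod (x - y) \<le> B + C" if "cmod (x - w) \<le> B" "cmod (w - y) \<le> C" for x y w :: complex and B C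
    using norm_triangle_ineq[of "x - w" "w - y"] that by simp
  have q: "cmod (w / of_real (4 * m)) \<le> (m\<^sup>2 / 2 + 2 * m + 2) / (4 * m)" if "cmod w \<le> m\<^sup>2 / 2 + 2 * m + 2" for w
    using that m by (simp add: norm_divide divide_right_mono)
  have lead: "lead m z $ 1 = \<i> * (2 * z + of_real m)" "lead m z $ 2 = 2 * z - of_real m"
    by (simp_all add: lead_def)
  have nm: "cmod (of_real (m\<^sup>2) / 2 :: complex) = m\<^sup>2 / 2" by (simp add: norm_divide norm_power)
  have n1: "cmod (2 - of_real (m\<^sup>2) / 2 :: complex) \<le> m\<^sup>2 / 2 + 2 * m + 2"
    using norm_triangle_ineq4[of 2 "of_real (m\<^sup>2) / 2 :: complex"] nm m by simp
  have n2: "cmod (\<i> * (of_real (m\<^sup>2) / 2 + 2 * \<i> * of_real m - 2)) \<le> m\<^sup>2 / 2 + 2 * m + 2"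
  proof -
    have "cmod (of_real (m\<^sup>2) / 2 + 2 * \<i> * of_real m - 2) \<le> cmod (of_real (m\<^sup>2) / 2) + cmod (2 * \<i> * of_real m) + cmod 2"
      by (rule order_trans[OF norm_triangle_ineq4]) (intro add_mono norm_triangle_ineq order_refl)
    then show ?thesis unfolding nm using m by (simp add: norm_mult)
  qed
  have n3: "cmod (of_real (m\<^sup>2) / 2 - 2 :: complex) \<le> m\<^sup>2 / 2 + 2 * m + 2"
    using norm_triangle_ineq4[of "of_real (m\<^sup>2) / 2 :: complex" 2] nm m by simp
  have m0: "complex_of_real m \<noteq> 0" using m by simp
  have d1: "\<i> / of_real (4 * m) * ((-1) * \<i> * wm z * (of_real m + wp z) - 1 * \<i> * wp z * (of_real m + wm z))
      - (- (lead m z $ 1 * lead m z $ 1) / of_real (8 * m)) = (2 - of_real (m\<^sup>2) / 2) / of_real (4 * m)"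
    unfolding lead using m0 by (simp add: wp_def wm_def field_simps power2_eq_square)
  have d2: "\<i> / of_real (4 * m) * ((of_real m - wp z) * (of_real m + wm z) + 1 * (-1) * wp z * wm z)
      - (- (lead m z $ 1 * lead m z $ 2) / of_real (8 * m)) = (\<i> * (of_real (m\<^sup>2) / 2 + 2 * \<i> * of_real m - 2)) / of_real (4 * m)"
    unfolding lead using m0 by (simp add: wp_def wm_def field_simps power2_eq_square)
  have d3: "\<i> / of_real (4 * m) * ((of_real m - wp z) * ((-1) * \<i> * wm z) - 1 * \<i> * wp z * (of_real m - wm z))
      - (- (lead m z $ 2 * lead m z $ 2) / of_real (8 * m)) = (of_real (m\<^sup>2) / 2 - 2) / of_real (4 * m)"
    unfolding lead using m0 by (simp add: wp_def wm_def field_simps power2_eq_square)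
  have c: "lead m z $ 2 * lead m z $ 1 = lead m z $ 1 * lead m z $ 2" by (rule mult.commute)
  have ne: "((2::2) = 1) = False" "((1::2) = 1) = True" by simp_all
  have "i = 1 \<or> i = 2" "j = 1 \<or> j = 2" using exhaust_2 by auto
  then show ?thesis
    using t[OF e(1) q[OF n1, folded d1]] t[OF e(2) q[OF n2, folded d2]] t[OF e(3) q[OF n3, folded d3]]
    by (elim disjE) (simp_all only: coef_def c if_True if_False ne refl)
qed

text \<open>The exact relation \<open>d (d + 2 s \<i> w) = m\<^sup>2\<close> for the defect \<open>d = \<mu> - s \<i> w\<close> gives
  \<open>d = - s \<i> m\<^sup>2 / (2 w) + O(w\<^sup>-\<^sup>3)\<close>, and \<open>1 / w\<close> differs from \<open>1 / Re w\<close> by \<open>O(w\<^sup>-\<^sup>2)\<close>.\<close>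

lemma exponent_defect:
  assumes m: "m > 0" and d: "d * (d + 2 * (s * \<i> * w)) = of_real (m\<^sup>2)" "cmod d * cmod w \<le> m\<^sup>2"
    and s: "s = 1 \<or> s = -1" and w: "Re w = r" "\<bar>Im w\<bar> \<le> 2" and r: "1 \<le> \<bar>r\<bar>"
  shows "cmod (d + s * \<i> * of_real (m\<^sup>2 / (2 * r))) \<le> (m\<^sup>2 + m ^ 4) / r\<^sup>2"
proof -
  have rw: "\<bar>r\<bar> \<le> cmod w" using abs_Re_le_cmod[of w] w by simp
  then have w0: "w \<noteq> 0" "r \<noteq> 0" "0 < cmod w" using r by auto
  have ss: "s * s = 1" "s \<noteq> 0" "cmod s = 1" using s by auto
  have eq: "d + s * \<i> * of_real (m\<^sup>2 / (2 * r))
    = s * \<i> * (of_real (m\<^sup>2) / 2 * ((w - of_real r) / (of_real r * w)) + d * d / (2 * w))"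
  proof -
    have h: "2 * s * \<i> * w * d = of_real (m\<^sup>2) - d * d" using d(1) by (simp add: algebra_simps)
    have "(s * s) * d = - (s * \<i> * (of_real (m\<^sup>2) - d * d) / (2 * w))"
      unfolding h[symmetric] using w0 by (simp add: field_simps)
    then have "d = - (s * \<i> * (of_real (m\<^sup>2) - d * d) / (2 * w))" by (simp only: ss mult_1_left)
    then have "d + s * \<i> * of_real (m\<^sup>2 / (2 * r))
      = - (s * \<i> * (of_real (m\<^sup>2) - d * d) / (2 * w)) + s * \<i> * of_real (m\<^sup>2 / (2 * r))"
      by (rule arg_cong)
    also have "\<dots> = s * \<i> * (of_real (m\<^sup>2) / 2 * ((w - of_real r) / (of_real r * w)) + d * d / (2 * w))"
    proof -
      have r0: "complex_of_real r \<noteq> 0" using w0 by simp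
      show ?thesis unfolding of_real_divide of_real_mult using w0(1) r0 by (simp add: field_simps)
    qed
    finally show ?thesis .
  qed
  have a: "cmod (of_real (m\<^sup>2) / 2 * ((w - of_real r) / (of_real r * w))) \<le> m\<^sup>2 / r\<^sup>2"
  proof -
    have "cmod (w - of_real r) \<le> 2" using cmod_le[of "w - of_real r"] w by simp
    moreover have "r\<^sup>2 \<le> \<bar>r\<bar> * cmod w" using mult_left_mono[OF rw, of "\<bar>r\<bar>"] by (simp add: power2_eq_square)
    ultimately have "cmod (w - of_real r) / (\<bar>r\<bar> * cmod w) \<le> 2 / r\<^sup>2"
      using w0 by (intro frac_le) auto
    then have "m\<^sup>2 / 2 * (cmod (w - of_real r) / (\<bar>r\<bar> * cmod w)) \<le> m\<^sup>2 / 2 * (2 / r\<^sup>2)"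
      by (intro mult_left_mono) auto
    then show ?thesis by (simp add: norm_mult norm_divide norm_power)
  qed
  have b: "cmod (d * d / (2 * w)) \<le> m ^ 4 / r\<^sup>2"
  proof -
    have "cmod d \<le> m\<^sup>2 / cmod w" using d(2) w0 by (simp add: field_simps)
    also have "\<dots> \<le> m\<^sup>2 / \<bar>r\<bar>" using rw r by (intro frac_le) auto
    finally have dr: "cmod d \<le> m\<^sup>2 / \<bar>r\<bar>" .
    have "cmod (d * d / (2 * w)) = cmod d * cmod d / (2 * cmod w)" by (simp add: norm_mult norm_divide)
    also have "\<dots> \<le> (m\<^sup>2 / \<bar>r\<bar>) * (m\<^sup>2 / \<bar>r\<bar>) / 1"
      using dr rw r by (intro frac_le mult_mono) auto
    also have "\<dots> = m ^ 4 / r\<^sup>2" by (simp add: power2_eq_square power4_eq_xxxx)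
    finally show ?thesis .
  qed
  have "cmod (d + s * \<i> * of_real (m\<^sup>2 / (2 * r)))
    = cmod (of_real (m\<^sup>2) / 2 * ((w - of_real r) / (of_real r * w)) + d * d / (2 * w))"
    unfolding eq norm_mult[of "s * \<i>"] by (simp add: norm_mult ss)
  also have "\<dots> \<le> m\<^sup>2 / r\<^sup>2 + m ^ 4 / r\<^sup>2" by (rule order_trans[OF norm_triangle_ineq add_mono[OF a b]])
  finally show ?thesis by (simp add: add_divide_distrib)
qed

lemma decay_wave_diff:
  assumes oc: "off_cuts m z" and m: "m > 0" and z: "\<bar>Im z\<bar> < 1" "1 \<le> \<bar>Re z\<bar>"
  shows "cmod (decay m z x - wave m z x) \<le> (m\<^sup>2 + m ^ 4) / (Re z)\<^sup>2 * \<bar>x\<bar>" "cmod (wave m z x) \<le> 1"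
proof -
  have Re: "0 < Re (mup m z)" "0 < Re (mum m z)" using oc by (auto simp: off_cuts_def)
  define \<zeta> where "\<zeta> = z - of_real (m\<^sup>2 / (2 * Re z))"
  have im\<zeta>: "Im \<zeta> = Im z" by (simp add: \<zeta>_def)
  have wpos: "wave m z x = exp (- ((1 + \<i> * \<zeta>) * of_real x))" if "0 \<le> x"
    using that by (simp add: wave_def \<zeta>_def algebra_simps)
  have wneg: "wave m z x = exp (- ((1 - \<i> * \<zeta>) * of_real (- x)))" if "x < 0"
    using that by (simp add: wave_def \<zeta>_def algebra_simps)
  have Rew: "0 \<le> Re ((1 + \<i> * \<zeta>) * of_real x)" if "0 \<le> x" using that z im\<zeta> by auto
  have Rew': "0 \<le> Re ((1 - \<i> * \<zeta>) * of_real (- x))" if "x < 0"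
    using that z im\<zeta> by (auto simp: mult_nonneg_nonpos)
  show "cmod (wave m z x) \<le> 1"
    using wpos wneg Rew Rew' by (cases "0 \<le> x") (simp_all add: norm_exp_eq_Re)
  show "cmod (decay m z x - wave m z x) \<le> (m\<^sup>2 + m ^ 4) / (Re z)\<^sup>2 * \<bar>x\<bar>"
  proof (cases "0 \<le> x")
    case True
    have sw: "0 \<le> Re (1 * \<i> * wp z)" using z by (simp add: wp_def)
    note b = branch_defect[OF m Re(1) mup_eq_plus_square sw]
    have "cmod ((mup m z - 1 * \<i> * wp z) + 1 * \<i> * of_real (m\<^sup>2 / (2 * Re z))) \<le> (m\<^sup>2 + m ^ 4) / (Re z)\<^sup>2"
      by (rule exponent_defect[OF m, of _ _ "wp z"]) (use b z in \<open>auto simp: wp_def norm_mult\<close>)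
    moreover have "(mup m z - 1 * \<i> * wp z) + 1 * \<i> * of_real (m\<^sup>2 / (2 * Re z)) = mup m z - (1 + \<i> * \<zeta>)"
      by (simp add: wp_def \<zeta>_def algebra_simps)
    ultimately have le: "cmod (mup m z - (1 + \<i> * \<zeta>)) \<le> (m\<^sup>2 + m ^ 4) / (Re z)\<^sup>2" by (simp only:)
    have "cmod (decay m z x - wave m z x) \<le> cmod (mup m z * of_real x - (1 + \<i> * \<zeta>) * of_real x)"
      unfolding wpos[OF True] decay_def using True Re
      by (simp, intro norm_exp_minus_diff_le Rew) auto
    also have "\<dots> = cmod (mup m z - (1 + \<i> * \<zeta>)) * \<bar>x\<bar>"
      by (simp add: norm_mult left_diff_distrib[symmetric])
    also have "\<dots> \<le> (m\<^sup>2 + m ^ 4) / (Re z)\<^sup>2 * \<bar>x\<bar>" using le by (intro mult_right_mono) auto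
    finally show ?thesis .
  next
    case False
    have sw: "0 \<le> Re ((-1) * \<i> * wm z)" using z by (simp add: wm_def)
    note b = branch_defect[OF m Re(2) mum_eq_plus_square sw]
    have "cmod ((mum m z - (-1) * \<i> * wm z) + (-1) * \<i> * of_real (m\<^sup>2 / (2 * Re z))) \<le> (m\<^sup>2 + m ^ 4) / (Re z)\<^sup>2"
      by (rule exponent_defect[OF m, of _ _ "wm z"]) (use b z in \<open>auto simp: wm_def norm_mult\<close>)
    moreover have "(mum m z - (-1) * \<i> * wm z) + (-1) * \<i> * of_real (m\<^sup>2 / (2 * Re z)) = mum m z - (1 - \<i> * \<zeta>)"
      by (simp add: wm_def \<zeta>_def algebra_simps)
    ultimately have le: "cmod (mum m z - (1 - \<i> * \<zeta>)) \<le> (m\<^sup>2 + m ^ 4) / (Re z)\<^sup>2" by (simp only:)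
    have dn: "decay m z x = exp (- (mum m z * of_real (- x)))" using False by (simp add: decay_def)
    have "cmod (decay m z x - wave m z x) \<le> cmod (mum m z * of_real (- x) - (1 - \<i> * \<zeta>) * of_real (- x))"
      unfolding dn wneg[OF False[unfolded not_le]] using False Re Rew'
      by (intro norm_exp_minus_diff_le) (auto simp: mult_nonneg_nonpos)
    also have "\<dots> = cmod (mum m z - (1 - \<i> * \<zeta>)) * \<bar>x\<bar>"
      unfolding left_diff_distrib[symmetric] norm_mult by simp
    also have "\<dots> \<le> (m\<^sup>2 + m ^ 4) / (Re z)\<^sup>2 * \<bar>x\<bar>" using le by (intro mult_right_mono) auto
    finally show ?thesis .
  qed
qed

text \<open>The rank one part has size \<open>\<bar>z\<bar>\<^sup>2\<close> while the decaying solutions differ from the wave by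
  \<open>O(\<bar>x\<bar> / \<bar>z\<bar>\<^sup>2)\<close>, so that the error made by the replacement is uniform in \<open>z\<close>.\<close>

theorem green_strip:
  assumes m: "m > 0"
  obtains C where "C > 0" "\<And>z x y i j. off_cuts m z \<Longrightarrow> \<bar>Im z\<bar> < 1 \<Longrightarrow> m + 1 \<le> \<bar>Re z\<bar> \<Longrightarrow>
    cmod (green m z x y $ i $ j - (- (lead m z $ i * lead m z $ j) / of_real (8 * m)) * wave m z x * wave m z y)
      \<le> C * ((1 + \<bar>x\<bar>) * (1 + \<bar>y\<bar>))"
proof -
  define D where "D = 5 * (m + 1)\<^sup>2 / (2 * m) + (m\<^sup>2 / 2 + 2 * m + 2) / (4 * m)"
  define L where "L = 25 / (8 * m) * (m\<^sup>2 + m ^ 4)"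
  have nn: "0 \<le> D" "0 \<le> L" using m by (auto simp: D_def L_def)
  show thesis
  proof
    show "local_bound m + 1 + D + L > 0" using m nn by (simp add: local_bound_def add_pos_nonneg)
    fix z x y i j assume oc: "off_cuts m z" and z: "\<bar>Im z\<bar> < 1" "m + 1 \<le> \<bar>Re z\<bar>"
    then have z1: "1 \<le> \<bar>Re z\<bar>" using m by simp
    let ?t = "- (lead m z $ i * lead m z $ j) / of_real (8 * m)"
    have ld: "cmod (lead m z $ k) \<le> 5 * \<bar>Re z\<bar>" for k
    proof -
      have zz: "cmod z \<le> 2 * \<bar>Re z\<bar>" using cmod_le[of z] z z1 by simp
      have "cmod (2 * z + of_real m) \<le> 5 * \<bar>Re z\<bar>" "cmod (2 * z - of_real m) \<le> 5 * \<bar>Re z\<bar>"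
        using norm_triangle_ineq[of "2 * z" "of_real m"] norm_triangle_ineq4[of "2 * z" "of_real m"] zz z m
        by (auto simp: norm_mult)
      then show ?thesis using exhaust_2[of k] by (auto simp: lead_def norm_mult)
    qed
    have t: "cmod ?t \<le> 25 / (8 * m) * (Re z)\<^sup>2"
    proof -
      have "cmod (lead m z $ i * lead m z $ j) \<le> (5 * \<bar>Re z\<bar>) * (5 * \<bar>Re z\<bar>)"
        unfolding norm_mult using ld by (intro mult_mono) auto
      then have "cmod (lead m z $ i * lead m z $ j) / (8 * m) \<le> (25 * (Re z)\<^sup>2) / (8 * m)"
        using m by (intro divide_right_mono) (auto simp: power2_eq_square)
      then show ?thesis using m by (simp add: norm_divide)
    qed
    have L: "cmod ?t * cmod (decay m z x - wave m z x) \<le> L * \<bar>x\<bar>" for x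
    proof -
      have "cmod ?t * cmod (decay m z x - wave m z x)
          \<le> (25 / (8 * m) * (Re z)\<^sup>2) * ((m\<^sup>2 + m ^ 4) / (Re z)\<^sup>2 * \<bar>x\<bar>)"
        using m by (intro mult_mono t decay_wave_diff(1)[OF oc m z(1) z1]) auto
      also have "\<dots> = L * \<bar>x\<bar>" using z1 by (auto simp: L_def)
      finally show ?thesis .
    qed
    show "cmod (green m z x y $ i $ j - ?t * wave m z x * wave m z y)
      \<le> (local_bound m + 1 + D + L) * ((1 + \<bar>x\<bar>) * (1 + \<bar>y\<bar>))"
      by (rule green_compare[OF oc m coef_strip[OF oc m z(1), folded D_def] decay_wave_diff(2)[OF oc m z(1) z1] L])
  qed
qed

section \<open>Integral operators on square-integrable functions\<close>

definition vec2 :: "complex \<Rightarrow> complex \<Rightarrow> complex^2" where "vec2 a b = vector [a, b]"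

lemma vec2_nth [simp]: "vec2 a b $ 1 = a" "vec2 a b $ 2 = b"
  by (simp_all add: vec2_def)

lemma continuous_on_vec2 [continuous_intros]:
  assumes "continuous_on S a" "continuous_on S b"
  shows "continuous_on S (\<lambda>x. vec2 (a x) (b x))"
proof -
  have "vec2 (a x) (b x) = (\<chi> i. if i = 1 then a x else b x)" for x
    by (simp add: vec2_eq_iff)
  moreover have "continuous_on S (\<lambda>x. if i = 1 then a x else b x)" for i :: 2
    using assms by (cases "i = 1") simp_all
  ultimately show ?thesis by (auto intro!: continuous_on_vec_lambda)
qed

lemma borel_measurable_vec2 [measurable (raw)]:
  assumes [measurable]: "a \<in> borel_measurable M" "b \<in> borel_measurable M"
  shows "(\<lambda>x. vec2 (a x) (b x)) \<in> borel_measurable M"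
proof -
  have "(\<lambda>x. (\<lambda>p. vec2 (fst p) (snd p)) (a x, b x)) \<in> borel_measurable M"
    by (rule borel_measurable_continuous_on[where f = "\<lambda>p. vec2 (fst p) (snd p)"])
      (auto intro!: continuous_intros borel_measurable_Pair)
  then show ?thesis by simp
qed

lemma borel_measurable_matrix_vector [measurable (raw)]:
  fixes F :: "'a \<Rightarrow> complex^2^2" and v :: "'a \<Rightarrow> complex^2"
  assumes "F \<in> borel_measurable M" and v: "v \<in> borel_measurable M"
  shows "(\<lambda>x. F x *v v x) \<in> borel_measurable M"
proof -
  note [measurable] = borel_measurable_entries[OF assms(1)] borel_measurable_vec_nth[OF v]
  have eq: "F x *v v x = vec2 (F x$1$1 * v x$1 + F x$1$2 * v x$2) (F x$2$1 * v x$1 + F x$2$2 * v x$2)" for x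
    by (simp add: vec2_eq_iff mult_vec2_nth)
  show ?thesis unfolding eq by measurable
qed

lemma matrix_vector_simps:
  fixes M :: "complex^2^2" and v w :: "complex^2"
  shows "M *v (a *s v + b *s w) = a *s (M *v v) + b *s (M *v w)"
    "M *v (r *\<^sub>R v) = r *\<^sub>R (M *v v)" "M *v (v + w) = M *v v + M *v w" "M *v (a *s v) = a *s (M *v v)"
  by (simp_all add: vec2_eq_iff mult_vec2_nth scaleR_eq_smult_vec algebra_simps del: vector_scaleR_component)

lemma bounded_linear_matrix_vector: "bounded_linear (\<lambda>v. (M :: complex^2^2) *v v)"
  by (rule bounded_linear_intro[of _ "norm M"])
    (simp_all add: matrix_vector_simps, metis norm_matrix_vector_le mult.commute)

lemma bounded_linear_smult_vec: "bounded_linear (\<lambda>v::complex^2. (c::complex) *s v)"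
  by (rule bounded_linear_intro[of _ "cmod c"])
    (simp_all add: scaleR_eq_smult_vec norm_smult_vec mult.commute vector_add_ldistrib vector_smult_assoc)

lemma integral_norm_le_nn: "ennreal (norm (LINT x|M. f x)) \<le> (\<integral>\<^sup>+x. ennreal (norm (f x)) \<partial>M)"
  for f :: "'a \<Rightarrow> 'b :: {banach, second_countable_topology}"
  by (cases "integrable M f") (auto intro: integral_norm_bound_ennreal simp: not_integrable_integral_eq)

definition complex_linear :: "(l2 \<Rightarrow> l2) \<Rightarrow> bool" where
  "complex_linear F \<longleftrightarrow> bounded_linear F \<and> (\<forall>c f. F (c *\<^sub>C f) = c *\<^sub>C F f)"

lemma complex_linearD:
  assumes "complex_linear F"
  shows "bounded_linear F" "F (f + g) = F f + F g" "F (c *\<^sub>C f) = c *\<^sub>C F f" "F (f - g) = F f - F g" "F 0 = 0"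
    "F (- f) = - F f"
  using assms by (auto simp: complex_linear_def linear_simps)

lemma complex_linear_compose: "complex_linear F \<Longrightarrow> complex_linear G \<Longrightarrow> complex_linear (\<lambda>f. F (G f))"
  by (auto simp: complex_linear_def intro: bounded_linear_compose)

lemma complex_linear_diff: "complex_linear F \<Longrightarrow> complex_linear G \<Longrightarrow> complex_linear (\<lambda>f. F f - G f)"
  by (auto simp: complex_linear_def scaleC_diff_right intro: bounded_linear_sub)

definition kernel_op :: "(real \<Rightarrow> real \<Rightarrow> complex^2^2) \<Rightarrow> l2 \<Rightarrow> l2" where
  "kernel_op K f = abs_l2 (\<lambda>x. LINT y|lborel. K x y *v rep_l2 f y)"

text \<open>Convergence is required for every \<open>x\<close>, not only for almost every one, so that bounded operators can
  be moved through the integral pointwise.\<close>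

definition kernel_bounded :: "(real \<Rightarrow> real \<Rightarrow> complex^2^2) \<Rightarrow> real \<Rightarrow> bool" where
  "kernel_bounded K C \<longleftrightarrow> 0 \<le> C \<and> case_prod K \<in> borel_measurable (lborel \<Otimes>\<^sub>M lborel) \<and>
     (\<forall>f x. integrable lborel (\<lambda>y. K x y *v rep_l2 f y)) \<and>
     (\<forall>f. (\<integral>\<^sup>+x. ennreal ((norm (LINT y|lborel. K x y *v rep_l2 f y))\<^sup>2) \<partial>lborel) \<le> ennreal ((C * norm f)\<^sup>2))"

lemma kernel_measurable:
  fixes K :: "real \<Rightarrow> real \<Rightarrow> complex^2^2"
  assumes [measurable]: "case_prod K \<in> borel_measurable (lborel \<Otimes>\<^sub>M lborel)" "f \<in> borel_measurable lborel"
  shows "(\<lambda>x. LINT y|lborel. K x y *v f y) \<in> borel_measurable lborel"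
proof -
  have [measurable]: "(\<lambda>p. K (fst p) (snd p)) \<in> borel_measurable (lborel \<Otimes>\<^sub>M lborel)"
    using assms(1) by (simp add: case_prod_unfold)
  have "(\<lambda>(x, y). K x y *v f y) \<in> borel_measurable (lborel \<Otimes>\<^sub>M lborel)"
    unfolding case_prod_unfold
  proof (rule borel_measurable_matrix_vector)
    show "(\<lambda>p. K (fst p) (snd p)) \<in> borel_measurable (lborel \<Otimes>\<^sub>M lborel)" by fact
    show "(\<lambda>p::real \<times> real. f (snd p)) \<in> borel_measurable (lborel \<Otimes>\<^sub>M lborel)" by measurable
  qed
  then show ?thesis by (rule lborel.borel_measurable_lebesgue_integral)
qed

lemma kernel_section_measurable:
  assumes [measurable]: "case_prod K \<in> borel_measurable (lborel \<Otimes>\<^sub>M lborel)"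
  shows "K x \<in> borel_measurable lborel"
proof -
  have "(\<lambda>y. case_prod K (x, y)) \<in> borel_measurable lborel" by measurable
  then show ?thesis by simp
qed

lemma kernel_op_rep:
  assumes "kernel_bounded K C"
  shows "square_integrable (\<lambda>x. LINT y|lborel. K x y *v rep_l2 f y)"
    "AE x in lborel. rep_l2 (kernel_op K f) x = (LINT y|lborel. K x y *v rep_l2 f y)"
    "norm (kernel_op K f) \<le> C * norm f"
proof -
  have [measurable]: "(\<lambda>x. LINT y|lborel. K x y *v rep_l2 f y) \<in> borel_measurable lborel"
    using assms by (intro kernel_measurable) (auto simp: kernel_bounded_def)
  note * = norm_abs_l2_le[of "\<lambda>x. LINT y|lborel. K x y *v rep_l2 f y" "C * norm f"]
  show si: "square_integrable (\<lambda>x. LINT y|lborel. K x y *v rep_l2 f y)" "norm (kernel_op K f) \<le> C * norm f"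
    using * assms by (auto simp: kernel_bounded_def kernel_op_def)
  show "AE x in lborel. rep_l2 (kernel_op K f) x = (LINT y|lborel. K x y *v rep_l2 f y)"
    unfolding kernel_op_def by (rule rep_abs_l2[OF si(1)])
qed

lemma kernel_op_complex_linear:
  assumes K: "kernel_bounded K C"
  shows "complex_linear (kernel_op K)"
proof -
  have int: "integrable lborel (\<lambda>y. K x y *v rep_l2 f y)" for x f
    using K by (auto simp: kernel_bounded_def)
  have [measurable]: "case_prod K \<in> borel_measurable (lborel \<Otimes>\<^sub>M lborel)"
    using K by (simp add: kernel_bounded_def)
  have [measurable]: "K x \<in> borel_measurable lborel" for x by (rule kernel_section_measurable) simp
  have add: "kernel_op K (f + g) = kernel_op K f + kernel_op K g" for f g
  proof (rule l2_eqI)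
    have eq: "(LINT y|lborel. K x y *v rep_l2 (f + g) y)
      = (LINT y|lborel. K x y *v rep_l2 f y) + (LINT y|lborel. K x y *v rep_l2 g y)" for x
    proof -
      have "(LINT y|lborel. K x y *v rep_l2 (f + g) y) = (LINT y|lborel. K x y *v rep_l2 f y + K x y *v rep_l2 g y)"
        using rep_add[of f g] by (intro integral_cong_AE) (auto elim!: eventually_mono simp: matrix_vector_simps)
      then show ?thesis using int by simp
    qed
    from kernel_op_rep(2)[OF K, of f] kernel_op_rep(2)[OF K, of g] kernel_op_rep(2)[OF K, of "f + g"]
      rep_add[of "kernel_op K f" "kernel_op K g"]
    show "AE x in lborel. rep_l2 (kernel_op K (f + g)) x = rep_l2 (kernel_op K f + kernel_op K g) x"
      by eventually_elim (simp add: eq)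
  qed
  have smult: "kernel_op K (c *\<^sub>C f) = c *\<^sub>C kernel_op K f" for c f
  proof (rule l2_eqI)
    have eq: "(LINT y|lborel. K x y *v rep_l2 (c *\<^sub>C f) y) = c *s (LINT y|lborel. K x y *v rep_l2 f y)" for x
    proof -
      have "(LINT y|lborel. K x y *v rep_l2 (c *\<^sub>C f) y) = (LINT y|lborel. c *s (K x y *v rep_l2 f y))"
      proof (rule integral_cong_AE)
        show "(\<lambda>y. c *s (K x y *v rep_l2 f y)) \<in> borel_measurable lborel"
          by (rule borel_measurable_smult_vec) measurable
        show "AE y in lborel. K x y *v rep_l2 (c *\<^sub>C f) y = c *s (K x y *v rep_l2 f y)"
          using rep_scaleC[of c f] by eventually_elim (simp add: matrix_vector_simps)
      qed measurable
      also have "\<dots> = c *s (LINT y|lborel. K x y *v rep_l2 f y)"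
        by (rule integral_bounded_linear[OF bounded_linear_smult_vec int])
      finally show ?thesis .
    qed
    from kernel_op_rep(2)[OF K, of f] kernel_op_rep(2)[OF K, of "c *\<^sub>C f"] rep_scaleC[of c "kernel_op K f"]
    show "AE x in lborel. rep_l2 (kernel_op K (c *\<^sub>C f)) x = rep_l2 (c *\<^sub>C kernel_op K f) x"
      by eventually_elim (simp add: eq)
  qed
  have "bounded_linear (kernel_op K)"
    by (rule bounded_linear_intro[of _ C])
      (use add smult kernel_op_rep(3)[OF K] in \<open>auto simp: mult.commute simp flip: scaleC_of_real\<close>)
  with smult show ?thesis by (simp add: complex_linear_def)
qed

lemma ennreal_sq_le_imp_le: "a\<^sup>2 \<le> (ennreal r)\<^sup>2 \<Longrightarrow> 0 \<le> r \<Longrightarrow> a \<le> ennreal r"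
  by (cases a) (auto simp: ennreal_power ennreal_le_iff power2_eq_square ennreal_top_mult ennreal_mult'[symmetric]
      abs_le_square_iff[symmetric, unfolded power2_eq_square] top_unique)

lemma nn_integral_rep_product:
  assumes [measurable]: "b \<in> borel_measurable lborel" and b: "\<And>y. 0 \<le> b y"
    and int: "integrable lborel (\<lambda>y. (b y)\<^sup>2)"
  shows "(\<integral>\<^sup>+y. ennreal (b y * norm (rep_l2 f y)) \<partial>lborel) \<le> ennreal (sqrt (LINT y|lborel. (b y)\<^sup>2) * norm f)"
proof -
  have "(\<integral>\<^sup>+y. ennreal (b y) * ennreal (norm (rep_l2 f y)) \<partial>lborel)\<^sup>2
    \<le> (\<integral>\<^sup>+y. (ennreal (b y))\<^sup>2 \<partial>lborel) * (\<integral>\<^sup>+y. (ennreal (norm (rep_l2 f y)))\<^sup>2 \<partial>lborel)"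
    by (rule Cauchy_Schwarz_nn_integral) measurable
  also have "(\<integral>\<^sup>+y. (ennreal (b y))\<^sup>2 \<partial>lborel) = ennreal (LINT y|lborel. (b y)\<^sup>2)"
    using b int by (simp add: ennreal_power nn_integral_eq_integral)
  also have "(\<integral>\<^sup>+y. (ennreal (norm (rep_l2 f y)))\<^sup>2 \<partial>lborel) = ennreal ((norm f)\<^sup>2)"
    by (simp add: ennreal_power nn_integral_norm_l2_sq)
  also have "ennreal (LINT y|lborel. (b y)\<^sup>2) * ennreal ((norm f)\<^sup>2)
    = (ennreal (sqrt (LINT y|lborel. (b y)\<^sup>2) * norm f))\<^sup>2"
    by (simp add: ennreal_power power_mult_distrib ennreal_mult')
  finally have "(\<integral>\<^sup>+y. ennreal (b y) * ennreal (norm (rep_l2 f y)) \<partial>lborel)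
      \<le> ennreal (sqrt (LINT y|lborel. (b y)\<^sup>2) * norm f)"
    by (rule ennreal_sq_le_imp_le) simp
  then show ?thesis using b by (simp add: ennreal_mult')
qed

text \<open>A Schur test: Cauchy--Schwarz splits the kernel into a factor that is square integrable in \<open>y\<close>
  and one that is square integrable in \<open>x\<close>, uniformly in the other variable. The bound \<open>\<gamma>\<close> makes the
  defining integral converge for every \<open>x\<close>, not only for almost every one.\<close>

lemma Schur_test:
  assumes Km [measurable]: "case_prod K \<in> borel_measurable (lborel \<Otimes>\<^sub>M lborel)"
    and hm [measurable]: "(\<lambda>p. h (fst p) (snd p)) \<in> borel_measurable (lborel \<Otimes>\<^sub>M lborel)"
    and gm [measurable]: "(\<lambda>p. g (fst p) (snd p)) \<in> borel_measurable (lborel \<Otimes>\<^sub>M lborel)"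
    and nn: "\<And>x y. 0 \<le> h x y" "\<And>x y. 0 \<le> g x y" "0 \<le> \<alpha>" "0 \<le> \<beta>" and \<gamma>: "\<And>x y. g x y \<le> \<gamma> x"
    and \<alpha>: "\<And>x. (\<integral>\<^sup>+y. ennreal ((h x y)\<^sup>2) \<partial>lborel) \<le> ennreal (\<alpha>\<^sup>2)"
    and \<beta>: "\<And>y. (\<integral>\<^sup>+x. ennreal ((g x y)\<^sup>2) \<partial>lborel) \<le> ennreal (\<beta>\<^sup>2)"
    and le: "\<And>x y. norm (K x y) \<le> h x y * g x y"
  shows "kernel_bounded K (\<alpha> * \<beta>)"
proof -
  have [measurable]: "K x \<in> borel_measurable lborel" for x by (rule kernel_section_measurable) simp
  have [measurable]: "h x \<in> borel_measurable lborel" "g x \<in> borel_measurable lborel" for x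
    using measurable_compose[OF measurable_Pair1' hm, of x] measurable_compose[OF measurable_Pair1' gm, of x] by simp_all
  have [measurable]: "(\<lambda>x. g x y) \<in> borel_measurable lborel" for y
    using measurable_compose[OF measurable_Pair2' gm, of y] by simp
  let ?I = "\<lambda>f x. \<integral>\<^sup>+y. ennreal (norm (K x y *v rep_l2 f y)) \<partial>lborel"
  let ?G = "\<lambda>f x. \<integral>\<^sup>+y. ennreal ((g x y)\<^sup>2) * ennreal ((norm (rep_l2 f y))\<^sup>2) \<partial>lborel"
  have CS: "(?I f x)\<^sup>2 \<le> ennreal (\<alpha>\<^sup>2) * ?G f x" for f x
  proof -
    have "?I f x \<le> (\<integral>\<^sup>+y. ennreal (h x y) * ennreal (g x y * norm (rep_l2 f y)) \<partial>lborel)"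
    proof (intro nn_integral_mono)
      fix y
      have "norm (K x y *v rep_l2 f y) \<le> h x y * g x y * norm (rep_l2 f y)"
        by (rule order_trans[OF norm_matrix_vector_le mult_right_mono[OF le norm_ge_zero]])
      then show "ennreal (norm (K x y *v rep_l2 f y)) \<le> ennreal (h x y) * ennreal (g x y * norm (rep_l2 f y))"
        using nn by (simp add: ennreal_mult'[symmetric] ennreal_leI mult.assoc)
    qed
    then have "(?I f x)\<^sup>2 \<le> (\<integral>\<^sup>+y. ennreal (h x y) * ennreal (g x y * norm (rep_l2 f y)) \<partial>lborel)\<^sup>2"
      by (intro power_mono) auto
    also have "\<dots> \<le> (\<integral>\<^sup>+y. (ennreal (h x y))\<^sup>2 \<partial>lborel) * (\<integral>\<^sup>+y. (ennreal (g x y * norm (rep_l2 f y)))\<^sup>2 \<partial>lborel)"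
      by (rule Cauchy_Schwarz_nn_integral) measurable
    also have "\<dots> = (\<integral>\<^sup>+y. ennreal ((h x y)\<^sup>2) \<partial>lborel) * ?G f x"
      using nn by (simp add: ennreal_power power_mult_distrib ennreal_mult')
    also have "\<dots> \<le> ennreal (\<alpha>\<^sup>2) * ?G f x" by (intro mult_right_mono \<alpha>) simp
    finally show ?thesis .
  qed
  have int: "integrable lborel (\<lambda>y. K x y *v rep_l2 f y)" for f x
  proof (rule integrableI_bounded)
    have "?G f x \<le> (\<integral>\<^sup>+y. ennreal ((\<gamma> x)\<^sup>2) * ennreal ((norm (rep_l2 f y))\<^sup>2) \<partial>lborel)"
      by (intro nn_integral_mono mult_right_mono ennreal_leI power_mono \<gamma> nn) auto
    also have "\<dots> = ennreal ((\<gamma> x)\<^sup>2 * (norm f)\<^sup>2)"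
      by (subst nn_integral_cmult) (simp_all add: nn_integral_norm_l2_sq ennreal_mult')
    finally have "?G f x < \<infinity>" by (rule le_less_trans) simp
    then have "(?I f x)\<^sup>2 < \<infinity>" by (intro le_less_trans[OF CS]) (simp add: ennreal_mult_less_top)
    then show "?I f x < \<infinity>" by (auto simp: power2_eq_square ennreal_mult_less_top)
  qed measurable
  have "(\<integral>\<^sup>+x. ennreal ((norm (LINT y|lborel. K x y *v rep_l2 f y))\<^sup>2) \<partial>lborel) \<le> ennreal ((\<alpha> * \<beta> * norm f)\<^sup>2)" for f
  proof -
    have "(\<integral>\<^sup>+x. ennreal ((norm (LINT y|lborel. K x y *v rep_l2 f y))\<^sup>2) \<partial>lborel) \<le> (\<integral>\<^sup>+x. ennreal (\<alpha>\<^sup>2) * ?G f x \<partial>lborel)"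
    proof (intro nn_integral_mono order_trans[OF _ CS])
      fix x
      have "(ennreal (norm (LINT y|lborel. K x y *v rep_l2 f y)))\<^sup>2 \<le> (?I f x)\<^sup>2"
        by (intro power_mono integral_norm_le_nn) auto
      then show "ennreal ((norm (LINT y|lborel. K x y *v rep_l2 f y))\<^sup>2) \<le> (?I f x)\<^sup>2" by (simp add: ennreal_power)
    qed
    also have "\<dots> = ennreal (\<alpha>\<^sup>2) * (\<integral>\<^sup>+x. ?G f x \<partial>lborel)" by (rule nn_integral_cmult) measurable
    also have "(\<integral>\<^sup>+x. ?G f x \<partial>lborel) = (\<integral>\<^sup>+y. \<integral>\<^sup>+x. ennreal ((g x y)\<^sup>2) * ennreal ((norm (rep_l2 f y))\<^sup>2) \<partial>lborel \<partial>lborel)"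
      by (rule lborel_pair.Fubini'[symmetric]) measurable
    also have "\<dots> = (\<integral>\<^sup>+y. (\<integral>\<^sup>+x. ennreal ((g x y)\<^sup>2) \<partial>lborel) * ennreal ((norm (rep_l2 f y))\<^sup>2) \<partial>lborel)"
      by (intro nn_integral_cong nn_integral_multc) measurable
    also have "\<dots> \<le> (\<integral>\<^sup>+y. ennreal (\<beta>\<^sup>2) * ennreal ((norm (rep_l2 f y))\<^sup>2) \<partial>lborel)"
      by (intro nn_integral_mono mult_right_mono \<beta>) simp
    also have "\<dots> = ennreal (\<beta>\<^sup>2 * (norm f)\<^sup>2)"
      by (subst nn_integral_cmult) (simp_all add: nn_integral_norm_l2_sq ennreal_mult')
    finally show ?thesis by (simp add: mult_left_mono ennreal_mult' power_mult_distrib mult.assoc)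
  qed
  then show ?thesis unfolding kernel_bounded_def using nn int by auto
qed

lemma kernel_bounded_product:
  assumes Km: "case_prod K \<in> borel_measurable (lborel \<Otimes>\<^sub>M lborel)"
    and [measurable]: "a \<in> borel_measurable lborel" "b \<in> borel_measurable lborel"
    and nn: "\<And>x. 0 \<le> a x" "\<And>y. 0 \<le> b y"
    and int: "integrable lborel (\<lambda>x. (a x)\<^sup>2)" "integrable lborel (\<lambda>y. (b y)\<^sup>2)"
    and le: "\<And>x y. norm (K x y) \<le> a x * b y"
  shows "kernel_bounded K (sqrt (LINT x|lborel. (a x)\<^sup>2) * sqrt (LINT y|lborel. (b y)\<^sup>2))"
  unfolding mult.commute[of "sqrt (LINT x|lborel. (a x)\<^sup>2)"]
  by (rule Schur_test[where h = "\<lambda>x y. b y" and g = "\<lambda>x y. a x" and \<gamma> = a, OF Km])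
    (use nn int le in \<open>auto simp: nn_integral_eq_integral mult.commute\<close>)

lemma nn_integral_exp_half_line:
  assumes "c > 0"
  shows "(\<integral>\<^sup>+t. ennreal (exp (- c * t)) * indicator {0..} t \<partial>lborel) = ennreal (1 / c)"
proof -
  have "(\<integral>\<^sup>+t. ennreal (exp (- c * t)) * indicator {0..} t \<partial>lborel) = ennreal (0 - (- exp (- c * 0) / c))"
  proof (rule nn_integral_FTC_atLeast)
    show "((\<lambda>t. - exp (- c * t) / c) has_real_derivative exp (- c * t)) (at t)" for t
      using assms by (auto intro!: derivative_eq_intros)
    have "((\<lambda>t. exp (- c * t)) \<longlongrightarrow> 0) at_top"
      using assms by (intro filterlim_compose[OF exp_at_bot] filterlim_tendsto_neg_mult_at_bot[OF tendsto_const] filterlim_ident) auto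
    then have "((\<lambda>t. - exp (- c * t) / c) \<longlongrightarrow> - 0 / c) at_top"
      using assms by (intro tendsto_intros) auto
    then show "((\<lambda>t. - exp (- c * t) / c) \<longlongrightarrow> 0) at_top" by simp
  qed auto
  then show ?thesis by simp
qed

lemma nn_integral_exp_abs:
  assumes "c > 0"
  shows "(\<integral>\<^sup>+y. ennreal (exp (- c * \<bar>x - y\<bar>)) \<partial>lborel) \<le> ennreal (2 / c)"
    "(\<integral>\<^sup>+y. ennreal (exp (- c * \<bar>y - x\<bar>)) \<partial>lborel) \<le> ennreal (2 / c)"
proof -
  let ?e = "\<lambda>t. ennreal (exp (- c * t)) * indicator {0..} t"
  have "(\<integral>\<^sup>+y. ennreal (exp (- c * \<bar>x - y\<bar>)) \<partial>lborel) = (\<integral>\<^sup>+t. ennreal (exp (- c * \<bar>t\<bar>)) \<partial>lborel)"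
    using nn_integral_real_affine[of "\<lambda>t. ennreal (exp (- c * \<bar>t\<bar>))" "-1" x] by simp
  also have "\<dots> \<le> (\<integral>\<^sup>+t. ?e t + ?e (- t) \<partial>lborel)"
    by (intro nn_integral_mono) (auto simp: indicator_def)
  also have "\<dots> = (\<integral>\<^sup>+t. ?e t \<partial>lborel) + (\<integral>\<^sup>+t. ?e (- t) \<partial>lborel)"
    by (rule nn_integral_add) auto
  also have "(\<integral>\<^sup>+t. ?e (- t) \<partial>lborel) = (\<integral>\<^sup>+t. ?e t \<partial>lborel)"
    using nn_integral_real_affine[of ?e "-1" 0] by simp
  also have "(\<integral>\<^sup>+t. ?e t \<partial>lborel) + (\<integral>\<^sup>+t. ?e t \<partial>lborel) = ennreal (2 / c)"
    unfolding nn_integral_exp_half_line[OF assms] using assms by (simp flip: ennreal_plus)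
  finally show *: "(\<integral>\<^sup>+y. ennreal (exp (- c * \<bar>x - y\<bar>)) \<partial>lborel) \<le> ennreal (2 / c)" .
  then show "(\<integral>\<^sup>+y. ennreal (exp (- c * \<bar>y - x\<bar>)) \<partial>lborel) \<le> ennreal (2 / c)"
    by (simp add: abs_minus_commute)
qed

text \<open>In the Schur test the exponential is shared equally between the two factors for the kernel \<open>G\<close>;
  for \<open>A G\<close> and \<open>G B\<close> it is opposed to the square integrable factor.\<close>

lemma kernel_bounded_exponential:
  assumes Gm [measurable]: "case_prod G \<in> borel_measurable (lborel \<Otimes>\<^sub>M lborel)"
    and c: "c > 0" and C: "C \<ge> 0" and le: "\<And>x y. norm (G x y) \<le> C * exp (- c * \<bar>x - y\<bar>)"
    and [measurable]: "A \<in> borel_measurable lborel" "B \<in> borel_measurable lborel"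
    and A: "integrable lborel (\<lambda>x. (norm (A x))\<^sup>2)" and B: "integrable lborel (\<lambda>x. (norm (B x))\<^sup>2)"
  shows "\<exists>D. kernel_bounded G D" "\<exists>D. kernel_bounded (\<lambda>x y. A x ** G x y) D"
    "\<exists>D. kernel_bounded (\<lambda>x y. G x y ** B y) D" "\<exists>D. kernel_bounded (\<lambda>x y. A x ** G x y ** B y) D"
proof -
  have Gm' [measurable]: "(\<lambda>p. G (fst p) (snd p)) \<in> borel_measurable (lborel \<Otimes>\<^sub>M lborel)"
    using Gm by (simp add: case_prod_unfold)
  have ms: "case_prod (\<lambda>x y. A x ** G x y) \<in> borel_measurable (lborel \<Otimes>\<^sub>M lborel)"
    "case_prod (\<lambda>x y. G x y ** B y) \<in> borel_measurable (lborel \<Otimes>\<^sub>M lborel)"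
    "case_prod (\<lambda>x y. A x ** G x y ** B y) \<in> borel_measurable (lborel \<Otimes>\<^sub>M lborel)"
    unfolding case_prod_unfold by measurable
  define e where "e = (\<lambda>d x y. C * exp (- d * \<bar>x - y\<bar>) :: real)"
  have em: "(\<lambda>p. e d (fst p) (snd p)) \<in> borel_measurable (lborel \<Otimes>\<^sub>M lborel)" for d unfolding e_def by measurable
  have e0: "0 \<le> e d x y" for d x y using C by (simp add: e_def)
  have eC: "e d x y \<le> C" if "d > 0" for d x y
    using that C mult_left_mono[of "exp (- d * \<bar>x - y\<bar>)" 1 C] by (simp add: e_def)
  have ei: "(\<integral>\<^sup>+y. ennreal ((e d x y)\<^sup>2) \<partial>lborel) \<le> ennreal ((C * sqrt (1 / d))\<^sup>2)"
    "(\<integral>\<^sup>+y. ennreal ((e d y x)\<^sup>2) \<partial>lborel) \<le> ennreal ((C * sqrt (1 / d))\<^sup>2)" if d: "d > 0" for d x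
  proof -
    have eq: "(e d u v)\<^sup>2 = C\<^sup>2 * exp (- (2 * d) * \<bar>u - v\<bar>)" for u v
      by (simp add: e_def power_mult_distrib exp_double[symmetric])
    have "ennreal (C\<^sup>2) * ennreal (2 / (2 * d)) = ennreal ((C * sqrt (1 / d))\<^sup>2)"
      using d by (simp add: power_mult_distrib ennreal_mult'[symmetric])
    then show "(\<integral>\<^sup>+y. ennreal ((e d x y)\<^sup>2) \<partial>lborel) \<le> ennreal ((C * sqrt (1 / d))\<^sup>2)"
      "(\<integral>\<^sup>+y. ennreal ((e d y x)\<^sup>2) \<partial>lborel) \<le> ennreal ((C * sqrt (1 / d))\<^sup>2)"
      unfolding eq using mult_left_mono[OF nn_integral_exp_abs(1)[of "2 * d" x], of "ennreal (C\<^sup>2)"]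
        mult_left_mono[OF nn_integral_exp_abs(2)[of "2 * d" x], of "ennreal (C\<^sup>2)"] d
      by (simp_all add: ennreal_mult' nn_integral_cmult)
  qed
  have Cd: "0 \<le> C * sqrt (1 / d)" if "d > 0" for d using that C by simp
  show "\<exists>D. kernel_bounded G D"
  proof (intro exI, rule Schur_test[where h = "e (c/2)" and g = "\<lambda>x y. exp (- (c/2) * \<bar>x - y\<bar>)" and \<gamma> = "\<lambda>x. 1", OF Gm em])
    have "e (c/2) x y * exp (- (c/2) * \<bar>x - y\<bar>) = C * exp (- c * \<bar>x - y\<bar>)" for x y
      by (simp add: e_def mult.assoc exp_add[symmetric])
    then show "norm (G x y) \<le> e (c/2) x y * exp (- (c/2) * \<bar>x - y\<bar>)" for x y using le[of x y] by simp
    have "(exp (- (c/2) * \<bar>x - y\<bar>))\<^sup>2 = exp (- c * \<bar>x - y\<bar>)" for x y by (simp add: exp_double[symmetric])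
    then show "(\<integral>\<^sup>+x. ennreal ((exp (- (c/2) * \<bar>x - y\<bar>))\<^sup>2) \<partial>lborel) \<le> ennreal ((sqrt (2 / c))\<^sup>2)" for y
      using nn_integral_exp_abs(2)[OF c, of y] c by simp
  qed (use c e0 ei(1)[of "c/2"] Cd[of "c/2"] in auto)
  have mAG: "norm (A x ** G x y) \<le> e c x y * norm (A x)" and mGB: "norm (G x y ** B y) \<le> norm (B y) * e c x y" for x y
    using order_trans[OF norm_matrix_mult_le mult_left_mono[OF le norm_ge_zero], of "A x" x y]
      order_trans[OF norm_matrix_mult_le mult_right_mono[OF le norm_ge_zero], of x y "B y"]
    by (simp_all add: e_def mult_ac)
  show "\<exists>D. kernel_bounded (\<lambda>x y. A x ** G x y) D"
    by (intro exI, rule Schur_test[where g = "\<lambda>x y. norm (A x)" and \<gamma> = "\<lambda>x. norm (A x)"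
          and \<beta> = "sqrt (LINT x|lborel. (norm (A x))\<^sup>2)", OF ms(1) em _ e0 _ _ _ _ ei(1)[OF c] _ mAG])
      (use c A Cd[of c] in \<open>auto simp: nn_integral_eq_integral\<close>)
  show "\<exists>D. kernel_bounded (\<lambda>x y. G x y ** B y) D"
    by (intro exI, rule Schur_test[where h = "\<lambda>x y. norm (B y)" and \<gamma> = "\<lambda>x. C"
          and \<alpha> = "sqrt (LINT x|lborel. (norm (B x))\<^sup>2)", OF ms(2) _ em _ e0 _ _ _ _ ei(2)[OF c] mGB])
      (use c B eC Cd[of c] in \<open>auto simp: nn_integral_eq_integral\<close>)
  show "\<exists>D. kernel_bounded (\<lambda>x y. A x ** G x y ** B y) D"
  proof (intro exI, rule kernel_bounded_product[OF ms(3), of "\<lambda>x. C * norm (A x)" "\<lambda>y. norm (B y)"])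
    show "norm (A x ** G x y ** B y) \<le> C * norm (A x) * norm (B y)" for x y
    proof -
      have "norm (A x ** G x y) \<le> C * norm (A x)"
        using mult_right_mono[OF eC[OF c, of x y] norm_ge_zero[of "A x"]] mAG[of x y] by linarith
      then show ?thesis by (rule order_trans[OF norm_matrix_mult_le mult_right_mono]) simp
    qed
  qed (use A B C in \<open>auto simp: power_mult_distrib\<close>)
qed

section \<open>The unperturbed resolvent\<close>

text \<open>The equation \<open>(L - z) u = f\<close> reads \<open>u' = slope u + (f\<^sub>2, - f\<^sub>1)\<close>.\<close>

definition slope :: "real \<Rightarrow> complex \<Rightarrow> real \<Rightarrow> complex^2^2" where
  "slope m z x = mat2 0 (of_real m + (z - \<i> * of_real (sgn x))) (of_real m - (z - \<i> * of_real (sgn x))) 0"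

text \<open>Up to constants, \<open>exp (- rate)\<close> and \<open>exp rate\<close> bound the solutions that decay at \<open>+\<infinity>\<close> and at \<open>-\<infinity>\<close>.\<close>

definition rate :: "real \<Rightarrow> complex \<Rightarrow> real \<Rightarrow> real" where
  "rate m z x = (if 0 \<le> x then Re (mup m z) * x else Re (mum m z) * x)"

lemma rate_diff:
  assumes "off_cuts m z" "y \<le> x"
  shows "min (Re (mup m z)) (Re (mum m z)) * (x - y) \<le> rate m z x - rate m z y"
proof -
  let ?c = "min (Re (mup m z)) (Re (mum m z))"
  have pos: "0 < Re (mup m z)" "0 < Re (mum m z)" using assms by (auto simp: off_cuts_def)
  have "?c * t \<le> Re (mup m z) * t" "?c * t \<le> Re (mum m z) * t" if "0 \<le> t" for t
    using that by (auto intro!: mult_right_mono)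
  note t = this
  consider "0 \<le> y" | "y < 0" "0 \<le> x" | "x < 0" using assms(2) by linarith
  then show ?thesis
  proof cases
    case 1
    then show ?thesis using t(1)[of "x - y"] assms(2) by (simp add: rate_def algebra_simps)
  next
    case 2
    then have "0 \<le> - y" by simp
    from t(2)[OF this] have "Re (mum m z) * y \<le> ?c * y" by (simp only: mult_minus_right neg_le_iff_le)
    moreover have "?c * (x - y) = ?c * x - ?c * y" by (rule right_diff_distrib)
    moreover have "rate m z x - rate m z y = Re (mup m z) * x - Re (mum m z) * y" using 2 by (simp add: rate_def)
    ultimately show ?thesis using t(1)[OF 2(2)] by linarith
  next
    case 3
    then show ?thesis using t(2)[of "x - y"] assms(2) by (simp add: rate_def algebra_simps)
  qed
qed

lemma sol_bounds:
  assumes oc: "off_cuts m z"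
  obtains C where "C > 0" "\<And>x i. cmod (sol_p m z x $ i) \<le> C * exp (- rate m z x)"
    "\<And>x i. cmod (sol_m m z x $ i) \<le> C * exp (rate m z x)"
proof -
  define p q where pq: "p = ratio_p m z" "q = ratio_m m z"
  have pos: "0 < Re (mup m z)" "0 < Re (mum m z)" using oc by (auto simp: off_cuts_def)
  define C where "C = (1 + cmod p + cmod q) * (1 + cmod ((1 + p / q) / 2) + cmod ((1 - p / q) / 2)
    + cmod ((1 + q / p) / 2) + cmod ((1 - q / p) / 2))"
  let ?S = "1 + cmod ((1 + p / q) / 2) + cmod ((1 - p / q) / 2) + cmod ((1 + q / p) / 2) + cmod ((1 - q / p) / 2)"
  have S1: "1 \<le> ?S" by simp
  have CS: "?S \<le> C" "cmod p * ?S \<le> C" "cmod q * ?S \<le> C" "1 \<le> C" "cmod p \<le> C" "cmod q \<le> C"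
  proof -
    have S0: "0 \<le> ?S" by simp
    have "1 * ?S \<le> C" "cmod p * ?S \<le> C" "cmod q * ?S \<le> C"
      unfolding C_def by (intro mult_right_mono S0; simp)+
    moreover have "1 * 1 \<le> C" "cmod p * 1 \<le> C" "cmod q * 1 \<le> C"
      unfolding C_def by (intro mult_mono S1 order_refl; simp)+
    ultimately show "?S \<le> C" "cmod p * ?S \<le> C" "cmod q * ?S \<le> C" "1 \<le> C" "cmod p \<le> C" "cmod q \<le> C" by auto
  qed
  have comb: "cmod (a * e + b * e') \<le> (cmod a + cmod b) * E" "cmod (a * e - b * e') \<le> (cmod a + cmod b) * E"
    if "cmod e \<le> E" "cmod e' \<le> E" for a b e e' :: complex and E
  proof -
    have "cmod (a * e) \<le> cmod a * E" "cmod (b * e') \<le> cmod b * E"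
      unfolding norm_mult using that by (auto intro!: mult_left_mono)
    then show "cmod (a * e + b * e') \<le> (cmod a + cmod b) * E" "cmod (a * e - b * e') \<le> (cmod a + cmod b) * E"
      using norm_triangle_ineq[of "a * e" "b * e'"] norm_triangle_ineq4[of "a * e" "b * e'"]
      by (auto simp: distrib_right)
  qed
  have fin: "cmod (r * X) \<le> C * E" if "cmod X \<le> T * E" "T \<le> ?S" "cmod r * ?S \<le> C" "0 \<le> E" for r X T E
  proof -
    have "cmod (r * X) \<le> cmod r * (?S * E)"
      unfolding norm_mult using that order_trans[OF that(1) mult_right_mono[OF that(2,4)]]
      by (intro mult_left_mono) auto
    also have "\<dots> \<le> C * E" using mult_right_mono[OF that(3,4)] by (simp only: mult.assoc)
    finally show ?thesis .
  qed
  have ij: "i = 1 \<or> i = 2" for i :: 2 using exhaust_2 by auto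
  have P: "cmod (sol_p m z x $ i) \<le> C * exp (- rate m z x)" for x i
  proof (cases "0 \<le> x")
    case True
    have E: "cmod (exp (- mup m z * of_real x)) = exp (- rate m z x)"
      using True by (simp add: norm_exp_eq_Re rate_def)
    show ?thesis
      using ij[of i] CS True by (auto simp: sol_p_def Let_def pq[symmetric] norm_mult E[simplified] intro!: mult_right_mono)
  next
    case False
    have E: "cmod (exp (mum m z * of_real x)) \<le> exp (- rate m z x)" "cmod (exp (- mum m z * of_real x)) \<le> exp (- rate m z x)"
      using False mult_pos_neg[OF pos(2), of x] by (simp_all add: norm_exp_eq_Re rate_def)
    have S: "sol_p m z x $ 1 = 1 * ((1 + p / q) / 2 * exp (mum m z * of_real x) + (1 - p / q) / 2 * exp (- mum m z * of_real x))"
      "sol_p m z x $ 2 = q * ((1 + p / q) / 2 * exp (mum m z * of_real x) - (1 - p / q) / 2 * exp (- mum m z * of_real x))"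
      using False by (simp_all add: sol_p_def Let_def pq[symmetric])
    have T: "cmod ((1 + p / q) / 2) + cmod ((1 - p / q) / 2) \<le> ?S" by simp
    have "cmod (sol_p m z x $ 1) \<le> C * exp (- rate m z x)" "cmod (sol_p m z x $ 2) \<le> C * exp (- rate m z x)"
      unfolding S by (rule fin[OF comb(1)[OF E] T], use CS in simp, simp) (rule fin[OF comb(2)[OF E] T], use CS in simp, simp)
    then show ?thesis using ij[of i] by auto
  qed
  have M: "cmod (sol_m m z x $ i) \<le> C * exp (rate m z x)" for x i
  proof (cases "0 \<le> x")
    case False
    have E: "cmod (exp (mum m z * of_real x)) = exp (rate m z x)"
      using False by (simp add: norm_exp_eq_Re rate_def)
    show ?thesis
      using ij[of i] CS False by (auto simp: sol_m_def Let_def pq[symmetric] norm_mult E[simplified] intro!: mult_right_mono)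
  next
    case True
    have E: "cmod (exp (- mup m z * of_real x)) \<le> exp (rate m z x)" "cmod (exp (mup m z * of_real x)) \<le> exp (rate m z x)"
      using True mult_nonneg_nonneg[OF less_imp_le[OF pos(1)], of x] by (simp_all add: norm_exp_eq_Re rate_def)
    have S: "sol_m m z x $ 1 = 1 * ((1 + q / p) / 2 * exp (- mup m z * of_real x) + (1 - q / p) / 2 * exp (mup m z * of_real x))"
      "sol_m m z x $ 2 = p * ((1 + q / p) / 2 * exp (- mup m z * of_real x) - (1 - q / p) / 2 * exp (mup m z * of_real x))"
      using True by (simp_all add: sol_m_def Let_def pq[symmetric])
    have T: "cmod ((1 + q / p) / 2) + cmod ((1 - q / p) / 2) \<le> ?S" by simp
    have "cmod (sol_m m z x $ 1) \<le> C * exp (rate m z x)" "cmod (sol_m m z x $ 2) \<le> C * exp (rate m z x)"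
      unfolding S by (rule fin[OF comb(1)[OF E] T], use CS in simp, simp) (rule fin[OF comb(2)[OF E] T], use CS in simp, simp)
    then show ?thesis using ij[of i] by auto
  qed
  show thesis using that[of C] CS P M by simp
qed

lemma green_exponential_bound:
  assumes oc: "off_cuts m z"
  obtains C c where "C > 0" "c > 0" "\<And>x y. norm (green m z x y) \<le> C * exp (- c * \<bar>x - y\<bar>)"
proof -
  obtain C where C: "C > 0" "\<And>x i. cmod (sol_p m z x $ i) \<le> C * exp (- rate m z x)"
    "\<And>x i. cmod (sol_m m z x $ i) \<le> C * exp (rate m z x)"
    using sol_bounds[OF oc] by metis
  define c where "c = min (Re (mup m z)) (Re (mum m z))"
  have c0: "c > 0" using oc by (simp add: c_def off_cuts_def)
  define K where "K = (cmod (g11 m z) + 1) * C\<^sup>2"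
  have K0: "K > 0" using C by (simp add: K_def add_nonneg_pos)
  have pm: "cmod (sol_p m z a $ i * sol_m m z b $ j) \<le> C\<^sup>2 * exp (- c * \<bar>a - b\<bar>)" if "b \<le> a" for a b i j
  proof -
    have "cmod (sol_p m z a $ i * sol_m m z b $ j) \<le> (C * exp (- rate m z a)) * (C * exp (rate m z b))"
      unfolding norm_mult using C by (intro mult_mono) auto
    also have "\<dots> = C\<^sup>2 * exp (- (rate m z a - rate m z b))"
      by (simp add: power2_eq_square exp_add[symmetric] mult_ac exp_diff exp_minus divide_inverse)
    also have "\<dots> \<le> C\<^sup>2 * exp (- c * \<bar>a - b\<bar>)"
      using rate_diff[OF oc that] that by (intro mult_left_mono) (auto simp: c_def)
    finally show ?thesis .
  qed
  have ent: "cmod (green m z x y $ i $ j) \<le> K * exp (- c * \<bar>x - y\<bar>)" for x y i j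
  proof -
    have "cmod (if y \<le> x then sol_p m z x $ i * sol_m m z y $ j else sol_m m z x $ i * sol_p m z y $ j)
      \<le> C\<^sup>2 * exp (- c * \<bar>x - y\<bar>)"
      using pm[of y x i j] pm[of x y j i] by (auto simp: mult.commute abs_minus_commute)
    then have "cmod (green m z x y $ i $ j) \<le> (cmod (g11 m z) + 1) * (C\<^sup>2 * exp (- c * \<bar>x - y\<bar>))"
      unfolding green_nth norm_mult by (intro mult_mono) auto
    then show ?thesis by (simp add: K_def mult.assoc)
  qed
  show thesis
  proof
    show "4 * K > 0" "c > 0" using K0 c0 by auto
    show "norm (green m z x y) \<le> 4 * K * exp (- c * \<bar>x - y\<bar>)" for x y
      using norm_mat2_le_sum[of "green m z x y"] ent[of x y 1 1] ent[of x y 1 2] ent[of x y 2 1] ent[of x y 2 2]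
      by linarith
  qed
qed

lemma sol_derivative:
  assumes oc: "off_cuts m z" and x: "x \<noteq> 0"
  shows "((\<lambda>x. sol_p m z x $ i) has_vector_derivative (slope m z x *v sol_p m z x) $ i) (at x)"
    "((\<lambda>x. sol_m m z x $ i) has_vector_derivative (slope m z x *v sol_m m z x) $ i) (at x)"
proof -
  define p q where pq: "p = ratio_p m z" "q = ratio_m m z"
  note r = ratio_p_mult[OF oc, folded pq] ratio_m_mult[OF oc, folded pq] ratio_p_mult_mup[OF oc, folded pq]
    ratio_m_mult_mum[OF oc, folded pq]
  have ij: "i = 1 \<or> i = 2" using exhaust_2 by auto
  have ev: "(F has_vector_derivative D) (at x)" if "(G has_vector_derivative D) (at x)"
    "\<And>y. 0 < x * y \<Longrightarrow> F y = G y" for F G :: "real \<Rightarrow> complex" and D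
  proof (rule has_vector_derivative_transform_within_open[OF that(1)])
    show "open {y. 0 < x * y}" by (intro open_Collect_less continuous_intros)
    show "x \<in> {y. 0 < x * y}" using x by (metis mem_Collect_eq not_real_square_gt_zero)
  qed (use that(2) in auto)
  have lin: "((\<lambda>y. a * exp (l * of_real y) + b * exp (k * of_real y)) has_vector_derivative
      a * (l * exp (l * of_real x)) + b * (k * exp (k * of_real x))) (at x)" for a b l k :: complex
    by (rule has_vector_derivative_real_field)
      (auto intro!: derivative_eq_intros simp: mult_ac)
  have sl: "(slope m z x *v v) $ 1 = (of_real m + (if 0 < x then wp z else wm z)) * v $ 2"
    "(slope m z x *v v) $ 2 = (of_real m - (if 0 < x then wp z else wm z)) * v $ 1" for v
    using x by (auto simp: slope_def mult_vec2_nth wp_def wm_def)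
  show "((\<lambda>x. sol_p m z x $ i) has_vector_derivative (slope m z x *v sol_p m z x) $ i) (at x)"
  proof (cases "0 < x")
    case True
    have s: "sol_p m z y $ 1 = 1 * exp (- mup m z * of_real y) + 0 * exp (0 * of_real y)"
      "sol_p m z y $ 2 = p * exp (- mup m z * of_real y) + 0 * exp (0 * of_real y)" if "0 < x * y" for y
      using that True by (simp_all add: sol_p_def Let_def pq zero_less_mult_iff)
    have x2: "0 < x * x" using x by (metis not_real_square_gt_zero)
    have "(slope m z x *v sol_p m z x) $ 1 = 1 * (- mup m z * exp (- mup m z * of_real x)) + 0 * (0 * exp (0 * of_real x))"
      "(slope m z x *v sol_p m z x) $ 2 = p * (- mup m z * exp (- mup m z * of_real x)) + 0 * (0 * exp (0 * of_real x))"
    proof -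
      have g: "(of_real m + wp z) * (p * a) = - (mup m z * a)" "(of_real m - wp z) * b = - (p * (mup m z * b))" for a b
        using r(1) r(3) by (metis mult.assoc mult.commute mult_minus_left, simp flip: mult.assoc add: left_diff_distrib)
      show "(slope m z x *v sol_p m z x) $ 1 = 1 * (- mup m z * exp (- mup m z * of_real x)) + 0 * (0 * exp (0 * of_real x))"
        "(slope m z x *v sol_p m z x) $ 2 = p * (- mup m z * exp (- mup m z * of_real x)) + 0 * (0 * exp (0 * of_real x))"
        unfolding sl s[OF x2] using True by (simp_all add: g)
    qed
    then show ?thesis using ij ev[OF lin s(1)] ev[OF lin s(2)] by auto
  next
    case False
    have s: "sol_p m z y $ 1 = (1 + p / q) / 2 * exp (mum m z * of_real y) + (1 - p / q) / 2 * exp (- mum m z * of_real y)"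
      "sol_p m z y $ 2 = (q * ((1 + p / q) / 2)) * exp (mum m z * of_real y) + (- q * ((1 - p / q) / 2)) * exp (- mum m z * of_real y)"
      if "0 < x * y" for y
    proof -
      have h: "q * (A * e - B * e') = (q * A) * e + (- q * B) * e'" for A B e e' by (simp add: algebra_simps)
      have "y < 0" using that False x by (simp add: zero_less_mult_iff)
      then show "sol_p m z y $ 1 = (1 + p / q) / 2 * exp (mum m z * of_real y) + (1 - p / q) / 2 * exp (- mum m z * of_real y)"
        "sol_p m z y $ 2 = (q * ((1 + p / q) / 2)) * exp (mum m z * of_real y) + (- q * ((1 - p / q) / 2)) * exp (- mum m z * of_real y)"
        unfolding h[symmetric] by (simp_all add: sol_p_def Let_def pq)
    qed
    have x2: "0 < x * x" using x by (metis not_real_square_gt_zero)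
    define A B where AB: "A = (1 + p / q) / 2" "B = (1 - p / q) / 2"
    define e e' where ee: "e = exp (mum m z * of_real x)" "e' = exp (- mum m z * of_real x)"
    have "(slope m z x *v sol_p m z x) $ 1 = A * (mum m z * e) + B * (- mum m z * e')"
    proof -
      have "(slope m z x *v sol_p m z x) $ 1 = (of_real m + wm z) * ((q * A) * e + (- q * B) * e')"
        unfolding sl s[OF x2, folded AB ee] using False by simp
      also have "\<dots> = (q * (of_real m + wm z)) * (A * e - B * e')" by (simp add: algebra_simps)
      finally show ?thesis unfolding r(2) by (simp add: algebra_simps)
    qed
    moreover have "(slope m z x *v sol_p m z x) $ 2 = (q * A) * (mum m z * e) + (- q * B) * (- mum m z * e')"
    proof -
      have "(slope m z x *v sol_p m z x) $ 2 = (of_real m - wm z) * (A * e + B * e')"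
        unfolding sl s[OF x2, folded AB ee] using False by simp
      also have "of_real m - wm z = (q * mum m z)" using r(4) by (simp add: algebra_simps)
      finally show ?thesis by (simp add: algebra_simps)
    qed
    ultimately show ?thesis using ij ev[OF lin s(1)] ev[OF lin s(2)] unfolding AB ee by auto
  qed
  show "((\<lambda>x. sol_m m z x $ i) has_vector_derivative (slope m z x *v sol_m m z x) $ i) (at x)"
  proof (cases "0 < x")
    case False
    have s: "sol_m m z y $ 1 = 1 * exp (mum m z * of_real y) + 0 * exp (0 * of_real y)"
      "sol_m m z y $ 2 = q * exp (mum m z * of_real y) + 0 * exp (0 * of_real y)" if "0 < x * y" for y
      using that False x by (auto simp: sol_m_def Let_def pq zero_less_mult_iff)
    have x2: "0 < x * x" using x by (metis not_real_square_gt_zero)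
    have "(slope m z x *v sol_m m z x) $ 1 = 1 * (mum m z * exp (mum m z * of_real x)) + 0 * (0 * exp (0 * of_real x))"
      "(slope m z x *v sol_m m z x) $ 2 = q * (mum m z * exp (mum m z * of_real x)) + 0 * (0 * exp (0 * of_real x))"
    proof -
      have g: "(of_real m + wm z) * (q * a) = mum m z * a" "(of_real m - wm z) * b = q * (mum m z * b)" for a b
        using r(2) r(4) by (metis mult.assoc mult.commute, simp flip: mult.assoc)
      show "(slope m z x *v sol_m m z x) $ 1 = 1 * (mum m z * exp (mum m z * of_real x)) + 0 * (0 * exp (0 * of_real x))"
        "(slope m z x *v sol_m m z x) $ 2 = q * (mum m z * exp (mum m z * of_real x)) + 0 * (0 * exp (0 * of_real x))"
        unfolding sl s[OF x2] using False by (simp_all add: g)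
    qed
    then show ?thesis using ij ev[OF lin s(1)] ev[OF lin s(2)] by auto
  next
    case True
    have s: "sol_m m z y $ 1 = (1 + q / p) / 2 * exp (- mup m z * of_real y) + (1 - q / p) / 2 * exp (mup m z * of_real y)"
      "sol_m m z y $ 2 = (p * ((1 + q / p) / 2)) * exp (- mup m z * of_real y) + (- p * ((1 - q / p) / 2)) * exp (mup m z * of_real y)"
      if "0 < x * y" for y
    proof -
      have h: "p * (A * e - B * e') = (p * A) * e + (- p * B) * e'" for A B e e' by (simp add: algebra_simps)
      have "0 < y" using that True by (simp add: zero_less_mult_iff)
      then show "sol_m m z y $ 1 = (1 + q / p) / 2 * exp (- mup m z * of_real y) + (1 - q / p) / 2 * exp (mup m z * of_real y)"
        "sol_m m z y $ 2 = (p * ((1 + q / p) / 2)) * exp (- mup m z * of_real y) + (- p * ((1 - q / p) / 2)) * exp (mup m z * of_real y)"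
        unfolding h[symmetric] by (simp_all add: sol_m_def Let_def pq)
    qed
    have x2: "0 < x * x" using x by (metis not_real_square_gt_zero)
    define A B where AB: "A = (1 + q / p) / 2" "B = (1 - q / p) / 2"
    define e e' where ee: "e = exp (- mup m z * of_real x)" "e' = exp (mup m z * of_real x)"
    have "(slope m z x *v sol_m m z x) $ 1 = A * (- mup m z * e) + B * (mup m z * e')"
    proof -
      have "(slope m z x *v sol_m m z x) $ 1 = (of_real m + wp z) * ((p * A) * e + (- p * B) * e')"
        unfolding sl s[OF x2, folded AB ee] using True by simp
      also have "\<dots> = (p * (of_real m + wp z)) * (A * e - B * e')" by (simp add: algebra_simps)
      finally show ?thesis unfolding r(1) by (simp add: algebra_simps)
    qed
    moreover have "(slope m z x *v sol_m m z x) $ 2 = (p * A) * (- mup m z * e) + (- p * B) * (mup m z * e')"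
    proof -
      have "(slope m z x *v sol_m m z x) $ 2 = (of_real m - wp z) * (A * e + B * e')"
        unfolding sl s[OF x2, folded AB ee] using True by simp
      also have "of_real m - wp z = - (p * mup m z)" using r(3) by (simp add: algebra_simps)
      finally show ?thesis by (simp add: algebra_simps)
    qed
    ultimately show ?thesis using ij ev[OF lin s(1)] ev[OF lin s(2)] unfolding AB ee by auto
  qed
qed

lemma continuous_on_piecewise:
  fixes f g :: "real \<Rightarrow> complex"
  assumes "continuous_on UNIV f" "continuous_on UNIV g" "f 0 = g 0"
  shows "continuous_on UNIV (\<lambda>x. if 0 \<le> x then f x else g x)"
proof -
  have "continuous_on ({0..} \<union> {..0}) (\<lambda>x. if 0 \<le> x then f x else g x)"
    by (intro continuous_on_If) (use assms in \<open>auto intro: continuous_on_subset\<close>)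
  moreover have "{0..} \<union> {..0} = (UNIV :: real set)" by auto
  ultimately show ?thesis by simp
qed

lemma sol_continuous:
  assumes oc: "off_cuts m z"
  shows "continuous_on UNIV (\<lambda>x. sol_p m z x $ i)" "continuous_on UNIV (\<lambda>x. sol_m m z x $ i)"
proof -
  define p q where pq: "p = ratio_p m z" "q = ratio_m m z"
  note nz = off_cuts_nonzero[OF oc, folded pq]
  have eq: "sol_p m z x $ 1 = (if 0 \<le> x then exp (- mup m z * of_real x) else
      (1 + p / q) / 2 * exp (mum m z * of_real x) + (1 - p / q) / 2 * exp (- mum m z * of_real x))"
    "sol_p m z x $ 2 = (if 0 \<le> x then p * exp (- mup m z * of_real x) else
      q * ((1 + p / q) / 2 * exp (mum m z * of_real x) - (1 - p / q) / 2 * exp (- mum m z * of_real x)))"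
    "sol_m m z x $ 1 = (if 0 \<le> x then (1 + q / p) / 2 * exp (- mup m z * of_real x) + (1 - q / p) / 2 * exp (mup m z * of_real x)
       else exp (mum m z * of_real x))"
    "sol_m m z x $ 2 = (if 0 \<le> x then p * ((1 + q / p) / 2 * exp (- mup m z * of_real x) - (1 - q / p) / 2 * exp (mup m z * of_real x))
       else q * exp (mum m z * of_real x))" for x
    by (simp_all add: sol_p_def sol_m_def Let_def pq)
  have "continuous_on UNIV (\<lambda>x. sol_p m z x $ 1)" "continuous_on UNIV (\<lambda>x. sol_p m z x $ 2)"
    "continuous_on UNIV (\<lambda>x. sol_m m z x $ 1)" "continuous_on UNIV (\<lambda>x. sol_m m z x $ 2)"
    unfolding eq by (rule continuous_on_piecewise; use nz in \<open>auto intro!: continuous_intros simp: field_simps\<close>)+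
  moreover have "i = 1 \<or> i = 2" using exhaust_2 by auto
  ultimately show "continuous_on UNIV (\<lambda>x. sol_p m z x $ i)" "continuous_on UNIV (\<lambda>x. sol_m m z x $ i)" by auto
qed

lemma green_measurable:
  assumes oc: "off_cuts m z"
  shows "case_prod (green m z) \<in> borel_measurable (lborel \<Otimes>\<^sub>M lborel)"
proof -
  have [measurable]: "(\<lambda>x. sol_p m z x $ i) \<in> borel_measurable borel" "(\<lambda>x. sol_m m z x $ i) \<in> borel_measurable borel" for i
    using sol_continuous[OF oc] by (auto intro: borel_measurable_continuous_onI)
  have e: "(\<lambda>p. green m z (fst p) (snd p) $ i $ j) \<in> borel_measurable (lborel \<Otimes>\<^sub>M lborel)" for i j
    unfolding green_nth by measurable
  have eq: "case_prod (green m z) = (\<lambda>p. mat2 (green m z (fst p) (snd p) $ 1 $ 1) (green m z (fst p) (snd p) $ 1 $ 2)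
      (green m z (fst p) (snd p) $ 2 $ 1) (green m z (fst p) (snd p) $ 2 $ 2))"
    by (auto simp: fun_eq_iff mat2_eq_iff)
  show ?thesis unfolding eq by (intro borel_measurable_mat2 e)
qed

lemma integral_FTC_piecewise:
  fixes F :: "real \<Rightarrow> complex"
  assumes d: "\<And>x. x \<noteq> 0 \<Longrightarrow> (F has_vector_derivative f x) (at x)" and c: "continuous_on UNIV F"
    and i: "integrable lborel f"
    and s: "\<And>x. N \<le> \<bar>x\<bar> \<Longrightarrow> F x = 0" "\<And>x. N \<le> \<bar>x\<bar> \<Longrightarrow> f x = 0" and N: "N > 0"
  shows "(LINT x|lborel. indicator {y..} x *\<^sub>R f x) = - F y"
    "(LINT x|lborel. indicator {..<y} x *\<^sub>R f x) = F y"
proof -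
  define M where "M = max N \<bar>y\<bar>"
  have M: "F M = 0" "F (-M) = 0" "-M \<le> y" "y \<le> M" "\<And>x. M < x \<Longrightarrow> f x = 0" "\<And>x. x < -M \<Longrightarrow> f x = 0"
    by (auto simp: M_def intro!: s)
  have ne: "AE x in lborel. x \<noteq> y" by (rule AE_lborel_singleton)
  have fm [measurable]: "f \<in> borel_measurable borel" using i by simp
  have FTC: "(LINT x|lborel. indicator {a..b} x *\<^sub>R f x) = F b - F a" if "a \<le> b" for a b
  proof -
    have "(f has_integral (F b - F a)) {a..b}"
      by (rule fundamental_theorem_of_calculus_interior_strong[of "{0}"])
        (use that d in \<open>auto intro: continuous_on_subset[OF c]\<close>)
    moreover have si: "set_integrable lborel {a..b} f"
      unfolding set_integrable_def by (rule integrable_mult_indicator[OF _ i]) simp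
    ultimately show ?thesis
      using set_borel_integral_eq_integral(2)[OF si] by (simp add: set_lebesgue_integral_def integral_unique)
  qed
  have "(LINT x|lborel. indicator {y..} x *\<^sub>R f x) = (LINT x|lborel. indicator {y..M} x *\<^sub>R f x)"
    by (intro Bochner_Integration.integral_cong) (auto simp: indicator_def M)
  then show "(LINT x|lborel. indicator {y..} x *\<^sub>R f x) = - F y"
    using FTC[of y M] M by simp
  have "(LINT x|lborel. indicator {..<y} x *\<^sub>R f x) = (LINT x|lborel. indicator {-M..y} x *\<^sub>R f x)"
    using ne by (intro integral_cong_AE) (auto elim!: eventually_mono simp: indicator_def M)
  then show "(LINT x|lborel. indicator {..<y} x *\<^sub>R f x) = F y"
    using FTC[of "-M" y] M by simp
qed

lemma integral_mat_nth:
  fixes f :: "'a \<Rightarrow> complex^2^2"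
  assumes "integrable M f"
  shows "integrable M (\<lambda>x. f x $ i $ j)" "(LINT x|M. f x $ i $ j) = (LINT x|M. f x) $ i $ j"
proof -
  have bl: "bounded_linear (\<lambda>A::complex^2^2. A $ i $ j)"
    using bounded_linear_compose[OF bounded_linear_vec_nth bounded_linear_vec_nth] .
  show "integrable M (\<lambda>x. f x $ i $ j)" "(LINT x|M. f x $ i $ j) = (LINT x|M. f x) $ i $ j"
    using integrable_bounded_linear[OF bl assms] integral_bounded_linear[OF bl assms] by auto
qed

lemma norm_vec2_le_sum: "norm v \<le> cmod (v$1) + cmod (v$2)" for v :: "complex^2"
proof -
  have "(norm v)\<^sup>2 \<le> (cmod (v$1) + cmod (v$2))\<^sup>2"
    unfolding norm_vec2_sq by (simp add: power2_eq_square algebra_simps)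
  then show ?thesis by (rule power2_le_imp_le) simp
qed

lemma bounded_linear_apply_vector: "bounded_linear (\<lambda>A::complex^2^2. A *v v)"
proof (rule bounded_linear_intro[of _ "norm v"])
  fix A B :: "complex^2^2" and r :: real
  show "(A + B) *v v = A *v v + B *v v" by (simp add: vec2_eq_iff mult_vec2_nth algebra_simps)
  show "(r *\<^sub>R A) *v v = r *\<^sub>R (A *v v)"
    by (simp add: vec2_eq_iff mult_vec2_nth scaleR_add_right)
  show "norm (A *v v) \<le> norm A * norm v" by (rule norm_matrix_vector_le)
qed

text \<open>The \<open>x\<close>-derivative of \<open>\<phi>(x) G(x, y)\<close> away from the diagonal.\<close>

definition tested :: "real \<Rightarrow> complex \<Rightarrow> (real \<Rightarrow> real) \<Rightarrow> real \<Rightarrow> real \<Rightarrow> complex^2^2" where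
  "tested m z \<phi> x y = deriv \<phi> x *\<^sub>R green m z x y + \<phi> x *\<^sub>R (slope m z x ** green m z x y)"

lemma slope_bounded: "norm (slope m z x) \<le> 2 * (\<bar>m\<bar> + cmod z + 1)"
proof -
  have "cmod (of_real m + (z - \<i> * of_real (sgn x))) \<le> \<bar>m\<bar> + cmod z + 1"
    "cmod (of_real m - (z - \<i> * of_real (sgn x))) \<le> \<bar>m\<bar> + cmod z + 1"
  proof -
    have "cmod (z - \<i> * of_real (sgn x)) \<le> cmod z + cmod (\<i> * of_real (sgn x))" by (rule norm_triangle_ineq4)
    also have "cmod (\<i> * of_real (sgn x)) \<le> 1" by (simp add: norm_mult sgn_real_def)
    finally have "cmod (z - \<i> * of_real (sgn x)) \<le> cmod z + 1" by simp
    then show "cmod (of_real m + (z - \<i> * of_real (sgn x))) \<le> \<bar>m\<bar> + cmod z + 1"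
      "cmod (of_real m - (z - \<i> * of_real (sgn x))) \<le> \<bar>m\<bar> + cmod z + 1"
      using norm_triangle_ineq[of "of_real m" "z - \<i> * of_real (sgn x)"]
        norm_triangle_ineq4[of "of_real m" "z - \<i> * of_real (sgn x)"] by auto
  qed
  then show ?thesis
    using norm_mat2_le_sum[of "slope m z x"] by (simp add: slope_def)
qed

lemma slope_measurable [measurable]: "slope m z \<in> borel_measurable borel"
  unfolding slope_def[abs_def] by (intro borel_measurable_mat2) measurable

lemma tested_measurable:
  assumes oc: "off_cuts m z" and \<phi>: "test_function \<phi>"
  shows "case_prod (tested m z \<phi>) \<in> borel_measurable (lborel \<Otimes>\<^sub>M lborel)"
proof -
  have [measurable]: "(\<lambda>p. green m z (fst p) (snd p)) \<in> borel_measurable (lborel \<Otimes>\<^sub>M lborel)"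
    using green_measurable[OF oc] by (simp add: case_prod_unfold)
  have [measurable]: "\<phi> \<in> borel_measurable borel" "deriv \<phi> \<in> borel_measurable borel"
    using test_function_derivative[OF \<phi>] by (auto intro: borel_measurable_continuous_onI)
  have "(\<lambda>p::real \<times> real. slope m z (fst p)) \<in> borel_measurable (lborel \<Otimes>\<^sub>M lborel)" by measurable
  then show ?thesis
    unfolding tested_def case_prod_unfold
    by (intro borel_measurable_add borel_measurable_scaleR borel_measurable_matrix_mult) measurable
qed

lemma tested_bound:
  assumes oc: "off_cuts m z" and \<phi>: "test_function \<phi>"
  obtains C c N where "C \<ge> 0" "c > 0" "N > 0" "\<And>x y. norm (tested m z \<phi> x y) \<le> C * indicator {-N..N} x * exp (- c * \<bar>y\<bar>)"
proof -
  obtain C c where C: "C > 0" "c > 0" "\<And>x y. norm (green m z x y) \<le> C * exp (- c * \<bar>x - y\<bar>)"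
    using green_exponential_bound[OF oc] by metis
  obtain B where B: "\<And>x. \<bar>\<phi> x\<bar> \<le> B" "\<And>x. \<bar>deriv \<phi> x\<bar> \<le> B" "B \<ge> 0"
    using test_function_bounded[OF \<phi>] by metis
  obtain N where N: "N > 0" "\<And>x. N \<le> \<bar>x\<bar> \<Longrightarrow> \<phi> x = 0" "\<And>x. N \<le> \<bar>x\<bar> \<Longrightarrow> deriv \<phi> x = 0"
    using test_function_support[OF \<phi>] by metis
  define S where "S = 2 * (\<bar>m\<bar> + cmod z + 1)"
  have S0: "0 \<le> S" by (simp add: S_def)
  define D where "D = (B + B * S) * (C * exp (c * N))"
  show thesis
  proof
    show "D \<ge> 0" using B S0 C by (simp add: D_def)
    fix x y
    show "norm (tested m z \<phi> x y) \<le> D * indicator {-N..N} x * exp (- c * \<bar>y\<bar>)"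
    proof (cases "N \<le> \<bar>x\<bar>")
      case True
      then show ?thesis using N \<open>D \<ge> 0\<close> by (simp add: tested_def)
    next
      case False
      have g: "norm (green m z x y) \<le> C * exp (c * N) * exp (- c * \<bar>y\<bar>)"
      proof -
        have "c * \<bar>y\<bar> \<le> c * (N + \<bar>x - y\<bar>)" using False C by (intro mult_left_mono) auto
        then have "- c * \<bar>x - y\<bar> \<le> c * N + - c * \<bar>y\<bar>" by (simp add: algebra_simps)
        then have "exp (- c * \<bar>x - y\<bar>) \<le> exp (c * N) * exp (- c * \<bar>y\<bar>)"
          unfolding exp_add[symmetric] by (simp only: exp_le_cancel_iff)
        then have "C * exp (- c * \<bar>x - y\<bar>) \<le> C * (exp (c * N) * exp (- c * \<bar>y\<bar>))"
          using C by (intro mult_left_mono) auto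
        with C(3)[of x y] show ?thesis by (simp only: mult.assoc)
      qed
      have "norm (tested m z \<phi> x y) \<le> \<bar>deriv \<phi> x\<bar> * norm (green m z x y) + \<bar>\<phi> x\<bar> * norm (slope m z x ** green m z x y)"
        unfolding tested_def by (rule order_trans[OF norm_triangle_ineq]) simp
      also have "\<dots> \<le> B * norm (green m z x y) + B * (S * norm (green m z x y))"
      proof (intro add_mono mult_mono B)
        show "norm (slope m z x ** green m z x y) \<le> S * norm (green m z x y)"
          unfolding S_def
          by (rule order_trans[OF norm_matrix_mult_le]) (intro mult_right_mono slope_bounded, simp)
      qed (use B in auto)
      also have "\<dots> = (B + B * S) * norm (green m z x y)" by (simp add: algebra_simps)
      also have "\<dots> \<le> (B + B * S) * (C * exp (c * N) * exp (- c * \<bar>y\<bar>))"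
        using B S0 by (intro mult_left_mono g) auto
      finally have "norm (tested m z \<phi> x y) \<le> D * exp (- c * \<bar>y\<bar>)" by (simp only: D_def mult.assoc)
      moreover have "x \<in> {-N..N}" using False by auto
      ultimately show ?thesis by (simp only: indicator_simps mult_1_right)
    qed
  qed (use C N in auto)
qed

text \<open>On both sides of \<open>y\<close> the integrand is an exact derivative. The boundary terms at \<open>y\<close> combine to
  the jump of the kernel on the diagonal, which the normalisation by the Wronskian fixes.\<close>

lemma integral_tested:
  assumes oc: "off_cuts m z" and m: "m > 0" and \<phi>: "test_function \<phi>"
  shows "integrable lborel (\<lambda>x. tested m z \<phi> x y)"
    "(LINT x|lborel. tested m z \<phi> x y) = mat2 0 (- of_real (\<phi> y)) (of_real (\<phi> y)) 0"
proof -
  obtain C c N where b: "C \<ge> 0" "c > 0" "N > 0"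
    "\<And>x y. norm (tested m z \<phi> x y) \<le> C * indicator {-N..N} x * exp (- c * \<bar>y\<bar>)"
    using tested_bound[OF oc \<phi>] by metis
  have [measurable]: "(\<lambda>x. tested m z \<phi> x y) \<in> borel_measurable lborel"
  proof -
    have [measurable]: "case_prod (tested m z \<phi>) \<in> borel_measurable (lborel \<Otimes>\<^sub>M lborel)"
      by (rule tested_measurable[OF oc \<phi>])
    have "(\<lambda>x. case_prod (tested m z \<phi>) (x, y)) \<in> borel_measurable lborel" by measurable
    then show ?thesis by simp
  qed
  show int: "integrable lborel (\<lambda>x. tested m z \<phi> x y)"
  proof (rule Bochner_Integration.integrable_bound)
    show "integrable lborel (\<lambda>x. (C * exp (- c * \<bar>y\<bar>)) * indicator {-N..N} x)"
      by (intro integrable_mult_right integrable_indicator_Icc)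
    show "AE x in lborel. norm (tested m z \<phi> x y) \<le> norm ((C * exp (- c * \<bar>y\<bar>)) * indicator {-N..N} x)"
      using b by (intro AE_I2) (simp add: mult_ac)
  qed measurable
  obtain N' where N: "N' > 0" "\<And>x. N' \<le> \<bar>x\<bar> \<Longrightarrow> \<phi> x = 0" "\<And>x. N' \<le> \<bar>x\<bar> \<Longrightarrow> deriv \<phi> x = 0"
    using test_function_support[OF \<phi>] by metis
  obtain B where B: "\<And>x. \<bar>\<phi> x\<bar> \<le> B" "\<And>x. \<bar>deriv \<phi> x\<bar> \<le> B" "B \<ge> 0"
    using test_function_bounded[OF \<phi>] by metis
  have [measurable]: "\<phi> \<in> borel_measurable borel" "deriv \<phi> \<in> borel_measurable borel"
    using test_function_derivative[OF \<phi>] by (auto intro: borel_measurable_continuous_onI)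
  have half: "(LINT x|lborel. indicator {y..} x *\<^sub>R (deriv \<phi> x *\<^sub>R s x $ i + \<phi> x *\<^sub>R (slope m z x *v s x) $ i)) = - (\<phi> y *\<^sub>R s y $ i)"
    "(LINT x|lborel. indicator {..<y} x *\<^sub>R (deriv \<phi> x *\<^sub>R s x $ i + \<phi> x *\<^sub>R (slope m z x *v s x) $ i)) = \<phi> y *\<^sub>R s y $ i"
    "integrable lborel (\<lambda>x. deriv \<phi> x *\<^sub>R s x $ i + \<phi> x *\<^sub>R (slope m z x *v s x) $ i)"
    if sc: "\<And>i. continuous_on UNIV (\<lambda>x. s x $ i)"
      and sd: "\<And>x i. x \<noteq> 0 \<Longrightarrow> ((\<lambda>x. s x $ i) has_vector_derivative (slope m z x *v s x) $ i) (at x)"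
    for s :: "real \<Rightarrow> complex^2" and i
  proof -
    let ?f = "\<lambda>x. deriv \<phi> x *\<^sub>R s x $ i + \<phi> x *\<^sub>R (slope m z x *v s x) $ i"
    have sm [measurable]: "(\<lambda>x. s x $ i) \<in> borel_measurable borel" for i
      using sc by (rule borel_measurable_continuous_onI)
    have se: "(slope m z x *v s x) $ i = slope m z x $ i $ 1 * s x $ 1 + slope m z x $ i $ 2 * s x $ 2" for x
      by (rule mult_vec2_nth)
    have [measurable]: "(\<lambda>x. slope m z x $ i $ j) \<in> borel_measurable borel" for j
      by (intro borel_measurable_entries slope_measurable)
    have fmeas: "?f \<in> borel_measurable borel" unfolding se by measurable
    have scn: "continuous_on UNIV (\<lambda>x. cmod (s x $ 1) + cmod (s x $ 2))"
      by (intro continuous_intros sc)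
    have "\<exists>K. \<forall>x. \<bar>x\<bar> \<le> N' \<longrightarrow> cmod (s x $ 1) + cmod (s x $ 2) \<le> K"
    proof -
      have "compact ((\<lambda>x. cmod (s x $ 1) + cmod (s x $ 2)) ` {-N'..N'})"
        by (intro compact_continuous_image continuous_on_subset[OF scn]) auto
      then have "bounded ((\<lambda>x. cmod (s x $ 1) + cmod (s x $ 2)) ` {-N'..N'})" by (rule compact_imp_bounded)
      then obtain K where K: "\<forall>v\<in>(\<lambda>x. cmod (s x $ 1) + cmod (s x $ 2)) ` {-N'..N'}. norm v \<le> K"
        unfolding bounded_iff by blast
      have "cmod (s x $ 1) + cmod (s x $ 2) \<le> K" if "\<bar>x\<bar> \<le> N'" for x
      proof -
        have "x \<in> {-N'..N'}" using that by auto
        then have "norm (cmod (s x $ 1) + cmod (s x $ 2)) \<le> K" using K by blast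
        then show ?thesis by simp
      qed
      then show ?thesis by blast
    qed
    then obtain K where K: "\<And>x. \<bar>x\<bar> \<le> N' \<Longrightarrow> cmod (s x $ 1) + cmod (s x $ 2) \<le> K" by blast
    define L where "L = B * K + B * (2 * (\<bar>m\<bar> + cmod z + 1) * K)"
    show i: "integrable lborel ?f"
    proof (rule Bochner_Integration.integrable_bound)
      show "integrable lborel (\<lambda>x. L * indicator {-N'..N'} x)"
        by (intro integrable_mult_right integrable_indicator_Icc)
      show "AE x in lborel. norm (?f x) \<le> norm (L * indicator {-N'..N'} x)"
      proof (rule AE_I2)
        fix x
        show "norm (?f x) \<le> norm (L * indicator {-N'..N'} x)"
        proof (cases "N' \<le> \<bar>x\<bar>")
          case False
          then have Kx: "cmod (s x $ 1) + cmod (s x $ 2) \<le> K" using K by simp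
          have "norm (s x) \<le> K"
            using norm_vec2_le_sum Kx by (rule order_trans)
          have si: "cmod (s x $ i) \<le> K" using Finite_Cartesian_Product.norm_nth_le[of "s x" i] \<open>norm (s x) \<le> K\<close> by simp
          have ss: "cmod ((slope m z x *v s x) $ i) \<le> 2 * (\<bar>m\<bar> + cmod z + 1) * K"
          proof -
            have "cmod ((slope m z x *v s x) $ i) \<le> norm (slope m z x) * norm (s x)"
              by (rule order_trans[OF Finite_Cartesian_Product.norm_nth_le norm_matrix_vector_le])
            also have "\<dots> \<le> 2 * (\<bar>m\<bar> + cmod z + 1) * K"
              using \<open>norm (s x) \<le> K\<close> by (intro mult_mono slope_bounded) auto
            finally show ?thesis .
          qed
          have "norm (?f x) \<le> \<bar>deriv \<phi> x\<bar> * cmod (s x $ i) + \<bar>\<phi> x\<bar> * cmod ((slope m z x *v s x) $ i)"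
            by (rule order_trans[OF norm_triangle_ineq]) simp
          also have "\<dots> \<le> L" unfolding L_def using B si ss by (intro add_mono mult_mono) auto
          finally have "norm (?f x) \<le> L" .
          moreover have "x \<in> {-N'..N'}" using False by auto
          ultimately show ?thesis by (simp only: indicator_simps mult_1_right real_norm_def)
        qed (use N in simp)
      qed
    qed (use fmeas in simp)
    have d: "((\<lambda>x. \<phi> x *\<^sub>R s x $ i) has_vector_derivative ?f x) (at x)" if "x \<noteq> 0" for x
      using has_vector_derivative_scaleR[OF test_function_derivative(1)[OF \<phi>, of x] sd[OF that, of i]]
      by (simp add: add.commute)
    have cc: "continuous_on UNIV (\<lambda>x. \<phi> x *\<^sub>R s x $ i)"
      by (intro continuous_intros sc test_function_derivative(2)[OF \<phi>])
    show "(LINT x|lborel. indicator {y..} x *\<^sub>R ?f x) = - (\<phi> y *\<^sub>R s y $ i)"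
      "(LINT x|lborel. indicator {..<y} x *\<^sub>R ?f x) = \<phi> y *\<^sub>R s y $ i"
      by (rule integral_FTC_piecewise[OF d cc i]; use N in simp)+
  qed
  note hp = half[of "sol_p m z", OF sol_continuous(1)[OF oc] sol_derivative(1)[OF oc]]
  note hm = half[of "sol_m m z", OF sol_continuous(2)[OF oc] sol_derivative(2)[OF oc]]
  have ent: "(LINT x|lborel. tested m z \<phi> x y $ i $ j)
    = g11 m z * (of_real (\<phi> y) * (sol_m m z y $ i * sol_p m z y $ j - sol_p m z y $ i * sol_m m z y $ j))" for i j
  proof -
    let ?fp = "\<lambda>x. deriv \<phi> x *\<^sub>R sol_p m z x $ i + \<phi> x *\<^sub>R (slope m z x *v sol_p m z x) $ i"
    let ?fm = "\<lambda>x. deriv \<phi> x *\<^sub>R sol_m m z x $ i + \<phi> x *\<^sub>R (slope m z x *v sol_m m z x) $ i"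
    have eq: "tested m z \<phi> x y $ i $ j = (g11 m z * sol_m m z y $ j) * (indicator {y..} x *\<^sub>R ?fp x)
        + (g11 m z * sol_p m z y $ j) * (indicator {..<y} x *\<^sub>R ?fm x)" for x
    proof (cases "y \<le> x")
      case True
      then show ?thesis
        by (simp add: tested_def mult2_nth green_nth mult_vec2_nth scaleR_conv_of_real[where 'a=complex] algebra_simps)
    next
      case False
      then show ?thesis
        by (simp add: tested_def mult2_nth green_nth mult_vec2_nth scaleR_conv_of_real[where 'a=complex] algebra_simps)
    qed
    have ip: "integrable lborel (\<lambda>x. indicator {y..} x *\<^sub>R ?fp x)" "integrable lborel (\<lambda>x. indicator {..<y} x *\<^sub>R ?fm x)"
      by (intro integrable_mult_indicator hp(3) hm(3); simp)+
    have "(LINT x|lborel. tested m z \<phi> x y $ i $ j) = (g11 m z * sol_m m z y $ j) * (- (\<phi> y *\<^sub>R sol_p m z y $ i))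
        + (g11 m z * sol_p m z y $ j) * (\<phi> y *\<^sub>R sol_m m z y $ i)"
    proof -
      have h: "(LINT x|lborel. indicator {y..} x *\<^sub>R ?fp x) = - (\<phi> y *\<^sub>R sol_p m z y $ i)"
        "(LINT x|lborel. indicator {..<y} x *\<^sub>R ?fm x) = \<phi> y *\<^sub>R sol_m m z y $ i"
        using hp(1)[of i] hm(2)[of i] by blast+
      show ?thesis
        unfolding eq h[symmetric] using ip
        by (simp only: Bochner_Integration.integral_add integrable_mult_right integral_mult_right_zero)
    qed
    then show ?thesis by (simp add: scaleR_conv_of_real[where 'a=complex] algebra_simps)
  qed
  have w: "g11 m z * (sol_p m z y $ 1 * sol_m m z y $ 2 - sol_p m z y $ 2 * sol_m m z y $ 1) = 1"
    unfolding sol_wronskian[OF oc] by (rule coefficients(1)[OF oc m])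
  have e11: "(LINT x|lborel. tested m z \<phi> x y) $ 1 $ 1 = 0" "(LINT x|lborel. tested m z \<phi> x y) $ 2 $ 2 = 0"
    unfolding integral_mat_nth(2)[OF int, symmetric] ent by (simp_all add: mult.commute)
  have e12: "(LINT x|lborel. tested m z \<phi> x y) $ 1 $ 2 = - of_real (\<phi> y)"
  proof -
    have "(LINT x|lborel. tested m z \<phi> x y) $ 1 $ 2 = - of_real (\<phi> y) *
      (g11 m z * (sol_p m z y $ 1 * sol_m m z y $ 2 - sol_p m z y $ 2 * sol_m m z y $ 1))"
      unfolding integral_mat_nth(2)[OF int, symmetric] ent by (simp add: algebra_simps)
    then show ?thesis unfolding w by simp
  qed
  have e21: "(LINT x|lborel. tested m z \<phi> x y) $ 2 $ 1 = of_real (\<phi> y)"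
  proof -
    have "(LINT x|lborel. tested m z \<phi> x y) $ 2 $ 1 = of_real (\<phi> y) *
      (g11 m z * (sol_p m z y $ 1 * sol_m m z y $ 2 - sol_p m z y $ 2 * sol_m m z y $ 1))"
      unfolding integral_mat_nth(2)[OF int, symmetric] ent by (simp add: algebra_simps)
    then show ?thesis unfolding w by simp
  qed
  show "(LINT x|lborel. tested m z \<phi> x y) = mat2 0 (- of_real (\<phi> y)) (of_real (\<phi> y)) 0"
    unfolding mat2_eq_iff mat2_nth using e11 e12 e21 by simp
qed

lemma kernel_bounded_green:
  assumes oc: "off_cuts m z"
  shows "\<exists>D. kernel_bounded (green m z) D"
proof -
  obtain C0 c0 where C0: "C0 > 0" "c0 > 0" "\<And>x y. norm (green m z x y) \<le> C0 * exp (- c0 * \<bar>x - y\<bar>)"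
    using green_exponential_bound[OF oc] by metis
  show ?thesis
    by (rule kernel_bounded_exponential(1)[OF green_measurable[OF oc] C0(2) _ C0(3), of "\<lambda>_. 0" "\<lambda>_. 0"])
      (use C0 in auto)
qed

text \<open>Fubini, followed by the evaluation of the inner integral over \<open>x\<close>.\<close>

lemma green_weak_equation:
  fixes f :: l2
  assumes oc: "off_cuts m z" and m: "m > 0" and \<phi>: "test_function \<phi>"
    and u_def: "u = (\<lambda>x. LINT y|lborel. green m z x y *v rep_l2 f y)"
  shows "(LINT x|lborel. deriv \<phi> x *\<^sub>R u x + \<phi> x *\<^sub>R (slope m z x *v u x))
    = (LINT y|lborel. \<phi> y *\<^sub>R vec2 (- rep_l2 f y $ 2) (rep_l2 f y $ 1))"
proof -
  have gint: "integrable lborel (\<lambda>y. green m z x y *v rep_l2 f y)" for x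
    using kernel_bounded_green[OF oc] by (auto simp: kernel_bounded_def)
  obtain C c N where b: "C \<ge> 0" "c > 0" "N > 0"
    "\<And>x y. norm (tested m z \<phi> x y) \<le> C * indicator {-N..N} x * exp (- c * \<bar>y\<bar>)"
    using tested_bound[OF oc \<phi>] by metis
  define H where "H = (\<lambda>x y. tested m z \<phi> x y *v rep_l2 f y)"
  have tm [measurable]: "(\<lambda>p. tested m z \<phi> (fst p) (snd p)) \<in> borel_measurable (lborel \<Otimes>\<^sub>M lborel)"
    using tested_measurable[OF oc \<phi>] by (simp add: case_prod_unfold)
  have Hint: "integrable (lborel \<Otimes>\<^sub>M lborel) (case_prod H)"
  proof (rule integrable_product_bound)
    show "case_prod H \<in> borel_measurable (lborel \<Otimes>\<^sub>M lborel)"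
      unfolding H_def case_prod_unfold
    proof (rule borel_measurable_matrix_vector)
      show "(\<lambda>p. tested m z \<phi> (fst p) (snd p)) \<in> borel_measurable (lborel \<Otimes>\<^sub>M lborel)" by (rule tm)
      show "(\<lambda>p::real \<times> real. rep_l2 f (snd p)) \<in> borel_measurable (lborel \<Otimes>\<^sub>M lborel)" by measurable
    qed
    show "integrable lborel (\<lambda>x. C * indicator {-N..N} x)"
      by (intro integrable_mult_right integrable_indicator_Icc)
    show "integrable lborel (\<lambda>y. exp (- c * \<bar>y\<bar>) * norm (rep_l2 f y))"
    proof (rule integrableI_bounded)
      have sq: "(exp (- c * \<bar>y\<bar>))\<^sup>2 = exp (- (2 * c) * \<bar>0 - y\<bar>)" for y
        by (simp add: exp_double[symmetric])
      have "integrable lborel (\<lambda>y. (exp (- c * \<bar>y\<bar>))\<^sup>2)"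
        unfolding sq using nn_integral_exp_abs(1)[of "2 * c" 0] b
        by (intro integrableI_bounded) (auto intro: le_less_trans)
      then have "(\<integral>\<^sup>+y. ennreal (exp (- c * \<bar>y\<bar>) * norm (rep_l2 f y)) \<partial>lborel)
          \<le> ennreal (sqrt (LINT y|lborel. (exp (- c * \<bar>y\<bar>))\<^sup>2) * norm f)"
        by (intro nn_integral_rep_product) auto
      then show "(\<integral>\<^sup>+y. ennreal (norm (exp (- c * \<bar>y\<bar>) * norm (rep_l2 f y))) \<partial>lborel) < \<infinity>"
        by (auto intro: le_less_trans)
    qed measurable
    show "norm (H x y) \<le> C * indicator {-N..N} x * (exp (- c * \<bar>y\<bar>) * norm (rep_l2 f y))" for x y
      using order_trans[OF norm_matrix_vector_le mult_right_mono[OF b(4) norm_ge_zero], of x y "rep_l2 f y"]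
      by (simp add: H_def mult.assoc)
  qed
  have Hx: "(LINT y|lborel. H x y) = deriv \<phi> x *\<^sub>R u x + \<phi> x *\<^sub>R (slope m z x *v u x)" for x
  proof -
    have "H x y = deriv \<phi> x *\<^sub>R (green m z x y *v rep_l2 f y) + \<phi> x *\<^sub>R (slope m z x *v (green m z x y *v rep_l2 f y))" for y
      unfolding H_def tested_def
      by (simp add: vec2_eq_iff mult_vec2_nth mult2_nth scaleR_conv_of_real[where 'a=complex] algebra_simps)
    then show ?thesis
      unfolding u_def
      using gint[of x] integrable_bounded_linear[OF bounded_linear_matrix_vector gint, of "slope m z x" x]
        integral_bounded_linear[OF bounded_linear_matrix_vector gint, of "slope m z x" x]
      by simp
  qed
  have Hy: "(LINT x|lborel. H x y) = \<phi> y *\<^sub>R vec2 (- rep_l2 f y $ 2) (rep_l2 f y $ 1)" for y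
  proof -
    have "(LINT x|lborel. H x y) = mat2 0 (- of_real (\<phi> y)) (of_real (\<phi> y)) 0 *v rep_l2 f y"
      unfolding H_def integral_tested(2)[OF oc m \<phi>, symmetric]
      by (rule integral_bounded_linear[OF bounded_linear_apply_vector integral_tested(1)[OF oc m \<phi>]])
    then show ?thesis
      by (simp add: vec2_eq_iff mult_vec2_nth scaleR_conv_of_real[where 'a=complex])
  qed
  have "(LINT x|lborel. LINT y|lborel. H x y) = (LINT y|lborel. LINT x|lborel. H x y)"
    using lborel_pair.Fubini_integral[OF Hint] by simp
  then show ?thesis unfolding Hx Hy .
qed

definition Rop :: "real \<Rightarrow> complex \<Rightarrow> l2 \<Rightarrow> l2" where "Rop m z = kernel_op (green m z)"

text \<open>The shift by \<open>z\<close> on the right cancels; it is inserted so that both the resolvent equation and,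
  for \<open>z = 0\<close>, linearity can be read off.\<close>

lemma L_op_iff: "(u, g) \<in> L_op m \<longleftrightarrow> (\<exists>u'. weak_deriv u u' \<and>
    (AE x in lborel. rep_l2 u' x = slope m z x *v rep_l2 u x
        + vec2 (rep_l2 (g - z *\<^sub>C u) x $ 2) (- rep_l2 (g - z *\<^sub>C u) x $ 1)))"
proof -
  have "(AE x in lborel. rep_l2 g x =
        vector [of_real m * rep_l2 u x $ 1 - rep_l2 u' x $ 2, rep_l2 u' x $ 1 - of_real m * rep_l2 u x $ 2]
        + (\<i> * of_real (sgn x)) *s rep_l2 u x)
    \<longleftrightarrow> (AE x in lborel. rep_l2 u' x = slope m z x *v rep_l2 u x
        + vec2 (rep_l2 (g - z *\<^sub>C u) x $ 2) (- rep_l2 (g - z *\<^sub>C u) x $ 1))" for u'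
  proof -
    have "AE x in lborel. rep_l2 (g - z *\<^sub>C u) x = rep_l2 g x - z *s rep_l2 u x"
      using rep_diff[of g "z *\<^sub>C u"] rep_scaleC[of z u] by eventually_elim simp
    then have "AE x in lborel. (rep_l2 g x =
        vector [of_real m * rep_l2 u x $ 1 - rep_l2 u' x $ 2, rep_l2 u' x $ 1 - of_real m * rep_l2 u x $ 2]
        + (\<i> * of_real (sgn x)) *s rep_l2 u x)
      \<longleftrightarrow> rep_l2 u' x = slope m z x *v rep_l2 u x
        + vec2 (rep_l2 (g - z *\<^sub>C u) x $ 2) (- rep_l2 (g - z *\<^sub>C u) x $ 1)"
    proof eventually_elim
      case (elim x)
      have c: "G1 = m' * U1 - D2 + s * U1 \<and> G2 = D1 - m' * U2 + s * U2 \<longleftrightarrow>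
          D1 = (m' + (z - s)) * U2 + (G2 - z * U2) \<and> D2 = (m' - (z - s)) * U1 + (z * U1 - G1)"
        for G1 G2 U1 U2 D1 D2 m' s :: complex
        by (auto simp: algebra_simps)
      show ?case
        unfolding elim vec2_eq_iff
        using c[where ?G1.0 = "rep_l2 g x $ 1" and ?G2.0 = "rep_l2 g x $ 2" and ?U1.0 = "rep_l2 u x $ 1"
            and ?U2.0 = "rep_l2 u x $ 2" and ?D1.0 = "rep_l2 u' x $ 1" and ?D2.0 = "rep_l2 u' x $ 2"
            and m' = "of_real m" and s = "\<i> * of_real (sgn x)"]
        by (simp add: slope_def mult_vec2_nth)
    qed
    then show ?thesis
      by (rule eventually_cong) simp
  qed
  then show ?thesis unfolding L_op_def by auto
qed

lemma Rop_solves: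
  assumes oc: "off_cuts m z" and m: "m > 0"
  shows "(Rop m z f, z *\<^sub>C Rop m z f + f) \<in> L_op m"
proof -
  obtain D where D: "kernel_bounded (green m z) D" using kernel_bounded_green[OF oc] by blast
  define u where "u = (\<lambda>x. LINT y|lborel. green m z x y *v rep_l2 f y)"
  have usi: "square_integrable u" unfolding u_def by (rule kernel_op_rep(1)[OF D])
  have urep: "AE x in lborel. rep_l2 (Rop m z f) x = u x"
    unfolding u_def Rop_def by (rule kernel_op_rep(2)[OF D])
  have [measurable]: "u \<in> borel_measurable borel" using usi by (simp add: square_integrable_def)
  have [measurable]: "(\<lambda>x. rep_l2 f x $ i) \<in> borel_measurable borel" for i
    by (intro borel_measurable_vec_nth) simp
  define Jf where "Jf = (\<lambda>x. vec2 (rep_l2 f x $ 2) (- rep_l2 f x $ 1))"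
  have nJ: "norm (Jf x) = norm (rep_l2 f x)" for x
    by (rule power2_eq_imp_eq) (simp_all add: Jf_def norm_vec2_sq)
  have Jsi: "square_integrable Jf"
    using square_integrable_rep[of f] by (simp add: square_integrable_def nJ) (simp add: Jf_def)
  define v where "v = (\<lambda>x. slope m z x *v u x)"
  have vsi: "square_integrable v"
  proof -
    define S where "S = 2 * (\<bar>m\<bar> + cmod z + 1)"
    have vm: "v \<in> borel_measurable borel"
      unfolding v_def by (intro borel_measurable_matrix_vector slope_measurable) measurable
    have "integrable lborel (\<lambda>x. (norm (v x))\<^sup>2)"
    proof (rule Bochner_Integration.integrable_bound)
      show "integrable lborel (\<lambda>x. S\<^sup>2 * (norm (u x))\<^sup>2)" using usi by (simp add: square_integrable_def)
      have "norm (v x) \<le> S * norm (u x)" for x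
        unfolding v_def S_def by (rule order_trans[OF norm_matrix_vector_le]) (intro mult_right_mono slope_bounded, simp)
      then show "AE x in lborel. norm ((norm (v x))\<^sup>2) \<le> norm (S\<^sup>2 * (norm (u x))\<^sup>2)"
        by (intro AE_I2) (simp add: power_mult_distrib[symmetric] power_mono)
    qed (use vm in measurable)
    with vm show ?thesis by (simp add: square_integrable_def)
  qed
  define u' where "u' = abs_l2 (\<lambda>x. v x + Jf x)"
  have u'rep: "AE x in lborel. rep_l2 u' x = v x + Jf x"
    unfolding u'_def by (rule rep_abs_l2[OF square_integrable_add[OF vsi Jsi]])
  have "weak_deriv (Rop m z f) u'"
    unfolding weak_deriv_def
  proof (intro allI impI)
    fix \<phi> assume \<phi>: "test_function \<phi>"
    obtain B where B: "\<And>x. \<bar>\<phi> x\<bar> \<le> B" "\<And>x. \<bar>deriv \<phi> x\<bar> \<le> B" "B \<ge> 0" using test_function_bounded[OF \<phi>] by metis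
    obtain N where N: "\<And>x. N \<le> \<bar>x\<bar> \<Longrightarrow> \<phi> x = 0" "\<And>x. N \<le> \<bar>x\<bar> \<Longrightarrow> deriv \<phi> x = 0" using test_function_support[OF \<phi>] by metis
    have [measurable]: "\<phi> \<in> borel_measurable borel" "deriv \<phi> \<in> borel_measurable borel"
      using test_function_derivative[OF \<phi>] by (auto intro: borel_measurable_continuous_onI)
    have ibm: "integrable lborel (\<lambda>x. \<theta> x *\<^sub>R w x)" if "square_integrable w" "\<theta> \<in> borel_measurable lborel"
      "\<And>x. \<bar>\<theta> x\<bar> \<le> B" "\<And>x. N \<le> \<bar>x\<bar> \<Longrightarrow> \<theta> x = 0" for \<theta> w
      by (rule integrable_bounded_mult[OF locally_integrable_l2[OF that(1)] that(2-4)])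
    have ints: "integrable lborel (\<lambda>x. deriv \<phi> x *\<^sub>R u x)" "integrable lborel (\<lambda>x. \<phi> x *\<^sub>R v x)" "integrable lborel (\<lambda>x. \<phi> x *\<^sub>R Jf x)"
      by (rule ibm; (fact usi vsi Jsi | use B N in simp))+
    have [measurable]: "v \<in> borel_measurable borel" "Jf \<in> borel_measurable borel"
      using vsi Jsi by (auto simp: square_integrable_def)
    have "(LINT x|lborel. deriv \<phi> x *\<^sub>R rep_l2 (Rop m z f) x) = (LINT x|lborel. deriv \<phi> x *\<^sub>R u x)"
      using urep by (intro integral_cong_AE) (auto elim: eventually_mono)
    moreover have "(LINT x|lborel. \<phi> x *\<^sub>R rep_l2 u' x) = (LINT x|lborel. \<phi> x *\<^sub>R v x + \<phi> x *\<^sub>R Jf x)"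
      using u'rep by (intro integral_cong_AE) (auto elim: eventually_mono simp: scaleR_add_right)
    moreover have "(LINT x|lborel. deriv \<phi> x *\<^sub>R u x + \<phi> x *\<^sub>R v x) = (LINT y|lborel. \<phi> y *\<^sub>R vec2 (- rep_l2 f y $ 2) (rep_l2 f y $ 1))"
      unfolding v_def by (rule green_weak_equation[OF oc m \<phi> u_def])
    moreover have "\<phi> y *\<^sub>R vec2 (- rep_l2 f y $ 2) (rep_l2 f y $ 1) = - (\<phi> y *\<^sub>R Jf y)" for y
      by (simp add: vec2_eq_iff Jf_def)
    ultimately have "(LINT x|lborel. deriv \<phi> x *\<^sub>R rep_l2 (Rop m z f) x) = (LINT x|lborel. deriv \<phi> x *\<^sub>R u x)"
      "(LINT x|lborel. \<phi> x *\<^sub>R rep_l2 u' x) = (LINT x|lborel. \<phi> x *\<^sub>R v x) + (LINT x|lborel. \<phi> x *\<^sub>R Jf x)"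
      "(LINT x|lborel. deriv \<phi> x *\<^sub>R u x) + (LINT x|lborel. \<phi> x *\<^sub>R v x) = - (LINT x|lborel. \<phi> x *\<^sub>R Jf x)"
      using ints by (simp_all only: Bochner_Integration.integral_add Bochner_Integration.integral_minus)
    then show "(LINT x|lborel. deriv \<phi> x *\<^sub>R rep_l2 (Rop m z f) x) = - (LINT x|lborel. \<phi> x *\<^sub>R rep_l2 u' x)"
      unfolding eq_neg_iff_add_eq_0 by (simp only: add.assoc)
  qed
  moreover have "AE x in lborel. rep_l2 u' x = slope m z x *v rep_l2 (Rop m z f) x
        + vec2 (rep_l2 ((z *\<^sub>C Rop m z f + f) - z *\<^sub>C Rop m z f) x $ 2) (- rep_l2 ((z *\<^sub>C Rop m z f + f) - z *\<^sub>C Rop m z f) x $ 1)"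
    using urep u'rep by eventually_elim (simp add: v_def Jf_def)
  ultimately show ?thesis unfolding L_op_iff[of _ _ _ z] by blast
qed

text \<open>For \<open>l = \<plusminus> \<mu>\<close> the function \<open>e\<^sup>-\<^sup>l\<^sup>x (a v\<^sub>2 + l v\<^sub>1)\<close> is constant along solutions. If the constant for
  \<open>l = \<mu>\<close> were nonzero, \<open>\<bar>v\<bar>\<close> would stay away from \<open>0\<close> and not be square integrable.\<close>

lemma half_line_solution:
  fixes v :: "real \<Rightarrow> complex^2"
  assumes mu: "0 < Re \<mu>" "\<mu> * \<mu> = a * b" and c: "continuous_on {0..} v"
    and d: "\<And>x y. 0 \<le> x \<Longrightarrow> x \<le> y \<Longrightarrow> v y - v x = (LINT t|lborel. indicator {x..y} t *\<^sub>R vec2 (a * v t $ 2) (b * v t $ 1))"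
    and si: "integrable lborel (\<lambda>x. indicator {0..} x *\<^sub>R (norm (v x))\<^sup>2)"
  shows "a * v 0 $ 2 = - \<mu> * v 0 $ 1" "v 0 = 0 \<Longrightarrow> 0 \<le> x \<Longrightarrow> v x = 0"
proof -
  have a0: "a \<noteq> 0" "\<mu> \<noteq> 0" using mu by auto
  have cn: "continuous_on {0..} (\<lambda>x. v x $ i)" for i by (intro continuous_intros c)
  have cG: "continuous_on {0..} (\<lambda>t. vec2 (a * v t $ 2) (b * v t $ 1))"
    by (intro continuous_intros cn)
  have der: "(v has_vector_derivative vec2 (a * v x $ 2) (b * v x $ 1)) (at x within {0..M})" if "x \<in> {0..M}" for x M
  proof -
    let ?G = "\<lambda>t. vec2 (a * v t $ 2) (b * v t $ 1)"
    have cM: "continuous_on {0..M} ?G" by (rule continuous_on_subset[OF cG]) auto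
    have "((\<lambda>u. integral {0..u} ?G) has_vector_derivative ?G x) (at x within {0..M})"
      by (rule integral_has_vector_derivative[OF cM that])
    then have "((\<lambda>u. v 0 + integral {0..u} ?G) has_vector_derivative ?G x) (at x within {0..M})"
      by (auto intro!: derivative_eq_intros)
    then show ?thesis
    proof (rule has_vector_derivative_transform[OF that, rotated])
      fix u assume u: "u \<in> {0..M}"
      have "set_integrable lborel {0..u} ?G"
        by (rule borel_integrable_atLeastAtMost'[OF continuous_on_subset[OF cM]]) (use u in auto)
      then show "v u = v 0 + integral {0..u} ?G"
        using d[of 0 u] u set_borel_integral_eq_integral(2)[of "{0..u}" ?G]
        by (simp add: set_lebesgue_integral_def algebra_simps)
    qed
  qed
  have dn: "((\<lambda>x. v x $ 1) has_vector_derivative a * v x $ 2) (at x within {0..M})"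
    "((\<lambda>x. v x $ 2) has_vector_derivative b * v x $ 1) (at x within {0..M})" if "x \<in> {0..M}" for x M
    using bounded_linear.has_vector_derivative[OF bounded_linear_vec_nth der[OF that], of 1]
      bounded_linear.has_vector_derivative[OF bounded_linear_vec_nth der[OF that], of 2] by auto
  have const: "exp (- l * of_real x) * (a * v x $ 2 + l * v x $ 1) = a * v 0 $ 2 + l * v 0 $ 1"
    if l: "l * l = a * b" and x: "0 \<le> x" for l x
  proof -
    have "((\<lambda>x. exp (- l * of_real x) * (a * v x $ 2 + l * v x $ 1)) has_vector_derivative 0) (at y within {0..x})"
      if y: "y \<in> {0..x}" for y
    proof -
      have e: "((\<lambda>x. exp (- l * of_real x)) has_vector_derivative (- l * exp (- l * of_real y))) (at y within {0..x})"
        by (rule has_vector_derivative_real_field) (auto intro!: derivative_eq_intros)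
      have f: "((\<lambda>x. a * v x $ 2 + l * v x $ 1) has_vector_derivative a * (b * v y $ 1) + l * (a * v y $ 2)) (at y within {0..x})"
        by (intro has_vector_derivative_add has_vector_derivative_mult_right dn y)
      have eq: "a * (b * v y $ 1) + l * (a * v y $ 2) = l * (a * v y $ 2 + l * v y $ 1)"
        using l by (simp add: algebra_simps flip: mult.assoc)
      have z: "E * (l * Y) + - l * E * Y = 0" for E Y by simp
      show ?thesis
        using has_vector_derivative_mult[OF e f[unfolded eq]] unfolding z .
    qed
    then obtain k where k: "\<And>y. y \<in> {0..x} \<Longrightarrow> exp (- l * of_real y) * (a * v y $ 2 + l * v y $ 1) = k"
      using has_vector_derivative_zero_constant[OF convex_real_interval(5),
        of 0 x "\<lambda>x. exp (- l * of_real x) * (a * v x $ 2 + l * v x $ 1)"] by blast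
    from k[of x] k[of 0] x show ?thesis by simp
  qed
  define k where "k = a * v 0 $ 2 + \<mu> * v 0 $ 1"
  have "k = 0"
  proof (rule ccontr)
    assume "k \<noteq> 0"
    define K where "K = cmod a + cmod \<mu>"
    have K0: "K > 0" using a0 by (simp add: K_def add_pos_pos)
    have low: "(cmod k / K)\<^sup>2 \<le> (norm (v x))\<^sup>2" if x: "0 \<le> x" for x
    proof -
      have "cmod k = exp (- (Re \<mu> * x)) * cmod (a * v x $ 2 + \<mu> * v x $ 1)"
        unfolding k_def const[OF mu(2) x, symmetric] by (simp add: norm_mult norm_exp_eq_Re)
      also have "\<dots> \<le> 1 * cmod (a * v x $ 2 + \<mu> * v x $ 1)"
        using mu x by (intro mult_right_mono) auto
      also have "\<dots> \<le> cmod a * norm (v x) + cmod \<mu> * norm (v x)"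
        unfolding mult_1_left
        by (rule order_trans[OF norm_triangle_ineq]) (simp add: norm_mult add_mono mult_left_mono Finite_Cartesian_Product.norm_nth_le)
      finally have "cmod k / K \<le> norm (v x)" using K0 by (simp add: K_def field_simps)
      then show ?thesis using K0 by (intro power_mono) auto
    qed
    define I where "I = (LINT x|lborel. indicator {0..} x *\<^sub>R (norm (v x))\<^sup>2)"
    have "real n * (cmod k / K)\<^sup>2 \<le> I" for n :: nat
    proof -
      have "real n * (cmod k / K)\<^sup>2 = (LINT x|lborel. indicator {0..real n} x * (cmod k / K)\<^sup>2)"
        by simp
      also have "\<dots> \<le> I"
        unfolding I_def
      proof (rule integral_mono[OF _ si])
        show "integrable lborel (\<lambda>x. indicator {0..real n} x * (cmod k / K)\<^sup>2)"
          by (intro integrable_mult_left integrable_indicator_Icc)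
        show "indicator {0..real n} x * (cmod k / K)\<^sup>2 \<le> indicator {0..} x *\<^sub>R (norm (v x))\<^sup>2" for x
          using low[of x] by (auto simp: indicator_def)
      qed
      finally show ?thesis .
    qed
    moreover have "0 < (cmod k / K)\<^sup>2" using \<open>k \<noteq> 0\<close> K0 by simp
    ultimately show False
      using reals_Archimedean3[of "(cmod k / K)\<^sup>2"] by (metis not_less)
  qed
  then show h: "a * v 0 $ 2 = - \<mu> * v 0 $ 1" by (simp add: k_def eq_neg_iff_add_eq_0)
  assume v0: "v 0 = 0" and x: "0 \<le> x"
  have "a * v x $ 2 + \<mu> * v x $ 1 = 0" "a * v x $ 2 + (- \<mu>) * v x $ 1 = 0"
    using const[OF mu(2) x] const[of "- \<mu>", OF _ x] mu(2) v0 by simp_all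
  then have "2 * (a * v x $ 2) = 0" "2 * (\<mu> * v x $ 1) = 0" by algebra+
  then show "v x = 0" using a0 by (simp add: vec2_eq_iff)
qed

text \<open>An eigenfunction decays on both half lines, so its value at \<open>0\<close> is proportional to both \<open>(1, p)\<close>
  and \<open>(1, q)\<close>. These are independent because the Wronskian does not vanish.\<close>

lemma L_op_injective:
  assumes oc: "off_cuts m z" and m: "m > 0" and u: "(u, z *\<^sub>C u) \<in> L_op m"
  shows "u = 0"
proof -
  obtain u' where wd: "weak_deriv u u'"
    and u'0: "AE x in lborel. rep_l2 u' x = slope m z x *v rep_l2 u x + vec2 (rep_l2 (z *\<^sub>C u - z *\<^sub>C u) x $ 2) (- rep_l2 (z *\<^sub>C u - z *\<^sub>C u) x $ 1)"
    using u unfolding L_op_iff[of _ _ _ z] by blast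
  obtain v where cv: "continuous_on UNIV v" and uv: "AE x in lborel. rep_l2 u x = v x"
    and dv: "\<And>a b. a \<le> b \<Longrightarrow> v b - v a = (LINT y|lborel. indicator {a..b} y *\<^sub>R rep_l2 u' y)"
    using weak_deriv_continuous_rep[OF wd] by metis
  have vm [measurable]: "v \<in> borel_measurable borel" using cv by (rule borel_measurable_continuous_onI)
  have [measurable]: "(\<lambda>x. v x $ i) \<in> borel_measurable borel" for i by (intro borel_measurable_vec_nth vm)
  have u'v: "AE x in lborel. rep_l2 u' x = slope m z x *v v x"
    using u'0 uv rep_zero by eventually_elim (simp add: vec2_eq_iff)
  have vsi: "integrable lborel (\<lambda>x. (norm (v x))\<^sup>2)"
  proof -
    have "integrable lborel (\<lambda>x. (norm (v x))\<^sup>2) \<longleftrightarrow> integrable lborel (\<lambda>x. (norm (rep_l2 u x))\<^sup>2)"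
      using uv by (intro integrable_cong_AE) (auto elim: eventually_mono)
    then show ?thesis using integrable_norm_rep_sq by simp
  qed
  note pos = oc[unfolded off_cuts_def]
  have right: "v y - v x = (LINT t|lborel. indicator {x..y} t *\<^sub>R vec2 ((of_real m + wp z) * v t $ 2) ((of_real m - wp z) * v t $ 1))"
    if "0 \<le> x" "x \<le> y" for x y
    unfolding dv[OF that(2)]
  proof (rule integral_cong_AE)
    show "AE t in lborel. indicator {x..y} t *\<^sub>R rep_l2 u' t = indicator {x..y} t *\<^sub>R vec2 ((of_real m + wp z) * v t $ 2) ((of_real m - wp z) * v t $ 1)"
      using u'v AE_lborel_singleton[of 0]
      by eventually_elim (use that in \<open>auto simp: indicator_def slope_def wp_def vec2_eq_iff mult_vec2_nth\<close>)
  qed measurable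
  have si: "integrable lborel (\<lambda>x. indicator {0..} x *\<^sub>R (norm (v x))\<^sup>2)"
    by (rule integrable_mult_indicator[OF _ vsi]) simp
  note R = half_line_solution[OF conjunct1[OF pos] mup_sq continuous_on_subset[OF cv subset_UNIV] right si]
  \<comment> \<open>The reflection \<open>(v\<^sub>1, - v\<^sub>2)(- x)\<close> carries the left half line to the right one.\<close>
  define r where "r = (\<lambda>x. vec2 (v (- x) $ 1) (- v (- x) $ 2))"
  have nr: "norm (r x) = norm (v (- x))" for x
    by (rule power2_eq_imp_eq) (simp_all add: r_def norm_vec2_sq)
  have cr: "continuous_on {0..} r"
    unfolding r_def by (intro continuous_intros continuous_on_compose2[OF cv]) auto
  have left: "r y - r x = (LINT t|lborel. indicator {x..y} t *\<^sub>R vec2 ((of_real m + wm z) * r t $ 2) ((of_real m - wm z) * r t $ 1))"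
    if xy: "0 \<le> x" "x \<le> y" for x y
  proof -
    define P where "P = mat2 1 0 0 (-1)"
    have P: "r s = P *v v (- s)" for s by (simp add: P_def r_def vec2_eq_iff mult_vec2_nth)
    have "v (- x) - v (- y) = (LINT t|lborel. indicator {-y..-x} t *\<^sub>R rep_l2 u' t)"
      using dv[of "- y" "- x"] xy by simp
    also have "\<dots> = (LINT t|lborel. indicator {-y..-x} t *\<^sub>R (slope m z t *v v t))"
      by (rule integral_cong_AE) (use u'v in \<open>auto elim: eventually_mono\<close>)
    also have "\<dots> = (LINT t|lborel. indicator {x..y} t *\<^sub>R (slope m z (- t) *v v (- t)))"
      using lborel_integral_real_affine[of "-1" "\<lambda>t. indicator {-y..-x} t *\<^sub>R (slope m z t *v v t)" 0]
      by (simp add: indicator_def conj_commute)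
    finally have e: "v (- x) - v (- y) = (LINT t|lborel. indicator {x..y} t *\<^sub>R (slope m z (- t) *v v (- t)))" .
    have ig: "integrable lborel (\<lambda>t. indicator {x..y} t *\<^sub>R (slope m z (- t) *v v (- t)))"
    proof -
      have "integrable lborel (\<lambda>t. indicator {x..y} t *\<^sub>R v (- t))"
        by (intro borel_integrable_compact compact_Icc continuous_on_compose2[OF cv] continuous_intros) auto
      then have "integrable lborel (\<lambda>t. norm (indicator {x..y} t *\<^sub>R v (- t)) * (2 * (\<bar>m\<bar> + cmod z + 1)))"
        by (intro integrable_mult_left integrable_norm)
      then show ?thesis
      proof (rule Bochner_Integration.integrable_bound)
        show "AE t in lborel. norm (indicator {x..y} t *\<^sub>R (slope m z (- t) *v v (- t)))
            \<le> norm (norm (indicator {x..y} t *\<^sub>R v (- t)) * (2 * (\<bar>m\<bar> + cmod z + 1)))"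
        proof (rule AE_I2)
          fix t
          have "norm (slope m z (- t) *v v (- t)) \<le> (2 * (\<bar>m\<bar> + cmod z + 1)) * norm (v (- t))"
            by (rule order_trans[OF norm_matrix_vector_le]) (intro mult_right_mono slope_bounded, simp)
          then show "norm (indicator {x..y} t *\<^sub>R (slope m z (- t) *v v (- t)))
            \<le> norm (norm (indicator {x..y} t *\<^sub>R v (- t)) * (2 * (\<bar>m\<bar> + cmod z + 1)))"
            by (auto simp: indicator_def mult.commute abs_mult)
        qed
        have "(\<lambda>t. slope m z (- t) *v v (- t)) \<in> borel_measurable lborel"
          by (intro borel_measurable_matrix_vector) measurable
        then show "(\<lambda>t. indicator {x..y} t *\<^sub>R (slope m z (- t) *v v (- t))) \<in> borel_measurable lborel" by measurable
      qed
    qed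
    have "r y - r x = P *v (- (v (- x) - v (- y)))"
      unfolding P by (simp add: vec2_eq_iff mult_vec2_nth algebra_simps)
    also have "\<dots> = - (P *v (v (- x) - v (- y)))" by (simp add: vec2_eq_iff mult_vec2_nth algebra_simps)
    also have "\<dots> = - (LINT t|lborel. P *v (indicator {x..y} t *\<^sub>R (slope m z (- t) *v v (- t))))"
      unfolding e by (simp only: integral_bounded_linear[OF bounded_linear_matrix_vector ig])
    also have "\<dots> = (LINT t|lborel. - (P *v (indicator {x..y} t *\<^sub>R (slope m z (- t) *v v (- t)))))"
      by (rule Bochner_Integration.integral_minus[symmetric])
    also have "\<dots> = (LINT t|lborel. indicator {x..y} t *\<^sub>R vec2 ((of_real m + wm z) * r t $ 2) ((of_real m - wm z) * r t $ 1))"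
    proof (rule integral_cong_AE)
      show "AE t in lborel. - (P *v (indicator {x..y} t *\<^sub>R (slope m z (- t) *v v (- t))))
          = indicator {x..y} t *\<^sub>R vec2 ((of_real m + wm z) * r t $ 2) ((of_real m - wm z) * r t $ 1)"
        using AE_lborel_singleton[of 0]
        by eventually_elim (use xy in \<open>auto simp: indicator_def slope_def wm_def vec2_eq_iff mult_vec2_nth P_def r_def\<close>)
      have "(\<lambda>t. P *v (indicator {x..y} t *\<^sub>R (slope m z (- t) *v v (- t)))) \<in> borel_measurable lborel"
        by (intro borel_measurable_matrix_vector borel_measurable_scaleR) measurable
      then show "(\<lambda>t. - (P *v (indicator {x..y} t *\<^sub>R (slope m z (- t) *v v (- t))))) \<in> borel_measurable lborel" by measurable
      have "(\<lambda>t. v (- t) $ i) \<in> borel_measurable lborel" for i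
        by (intro borel_measurable_vec_nth) measurable
      then show "(\<lambda>t. indicator {x..y} t *\<^sub>R vec2 ((of_real m + wm z) * r t $ 2) ((of_real m - wm z) * r t $ 1)) \<in> borel_measurable lborel"
        unfolding r_def vec2_nth by (intro borel_measurable_scaleR borel_measurable_vec2 borel_measurable_times borel_measurable_uminus) auto
    qed
    finally show ?thesis .
  qed
  have sir: "integrable lborel (\<lambda>x. indicator {0..} x *\<^sub>R (norm (r x))\<^sup>2)"
  proof (rule integrable_mult_indicator)
    show "integrable lborel (\<lambda>x. (norm (r x))\<^sup>2)"
      unfolding nr using lborel_integrable_real_affine[OF vsi, of "-1" 0] by simp
  qed simp
  note L = half_line_solution[OF conjunct2[OF pos] mum_sq cr left sir]
  have v0: "v 0 = 0"
  proof -
    have e1: "v 0 $ 2 = ratio_p m z * v 0 $ 1"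
      using R(1) off_cuts_nonzero[OF oc] by (simp add: ratio_p_def field_simps)
    have e2: "v 0 $ 2 = ratio_m m z * v 0 $ 1"
      using L(1) off_cuts_nonzero[OF oc] by (simp add: r_def ratio_m_def field_simps)
    have "ratio_m m z \<noteq> ratio_p m z" using coefficients(1)[OF oc m] by auto
    then have "v 0 $ 1 = 0" using e1 e2 by auto
    then show ?thesis using e1 by (simp add: vec2_eq_iff)
  qed
  have "v x = 0" for x
  proof (cases "0 \<le> x")
    case False
    have "r 0 = 0" using v0 by (simp add: r_def vec2_eq_iff)
    then have "r (- x) = 0" using L(2)[of "- x"] False by simp
    then show ?thesis using nr[of "- x"] by simp
  qed (use R(2) v0 in auto)
  then show "u = 0"
    using uv rep_zero by (intro l2_eqI) (auto elim: eventually_elim2)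
qed

section \<open>Graphs of everywhere defined operators\<close>

definition gr :: "(l2 \<Rightarrow> l2) \<Rightarrow> op_graph" where "gr F = {(f, F f) | f. True}"

lemma gr_iff [simp]: "(f, g) \<in> gr F \<longleftrightarrow> g = F f" by (auto simp: gr_def)

lemma graph_of_Blinfun: "bounded_linear F \<Longrightarrow> graph_of (Blinfun F) = gr F"
  by (simp add: graph_of_def gr_def bounded_linear_Blinfun_apply)

lemma graph_of_eq_gr: "graph_of F = gr (blinfun_apply F)"
  by (simp add: graph_of_def gr_def)

lemma gr_relcomp: "gr F O gr G = gr (\<lambda>f. G (F f))"
  by (auto simp: gr_def)

lemma op_diff_gr: "op_diff (gr F) (gr G) = gr (\<lambda>f. F f - G f)"
  by (auto simp: op_diff_def gr_def)

lemma closed_gr: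
  assumes "bounded_linear F"
  shows "closed (gr F)"
proof -
  have "gr F = {p. F (fst p) = snd p}" by (auto simp: gr_def)
  moreover have "closed {p. F (fst p) = snd p}"
    by (intro closed_Collect_eq bounded_linear.continuous_on[OF assms] continuous_intros)
  ultimately show ?thesis by simp
qed

lemma closure_restriction:
  assumes F: "bounded_linear F" and sub: "r \<subseteq> gr F"
    and dense: "\<And>h. \<exists>s. (\<forall>n. s n \<in> Domain r) \<and> s \<longlonglongrightarrow> h"
  shows "closure r = gr F"
proof
  show "closure r \<subseteq> gr F" by (rule closure_minimal[OF sub closed_gr[OF F]])
  show "gr F \<subseteq> closure r"
  proof
    fix p assume "p \<in> gr F"
    then obtain h where p: "p = (h, F h)" by (auto simp: gr_def)
    obtain s where s: "\<And>n. s n \<in> Domain r" "s \<longlonglongrightarrow> h" using dense by blast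
    have "(s n, F (s n)) \<in> r" for n using s(1)[of n] sub by (auto simp: gr_def)
    moreover have "(\<lambda>n. (s n, F (s n))) \<longlonglongrightarrow> (h, F h)"
      by (intro tendsto_Pair s(2) bounded_linear.tendsto[OF F])
    ultimately show "p \<in> closure r" unfolding p closure_sequential
      by (intro exI[of _ "\<lambda>n. (s n, F (s n))"]) simp
  qed
qed

lemma resolvent_iff: "(g, u) \<in> resolvent T z \<longleftrightarrow> (u, g + z *\<^sub>C u) \<in> T"
proof
  assume "(g, u) \<in> resolvent T z"
  then obtain h where "(u, h) \<in> T" "g = h - z *\<^sub>C u"
    by (auto simp: resolvent_def op_diff_def scalar_op_def)
  then show "(u, g + z *\<^sub>C u) \<in> T" by simp
next
  assume "(u, g + z *\<^sub>C u) \<in> T"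
  then have "(u, (g + z *\<^sub>C u) - z *\<^sub>C u) \<in> op_diff T (scalar_op z)"
    unfolding op_diff_def scalar_op_def by blast
  then show "(g, u) \<in> resolvent T z" by (simp add: resolvent_def)
qed

definition inverts :: "(l2 \<Rightarrow> l2) \<Rightarrow> (l2 \<Rightarrow> l2) \<Rightarrow> bool" where
  "inverts F Q \<longleftrightarrow> bounded_linear F \<and> (\<forall>g. F g + Q (F g) = g) \<and> (\<forall>f. F (f + Q f) = f)"

lemma resolvent_gr_minus_one:
  assumes "inverts F Q"
  shows "resolvent (gr Q) (-1) = gr F"
proof -
  have "(g, u) \<in> resolvent (gr Q) (-1) \<longleftrightarrow> u = F g" for g u
  proof
    assume "(g, u) \<in> resolvent (gr Q) (-1)"
    then have "g - u = Q u" by (simp add: resolvent_iff scaleC_minus_one)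
    then have "g = u + Q u" by (simp add: algebra_simps)
    then show "u = F g" using assms by (simp add: inverts_def)
  next
    assume u: "u = F g"
    have "F g + Q (F g) = g" using assms by (simp add: inverts_def)
    then have "g - u = Q u" unfolding u by (metis add_diff_cancel_left')
    then show "(g, u) \<in> resolvent (gr Q) (-1)" by (simp add: resolvent_iff scaleC_minus_one)
  qed
  then show ?thesis by (auto simp: gr_def)
qed

lemma minus_one_in_resolvent_set_iff:
  "-1 \<in> resolvent_set (gr Q) \<longleftrightarrow> (\<exists>F. inverts F Q)"
proof
  assume "-1 \<in> resolvent_set (gr Q)"
  then obtain F where F: "resolvent (gr Q) (-1) = graph_of F" by (auto simp: resolvent_set_def)
  have *: "u = blinfun_apply F g \<longleftrightarrow> g = u + Q u" for g u
  proof -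
    have "u = blinfun_apply F g \<longleftrightarrow> (g, u) \<in> resolvent (gr Q) (-1)" unfolding F graph_of_eq_gr by simp
    also have "\<dots> \<longleftrightarrow> g - u = Q u" by (simp add: resolvent_iff scaleC_minus_one)
    also have "\<dots> \<longleftrightarrow> g = u + Q u" by (auto simp: algebra_simps)
    finally show ?thesis .
  qed
  have "inverts (blinfun_apply F) Q"
    unfolding inverts_def using *[of "blinfun_apply F g" g for g] *[of f "f + Q f" for f]
    by (auto simp: blinfun.bounded_linear_right)
  then show "\<exists>F. inverts F Q" by blast
next
  assume "\<exists>F. inverts F Q"
  then obtain F where F: "inverts F Q" by blast
  then have "resolvent (gr Q) (-1) = graph_of (Blinfun F)"
    by (simp add: resolvent_gr_minus_one graph_of_Blinfun inverts_def)
  then show "-1 \<in> resolvent_set (gr Q)" by (auto simp: resolvent_set_def)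
qed

lemma inverts_scaleC:
  assumes F: "inverts F Q" and Q: "complex_linear Q"
  shows "complex_linear F"
proof -
  have "F (c *\<^sub>C g) = c *\<^sub>C F g" for c g
  proof -
    have "c *\<^sub>C g = c *\<^sub>C (F g + Q (F g))" using F by (simp add: inverts_def)
    also have "\<dots> = c *\<^sub>C F g + Q (c *\<^sub>C F g)" by (simp add: scaleC_add_right complex_linearD(3)[OF Q])
    finally show ?thesis using F by (simp add: inverts_def)
  qed
  with F show ?thesis by (simp add: complex_linear_def inverts_def)
qed

text \<open>The solution of \<open>f + Q f = g\<close> is the fixed point of the contraction \<open>f \<mapsto> g - Q f\<close>.\<close>

lemma Neumann_inverse:
  assumes Q: "complex_linear Q" and q: "0 \<le> q" "q < 1" and le: "\<And>f. norm (Q f) \<le> q * norm f"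
  obtains F where "inverts F Q" "\<And>g. norm (F g) \<le> norm g / (1 - q)" "\<And>g. norm (F g - g) \<le> q * norm g / (1 - q)"
proof -
  have "\<exists>!f. g - Q f = f" for g
  proof (rule banach_fix_type[OF q])
    show "\<forall>x y. dist (g - Q x) (g - Q y) \<le> q * dist x y"
    proof (intro allI)
      fix x y
      have "(g - Q x) - (g - Q y) = Q (y - x)" by (simp add: complex_linearD(4)[OF Q])
      then show "dist (g - Q x) (g - Q y) \<le> q * dist x y"
        using le[of "y - x"] by (simp add: dist_norm norm_minus_commute)
    qed
  qed
  then obtain F where F: "\<And>g. g - Q (F g) = F g" and uniq: "\<And>g f. g - Q f = f \<Longrightarrow> f = F g" by metis
  have right: "F g + Q (F g) = g" for g using F[of g] by (metis diff_add_cancel)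
  have left: "F (f + Q f) = f" for f using uniq[of "f + Q f" f] by simp
  have bd: "norm (F g) \<le> norm g / (1 - q)" for g
  proof -
    have "norm (F g) \<le> norm g + norm (Q (F g))"
      using norm_triangle_ineq4[of g "Q (F g)"] by (simp only: F)
    also have "norm (Q (F g)) \<le> q * norm (F g)" by (rule le)
    finally have "norm (F g) * (1 - q) \<le> norm g" by (simp add: algebra_simps)
    then show ?thesis using q by (simp add: pos_le_divide_eq)
  qed
  have bd2: "norm (F g - g) \<le> q * norm g / (1 - q)" for g
  proof -
    have "F g - g = - Q (F g)" using F[of g] by (metis diff_diff_eq2 add_diff_cancel_left' minus_diff_eq)
    then have "norm (F g - g) \<le> q * norm (F g)" using le[of "F g"] by simp
    also have "\<dots> \<le> q * (norm g / (1 - q))" using q bd by (intro mult_left_mono) auto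
    finally show ?thesis by simp
  qed
  have add: "F (g + h) = F g + F h" for g h
  proof (rule sym, rule uniq)
    have "(g + h) - Q (F g + F h) = (g - Q (F g)) + (h - Q (F h))" by (simp add: complex_linearD(2)[OF Q])
    then show "(g + h) - Q (F g + F h) = F g + F h" by (simp only: F)
  qed
  have scale: "F (r *\<^sub>R g) = r *\<^sub>R F g" for r g
  proof (rule sym, rule uniq)
    have "r *\<^sub>R g - Q (r *\<^sub>R F g) = r *\<^sub>R (g - Q (F g))"
      using complex_linearD(3)[OF Q, of "of_real r"] by (simp add: scaleC_of_real scaleR_diff_right)
    then show "r *\<^sub>R g - Q (r *\<^sub>R F g) = r *\<^sub>R F g" by (simp only: F)
  qed
  have "bounded_linear F"
    by (rule bounded_linear_intro[of _ "1 / (1 - q)"]) (use add scale bd in auto)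
  then show thesis using that[of F] right left bd bd2 by (simp add: inverts_def)
qed

text \<open>The Sherman--Morrison formula.\<close>

lemma rank_one_inverse:
  assumes Q1: "complex_linear Q1" and F1: "inverts F1 Q1"
    and l: "\<And>f g. l (f + g) = l f + l g" "\<And>c f. l (c *\<^sub>C f) = c * l f" "bounded_linear l"
    and d: "1 + l (F1 a) \<noteq> (0::complex)"
  shows "\<exists>F. inverts F (\<lambda>f. Q1 f + l f *\<^sub>C a)"
proof (intro exI)
  let ?d = "1 + l (F1 a)"
  let ?F = "\<lambda>g. F1 g - (l (F1 g) / ?d) *\<^sub>C F1 a"
  have F1c: "complex_linear F1" by (rule inverts_scaleC[OF F1 Q1])
  have ldiff: "l (f - g) = l f - l g" for f g using l(3) by (simp add: linear_simps)
  have bl: "bounded_linear (\<lambda>g. (l (F1 g) / ?d) *\<^sub>C F1 a)"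
  proof -
    obtain K where K: "\<And>f. norm (l (F1 f)) \<le> norm f * K"
      using bounded_linear.bounded[OF bounded_linear_compose[OF l(3) complex_linearD(1)[OF F1c]]] by blast
    show ?thesis
    proof (rule bounded_linear_intro[of _ "K * norm (F1 a) / cmod ?d"])
      fix f g :: l2 and r :: real
      show "(l (F1 (f + g)) / ?d) *\<^sub>C F1 a = (l (F1 f) / ?d) *\<^sub>C F1 a + (l (F1 g) / ?d) *\<^sub>C F1 a"
        by (simp add: complex_linearD(2)[OF F1c] l(1) add_divide_distrib scaleC_add_left)
      have "l (F1 (r *\<^sub>R f)) = of_real r * l (F1 f)"
        using complex_linearD(3)[OF F1c, of "of_real r" f] l(2)[of "of_real r" "F1 f"] by (simp add: scaleC_of_real)
      then show "(l (F1 (r *\<^sub>R f)) / ?d) *\<^sub>C F1 a = r *\<^sub>R ((l (F1 f) / ?d) *\<^sub>C F1 a)"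
        by (simp flip: scaleC_of_real)
      have "cmod (l (F1 f)) / cmod ?d * norm (F1 a) \<le> (norm f * K) / cmod ?d * norm (F1 a)"
        using K by (intro mult_right_mono divide_right_mono) auto
      then show "norm ((l (F1 f) / ?d) *\<^sub>C F1 a) \<le> norm f * (K * norm (F1 a) / cmod ?d)"
        by (simp add: norm_scaleC norm_divide)
    qed
  qed
  show "inverts ?F (\<lambda>f. Q1 f + l f *\<^sub>C a)"
    unfolding inverts_def
  proof (intro conjI allI)
    show "bounded_linear ?F" by (intro bounded_linear_sub bl complex_linearD(1)[OF F1c])
    fix g
    have i1: "F1 h + Q1 (F1 h) = h" and i2: "F1 (h + Q1 h) = h" for h using F1 by (auto simp: inverts_def)
    let ?k = "l (F1 g) / ?d"
    have lF: "l (?F g) = ?k"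
      using d by (simp add: ldiff l(2) field_simps)
    have "?F g + (Q1 (?F g) + l (?F g) *\<^sub>C a) = (F1 g + Q1 (F1 g)) - ?k *\<^sub>C (F1 a + Q1 (F1 a)) + ?k *\<^sub>C a"
      unfolding lF by (simp add: complex_linearD(3,4)[OF Q1] scaleC_add_right)
    then show "?F g + (Q1 (?F g) + l (?F g) *\<^sub>C a) = g" unfolding i1 by simp
    have e: "F1 (g + (Q1 g + l g *\<^sub>C a)) = g + l g *\<^sub>C F1 a"
    proof -
      have "F1 (g + (Q1 g + l g *\<^sub>C a)) = F1 ((g + Q1 g) + l g *\<^sub>C a)" by (simp only: add.assoc)
      also have "\<dots> = F1 (g + Q1 g) + F1 (l g *\<^sub>C a)" by (rule complex_linearD(2)[OF F1c])
      finally show ?thesis by (simp only: complex_linearD(3)[OF F1c] i2)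
    qed
    have "l (g + l g *\<^sub>C F1 a) / ?d = l g"
      using d by (simp add: l(1,2) field_simps)
    then show "?F (g + (Q1 g + l g *\<^sub>C a)) = g" unfolding e by simp
  qed
qed

section \<open>The factors of the perturbed resolvent\<close>

lemma weak_deriv_diff:
  assumes "weak_deriv f f'" "weak_deriv g g'"
  shows "weak_deriv (f - g) (f' - g')"
  unfolding weak_deriv_def
proof (intro allI impI)
  fix \<phi> assume \<phi>: "test_function \<phi>"
  obtain B where B: "\<And>x. \<bar>\<phi> x\<bar> \<le> B" "\<And>x. \<bar>deriv \<phi> x\<bar> \<le> B" using test_function_bounded[OF \<phi>] by metis
  obtain N where N: "\<And>x. N \<le> \<bar>x\<bar> \<Longrightarrow> \<phi> x = 0" "\<And>x. N \<le> \<bar>x\<bar> \<Longrightarrow> deriv \<phi> x = 0" using test_function_support[OF \<phi>] by metis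
  have [measurable]: "\<phi> \<in> borel_measurable borel" "deriv \<phi> \<in> borel_measurable borel"
    using test_function_derivative[OF \<phi>] by (auto intro: borel_measurable_continuous_onI)
  have i: "integrable lborel (\<lambda>x. \<phi> x *\<^sub>R rep_l2 h x)" "integrable lborel (\<lambda>x. deriv \<phi> x *\<^sub>R rep_l2 h x)" for h
    by (rule integrable_bounded_mult[OF locally_integrable_l2[OF square_integrable_rep], of _ B N]; use B N in simp)+
  have "(LINT x|lborel. deriv \<phi> x *\<^sub>R rep_l2 (f - g) x) = (LINT x|lborel. deriv \<phi> x *\<^sub>R rep_l2 f x - deriv \<phi> x *\<^sub>R rep_l2 g x)"
    using rep_diff[of f g] by (intro integral_cong_AE) (auto elim!: eventually_mono simp: scaleR_diff_right)
  moreover have "(LINT x|lborel. \<phi> x *\<^sub>R rep_l2 (f' - g') x) = (LINT x|lborel. \<phi> x *\<^sub>R rep_l2 f' x - \<phi> x *\<^sub>R rep_l2 g' x)"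
    using rep_diff[of f' g'] by (intro integral_cong_AE) (auto elim!: eventually_mono simp: scaleR_diff_right)
  ultimately show "(LINT x|lborel. deriv \<phi> x *\<^sub>R rep_l2 (f - g) x) = - (LINT x|lborel. \<phi> x *\<^sub>R rep_l2 (f' - g') x)"
    using i assms \<phi> by (simp add: weak_deriv_def)
qed

lemma L_op_diff:
  assumes "(u, g) \<in> L_op m" "(v, h) \<in> L_op m"
  shows "(u - v, g - h) \<in> L_op m"
proof -
  obtain u' where u: "weak_deriv u u'" "AE x in lborel. rep_l2 u' x = slope m 0 x *v rep_l2 u x + vec2 (rep_l2 (g - 0 *\<^sub>C u) x $ 2) (- rep_l2 (g - 0 *\<^sub>C u) x $ 1)"
    using assms(1) unfolding L_op_iff[of _ _ _ 0] by blast
  obtain v' where v: "weak_deriv v v'" "AE x in lborel. rep_l2 v' x = slope m 0 x *v rep_l2 v x + vec2 (rep_l2 (h - 0 *\<^sub>C v) x $ 2) (- rep_l2 (h - 0 *\<^sub>C v) x $ 1)"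
    using assms(2) unfolding L_op_iff[of _ _ _ 0] by blast
  have "AE x in lborel. rep_l2 (u' - v') x = slope m 0 x *v rep_l2 (u - v) x
      + vec2 (rep_l2 ((g - h) - 0 *\<^sub>C (u - v)) x $ 2) (- rep_l2 ((g - h) - 0 *\<^sub>C (u - v)) x $ 1)"
    using u(2) v(2) rep_diff[of u' v'] rep_diff[of u v] rep_diff[of g h]
  proof eventually_elim
    case (elim x)
    then have e: "rep_l2 u' x = slope m 0 x *v rep_l2 u x + vec2 (rep_l2 g x $ 2) (- rep_l2 g x $ 1)"
      "rep_l2 v' x = slope m 0 x *v rep_l2 v x + vec2 (rep_l2 h x $ 2) (- rep_l2 h x $ 1)" by simp_all
    show ?case
      unfolding elim(3,4) e by (simp add: elim(5) vec2_eq_iff mult_vec2_nth) (simp add: algebra_simps)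
  qed
  then show ?thesis unfolding L_op_iff[of _ _ _ 0] using weak_deriv_diff[OF u(1) v(1)] by blast
qed

lemma resolvent_L_op:
  assumes oc: "off_cuts m z" and m: "m > 0"
  shows "resolvent (L_op m) z = gr (Rop m z)"
proof -
  have "(f, u) \<in> resolvent (L_op m) z \<longleftrightarrow> u = Rop m z f" for f u
  proof
    assume "(f, u) \<in> resolvent (L_op m) z"
    then have "(u, f + z *\<^sub>C u) \<in> L_op m" by (simp add: resolvent_iff)
    from L_op_diff[OF this Rop_solves[OF oc m, of f]]
    have "(u - Rop m z f, z *\<^sub>C (u - Rop m z f)) \<in> L_op m" by (simp add: scaleC_diff_right)
    from L_op_injective[OF oc m this] show "u = Rop m z f" by simp
  next
    assume "u = Rop m z f"
    then show "(f, u) \<in> resolvent (L_op m) z" using Rop_solves[OF oc m, of f] by (simp add: resolvent_iff add.commute)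
  qed
  then show ?thesis by (auto simp: gr_def)
qed

lemma Rop_complex_linear: "off_cuts m z \<Longrightarrow> complex_linear (Rop m z)"
  unfolding Rop_def using kernel_bounded_green kernel_op_complex_linear by blast

text \<open>Integrability of \<open>\<bar>W\<bar>\<close> makes both factors of \<open>W\<close> square integrable.\<close>

definition potential :: "(real \<Rightarrow> complex^2^2) \<Rightarrow> bool" where
  "potential W \<longleftrightarrow> W \<in> borel_measurable lborel \<and> integrable lborel (\<lambda>x. norm (W x))"

text \<open>Everywhere defined versions of \<open>A R\<^sub>0(z)\<close>, \<open>R\<^sub>0(z) B\<close> and \<open>A R\<^sub>0(z) B\<close>, by their kernels.\<close>

definition ARop :: "real \<Rightarrow> (real \<Rightarrow> complex^2^2) \<Rightarrow> complex \<Rightarrow> l2 \<Rightarrow> l2" where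
  "ARop m W z = kernel_op (\<lambda>x y. Amat (W x) ** green m z x y)"
definition RBop :: "real \<Rightarrow> (real \<Rightarrow> complex^2^2) \<Rightarrow> complex \<Rightarrow> l2 \<Rightarrow> l2" where
  "RBop m W z = kernel_op (\<lambda>x y. green m z x y ** Bmat (W y))"
definition ARBop :: "real \<Rightarrow> (real \<Rightarrow> complex^2^2) \<Rightarrow> complex \<Rightarrow> l2 \<Rightarrow> l2" where
  "ARBop m W z = kernel_op (\<lambda>x y. Amat (W x) ** green m z x y ** Bmat (W y))"

lemma potential_factors:
  assumes W: "potential W"
  shows "(\<lambda>x. Amat (W x)) \<in> borel_measurable lborel" "(\<lambda>x. Bmat (W x)) \<in> borel_measurable lborel"
    "integrable lborel (\<lambda>x. (norm (Amat (W x)))\<^sup>2)" "integrable lborel (\<lambda>x. (norm (Bmat (W x)))\<^sup>2)"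
proof -
  have [measurable]: "W \<in> borel_measurable borel" using W by (simp add: potential_def)
  have i: "integrable lborel (\<lambda>x. 96 * norm (W x))" using W by (simp add: potential_def)
  show m: "(\<lambda>x. Amat (W x)) \<in> borel_measurable lborel" "(\<lambda>x. Bmat (W x)) \<in> borel_measurable lborel" by measurable
  have "(norm (Amat (W x)))\<^sup>2 \<le> 96 * norm (W x)" for x
    using norm_Amat_sq[of "W x"] norm_ge_zero[of "W x"] by linarith
  then show "integrable lborel (\<lambda>x. (norm (Amat (W x)))\<^sup>2)"
    by (intro Bochner_Integration.integrable_bound[OF i]) (use m in auto)
  show "integrable lborel (\<lambda>x. (norm (Bmat (W x)))\<^sup>2)"
    using norm_Bmat_sq by (intro Bochner_Integration.integrable_bound[OF i]) (use m in auto)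
qed

lemma kernels_bounded:
  assumes oc: "off_cuts m z" and W: "potential W"
  shows "\<exists>D. kernel_bounded (\<lambda>x y. Amat (W x) ** green m z x y) D"
    "\<exists>D. kernel_bounded (\<lambda>x y. green m z x y ** Bmat (W y)) D"
    "\<exists>D. kernel_bounded (\<lambda>x y. Amat (W x) ** green m z x y ** Bmat (W y)) D"
proof -
  obtain C c where C: "C > 0" "c > 0" "\<And>x y. norm (green m z x y) \<le> C * exp (- c * \<bar>x - y\<bar>)"
    using green_exponential_bound[OF oc] by metis
  note k = kernel_bounded_exponential[OF green_measurable[OF oc] C(2) less_imp_le[OF C(1)] C(3) potential_factors[OF W]]
  show "\<exists>D. kernel_bounded (\<lambda>x y. Amat (W x) ** green m z x y) D"
    "\<exists>D. kernel_bounded (\<lambda>x y. green m z x y ** Bmat (W y)) D"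
    "\<exists>D. kernel_bounded (\<lambda>x y. Amat (W x) ** green m z x y ** Bmat (W y)) D"
    by (rule k)+
qed

lemma factors_complex_linear:
  assumes "off_cuts m z" "potential W"
  shows "complex_linear (ARop m W z)" "complex_linear (RBop m W z)" "complex_linear (ARBop m W z)"
  unfolding ARop_def RBop_def ARBop_def
  using kernels_bounded[OF assms] kernel_op_complex_linear by blast+

lemma A_op_iff: "(f, g) \<in> A_op W \<longleftrightarrow> (AE x in lborel. rep_l2 g x = Amat (W x) *v rep_l2 f x)"
  and B_op_iff: "(f, g) \<in> B_op W \<longleftrightarrow> (AE x in lborel. rep_l2 g x = Bmat (W x) *v rep_l2 f x)"
  by (simp_all add: A_op_def B_op_def mult_op_def Amat_def Bmat_def)

lemma A_op_unique: "(f, g) \<in> A_op W \<Longrightarrow> (f, h) \<in> A_op W \<Longrightarrow> g = h"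
  unfolding A_op_iff by (rule l2_eqI) (auto elim: eventually_elim2)

lemma A_op_diff:
  assumes "(f, g) \<in> A_op W" "(f', g') \<in> A_op W"
  shows "(f - f', g - g') \<in> A_op W"
  using assms rep_diff[of f f'] rep_diff[of g g'] unfolding A_op_iff
  by eventually_elim (simp add: matrix_vector_mult_diff_distrib)

lemma A_op_scaleC:
  assumes "(f, g) \<in> A_op W"
  shows "(c *\<^sub>C f, c *\<^sub>C g) \<in> A_op W"
  using assms rep_scaleC[of c f] rep_scaleC[of c g] unfolding A_op_iff
  by eventually_elim (simp add: matrix_vector_simps)

lemma Rop_A_op:
  assumes oc: "off_cuts m z" and W: "potential W"
  shows "(Rop m z f, ARop m W z f) \<in> A_op W"
proof -
  obtain D where D: "kernel_bounded (green m z) D" using kernel_bounded_green[OF oc] by blast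
  obtain D' where D': "kernel_bounded (\<lambda>x y. Amat (W x) ** green m z x y) D'" using kernels_bounded[OF oc W] by blast
  have i: "integrable lborel (\<lambda>y. green m z x y *v rep_l2 f y)" for x using D by (simp add: kernel_bounded_def)
  show ?thesis
    unfolding A_op_iff Rop_def ARop_def using kernel_op_rep(2)[OF D, of f] kernel_op_rep(2)[OF D', of f]
  proof eventually_elim
    case (elim x)
    show ?case
      unfolding elim using integral_bounded_linear[OF bounded_linear_matrix_vector i, of "Amat (W x)" x]
      by (simp add: matrix_vector_mul_assoc)
  qed
qed

lemma RBop_A_op:
  assumes oc: "off_cuts m z" and W: "potential W"
  shows "(RBop m W z h, ARBop m W z h) \<in> A_op W"
proof -
  obtain D where D: "kernel_bounded (\<lambda>x y. green m z x y ** Bmat (W y)) D" using kernels_bounded[OF oc W] by blast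
  obtain D' where D': "kernel_bounded (\<lambda>x y. Amat (W x) ** green m z x y ** Bmat (W y)) D'" using kernels_bounded[OF oc W] by blast
  have i: "integrable lborel (\<lambda>y. (green m z x y ** Bmat (W y)) *v rep_l2 h y)" for x using D by (simp add: kernel_bounded_def)
  show ?thesis
    unfolding A_op_iff RBop_def ARBop_def using kernel_op_rep(2)[OF D, of h] kernel_op_rep(2)[OF D', of h]
  proof eventually_elim
    case (elim x)
    show ?case
      unfolding elim using integral_bounded_linear[OF bounded_linear_matrix_vector i, of "Amat (W x)" x]
      by (simp add: matrix_vector_mul_assoc matrix_mul_assoc)
  qed
qed

lemma Rop_B_op:
  assumes oc: "off_cuts m z" and W: "potential W" and B: "(h, k) \<in> B_op W"
  shows "Rop m z k = RBop m W z h"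
proof (rule l2_eqI)
  obtain D where D: "kernel_bounded (green m z) D" using kernel_bounded_green[OF oc] by blast
  obtain D' where D': "kernel_bounded (\<lambda>x y. green m z x y ** Bmat (W y)) D'" using kernels_bounded[OF oc W] by blast
  have eq: "(LINT y|lborel. green m z x y *v rep_l2 k y) = (LINT y|lborel. (green m z x y ** Bmat (W y)) *v rep_l2 h y)" for x
  proof (rule integral_cong_AE)
    show "(\<lambda>y. green m z x y *v rep_l2 k y) \<in> borel_measurable lborel"
      using D by (auto simp: kernel_bounded_def dest: borel_measurable_integrable)
    show "(\<lambda>y. (green m z x y ** Bmat (W y)) *v rep_l2 h y) \<in> borel_measurable lborel"
      using D' by (auto simp: kernel_bounded_def dest: borel_measurable_integrable)
    show "AE y in lborel. green m z x y *v rep_l2 k y = (green m z x y ** Bmat (W y)) *v rep_l2 h y"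
      using B unfolding B_op_iff by eventually_elim (simp add: matrix_vector_mul_assoc)
  qed
  show "AE x in lborel. rep_l2 (Rop m z k) x = rep_l2 (RBop m W z h) x"
    unfolding Rop_def RBop_def using kernel_op_rep(2)[OF D, of k] kernel_op_rep(2)[OF D', of h]
    by eventually_elim (simp add: eq)
qed

text \<open>Cut off where the matrix is large.\<close>

lemma B_op_dense:
  assumes W: "potential W"
  shows "\<exists>s. (\<forall>n. s n \<in> Domain (B_op W)) \<and> s \<longlonglongrightarrow> h"
proof -
  have [measurable]: "(\<lambda>x. Bmat (W x)) \<in> borel_measurable borel" using potential_factors[OF W] by simp
  define S where "S = (\<lambda>n::nat. {x. norm (Bmat (W x)) \<le> real n})"
  have [measurable]: "S n \<in> sets borel" for n unfolding S_def by measurable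
  define c where "c = (\<lambda>n x. indicator (S n) x *\<^sub>R rep_l2 h x)"
  have csi: "square_integrable (c n)" for n
  proof -
    have "integrable lborel (\<lambda>x. (norm (c n x))\<^sup>2)"
      by (rule Bochner_Integration.integrable_bound[OF integrable_norm_rep_sq[of h]])
        (auto simp: c_def indicator_def)
    moreover have "c n \<in> borel_measurable lborel" unfolding c_def by measurable
    ultimately show ?thesis by (simp add: square_integrable_def)
  qed
  define s where "s = (\<lambda>n. abs_l2 (c n))"
  have srep: "AE x in lborel. rep_l2 (s n) x = c n x" for n unfolding s_def by (rule rep_abs_l2[OF csi])
  have "s n \<in> Domain (B_op W)" for n
  proof -
    define k where "k = (\<lambda>x. Bmat (W x) *v c n x)"
    have ksi: "square_integrable k"
    proof -
      have km: "k \<in> borel_measurable lborel" unfolding k_def c_def by (intro borel_measurable_matrix_vector) measurable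
      have "norm (k x) \<le> real n * norm (rep_l2 h x)" for x
      proof (cases "x \<in> S n")
        case True
        then show ?thesis
          unfolding k_def c_def by (intro order_trans[OF norm_matrix_vector_le] mult_mono) (auto simp: S_def)
      qed (simp add: k_def c_def)
      then have "(norm (k x))\<^sup>2 \<le> (real n)\<^sup>2 * (norm (rep_l2 h x))\<^sup>2" for x
        by (metis norm_ge_zero power_mono power_mult_distrib)
      then have "integrable lborel (\<lambda>x. (norm (k x))\<^sup>2)"
        by (intro Bochner_Integration.integrable_bound[OF integrable_mult_right[OF integrable_norm_rep_sq[of h], of "(real n)\<^sup>2"]])
          (use km in auto)
      with km show ?thesis by (simp add: square_integrable_def)
    qed
    have "(s n, abs_l2 k) \<in> B_op W"
      unfolding B_op_iff using srep[of n] rep_abs_l2[OF ksi] by eventually_elim (simp add: k_def)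
    then show ?thesis by blast
  qed
  moreover have "s \<longlonglongrightarrow> h"
  proof -
    have "(\<lambda>n. LINT x|lborel. (norm (c n x - rep_l2 h x))\<^sup>2) \<longlonglongrightarrow> (LINT x::real|lborel. 0::real)"
    proof (rule integral_dominated_convergence)
      show "integrable lborel (\<lambda>x. (norm (rep_l2 h x))\<^sup>2)" by (rule integrable_norm_rep_sq)
      show "AE x in lborel. (\<lambda>n. (norm (c n x - rep_l2 h x))\<^sup>2) \<longlonglongrightarrow> 0"
      proof (rule AE_I2)
        fix x
        obtain n0 :: nat where "norm (Bmat (W x)) \<le> real n0" using real_arch_simple by blast
        then have "eventually (\<lambda>n. (norm (c n x - rep_l2 h x))\<^sup>2 = 0) sequentially"
          by (intro eventually_sequentiallyI[of n0]) (auto simp: c_def S_def indicator_def)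
        then show "(\<lambda>n. (norm (c n x - rep_l2 h x))\<^sup>2) \<longlonglongrightarrow> 0" by (rule tendsto_eventually)
      qed
      show "AE x in lborel. norm ((norm (c n x - rep_l2 h x))\<^sup>2) \<le> (norm (rep_l2 h x))\<^sup>2" for n
        by (auto simp: c_def indicator_def)
    qed (unfold c_def, measurable)
    moreover have "(LINT x|lborel. (norm (c n x - rep_l2 h x))\<^sup>2) = (norm (s n - h))\<^sup>2" for n
      unfolding norm_l2_sq using srep[of n] rep_diff[of "s n" h]
      by (intro integral_cong_AE) (auto elim!: eventually_elim2 simp: c_def)
    ultimately have "(\<lambda>n. (norm (s n - h))\<^sup>2) \<longlonglongrightarrow> 0" by simp
    then have "(\<lambda>n. sqrt ((norm (s n - h))\<^sup>2)) \<longlonglongrightarrow> sqrt 0" by (rule tendsto_real_sqrt)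
    then have "(\<lambda>n. norm (s n - h)) \<longlonglongrightarrow> 0" by simp
    then show ?thesis by (simp add: tendsto_norm_zero_iff LIM_zero_iff)
  qed
  ultimately show ?thesis by blast
qed

text \<open>Products with \<open>B\<close> on the right are only densely defined, as \<open>B\<close> is unbounded; their closures are
  the bounded operators given by the kernels.\<close>

lemma factor_graphs:
  assumes oc: "off_cuts m z" and m: "m > 0" and W: "potential W"
  shows "R0 m z O A_op W = gr (ARop m W z)" "closure (B_op W O R0 m z) = gr (RBop m W z)"
    "Q_op m W z = gr (ARBop m W z)"
proof -
  note R0 = resolvent_L_op[OF oc m]
  note lin = factors_complex_linear[OF oc W]
  show "R0 m z O A_op W = gr (ARop m W z)"
    unfolding R0 using Rop_A_op[OF oc W] A_op_unique by (fastforce simp: gr_def relcomp_unfold)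
  show "closure (B_op W O R0 m z) = gr (RBop m W z)"
  proof (rule closure_restriction[OF complex_linearD(1)[OF lin(2)]])
    show "B_op W O R0 m z \<subseteq> gr (RBop m W z)" unfolding R0 using Rop_B_op[OF oc W] by auto
    show "\<exists>s. (\<forall>n. s n \<in> Domain (B_op W O R0 m z)) \<and> s \<longlonglongrightarrow> h" for h
      using B_op_dense[OF W, of h] unfolding R0 by (auto simp: gr_def relcomp_unfold Domain_iff)
  qed
  show "Q_op m W z = gr (ARBop m W z)"
    unfolding Q_op_def
  proof (rule closure_restriction[OF complex_linearD(1)[OF lin(3)]])
    have 1: "(h, g) \<in> gr (ARBop m W z)" if "(h, k) \<in> B_op W" "(Rop m z k, g) \<in> A_op W" for h k g
      using A_op_unique[OF RBop_A_op[OF oc W, of h], of g] that Rop_B_op[OF oc W that(1)] by simp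
    then show "B_op W O R0 m z O A_op W \<subseteq> gr (ARBop m W z)" unfolding R0 by auto
    have "h \<in> Domain (B_op W O R0 m z O A_op W)" if hd: "h \<in> Domain (B_op W)" for h
    proof -
      obtain k where k: "(h, k) \<in> B_op W" using hd by blast
      then have "(h, ARop m W z k) \<in> B_op W O R0 m z O A_op W"
        unfolding R0 using Rop_A_op[OF oc W, of k] by (auto simp: relcomp_unfold)
      then show ?thesis by blast
    qed
    then show "\<exists>s. (\<forall>n. s n \<in> Domain (B_op W O R0 m z O A_op W)) \<and> s \<longlonglongrightarrow> h" for h
      using B_op_dense[OF W, of h] by blast
  qed
qed

section \<open>The perturbed operator\<close>

text \<open>Here \<open>F\<close> stands for \<open>(1 + Q(z))\<^sup>-\<^sup>1\<close>.\<close>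

definition pert_res :: "real \<Rightarrow> (real \<Rightarrow> complex^2^2) \<Rightarrow> complex \<Rightarrow> (l2 \<Rightarrow> l2) \<Rightarrow> l2 \<Rightarrow> l2" where
  "pert_res m W z F f = Rop m z f - RBop m W z (F (ARop m W z f))"

lemma perturbed_resolvent_gr:
  assumes oc: "off_cuts m z" and m: "m > 0" and W: "potential W" and F: "inverts F (ARBop m W z)"
  shows "perturbed_resolvent m W z = gr (pert_res m W z F)" "complex_linear (pert_res m W z F)"
proof -
  note g = factor_graphs[OF oc m W]
  note lin = factors_complex_linear[OF oc W]
  have Fl: "complex_linear F" by (rule inverts_scaleC[OF F lin(3)])
  show "perturbed_resolvent m W z = gr (pert_res m W z F)"
    unfolding perturbed_resolvent_def g(1) g(2) g(3) resolvent_gr_minus_one[OF F] gr_relcomp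
    unfolding resolvent_L_op[OF oc m] op_diff_gr by (simp add: pert_res_def[abs_def])
  show "complex_linear (pert_res m W z F)"
    unfolding pert_res_def[abs_def]
    by (intro complex_linear_diff Rop_complex_linear oc complex_linear_compose[OF lin(2)] complex_linear_compose[OF Fl] lin(1))
qed

lemma Rop_resolvent_equation:
  assumes oc: "off_cuts m z" "off_cuts m w" and m: "m > 0"
  shows "Rop m z f - Rop m w f = (z - w) *\<^sub>C Rop m z (Rop m w f)"
proof -
  let ?u = "Rop m w f"
  have "(f - (z - w) *\<^sub>C ?u, ?u) \<in> resolvent (L_op m) z"
    using Rop_solves[OF oc(2) m, of f] by (simp add: resolvent_iff scaleC_diff_left algebra_simps)
  then have "?u = Rop m z (f - (z - w) *\<^sub>C ?u)" unfolding resolvent_L_op[OF oc(1) m] by simp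
  then show ?thesis
    using Rop_complex_linear[OF oc(1)] by (metis complex_linearD(3,4) add_diff_cancel_left' diff_add_cancel)
qed

text \<open>Apply \<open>A\<close> to the left and \<open>B\<close> to the right of the resolvent equation; for the latter, pass from the
  dense domain of \<open>B\<close> to the limit.\<close>

lemma factor_resolvent_equations:
  assumes oc: "off_cuts m z" "off_cuts m w" and m: "m > 0" and W: "potential W"
  shows "ARop m W z f - ARop m W w f = (z - w) *\<^sub>C ARop m W z (Rop m w f)"
    "RBop m W z h - RBop m W w h = (z - w) *\<^sub>C Rop m z (RBop m W w h)"
    "ARBop m W z h - ARBop m W w h = (z - w) *\<^sub>C ARop m W z (RBop m W w h)"
proof -
  show "ARop m W z f - ARop m W w f = (z - w) *\<^sub>C ARop m W z (Rop m w f)"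
  proof (rule A_op_unique)
    show "(Rop m z f - Rop m w f, ARop m W z f - ARop m W w f) \<in> A_op W"
      by (intro A_op_diff Rop_A_op oc W)
    show "(Rop m z f - Rop m w f, (z - w) *\<^sub>C ARop m W z (Rop m w f)) \<in> A_op W"
      unfolding Rop_resolvent_equation[OF oc m] by (intro A_op_scaleC Rop_A_op oc W)
  qed
  have rb: "RBop m W z h - RBop m W w h = (z - w) *\<^sub>C Rop m z (RBop m W w h)" for h
  proof -
    obtain s where s: "\<And>n. s n \<in> Domain (B_op W)" "s \<longlonglongrightarrow> h" using B_op_dense[OF W] by blast
    have eq: "RBop m W z (s n) - RBop m W w (s n) = (z - w) *\<^sub>C Rop m z (RBop m W w (s n))" for n
    proof -
      obtain k where "(s n, k) \<in> B_op W" using s(1)[of n] by (auto simp: Domain_iff)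
      from Rop_B_op[OF oc(1) W this] Rop_B_op[OF oc(2) W this] show ?thesis
        using Rop_resolvent_equation[OF oc m, of k] by simp
    qed
    note bl = complex_linearD(1)[OF factors_complex_linear(2)[OF oc(1) W]]
      complex_linearD(1)[OF factors_complex_linear(2)[OF oc(2) W]] complex_linearD(1)[OF Rop_complex_linear[OF oc(1)]]
    have "(\<lambda>n. RBop m W z (s n) - RBop m W w (s n)) \<longlonglongrightarrow> RBop m W z h - RBop m W w h"
      by (intro tendsto_diff bounded_linear.tendsto[OF bl(1)] bounded_linear.tendsto[OF bl(2)] s(2))
    moreover have "(\<lambda>n. (z - w) *\<^sub>C Rop m z (RBop m W w (s n))) \<longlonglongrightarrow> (z - w) *\<^sub>C Rop m z (RBop m W w h)"
      by (intro bounded_linear.tendsto[OF bounded_linear_scaleC] bounded_linear.tendsto[OF bl(3)] bounded_linear.tendsto[OF bl(2)] s(2))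
    ultimately show ?thesis unfolding eq by (rule LIMSEQ_unique)
  qed
  then show "RBop m W z h - RBop m W w h = (z - w) *\<^sub>C Rop m z (RBop m W w h)" .
  show "ARBop m W z h - ARBop m W w h = (z - w) *\<^sub>C ARop m W z (RBop m W w h)"
  proof (rule A_op_unique)
    show "(RBop m W z h - RBop m W w h, ARBop m W z h - ARBop m W w h) \<in> A_op W"
      by (intro A_op_diff RBop_A_op oc W)
    show "(RBop m W z h - RBop m W w h, (z - w) *\<^sub>C ARop m W z (RBop m W w h)) \<in> A_op W"
      unfolding rb by (intro A_op_scaleC Rop_A_op oc W)
  qed
qed

text \<open>The perturbed resolvents inherit the resolvent equation from the unperturbed ones by algebra
  alone.\<close>

lemma pert_res_equation:
  assumes oc: "off_cuts m z" "off_cuts m w" and m: "m > 0" and W: "potential W"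
    and F: "inverts F (ARBop m W z)" and G: "inverts G (ARBop m W w)"
  shows "pert_res m W z F f - pert_res m W w G f = (z - w) *\<^sub>C pert_res m W z F (pert_res m W w G f)"
proof -
  note lz = factors_complex_linear[OF oc(1) W] and lw = factors_complex_linear[OF oc(2) W]
  note Fl = inverts_scaleC[OF F lz(3)] and Gl = inverts_scaleC[OF G lw(3)]
  note Rl = Rop_complex_linear[OF oc(1)]
  note eqs = factor_resolvent_equations[OF oc m W] Rop_resolvent_equation[OF oc m]
  define c where "c = z - w"
  define a where "a = G (ARop m W w f)"
  define b where "b = RBop m W w a"
  have 1: "c *\<^sub>C Rop m z (Rop m w f - b) = (Rop m z f - Rop m w f) - (RBop m W z a - b)"
    unfolding complex_linearD(4)[OF Rl] scaleC_diff_right b_def using eqs(4)[of f] eqs(2)[of a] by (simp add: c_def)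
  have 2: "c *\<^sub>C ARop m W z (Rop m w f - b) = (ARop m W z f - ARop m W w f) - (ARBop m W z a - ARBop m W w a)"
    unfolding complex_linearD(4)[OF lz(1)] scaleC_diff_right b_def using eqs(1)[of f] eqs(3)[of a] by (simp add: c_def)
  have Ga: "a + ARBop m W w a = ARop m W w f" using G by (simp add: inverts_def a_def)
  have 3: "F (c *\<^sub>C ARop m W z (Rop m w f - b)) = F (ARop m W z f) - a"
  proof -
    have "c *\<^sub>C ARop m W z (Rop m w f - b) = ARop m W z f - (a + ARBop m W z a)"
      unfolding 2 Ga[symmetric] by (simp add: algebra_simps)
    then show ?thesis using F by (simp add: complex_linearD(4)[OF Fl] inverts_def)
  qed
  have "c *\<^sub>C pert_res m W z F (pert_res m W w G f)
      = c *\<^sub>C Rop m z (Rop m w f - b) - RBop m W z (F (c *\<^sub>C ARop m W z (Rop m w f - b)))"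
    by (simp add: pert_res_def a_def[symmetric] b_def[symmetric] scaleC_diff_right complex_linearD(3)[OF Fl] complex_linearD(3)[OF lz(2)])
  also have "\<dots> = pert_res m W z F f - pert_res m W w G f"
    unfolding 1 3 complex_linearD(4)[OF lz(2)] pert_res_def a_def[symmetric] b_def[symmetric] by simp
  finally show ?thesis by (simp add: c_def)
qed

text \<open>If \<open>R f = R B a\<close> for \<open>a = (1 + Q)\<^sup>-\<^sup>1 A R f\<close>, applying \<open>A\<close> gives \<open>a + Q a = Q a\<close>. So \<open>a = 0\<close>, hence
  \<open>R f = 0\<close>, and \<open>f = 0\<close> because the weak derivative of \<open>0\<close> is \<open>0\<close>.\<close>

lemma pert_res_injective:
  assumes oc: "off_cuts m z" and m: "m > 0" and W: "potential W" and F: "inverts F (ARBop m W z)"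
    and zero: "pert_res m W z F f = 0"
  shows "f = 0"
proof -
  note lin = factors_complex_linear[OF oc W]
  let ?a = "F (ARop m W z f)"
  have R: "Rop m z f = RBop m W z ?a" using zero by (simp add: pert_res_def)
  have "ARop m W z f = ARBop m W z ?a"
    using A_op_unique[OF Rop_A_op[OF oc W, of f]] RBop_A_op[OF oc W, of ?a] unfolding R by blast
  moreover have "?a + ARBop m W z ?a = ARop m W z f" using F by (simp add: inverts_def)
  ultimately have "?a = 0" by simp
  then have "Rop m z f = 0" using R complex_linearD(5)[OF lin(2)] by simp
  then have "(f, 0) \<in> resolvent (L_op m) z" unfolding resolvent_L_op[OF oc m] by simp
  moreover have "(0, 0) \<in> resolvent (L_op m) z"
    unfolding resolvent_L_op[OF oc m] by (simp add: complex_linearD(5)[OF Rop_complex_linear[OF oc]])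
  ultimately have L: "(0, f) \<in> L_op m" "(0, 0) \<in> L_op m" by (simp_all add: resolvent_iff)
  obtain u' where u': "weak_deriv 0 u'" and r: "AE x in lborel. rep_l2 u' x = slope m 0 x *v rep_l2 0 x
      + vec2 (rep_l2 (f - 0 *\<^sub>C 0) x $ 2) (- rep_l2 (f - 0 *\<^sub>C 0) x $ 1)"
    using L(1) unfolding L_op_iff[of _ _ _ 0] by blast
  have "(Rop m z f, z *\<^sub>C Rop m z f + f) \<in> L_op m" by (rule Rop_solves[OF oc m])
  show "f = 0"
  proof (rule l2_eqI)
    obtain v where v: "continuous_on UNIV v" "AE x in lborel. rep_l2 0 x = v x"
      "\<And>a b. a \<le> b \<Longrightarrow> v b - v a = (LINT y|lborel. indicator {a..b} y *\<^sub>R rep_l2 u' y)"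
      by (rule weak_deriv_continuous_rep[OF u']) blast
    have v0: "AE x in lborel. v x = 0" using v(2) rep_zero by eventually_elim simp
    have "v x = 0" for x
    proof (rule ccontr)
      assume "v x \<noteq> 0"
      have "open {y. v y \<noteq> 0}" by (intro open_Collect_neq v(1) continuous_intros)
      then obtain e where e: "e > 0" "ball x e \<subseteq> {y. v y \<noteq> 0}"
        using \<open>v x \<noteq> 0\<close> by (metis (mono_tags, lifting) mem_Collect_eq open_contains_ball)
      have "AE y in lborel. y \<notin> ball x e" using v0 by eventually_elim (use e in auto)
      then have "ball x e \<in> null_sets lborel" by (subst AE_iff_null_sets) auto
      then have "emeasure lborel (ball x e) = 0" by auto
      then show False using e by (simp add: ball_eq_greaterThanLessThan)
    qed
    then have iv: "(LINT y|lborel. indicator {a..b} y *\<^sub>R rep_l2 u' y) = 0" if "a \<le> b" for a b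
      using v(3)[OF that] by simp
    have "AE x in lborel. rep_l2 u' x = 0"
    proof (rule AE_zero_of_interval_integrals)
      show "integrable lborel (\<lambda>x. indicator {-N..N} x *\<^sub>R rep_l2 u' x)" for N
        by (rule locally_integrable_l2[OF square_integrable_rep])
      show "(LINT x|lborel. indicator {a<..<b} x *\<^sub>R rep_l2 u' x) = 0" if "a < b" for a b
      proof -
        have "(LINT x|lborel. indicator {a<..<b} x *\<^sub>R rep_l2 u' x) = (LINT x|lborel. indicator {a..b} x *\<^sub>R rep_l2 u' x)"
        proof (rule integral_cong_AE)
          show "AE x in lborel. indicator {a<..<b} x *\<^sub>R rep_l2 u' x = indicator {a..b} x *\<^sub>R rep_l2 u' x"
            using AE_lborel_singleton[of a] AE_lborel_singleton[of b] by eventually_elim (auto simp: indicator_def)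
        qed measurable
        then show ?thesis using iv[of a b] that by simp
      qed
    qed
    then show "AE x in lborel. rep_l2 f x = rep_l2 0 x"
      using r rep_zero by eventually_elim (auto simp: vec2_eq_iff mult_vec2_nth)
  qed
qed

section \<open>The perturbed operator and the lines \<open>Im z = \<plusminus> 1\<close>\<close>

lemma square_integrable_compact_support:
  assumes c: "continuous_on UNIV f" and s: "\<And>x. N \<le> \<bar>x\<bar> \<Longrightarrow> f x = 0"
  shows "square_integrable f"
proof -
  have "integrable lborel (\<lambda>x. (norm (f x))\<^sup>2)"
    by (rule integrable_compact_support[of _ N]) (auto intro!: continuous_intros c simp: s)
  then show ?thesis using c by (simp add: square_integrable_def borel_measurable_continuous_onI)
qed

lemma plane_wave:
  assumes m: "m > 0" and w: "m \<le> \<bar>w\<bar>"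
  obtains k :: real and v :: "complex^2" where "norm v = 1"
    "(of_real m + of_real w) * v$2 = \<i> * of_real k * v$1" "(of_real m - of_real w) * v$1 = \<i> * of_real k * v$2"
proof -
  obtain k :: real and v :: "complex^2" where v: "v \<noteq> 0"
    "(of_real m + of_real w) * v$2 = \<i> * of_real k * v$1" "(of_real m - of_real w) * v$1 = \<i> * of_real k * v$2"
  proof (cases "m + w = 0")
    case True
    then have "of_real m + of_real w = (0::complex)" by (metis of_real_0 of_real_add)
    then show ?thesis using that[of "vec2 0 1" 0] by (auto simp: vec2_eq_iff)
  next
    case False
    have "m\<^sup>2 \<le> w\<^sup>2" using m w abs_le_square_iff[of m w] by simp
    then have "(sqrt (w\<^sup>2 - m\<^sup>2))\<^sup>2 = w\<^sup>2 - m\<^sup>2" by simp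
    then have k: "(of_real (sqrt (w\<^sup>2 - m\<^sup>2)) :: complex)\<^sup>2 = of_real w ^ 2 - of_real m ^ 2"
      by (metis of_real_diff of_real_power)
    show ?thesis
    proof (rule that[of "vec2 (of_real m + of_real w) (\<i> * of_real (sqrt (w\<^sup>2 - m\<^sup>2)))" "sqrt (w\<^sup>2 - m\<^sup>2)"])
      show "vec2 (of_real m + of_real w) (\<i> * of_real (sqrt (w\<^sup>2 - m\<^sup>2))) \<noteq> 0"
        using False by (auto simp: vec2_eq_iff simp flip: of_real_add)
      have "\<i> * complex_of_real (sqrt (w\<^sup>2 - m\<^sup>2)) * (\<i> * complex_of_real (sqrt (w\<^sup>2 - m\<^sup>2))) = - (of_real (sqrt (w\<^sup>2 - m\<^sup>2)))\<^sup>2"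
        unfolding power2_eq_square by (simp only: mult_ac) simp
      also have "\<dots> = (of_real m - of_real w) * (of_real m + of_real w)"
        unfolding k by (simp add: power2_eq_square algebra_simps)
      finally show "(of_real m - of_real w) * vec2 (of_real m + of_real w) (\<i> * of_real (sqrt (w\<^sup>2 - m\<^sup>2))) $ 1
          = \<i> * complex_of_real (sqrt (w\<^sup>2 - m\<^sup>2)) * vec2 (of_real m + of_real w) (\<i> * of_real (sqrt (w\<^sup>2 - m\<^sup>2))) $ 2"
        by simp
    qed (simp add: algebra_simps)
  qed
  define c where "c = complex_of_real (inverse (norm v))"
  have "norm (c *s v) = 1" using v(1) by (simp add: c_def norm_smult_vec norm_inverse)
  moreover have "a * (c * x) = b * (c * y)" if "a * x = b * y" for a b x y :: complex
    using arg_cong[OF that, of "(*) c"] by (simp add: mult_ac)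
  ultimately show thesis using that[of "c *s v" k] v(2,3) by simp
qed

text \<open>Approximate eigenfunctions: a plane wave on the half-line where \<open>i sgn x\<close> equals \<open>i Im lam\<close>,
  cut off by a wide bump that can be translated arbitrarily far out.\<close>

lemma quasi_mode:
  assumes m: "m > 0" and lam: "Im lam = s" "s = 1 \<or> s = -1" "m \<le> \<bar>Re lam\<bar>" and \<delta>: "\<delta> > 0"
  obtains K where "K > 0" "\<And>a. a \<ge> 0 \<Longrightarrow> \<exists>u r. (u, lam *\<^sub>C u + r) \<in> L_op m \<and> norm u = 1 \<and> norm r \<le> \<delta> \<and>
      (AE x in lborel. norm (rep_l2 u x) \<le> K * indicator {x. a \<le> \<bar>x\<bar>} x)"
proof -
  obtain k :: real and v :: "complex^2" where v: "norm v = 1"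
    "(of_real m + of_real (Re lam)) * v$2 = \<i> * of_real k * v$1"
    "(of_real m - of_real (Re lam)) * v$1 = \<i> * of_real k * v$2"
    using plane_wave[OF m lam(3)] by blast
  define \<beta> where "\<beta> = smooth_window 0 1 1"
  have \<beta>: "test_function \<beta>" by (simp add: \<beta>_def test_function_smooth_window)
  obtain N0 where N0: "N0 > 0" "\<And>x. N0 \<le> \<bar>x\<bar> \<Longrightarrow> \<beta> x = 0" "\<And>x. N0 \<le> \<bar>x\<bar> \<Longrightarrow> deriv \<beta> x = 0"
    using test_function_support[OF \<beta>] by blast
  note \<beta>' = test_function_derivative[OF \<beta>]
  have i: "integrable lborel (\<lambda>x. (\<beta> x)\<^sup>2)" "integrable lborel (\<lambda>x. (deriv \<beta> x)\<^sup>2)"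
    by (rule integrable_compact_support[of _ N0]; use N0 in \<open>auto intro!: continuous_intros \<beta>'(2,3)\<close>)+
  define I0 where "I0 = (LINT x|lborel. (\<beta> x)\<^sup>2)"
  define I1 where "I1 = (LINT x|lborel. (deriv \<beta> x)\<^sup>2)"
  have "I0 \<noteq> 0"
  proof
    assume "I0 = 0"
    then have "AE x in lborel. (\<beta> x)\<^sup>2 = 0"
      using integral_nonneg_eq_0_iff_AE[OF i(1)] by (simp add: I0_def)
    then have "AE x in lborel. x \<notin> {0<..<1::real}"
      by eventually_elim (use smooth_window_pos[of 0 _ 1 1] in \<open>force simp: \<beta>_def\<close>)
    then have "{0<..<1::real} \<in> null_sets lborel" by (subst AE_iff_null_sets) auto
    then show False by (simp add: null_sets_def)
  qed
  moreover have "I0 \<ge> 0" "I1 \<ge> 0" by (simp_all add: I0_def I1_def)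
  ultimately have I: "I0 > 0" "I1 \<ge> 0" by auto
  define n where "n = sqrt (I1 / I0) / \<delta> + 1"
  have n: "n > 0" using I \<delta> by (auto simp: n_def intro!: add_nonneg_pos)
  have n\<delta>: "I1 / I0 \<le> (n * \<delta>)\<^sup>2"
  proof -
    have "sqrt (I1 / I0) \<le> n * \<delta>" using \<delta> by (simp add: n_def field_simps)
    then have "(sqrt (I1 / I0))\<^sup>2 \<le> (n * \<delta>)\<^sup>2" using I by (intro power_mono) auto
    then show ?thesis using I by simp
  qed
  \<comment> \<open>The width \<open>n\<close> makes the derivative of the bump small; \<open>t\<close> normalises it.\<close>
  define t where "t = 1 / sqrt (n * I0)"
  have t: "t > 0" "t\<^sup>2 * (n * I0) = 1" using n I by (simp_all add: t_def power_divide)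
  have s: "\<bar>s\<bar> = 1" "s \<noteq> 0" "s * s = 1" using lam(2) by auto
  show thesis
  proof (rule that[of t])
    show "t > 0" by (rule t)
    fix a :: real assume a: "a \<ge> 0"
    define y where "y = (\<lambda>x. - (a / n) + (s / n) * x)"
    define e where "e = (\<lambda>x. exp (\<i> * of_real k * of_real x))"
    define c where "c = (\<lambda>x. of_real (t * \<beta> (y x)) * e x)"
    define d where "d = (\<lambda>x. of_real (t * (s / n) * deriv \<beta> (y x)) * e x)"
    define uf where "uf = (\<lambda>x. c x *s v)"
    define uf' where "uf' = (\<lambda>x. (d x + \<i> * of_real k * c x) *s v)"
    define rf where "rf = (\<lambda>x. d x *s vec2 (- v$2) (v$1))"
    have e1: "cmod (e x) = 1" for x by (simp add: e_def)
    have ys: "a < \<bar>x\<bar> \<and> sgn x = s" if "\<beta> (y x) \<noteq> 0" for x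
    proof -
      have "y x > 0" using that smooth_window_outside[of "y x" 0 1 1] by (auto simp: \<beta>_def)
      then have "a < s * x" using n by (simp add: y_def field_simps)
      then show ?thesis using a lam(2) by auto
    qed
    have far: "\<beta> (y x) = 0 \<and> deriv \<beta> (y x) = 0" if x: "a + n * N0 + 1 \<le> \<bar>x\<bar>" for x
    proof -
      have "\<bar>(s / n) * x\<bar> \<le> \<bar>y x\<bar> + a / n" using a n abs_triangle_ineq[of "y x" "a / n"] by (simp add: y_def)
      moreover have "\<bar>(s / n) * x\<bar> = \<bar>x\<bar> / n" using s n by (simp add: abs_mult)
      moreover have "N0 \<le> (\<bar>x\<bar> - a) / n" using x n by (simp add: pos_le_divide_eq mult.commute)
      ultimately have "N0 \<le> \<bar>y x\<bar>" by (simp add: diff_divide_distrib)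
      then show ?thesis using N0 by blast
    qed
    have yd: "(y has_field_derivative (s / n)) (at x)" for x
      unfolding y_def using n by (auto intro!: derivative_eq_intros)
    have yc: "continuous_on UNIV y" unfolding y_def by (intro continuous_intros)
    have ec: "continuous_on UNIV e" unfolding e_def by (intro continuous_intros)
    have \<beta>c: "continuous_on UNIV (\<lambda>x. \<beta> (y x))" "continuous_on UNIV (\<lambda>x. deriv \<beta> (y x))"
      using continuous_on_compose2[OF \<beta>'(2) yc] continuous_on_compose2[OF \<beta>'(3) yc] by auto
    have cc: "continuous_on UNIV c" "continuous_on UNIV d"
      unfolding c_def d_def by (intro continuous_intros \<beta>c ec)+
    have smc: "continuous_on UNIV (\<lambda>x. f x *s u)" if "continuous_on UNIV f" for f and u :: "complex^2"
    proof -
      have "(\<lambda>x. f x *s u) = (\<lambda>x. vec2 (f x * u$1) (f x * u$2))" by (simp add: fun_eq_iff vec2_eq_iff)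
      then show ?thesis by (simp only:) (intro continuous_intros that)
    qed
    have ucont: "continuous_on UNIV uf" "continuous_on UNIV uf'" "continuous_on UNIV rf"
      unfolding uf_def uf'_def rf_def by (intro smc continuous_intros cc)+
    have zero: "uf x = 0 \<and> uf' x = 0 \<and> rf x = 0" if "a + n * N0 + 1 \<le> \<bar>x\<bar>" for x
      using far[OF that] by (simp add: uf_def uf'_def rf_def c_def d_def)
    have si: "square_integrable uf" "square_integrable uf'" "square_integrable rf"
      using ucont zero by (blast intro: square_integrable_compact_support)+
    define u where "u = abs_l2 uf"
    define u' where "u' = abs_l2 uf'"
    define r where "r = abs_l2 rf"
    have rep: "AE x in lborel. rep_l2 u x = uf x" "AE x in lborel. rep_l2 u' x = uf' x" "AE x in lborel. rep_l2 r x = rf x"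
      unfolding u_def u'_def r_def by (rule rep_abs_l2[OF si(1)] rep_abs_l2[OF si(2)] rep_abs_l2[OF si(3)])+
    have ud: "(uf has_vector_derivative uf' x) (at x)" for x
    proof -
      have 1: "((\<lambda>x. t * \<beta> (y x)) has_field_derivative (t * (s / n) * deriv \<beta> (y x))) (at x)"
        using DERIV_cmult[OF DERIV_chain2[OF \<beta>'(1) yd], of t x] by (simp add: mult_ac)
      have 2: "((\<lambda>x. complex_of_real (t * \<beta> (y x))) has_vector_derivative of_real (t * (s / n) * deriv \<beta> (y x))) (at x)"
        using has_vector_derivative_of_real[OF 1] .
      have 3: "(e has_vector_derivative (\<i> * of_real k * e x)) (at x)"
        unfolding e_def
        by (rule has_vector_derivative_real_field[of "\<lambda>\<zeta>. exp (\<i> * of_real k * \<zeta>)"]) (auto intro!: derivative_eq_intros)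
      have "(c has_vector_derivative (d x + \<i> * of_real k * c x)) (at x)"
        using has_vector_derivative_mult[OF 2 3] by (simp add: c_def[abs_def] d_def algebra_simps)
      moreover have "bounded_linear (\<lambda>b::complex. b *s v)"
        by (rule bounded_linear_intro[of _ "norm v"])
          (simp_all add: norm_smult_vec vector_sadd_rdistrib scaleR_eq_smult_vec scaleR_conv_of_real)
      ultimately show ?thesis
        unfolding uf_def uf'_def by (rule bounded_linear.has_vector_derivative[rotated])
    qed
    have wd: "weak_deriv u u'"
      by (rule weak_derivI_smooth[OF ud ucont(2) _ _ _ rep(1,2), of "a + n * N0 + 1"])
        (use zero a n N0(1) in \<open>auto intro!: add_nonneg_pos\<close>)
    have "(u, lam *\<^sub>C u + r) \<in> L_op m"
      unfolding L_op_iff[of _ _ _ lam] add_diff_cancel_left'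
    proof (intro exI conjI)
      show "weak_deriv u u'" by (rule wd)
      show "AE x in lborel. rep_l2 u' x = slope m lam x *v rep_l2 u x + vec2 (rep_l2 r x $ 2) (- rep_l2 r x $ 1)"
        using rep
      proof eventually_elim
        case (elim x)
        show ?case
        proof (cases "c x = 0")
          case True
          then show ?thesis by (simp add: elim uf_def uf'_def rf_def vec2_eq_iff)
        next
          case False
          then have "sgn x = s" using ys[of x] by (auto simp: c_def)
          then have "lam - \<i> * of_real (sgn x) = of_real (Re lam)" by (simp add: complex_eq_iff lam)
          then have sl: "slope m lam x = mat2 0 (of_real m + of_real (Re lam)) (of_real m - of_real (Re lam)) 0"
            by (simp add: slope_def)
          have "slope m lam x *v uf x = (\<i> * of_real k * c x) *s v"
            unfolding sl uf_def using arg_cong[OF v(2), of "(*) (c x)"] arg_cong[OF v(3), of "(*) (c x)"]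
            by (simp add: vec2_eq_iff mult_vec2_nth mult_ac)
          then show ?thesis unfolding elim by (simp add: uf'_def rf_def vec2_eq_iff algebra_simps)
        qed
      qed
    qed
    moreover have "norm u = 1"
    proof -
      have "(norm u)\<^sup>2 = (LINT x|lborel. t\<^sup>2 * (\<beta> (y x))\<^sup>2)"
        unfolding u_def norm_abs_l2_sq[OF si(1)] by (simp add: uf_def norm_smult_vec c_def e1 norm_mult v(1) power_mult_distrib)
      also have "\<dots> = t\<^sup>2 * (n * I0)"
        using lborel_integral_real_affine[of "s / n" "\<lambda>x. (\<beta> x)\<^sup>2" "- (a / n)"] n s
        by (simp add: I0_def y_def abs_mult)
      finally show ?thesis using t(2) norm_ge_zero[of u] by (auto simp: power2_eq_1_iff)
    qed
    moreover have "norm r \<le> \<delta>"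
    proof -
      have nv: "norm (vec2 (- v$2) (v$1)) = norm v"
        by (rule power2_eq_imp_eq) (simp_all add: norm_vec2_sq)
      have "(norm r)\<^sup>2 = (LINT x|lborel. (t / n)\<^sup>2 * (deriv \<beta> (y x))\<^sup>2)"
        unfolding r_def norm_abs_l2_sq[OF si(3)]
        using s n by (simp add: rf_def norm_smult_vec d_def e1 norm_mult nv v(1) power_mult_distrib norm_divide power_divide)
      also have "\<dots> = (t / n)\<^sup>2 * (n * I1)"
        using lborel_integral_real_affine[of "s / n" "\<lambda>x. (deriv \<beta> x)\<^sup>2" "- (a / n)"] n s
        by (simp add: I1_def y_def abs_mult)
      also have "\<dots> = (I1 / I0) / n\<^sup>2"
      proof -
        have "t\<^sup>2 = 1 / (n * I0)" using t(2) n I by (simp add: field_simps)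
        then show ?thesis using n I by (simp add: power_divide field_simps power2_eq_square)
      qed
      also have "\<dots> \<le> \<delta>\<^sup>2" using n\<delta> n pos_divide_le_eq[of "n\<^sup>2" "I1 / I0" "\<delta>\<^sup>2"] by (simp add: power_mult_distrib mult.commute)
      finally show ?thesis by (rule power2_le_imp_le) (use \<delta> in simp)
    qed
    moreover have "AE x in lborel. norm (rep_l2 u x) \<le> t * indicator {x. a \<le> \<bar>x\<bar>} x"
      using rep(1)
    proof eventually_elim
      case (elim x)
      have "norm (uf x) = t * \<bar>\<beta> (y x)\<bar>"
        using t(1) by (simp add: uf_def norm_smult_vec v(1) c_def norm_mult e1 abs_mult)
      moreover have "\<bar>\<beta> (y x)\<bar> \<le> indicator {x. a \<le> \<bar>x\<bar>} x"
        using ys[of x] smooth_window_bounds[of 0 1 1 "y x"] unfolding \<beta>_def[symmetric]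
        by (cases "\<beta> (y x) = 0") (auto simp: indicator_def)
      ultimately show ?case using t(1) elim by simp
    qed
    ultimately show "\<exists>u r. (u, lam *\<^sub>C u + r) \<in> L_op m \<and> norm u = 1 \<and> norm r \<le> \<delta> \<and>
      (AE x in lborel. norm (rep_l2 u x) \<le> t * indicator {x. a \<le> \<bar>x\<bar>} x)" by blast
  qed
qed

text \<open>Quasi-modes are incompatible with a bounded resolvent.\<close>

lemma resolvent_set_L_op:
  assumes m: "m > 0" and z: "z \<in> resolvent_set (L_op m)"
  shows "off_cuts m z"
proof (rule ccontr)
  assume no: "\<not> off_cuts m z"
  obtain F where F: "resolvent (L_op m) z = graph_of F" using z by (auto simp: resolvent_set_def)
  define \<delta> where "\<delta> = 1 / (norm F + 1) / 2"
  have \<delta>: "\<delta> > 0" by (simp add: \<delta>_def add_nonneg_pos)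
  obtain s where s: "Im z = s" "s = 1 \<or> s = -1" "m \<le> \<bar>Re z\<bar>" using not_off_cuts[OF m no] by blast
  obtain u r where u: "(u, z *\<^sub>C u + r) \<in> L_op m" "norm u = 1" "norm r \<le> \<delta>"
    using quasi_mode[OF m s \<delta>] by (metis order_refl)
  have "(r, u) \<in> resolvent (L_op m) z" using u(1) by (simp add: resolvent_iff add.commute)
  then have "u = blinfun_apply F r" by (simp add: F graph_of_def)
  then have "norm u \<le> norm F * norm r" using norm_blinfun by blast
  also have "\<dots> \<le> (norm F + 1) * \<delta>" using u(3) \<delta> by (intro mult_mono) auto
  also have "\<dots> = 1 / 2" using norm_ge_zero[of F] unfolding \<delta>_def by (simp add: field_simps add_nonneg_eq_0_iff)
  finally show False using u(2) by simp
qed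

text \<open>The defining description of \<^const>\<open>L_pert\<close> denotes: a family of injective bounded operators that
  satisfies the resolvent equation is the resolvent family of exactly one closed operator \<open>T\<close>, with
  graph \<open>{(P f, f + z\<^sub>0 P f)}\<close> for \<open>P\<close> the member at any admissible point \<open>z\<^sub>0\<close>.\<close>

lemma L_pert_properties:
  assumes m: "m > 0" and W: "potential W"
    and z0: "z0 \<in> resolvent_set (L_op m)" "- 1 \<in> resolvent_set (Q_op m W z0)"
  shows "\<And>z F. off_cuts m z \<Longrightarrow> inverts F (ARBop m W z) \<Longrightarrow>
      z \<in> resolvent_set (L_pert m W) \<and> resolvent (L_pert m W) z = gr (pert_res m W z F)"
proof -
  let ?ok = "\<lambda>z. z \<in> resolvent_set (L_op m) \<and> - 1 \<in> resolvent_set (Q_op m W z)"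
  let ?spec = "\<lambda>T. closed_op T \<and> (\<forall>z \<in> resolvent_set (L_op m). - 1 \<in> resolvent_set (Q_op m W z) \<longrightarrow>
        z \<in> resolvent_set T \<and> resolvent T z = perturbed_resolvent m W z)"
  have ok_iff: "?ok z \<longleftrightarrow> off_cuts m z \<and> (\<exists>F. inverts F (ARBop m W z))" for z
  proof
    assume ok: "?ok z"
    then have oc: "off_cuts m z" using resolvent_set_L_op[OF m] by blast
    then show "off_cuts m z \<and> (\<exists>F. inverts F (ARBop m W z))"
      using ok unfolding factor_graphs(3)[OF oc m W] minus_one_in_resolvent_set_iff by blast
  next
    assume oc: "off_cuts m z \<and> (\<exists>F. inverts F (ARBop m W z))"
    then have "resolvent (L_op m) z = graph_of (Blinfun (Rop m z))"
      using resolvent_L_op m Rop_complex_linear complex_linearD(1) by (metis graph_of_Blinfun)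
    then have "z \<in> resolvent_set (L_op m)" by (auto simp: resolvent_set_def)
    then show "?ok z" using oc factor_graphs(3)[of m z W] m W minus_one_in_resolvent_set_iff by auto
  qed
  obtain F0 where oc0: "off_cuts m z0" and F0: "inverts F0 (ARBop m W z0)" using z0 ok_iff by blast
  define P where "P = pert_res m W z0 F0"
  have Pl: "complex_linear P" unfolding P_def by (rule perturbed_resolvent_gr(2)[OF oc0 m W F0])
  have Pinj: "f = g" if "P f = P g" for f g
  proof -
    have "P (f - g) = 0" using that by (simp add: complex_linearD(4)[OF Pl])
    then have "f - g = 0" unfolding P_def by (rule pert_res_injective[OF oc0 m W F0])
    then show ?thesis by simp
  qed
  define T where "T = {(P f, f + z0 *\<^sub>C P f) | f. True}"
  have T_iff: "(u, v) \<in> T \<longleftrightarrow> u = P (v - z0 *\<^sub>C u)" for u v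
  proof
    assume "u = P (v - z0 *\<^sub>C u)"
    then have "(u, v) = (P (v - z0 *\<^sub>C u), (v - z0 *\<^sub>C u) + z0 *\<^sub>C P (v - z0 *\<^sub>C u))" by simp
    then show "(u, v) \<in> T" unfolding T_def by blast
  qed (auto simp: T_def)
  have T_res: "resolvent T z = gr (pert_res m W z F)" if oc: "off_cuts m z" and F: "inverts F (ARBop m W z)" for z F
  proof -
    let ?Pz = "pert_res m W z F"
    have Pzl: "complex_linear ?Pz" by (rule perturbed_resolvent_gr(2)[OF oc m W F])
    have e1: "?Pz f - P f = (z - z0) *\<^sub>C ?Pz (P f)" and e2: "P f - ?Pz f = (z0 - z) *\<^sub>C P (?Pz f)" for f
      unfolding P_def by (rule pert_res_equation[OF oc oc0 m W F F0], rule pert_res_equation[OF oc0 oc m W F0 F])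
    have "(g, u) \<in> resolvent T z \<longleftrightarrow> u = ?Pz g" for g u
    proof
      assume "(g, u) \<in> resolvent T z"
      then have u: "u = P (g + z *\<^sub>C u - z0 *\<^sub>C u)" by (simp add: resolvent_iff T_iff)
      define f where "f = g + (z - z0) *\<^sub>C u"
      have uf: "u = P f" using u by (simp add: f_def scaleC_diff_left algebra_simps)
      have "g = f - (z - z0) *\<^sub>C u" by (simp add: f_def)
      then have "?Pz g = ?Pz (f - (z - z0) *\<^sub>C P f)" using uf by simp
      also have "\<dots> = ?Pz f - (?Pz f - P f)" unfolding e1 by (simp add: complex_linearD(3,4)[OF Pzl])
      finally show "u = ?Pz g" by (simp add: uf)
    next
      assume u: "u = ?Pz g"
      have "P (g + z *\<^sub>C u - z0 *\<^sub>C u) = P g + (z - z0) *\<^sub>C P u"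
        by (simp add: complex_linearD(2,3,4)[OF Pl] scaleC_diff_left)
      also have "(z - z0) *\<^sub>C P u = - (P g - ?Pz g)"
        unfolding e2 u by (simp add: scaleC_minus_left[symmetric])
      finally show "(g, u) \<in> resolvent T z" by (simp add: resolvent_iff T_iff u)
    qed
    then show ?thesis by (auto simp: gr_def)
  qed
  have T_spec: "?spec T"
  proof
    show "closed_op T"
      unfolding closed_op_def linear_op_def
    proof (intro conjI allI impI)
      show "single_valued T"
        unfolding single_valued_def T_def using Pinj by auto
      show "(0, 0) \<in> T" by (simp add: T_iff complex_linearD(5)[OF Pl])
      show "(f + f', g + g') \<in> T" if "(f, g) \<in> T" "(f', g') \<in> T" for f g f' g'
      proof -
        have "g + g' - z0 *\<^sub>C (f + f') = (g - z0 *\<^sub>C f) + (g' - z0 *\<^sub>C f')" by (simp add: scaleC_add_right)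
        then show ?thesis using that unfolding T_iff by (metis complex_linearD(2)[OF Pl])
      qed
      show "(c *\<^sub>C f, c *\<^sub>C g) \<in> T" if "(f, g) \<in> T" for c f g
      proof -
        have "c *\<^sub>C g - z0 *\<^sub>C c *\<^sub>C f = c *\<^sub>C (g - z0 *\<^sub>C f)" by (simp add: scaleC_diff_right mult.commute)
        then show ?thesis using that unfolding T_iff by (metis complex_linearD(3)[OF Pl])
      qed
      have "T = {p. fst p = P (snd p - z0 *\<^sub>C fst p)}" by (auto simp: T_iff)
      moreover have "closed {p. fst p = P (snd p - z0 *\<^sub>C fst p)}"
        by (intro closed_Collect_eq continuous_intros bounded_linear.continuous_on[OF complex_linearD(1)[OF Pl]]
            bounded_linear.continuous_on[OF bounded_linear_scaleC])
      ultimately show "closed T" by simp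
    qed
    show "\<forall>z \<in> resolvent_set (L_op m). - 1 \<in> resolvent_set (Q_op m W z) \<longrightarrow>
        z \<in> resolvent_set T \<and> resolvent T z = perturbed_resolvent m W z"
    proof (intro ballI impI)
      fix z assume "z \<in> resolvent_set (L_op m)" "- 1 \<in> resolvent_set (Q_op m W z)"
      then obtain F where oc: "off_cuts m z" and F: "inverts F (ARBop m W z)" using ok_iff by blast
      have "resolvent T z = graph_of (Blinfun (pert_res m W z F))"
        unfolding T_res[OF oc F] by (rule graph_of_Blinfun[symmetric, OF complex_linearD(1)[OF perturbed_resolvent_gr(2)[OF oc m W F]]])
      then show "z \<in> resolvent_set T \<and> resolvent T z = perturbed_resolvent m W z"
        unfolding perturbed_resolvent_gr(1)[OF oc m W F] T_res[OF oc F, symmetric] by (auto simp: resolvent_set_def)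
    qed
  qed
  have "L_pert m W = T"
    unfolding L_pert_def
  proof (rule the_equality)
    show "?spec T" by (rule T_spec)
  next
    fix T' assume T': "?spec T'"
    then have "resolvent T' z0 = resolvent T z0" using T_spec z0 by simp
    then have "(u, g) \<in> T' \<longleftrightarrow> (u, g) \<in> T" for u g
      using resolvent_iff[of "g - z0 *\<^sub>C u" u T' z0] resolvent_iff[of "g - z0 *\<^sub>C u" u T z0] by simp
    then show "T' = T" by auto
  qed
  then show "z \<in> resolvent_set (L_pert m W) \<and> resolvent (L_pert m W) z = gr (pert_res m W z F)"
    if "off_cuts m z" "inverts F (ARBop m W z)" for z F
    using T_spec T_res[OF that] ok_iff that by auto
qed

text \<open>As the quasi-mode moves to infinity, the integral of \<open>\<bar>W\<bar>\<close> over its support tends to \<open>0\<close>.\<close>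

lemma quasi_mode_factor:
  assumes m: "m > 0" and lam: "Im lam = s" "s = 1 \<or> s = -1" "m \<le> \<bar>Re lam\<bar>" and \<delta>: "\<delta> > 0" and W: "potential W"
  obtains u r g where "(u, lam *\<^sub>C u + r) \<in> L_op m" "norm u = 1" "norm r \<le> \<delta>" "(u, g) \<in> A_op W" "norm g \<le> \<delta>"
proof -
  have [measurable]: "W \<in> borel_measurable borel" and Wi: "integrable lborel (\<lambda>x. norm (W x))"
    using W by (simp_all add: potential_def)
  have Am [measurable]: "(\<lambda>x. Amat (W x)) \<in> borel_measurable borel" using potential_factors[OF W] by simp
  obtain K where K: "K > 0" and ex: "\<And>a. a \<ge> 0 \<Longrightarrow> \<exists>u r. (u, lam *\<^sub>C u + r) \<in> L_op m \<and> norm u = 1 \<and> norm r \<le> \<delta> \<and>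
      (AE x in lborel. norm (rep_l2 u x) \<le> K * indicator {x. a \<le> \<bar>x\<bar>} x)"
    using quasi_mode[OF m lam \<delta>] by blast
  have "(\<lambda>n. LINT x|lborel. indicator {x. real n \<le> \<bar>x\<bar>} x * norm (W x)) \<longlonglongrightarrow> (LINT x::real|lborel. 0::real)"
  proof (rule integral_dominated_convergence[OF _ _ Wi])
    show "AE x in lborel. (\<lambda>n. indicator {x. real n \<le> \<bar>x\<bar>} x * norm (W x)) \<longlonglongrightarrow> 0"
    proof (rule AE_I2)
      fix x :: real
      obtain n0 :: nat where "\<bar>x\<bar> < real n0" using reals_Archimedean2 by blast
      then have "eventually (\<lambda>n. indicator {x. real n \<le> \<bar>x\<bar>} x * norm (W x) = 0) sequentially"
        by (intro eventually_sequentiallyI[of n0]) (auto simp: indicator_def)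
      then show "(\<lambda>n. indicator {x. real n \<le> \<bar>x\<bar>} x * norm (W x)) \<longlonglongrightarrow> 0" by (rule tendsto_eventually)
    qed
  qed (auto simp: indicator_def)
  moreover have "\<delta>\<^sup>2 / (2 * K\<^sup>2) > 0" using K \<delta> by simp
  ultimately have "eventually (\<lambda>n. (LINT x|lborel. indicator {x. real n \<le> \<bar>x\<bar>} x * norm (W x)) < \<delta>\<^sup>2 / (2 * K\<^sup>2)) sequentially"
    by (intro order_tendstoD) auto
  then obtain n :: nat where n: "(LINT x|lborel. indicator {x. real n \<le> \<bar>x\<bar>} x * norm (W x)) < \<delta>\<^sup>2 / (2 * K\<^sup>2)"
    by (auto simp: eventually_sequentially)
  let ?I = "\<lambda>x. indicator {x. real n \<le> \<bar>x\<bar>} x :: real"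
  obtain u r where u: "(u, lam *\<^sub>C u + r) \<in> L_op m" "norm u = 1" "norm r \<le> \<delta>"
    and ub: "AE x in lborel. norm (rep_l2 u x) \<le> K * ?I x" using ex[of "real n"] by auto
  define gf where "gf = (\<lambda>x. Amat (W x) *v rep_l2 u x)"
  have gm [measurable]: "gf \<in> borel_measurable borel" unfolding gf_def by measurable
  have ii: "integrable lborel (\<lambda>x. 2 * K\<^sup>2 * (?I x * norm (W x)))"
    by (intro integrable_mult_right Bochner_Integration.integrable_bound[OF Wi]) (auto simp: indicator_def)
  have gb: "AE x in lborel. (norm (gf x))\<^sup>2 \<le> 2 * K\<^sup>2 * (?I x * norm (W x))"
    using ub
  proof eventually_elim
    case (elim x)
    have "norm (gf x) \<le> norm (Amat (W x)) * (K * ?I x)"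
      unfolding gf_def by (intro order_trans[OF norm_matrix_vector_le] mult_left_mono elim) auto
    then have "(norm (gf x))\<^sup>2 \<le> (norm (Amat (W x)) * (K * ?I x))\<^sup>2" by (intro power_mono) auto
    also have "\<dots> = (norm (Amat (W x)))\<^sup>2 * (K\<^sup>2 * ?I x)" by (simp add: power_mult_distrib indicator_def)
    also have "\<dots> \<le> (2 * norm (W x)) * (K\<^sup>2 * ?I x)"
    proof (rule mult_right_mono)
      show "(norm (Amat (W x)))\<^sup>2 \<le> 2 * norm (W x)"
        using norm_Amat_sq[of "W x"] norm_ge_zero[of "W x"] by linarith
    qed (auto simp: indicator_def)
    finally show ?case by (simp add: mult_ac)
  qed
  have gi: "integrable lborel (\<lambda>x. (norm (gf x))\<^sup>2)"
    by (rule Bochner_Integration.integrable_bound[OF ii]) (use gb in \<open>auto elim!: eventually_mono\<close>)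
  then have gsi: "square_integrable gf" using gm by (simp add: square_integrable_def)
  have "(u, abs_l2 gf) \<in> A_op W"
    unfolding A_op_iff using rep_abs_l2[OF gsi] by eventually_elim (simp add: gf_def)
  moreover have "norm (abs_l2 gf) \<le> \<delta>"
  proof (rule power2_le_imp_le)
    have "(norm (abs_l2 gf))\<^sup>2 \<le> (LINT x|lborel. 2 * K\<^sup>2 * (?I x * norm (W x)))"
      unfolding norm_abs_l2_sq[OF gsi] by (rule integral_mono_AE[OF gi ii gb])
    also have "\<dots> = 2 * K\<^sup>2 * (LINT x|lborel. ?I x * norm (W x))" by simp
    also have "\<dots> \<le> \<delta>\<^sup>2" using n K by (simp add: pos_less_divide_eq mult.commute)
    finally show "(norm (abs_l2 gf))\<^sup>2 \<le> \<delta>\<^sup>2" .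
  qed (use \<delta> in simp)
  ultimately show thesis using that u by blast
qed

text \<open>With \<open>u\<close> a quasi-mode and \<open>z\<close> any admissible point, \<open>(T - z)\<^sup>-\<^sup>1 (L - z) u = u - R\<^sub>0 B (1 + Q)\<^sup>-\<^sup>1 A u\<close> is
  in the domain of \<open>T\<close> and close to \<open>u\<close>, since \<open>A u\<close> is small. It is therefore a quasi-mode of \<open>T\<close>.\<close>

lemma lines_in_spectrum:
  assumes m: "m > 0" and W: "potential W" and oc: "off_cuts m z" and F: "inverts F (ARBop m W z)"
    and T: "resolvent T z = gr (pert_res m W z F)" and lam: "Im lam = 1 \<or> Im lam = -1" "m \<le> \<bar>Re lam\<bar>"
  shows "lam \<in> spectrum T"
proof (rule ccontr)
  assume "lam \<notin> spectrum T"
  then obtain G where G: "resolvent T lam = graph_of G" by (auto simp: spectrum_def resolvent_set_def)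
  note lin = factors_complex_linear[OF oc W]
  have Fl: "complex_linear F" by (rule inverts_scaleC[OF F lin(3)])
  obtain C where C: "C > 0" "\<And>g. norm (RBop m W z (F g)) \<le> norm g * C"
    using bounded_linear.pos_bounded[OF complex_linearD(1)[OF complex_linear_compose[OF lin(2) Fl]]] by blast
  obtain s where s: "Im lam = s" "s = 1 \<or> s = -1" "m \<le> \<bar>Re lam\<bar>" using lam by blast
  \<comment> \<open>The contradiction will be \<open>1 \<le> D \<delta> = 1/2\<close>.\<close>
  define D where "D = C + norm G * (cmod (lam - z) * C + 1)"
  have D: "D > 0" using C unfolding D_def by (intro add_pos_nonneg mult_nonneg_nonneg) auto
  define \<delta> where "\<delta> = 1 / (2 * D)"
  have \<delta>: "\<delta> > 0" using D by (simp add: \<delta>_def)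
  obtain u r g where u: "(u, lam *\<^sub>C u + r) \<in> L_op m" "norm u = 1" "norm r \<le> \<delta>" "(u, g) \<in> A_op W" "norm g \<le> \<delta>"
    using quasi_mode_factor[OF m s \<delta> W] by blast
  define f where "f = (lam - z) *\<^sub>C u + r"
  have "(f, u) \<in> resolvent (L_op m) z"
    using u(1) by (simp add: resolvent_iff f_def scaleC_diff_left)
  then have uR: "u = Rop m z f" unfolding resolvent_L_op[OF oc m] by simp
  have gA: "ARop m W z f = g" using Rop_A_op[OF oc W, of f] u(4) A_op_unique unfolding uR by blast
  define b where "b = RBop m W z (F g)"
  have b: "norm b \<le> C * \<delta>" using C(2)[of g] mult_right_mono[OF u(5) less_imp_le[OF C(1)]] unfolding b_def by (simp add: mult.commute)
  have "(f, u - b) \<in> resolvent T z" unfolding T by (simp add: pert_res_def gA b_def uR[symmetric])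
  then have "(u - b, f + z *\<^sub>C (u - b)) \<in> T" by (simp add: resolvent_iff)
  moreover have "f + z *\<^sub>C (u - b) = (r + (lam - z) *\<^sub>C b) + lam *\<^sub>C (u - b)"
    by (simp add: f_def scaleC_diff_left scaleC_diff_right algebra_simps)
  ultimately have "(r + (lam - z) *\<^sub>C b, u - b) \<in> resolvent T lam" by (simp add: resolvent_iff)
  then have "u - b = blinfun_apply G (r + (lam - z) *\<^sub>C b)" by (simp add: G graph_of_def)
  then have "norm (u - b) \<le> norm G * norm (r + (lam - z) *\<^sub>C b)" using norm_blinfun by metis
  also have "norm (r + (lam - z) *\<^sub>C b) \<le> \<delta> + cmod (lam - z) * (C * \<delta>)"
    using u(3) b by (intro order_trans[OF norm_triangle_ineq] add_mono) (auto simp: norm_scaleC mult_left_mono)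
  finally have "norm (u - b) \<le> norm G * (\<delta> + cmod (lam - z) * (C * \<delta>))" by (simp add: mult_left_mono)
  moreover have "1 \<le> norm (u - b) + norm b" using norm_triangle_ineq[of "u - b" b] u(2) by simp
  ultimately have "1 \<le> D * \<delta>" using b by (simp add: D_def algebra_simps)
  then show False using D by (simp add: \<delta>_def)
qed

section \<open>The Birman--Schwinger operator away from the strip\<close>

definition weighted :: "(real \<Rightarrow> complex^2^2) \<Rightarrow> bool" where
  "weighted W \<longleftrightarrow> W \<in> borel_measurable lborel \<and> integrable lborel (\<lambda>x. (1 + \<bar>x\<bar>)\<^sup>2 * norm (W x))"

definition moment :: "(real \<Rightarrow> complex^2^2) \<Rightarrow> real" where
  "moment W = (LINT x|lborel. (1 + \<bar>x\<bar>)\<^sup>2 * norm (W x))"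

lemma one_le_weight: "1 \<le> (1 + \<bar>x\<bar>)\<^sup>2" for x :: real
  using power_mono[of 1 "1 + \<bar>x\<bar>" 2] by simp

lemma weighted_potential:
  assumes "weighted W"
  shows "potential W" "(LINT x|lborel. norm (W x)) \<le> moment W"
proof -
  have [measurable]: "W \<in> borel_measurable borel" and i: "integrable lborel (\<lambda>x. (1 + \<bar>x\<bar>)\<^sup>2 * norm (W x))"
    using assms by (simp_all add: weighted_def)
  have le: "norm (W x) \<le> (1 + \<bar>x\<bar>)\<^sup>2 * norm (W x)" for x
    using mult_right_mono[OF one_le_weight[of x] norm_ge_zero[of "W x"]] by simp
  have n: "integrable lborel (\<lambda>x. norm (W x))"
    by (rule Bochner_Integration.integrable_bound[OF i]) (use le in \<open>auto simp: abs_mult\<close>)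
  then show "potential W" by (simp add: potential_def)
  show "(LINT x|lborel. norm (W x)) \<le> moment W"
    unfolding moment_def by (rule integral_mono[OF n i le])
qed

lemma factor_moments:
  assumes "weighted W"
  shows "integrable lborel (\<lambda>x. ((1 + \<bar>x\<bar>) * norm (Amat (W x)))\<^sup>2)" "integrable lborel (\<lambda>x. ((1 + \<bar>x\<bar>) * norm (Bmat (W x)))\<^sup>2)"
    "(LINT x|lborel. ((1 + \<bar>x\<bar>) * norm (Amat (W x)))\<^sup>2) \<le> 3 / 2 * moment W"
    "(LINT x|lborel. ((1 + \<bar>x\<bar>) * norm (Bmat (W x)))\<^sup>2) \<le> 96 * moment W"
proof -
  have i: "integrable lborel (\<lambda>x. (1 + \<bar>x\<bar>)\<^sup>2 * norm (W x))" using assms by (simp add: weighted_def)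
  note [measurable] = potential_factors(1,2)[OF weighted_potential(1)[OF assms], simplified]
  have le: "((1 + \<bar>x\<bar>) * norm (Amat (W x)))\<^sup>2 \<le> 3 / 2 * ((1 + \<bar>x\<bar>)\<^sup>2 * norm (W x))"
    "((1 + \<bar>x\<bar>) * norm (Bmat (W x)))\<^sup>2 \<le> 96 * ((1 + \<bar>x\<bar>)\<^sup>2 * norm (W x))" for x
    using mult_left_mono[OF norm_Amat_sq[of "W x"], of "(1 + \<bar>x\<bar>)\<^sup>2"] mult_left_mono[OF norm_Bmat_sq[of "W x"], of "(1 + \<bar>x\<bar>)\<^sup>2"]
    by (simp_all add: power_mult_distrib)
  have i': "integrable lborel (\<lambda>x. c * ((1 + \<bar>x\<bar>)\<^sup>2 * norm (W x)))" for c using i by simp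
  show 1: "integrable lborel (\<lambda>x. ((1 + \<bar>x\<bar>) * norm (Amat (W x)))\<^sup>2)"
    by (rule Bochner_Integration.integrable_bound[OF i'[of "3 / 2"]]) (use le(1) in \<open>auto simp: abs_mult\<close>)
  show 2: "integrable lborel (\<lambda>x. ((1 + \<bar>x\<bar>) * norm (Bmat (W x)))\<^sup>2)"
    by (rule Bochner_Integration.integrable_bound[OF i'[of 96]]) (use le(2) in \<open>auto simp: abs_mult\<close>)
  show "(LINT x|lborel. ((1 + \<bar>x\<bar>) * norm (Amat (W x)))\<^sup>2) \<le> 3 / 2 * moment W"
    using integral_mono[OF 1 i'[of "3 / 2"] le(1)] by (simp only: integral_mult_right_zero moment_def)
  show "(LINT x|lborel. ((1 + \<bar>x\<bar>) * norm (Bmat (W x)))\<^sup>2) \<le> 96 * moment W"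
    using integral_mono[OF 2 i'[of 96] le(2)] by (simp only: integral_mult_right_zero moment_def)
qed

lemma moment_nonneg: "0 \<le> moment W" by (simp add: moment_def)

text \<open>The weights \<open>1 + \<bar>x\<bar>\<close> and \<open>1 + \<bar>y\<bar>\<close> are absorbed by \<open>A\<close> and \<open>B\<close>, whose weighted \<open>L\<^sup>2\<close> norms are
  controlled by the second moment of \<open>W\<close>.\<close>

lemma weighted_kernel:
  assumes W: "weighted W" and K: "case_prod K \<in> borel_measurable (lborel \<Otimes>\<^sub>M lborel)" and C: "C \<ge> 0"
    and le: "\<And>x y i j. cmod (K x y $ i $ j) \<le> C * ((1 + \<bar>x\<bar>) * (1 + \<bar>y\<bar>))"
  shows "\<exists>D. kernel_bounded (\<lambda>x y. Amat (W x) ** K x y ** Bmat (W y)) D"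
    "norm (kernel_op (\<lambda>x y. Amat (W x) ** K x y ** Bmat (W y)) f) \<le> 48 * C * moment W * norm f"
proof -
  note [measurable] = potential_factors(1,2)[OF weighted_potential(1)[OF W], simplified]
  have Km [measurable]: "(\<lambda>p. K (fst p) (snd p)) \<in> borel_measurable (lborel \<Otimes>\<^sub>M lborel)"
    using K by (simp add: case_prod_unfold)
  have m: "case_prod (\<lambda>x y. Amat (W x) ** K x y ** Bmat (W y)) \<in> borel_measurable (lborel \<Otimes>\<^sub>M lborel)"
    unfolding case_prod_unfold by measurable
  note fm = factor_moments[OF W]
  define a where "a = (\<lambda>x. (4 * C) * ((1 + \<bar>x\<bar>) * norm (Amat (W x))))"
  define b where "b = (\<lambda>x. (1 + \<bar>x\<bar>) * norm (Bmat (W x)))"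
  have "norm (Amat (W x) ** K x y ** Bmat (W y)) \<le> a x * b y" for x y
  proof -
    have "norm (K x y) \<le> 4 * C * ((1 + \<bar>x\<bar>) * (1 + \<bar>y\<bar>))"
      using norm_mat2_le_sum[of "K x y"] le[of x y 1 1] le[of x y 1 2] le[of x y 2 1] le[of x y 2 2] by linarith
    have "norm (Amat (W x) ** K x y ** Bmat (W y)) \<le> norm (Amat (W x)) * norm (K x y) * norm (Bmat (W y))"
      by (rule order_trans[OF norm_matrix_mult_le mult_right_mono[OF norm_matrix_mult_le norm_ge_zero]])
    also have "\<dots> \<le> norm (Amat (W x)) * (4 * C * ((1 + \<bar>x\<bar>) * (1 + \<bar>y\<bar>))) * norm (Bmat (W y))"
      by (intro mult_right_mono mult_left_mono) (use \<open>norm (K x y) \<le> _\<close> in auto)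
    finally show ?thesis by (simp only: a_def b_def mult_ac)
  qed
  then have k: "kernel_bounded (\<lambda>x y. Amat (W x) ** K x y ** Bmat (W y))
      (sqrt (LINT x|lborel. (a x)\<^sup>2) * sqrt (LINT y|lborel. (b y)\<^sup>2))"
  proof (rule kernel_bounded_product[OF m, rotated -1])
    show "integrable lborel (\<lambda>x. (a x)\<^sup>2)"
      unfolding a_def power_mult_distrib[of "4 * C"] using fm(1) by simp
    show "integrable lborel (\<lambda>x. (b x)\<^sup>2)" unfolding b_def by (rule fm(2))
  qed (use C in \<open>auto simp: a_def b_def\<close>)
  then show "\<exists>D. kernel_bounded (\<lambda>x y. Amat (W x) ** K x y ** Bmat (W y)) D" by blast
  have "sqrt (LINT x|lborel. (a x)\<^sup>2) * sqrt (LINT y|lborel. (b y)\<^sup>2) \<le> (4 * C * sqrt (3 / 2 * moment W)) * sqrt (96 * moment W)"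
  proof (intro mult_mono)
    have "(LINT x|lborel. (a x)\<^sup>2) = (4 * C)\<^sup>2 * (LINT x|lborel. ((1 + \<bar>x\<bar>) * norm (Amat (W x)))\<^sup>2)"
      unfolding a_def power_mult_distrib[of "4 * C"] by simp
    also have "sqrt \<dots> = 4 * C * sqrt (LINT x|lborel. ((1 + \<bar>x\<bar>) * norm (Amat (W x)))\<^sup>2)"
      unfolding real_sqrt_mult[of "(4 * C)\<^sup>2"] real_sqrt_abs using C by simp
    also have "\<dots> \<le> 4 * C * sqrt (3 / 2 * moment W)"
      using C by (intro mult_left_mono real_sqrt_le_mono[OF fm(3)]) simp
    finally show "sqrt (LINT x|lborel. (a x)\<^sup>2) \<le> 4 * C * sqrt (3 / 2 * moment W)" .
    show "sqrt (LINT y|lborel. (b y)\<^sup>2) \<le> sqrt (96 * moment W)" unfolding b_def using fm(4) by simp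
  qed (use C moment_nonneg[of W] in auto)
  also have "\<dots> = 48 * C * moment W"
  proof -
    have "sqrt (3 / 2 * moment W) * sqrt (96 * moment W) = sqrt ((12 * moment W)\<^sup>2)"
      by (simp only: real_sqrt_mult[symmetric]) (simp add: power2_eq_square)
    also have "\<dots> = 12 * moment W" unfolding real_sqrt_abs using moment_nonneg[of W] by simp
    finally show ?thesis by (simp add: mult.assoc)
  qed
  finally show "norm (kernel_op (\<lambda>x y. Amat (W x) ** K x y ** Bmat (W y)) f) \<le> 48 * C * moment W * norm f"
    using kernel_op_rep(3)[OF k, of f] by (meson mult_right_mono norm_ge_zero order_trans)
qed

lemma invertible_away_from_strip:
  assumes m: "m > 0"
  obtains C where "C > 0" "\<And>W z. weighted W \<Longrightarrow> 48 * C * moment W < 1 \<Longrightarrow> off_cuts m z \<Longrightarrow>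
    \<not> (\<bar>Im z\<bar> < 1 \<and> m + 1 \<le> \<bar>Re z\<bar>) \<Longrightarrow> \<exists>F. inverts F (ARBop m W z)"
proof -
  obtain C where C: "C > 0" "\<And>z x y i j. off_cuts m z \<Longrightarrow> \<not> (\<bar>Im z\<bar> < 1 \<and> m + 1 \<le> \<bar>Re z\<bar>) \<Longrightarrow>
    cmod (green m z x y $ i $ j) \<le> C * ((1 + \<bar>x\<bar>) * (1 + \<bar>y\<bar>))" using green_bounded[OF m] by blast
  show thesis
  proof (rule that[OF C(1)])
    fix W z assume W: "weighted W" and small: "48 * C * moment W < 1" and oc: "off_cuts m z"
      and z: "\<not> (\<bar>Im z\<bar> < 1 \<and> m + 1 \<le> \<bar>Re z\<bar>)"
    have "norm (ARBop m W z f) \<le> 48 * C * moment W * norm f" for f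
      unfolding ARBop_def by (rule weighted_kernel(2)[OF W green_measurable[OF oc] less_imp_le[OF C(1)] C(2)[OF oc z]])
    then show "\<exists>F. inverts F (ARBop m W z)"
      using Neumann_inverse[OF factors_complex_linear(3)[OF oc weighted_potential(1)[OF W]] _ small]
        C(1) moment_nonneg[of W] by (metis (no_types) mult_nonneg_nonneg less_imp_le zero_le_numeral)
  qed
qed

section \<open>The Birman--Schwinger operator in the strip\<close>

definition dot2 :: "complex^2 \<Rightarrow> complex^2 \<Rightarrow> complex" where
  "dot2 v w = v$1 * w$1 + v$2 * w$2"

lemma dot2_simps:
  "dot2 v (w + w') = dot2 v w + dot2 v w'" "dot2 v (c *s w) = c * dot2 v w" "dot2 (c *s v) w = c * dot2 v w"
  "dot2 (transpose M *v v) w = dot2 v (M *v w)"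
  by (simp_all add: dot2_def mult_vec2_nth transpose_def algebra_simps)

lemma norm_dot2_le: "cmod (dot2 v w) \<le> norm v * norm w"
proof -
  have "cmod (dot2 v w) \<le> norm (mat2 (v$1) (v$2) 0 0 *v w)"
    using Finite_Cartesian_Product.norm_nth_le[of "mat2 (v$1) (v$2) 0 0 *v w" 1]
    by (simp add: dot2_def mult_vec2_nth)
  also have "\<dots> \<le> norm (mat2 (v$1) (v$2) 0 0) * norm w" by (rule norm_matrix_vector_le)
  also have "norm (mat2 (v$1) (v$2) 0 0) = norm v"
    by (rule power2_eq_imp_eq) (simp_all add: norm_mat2_sq norm_vec2_sq)
  finally show ?thesis .
qed

lemma borel_measurable_dot2 [measurable (raw)]:
  assumes [measurable]: "f \<in> borel_measurable M" "g \<in> borel_measurable M"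
  shows "(\<lambda>x. dot2 (f x) (g x)) \<in> borel_measurable M"
  unfolding dot2_def by measurable

definition pairing :: "(real \<Rightarrow> complex^2) \<Rightarrow> l2 \<Rightarrow> complex" where
  "pairing c f = (LINT x|lborel. dot2 (c x) (rep_l2 f x))"

lemma pairing_bounded:
  assumes c: "square_integrable c" and C: "C \<ge> 0" "(LINT x|lborel. (norm (c x))\<^sup>2) \<le> C\<^sup>2"
  shows "integrable lborel (\<lambda>x. dot2 (c x) (rep_l2 f x))" "pairing c (f + g) = pairing c f + pairing c g" "pairing c (a *\<^sub>C f) = a * pairing c f"
    "bounded_linear (pairing c)" "cmod (pairing c f) \<le> C * norm f"
proof -
  have [measurable]: "c \<in> borel_measurable borel" and ci: "integrable lborel (\<lambda>x. (norm (c x))\<^sup>2)"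
    using c by (simp_all add: square_integrable_def)
  have nn: "(\<integral>\<^sup>+x. ennreal (cmod (dot2 (c x) (rep_l2 f x))) \<partial>lborel) \<le> ennreal (C * norm f)" for f
  proof -
    have "(\<integral>\<^sup>+x. ennreal (cmod (dot2 (c x) (rep_l2 f x))) \<partial>lborel) \<le> (\<integral>\<^sup>+x. ennreal (norm (c x) * norm (rep_l2 f x)) \<partial>lborel)"
      by (intro nn_integral_mono ennreal_leI norm_dot2_le)
    also have "\<dots> \<le> ennreal (sqrt (LINT x|lborel. (norm (c x))\<^sup>2) * norm f)"
      by (rule nn_integral_rep_product) (use ci in auto)
    also have "\<dots> \<le> ennreal (C * norm f)"
      using C by (intro ennreal_leI mult_right_mono real_le_lsqrt) auto
    finally show ?thesis .
  qed
  have int: "integrable lborel (\<lambda>x. dot2 (c x) (rep_l2 f x))" for f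
    by (rule integrableI_bounded) (use nn[of f] in \<open>auto intro: le_less_trans\<close>)
  show "integrable lborel (\<lambda>x. dot2 (c x) (rep_l2 f x))" by (rule int)
  have add: "pairing c (f + g) = pairing c f + pairing c g" for f g
  proof -
    have "pairing c (f + g) = (LINT x|lborel. dot2 (c x) (rep_l2 f x) + dot2 (c x) (rep_l2 g x))"
      unfolding pairing_def using rep_add[of f g] by (intro integral_cong_AE) (auto elim!: eventually_mono simp: dot2_simps)
    then show ?thesis using int by (simp add: pairing_def)
  qed
  have scale: "pairing c (a *\<^sub>C f) = a * pairing c f" for a f
  proof -
    have "pairing c (a *\<^sub>C f) = (LINT x|lborel. a * dot2 (c x) (rep_l2 f x))"
      unfolding pairing_def using rep_scaleC[of a f] by (intro integral_cong_AE) (auto elim!: eventually_mono simp: dot2_simps)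
    then show ?thesis by (simp add: pairing_def)
  qed
  have bd: "cmod (pairing c f) \<le> C * norm f" for f
  proof -
    have "ennreal (cmod (pairing c f)) \<le> ennreal (C * norm f)"
      unfolding pairing_def by (rule order_trans[OF integral_norm_le_nn nn])
    then show ?thesis using C by (simp add: ennreal_le_iff)
  qed
  show "pairing c (f + g) = pairing c f + pairing c g" "pairing c (a *\<^sub>C f) = a * pairing c f" "cmod (pairing c f) \<le> C * norm f" by (rule add scale bd)+
  show "bounded_linear (pairing c)"
    by (rule bounded_linear_intro[of _ C])
      (use add bd scale[of "of_real r" f for r f] in \<open>auto simp: scaleC_of_real scaleR_conv_of_real mult.commute\<close>)
qed

lemma norm_lead_sq: "(norm (lead m z))\<^sup>2 = 2 * (4 * (cmod z)\<^sup>2 + m\<^sup>2)"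
  unfolding norm_vec2_sq cmod_power2 by (simp add: lead_def power2_eq_square algebra_simps)

lemma Upsilon_nth:
  "Upsilon m z $ i $ j = lead m z $ i * lead m z $ j / of_real (2 * (4 * (cmod z)\<^sup>2 + m\<^sup>2))"
proof -
  have "i = 1 \<or> i = 2" "j = 1 \<or> j = 2" using exhaust_2 by blast+
  then show ?thesis
    by (elim disjE) (simp_all add: Upsilon_def lead_def map_matrix_def power2_eq_square algebra_simps)
qed

lemma frobenius_Upsilon:
  "frobenius_inner W (map_matrix cnj (Upsilon m z))
    = dot2 (lead m z) (W *v lead m z) / of_real (2 * (4 * (cmod z)\<^sup>2 + m\<^sup>2))"
  by (simp add: frobenius_inner_def sum_2 map_matrix_def Upsilon_nth dot2_def mult_vec2_nth
      add_divide_distrib[symmetric]) (simp add: algebra_simps)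

lemma wave_measurable [measurable]: "wave m z \<in> borel_measurable borel"
  unfolding wave_def[abs_def] by measurable

lemma wave_square:
  "wave m z x * wave m z x = exp (- 2 * (of_real \<bar>x\<bar> + \<i> * (z - of_real (m\<^sup>2 / (2 * Re z))) * of_real x))"
  unfolding wave_def exp_add[symmetric] by (simp add: algebra_simps)

text \<open>Here \<open>Q(z) f = Q\<^sub>1 f - b(f) a / \<tau>\<close> with \<open>\<tau> = 4 m / (4 \<bar>z\<bar>\<^sup>2 + m\<^sup>2)\<close>. By the Sherman--Morrison formula
  \<open>1 + Q(z)\<close> fails to be invertible only if \<open>\<tau> = b((1 + Q\<^sub>1)\<^sup>-\<^sup>1 a)\<close>. To leading order the right hand
  side is \<open>b(a)\<close>, the asserted integral; the vectors \<open>a\<close> and \<open>b\<close> are of order \<open>moment W\<^sup>1\<^sup>/\<^sup>2\<close> and \<open>Q\<^sub>1\<close> is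
  of order \<open>moment W\<close>, so the remainder is quadratic.\<close>

lemma strip_equation:
  assumes m: "m > 0"
  obtains C K where "C > 0" "K \<ge> 0" "\<And>W z. weighted W \<Longrightarrow> 48 * C * moment W \<le> 1 / 2 \<Longrightarrow> off_cuts m z \<Longrightarrow>
    \<bar>Im z\<bar> < 1 \<Longrightarrow> m + 1 \<le> \<bar>Re z\<bar> \<Longrightarrow> (\<nexists>F. inverts F (ARBop m W z)) \<Longrightarrow>
    cmod (of_real (4 * m / (4 * (cmod z)\<^sup>2 + m\<^sup>2)) - W_integral m W z) \<le> K * (moment W)\<^sup>2"
proof -
  obtain C where C: "C > 0" and remainder: "\<And>z x y i j. off_cuts m z \<Longrightarrow> \<bar>Im z\<bar> < 1 \<Longrightarrow> m + 1 \<le> \<bar>Re z\<bar> \<Longrightarrow>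
    cmod (green m z x y $ i $ j - (- (lead m z $ i * lead m z $ j) / of_real (8 * m)) * wave m z x * wave m z y)
      \<le> C * ((1 + \<bar>x\<bar>) * (1 + \<bar>y\<bar>))" using green_strip[OF m] by blast
  show thesis
  proof (rule that[OF C, of "24 * (48 * C)"])
    show "0 \<le> 24 * (48 * C)" using C by simp
    fix W z
    assume W: "weighted W" and small: "48 * C * moment W \<le> 1 / 2" and oc: "off_cuts m z"
      and z: "\<bar>Im z\<bar> < 1" "m + 1 \<le> \<bar>Re z\<bar>" and no: "\<nexists>F. inverts F (ARBop m W z)"
    note pot = weighted_potential(1)[OF W]
    have wave1: "cmod (wave m z x) \<le> 1" for x using decay_wave_diff(2)[OF oc m z(1)] z(2) m by simp
    note [measurable] = potential_factors(1,2)[OF pot, simplified]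
    define q where "q = 48 * C * moment W"
    have q: "0 \<le> q" "q < 1" "q \<le> 1 / 2" using small C moment_nonneg[of W] by (auto simp: q_def)
    define S where "S = 2 * (4 * (cmod z)\<^sup>2 + m\<^sup>2)"
    have S: "S > 0" using m by (simp add: S_def add_nonneg_pos)
    define u where "u = complex_of_real (1 / sqrt S) *s lead m z"
    have nu: "norm u = 1"
    proof -
      have "norm (lead m z) = sqrt S" using norm_lead_sq[of m z] S
        by (metis S_def norm_ge_zero real_sqrt_unique)
      then show ?thesis using S by (simp add: u_def norm_smult_vec norm_divide)
    qed
    have leadu: "lead m z = complex_of_real (sqrt S) *s u" using S by (simp add: u_def vector_smult_assoc)
    define G0 where "G0 = (\<lambda>x y. mat2 (- (lead m z $ 1 * lead m z $ 1) / of_real (8 * m) * wave m z x * wave m z y)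
      (- (lead m z $ 1 * lead m z $ 2) / of_real (8 * m) * wave m z x * wave m z y)
      (- (lead m z $ 2 * lead m z $ 1) / of_real (8 * m) * wave m z x * wave m z y)
      (- (lead m z $ 2 * lead m z $ 2) / of_real (8 * m) * wave m z x * wave m z y))"
    have G0_nth: "G0 x y $ i $ j = (- (lead m z $ i * lead m z $ j) / of_real (8 * m)) * wave m z x * wave m z y" for x y i j
      using exhaust_2[of i] exhaust_2[of j] by (elim disjE) (simp_all add: G0_def)
    have G0_v: "G0 x y *v v = (- of_real (S / (8 * m)) * wave m z y * dot2 u v) *s (wave m z x *s u)" for x y v
    proof -
      have "complex_of_real S = of_real (sqrt S) * of_real (sqrt S)"
        using S by (simp flip: of_real_mult)
      then show ?thesis
        using m by (simp add: vec2_eq_iff mult_vec2_nth G0_nth leadu dot2_def field_simps)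
    qed
    define K1 where "K1 = (\<lambda>x y. green m z x y - G0 x y)"
    have K1m: "case_prod K1 \<in> borel_measurable (lborel \<Otimes>\<^sub>M lborel)"
    proof -
      have [measurable]: "(\<lambda>p. green m z (fst p) (snd p)) \<in> borel_measurable (lborel \<Otimes>\<^sub>M lborel)"
        using green_measurable[OF oc] by (simp add: case_prod_unfold)
      show ?thesis unfolding K1_def G0_def case_prod_unfold by measurable
    qed
    have K1le: "cmod (K1 x y $ i $ j) \<le> C * ((1 + \<bar>x\<bar>) * (1 + \<bar>y\<bar>))" for x y i j
      using remainder[OF oc z, of x y i j] by (simp add: K1_def G0_nth)
    define Q1 where "Q1 = kernel_op (\<lambda>x y. Amat (W x) ** K1 x y ** Bmat (W y))"
    obtain D1 where D1: "kernel_bounded (\<lambda>x y. Amat (W x) ** K1 x y ** Bmat (W y)) D1"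
      using weighted_kernel(1)[OF W K1m less_imp_le[OF C] K1le] by blast
    have Q1l: "complex_linear Q1" unfolding Q1_def by (rule kernel_op_complex_linear[OF D1])
    have Q1n: "norm (Q1 f) \<le> q * norm f" for f
      unfolding Q1_def q_def by (rule weighted_kernel(2)[OF W K1m less_imp_le[OF C] K1le])
    obtain F1 where F1: "inverts F1 Q1" and F1d: "\<And>g. norm (F1 g - g) \<le> q * norm g / (1 - q)"
      by (rule Neumann_inverse[OF Q1l q(1,2) Q1n]) blast
    define af where "af = (\<lambda>x. wave m z x *s (Amat (W x) *v u))"
    define cf where "cf = (\<lambda>x. wave m z x *s (transpose (Bmat (W x)) *v u))"
    have afm [measurable]: "af \<in> borel_measurable borel"
    proof -
      have "af = (\<lambda>x. vec2 (wave m z x * (Amat (W x) *v u) $ 1) (wave m z x * (Amat (W x) *v u) $ 2))"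
        by (simp add: af_def fun_eq_iff vec2_eq_iff)
      then show ?thesis by simp
    qed
    have cfm [measurable]: "cf \<in> borel_measurable borel"
    proof -
      have "cf = (\<lambda>x. vec2 (wave m z x * (Bmat (W x) $ 1 $ 1 * u $ 1 + Bmat (W x) $ 2 $ 1 * u $ 2))
          (wave m z x * (Bmat (W x) $ 1 $ 2 * u $ 1 + Bmat (W x) $ 2 $ 2 * u $ 2)))"
        by (simp add: cf_def fun_eq_iff vec2_eq_iff mult_vec2_nth transpose_def)
      then show ?thesis by simp
    qed
    have afn: "(norm (af x))\<^sup>2 \<le> ((1 + \<bar>x\<bar>) * norm (Amat (W x)))\<^sup>2" for x
    proof (rule power_mono)
      have "norm (af x) \<le> 1 * (norm (Amat (W x)) * norm u)"
        unfolding af_def norm_smult_vec by (intro mult_mono wave1 norm_matrix_vector_le) auto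
      also have "\<dots> \<le> (1 + \<bar>x\<bar>) * norm (Amat (W x))" unfolding nu by (simp add: mult_left_le_one_le distrib_right)
      finally show "norm (af x) \<le> (1 + \<bar>x\<bar>) * norm (Amat (W x))" .
    qed simp
    have cfn: "(norm (cf x))\<^sup>2 \<le> ((1 + \<bar>x\<bar>) * norm (Bmat (W x)))\<^sup>2" for x
    proof (rule power_mono)
      have nt: "norm (transpose (Bmat (W x))) = norm (Bmat (W x))"
        by (rule power2_eq_imp_eq) (simp_all add: norm_mat2_sq transpose_def)
      have "norm (cf x) \<le> 1 * (norm (transpose (Bmat (W x))) * norm u)"
        unfolding cf_def norm_smult_vec by (intro mult_mono wave1 norm_matrix_vector_le) auto
      also have "\<dots> \<le> (1 + \<bar>x\<bar>) * norm (Bmat (W x))" unfolding nu nt by (simp add: mult_left_le_one_le distrib_right)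
      finally show "norm (cf x) \<le> (1 + \<bar>x\<bar>) * norm (Bmat (W x))" .
    qed simp
    note fm = factor_moments[OF W]
    have afi: "integrable lborel (\<lambda>x. (norm (af x))\<^sup>2)"
      by (rule Bochner_Integration.integrable_bound[OF fm(1)]) (use afn in auto)
    have cfi: "integrable lborel (\<lambda>x. (norm (cf x))\<^sup>2)"
      by (rule Bochner_Integration.integrable_bound[OF fm(2)]) (use cfn in auto)
    have af: "square_integrable af" and cf: "square_integrable cf"
      using afi cfi by (simp_all add: square_integrable_def)
    define a where "a = abs_l2 af"
    have an: "norm a \<le> sqrt (3 / 2 * moment W)"
    proof (rule real_le_rsqrt)
      have "(norm a)\<^sup>2 \<le> (LINT x|lborel. ((1 + \<bar>x\<bar>) * norm (Amat (W x)))\<^sup>2)"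
        unfolding a_def norm_abs_l2_sq[OF af] by (rule integral_mono[OF afi fm(1) afn])
      then show "(norm a)\<^sup>2 \<le> 3 / 2 * moment W" using fm(3) by linarith
    qed
    define b where "b = pairing cf"
    have cb: "(LINT x|lborel. (norm (cf x))\<^sup>2) \<le> (sqrt (96 * moment W))\<^sup>2"
      using integral_mono[OF cfi fm(2) cfn] fm(4) moment_nonneg[of W] by simp
    have sq0: "0 \<le> sqrt (96 * moment W)" using moment_nonneg[of W] by simp
    note bp = pairing_bounded[OF cf sq0 cb, folded b_def]
    define l where "l = (\<lambda>f. - of_real (S / (8 * m)) * b f)"
    have lp: "l (f + g) = l f + l g" "l (c *\<^sub>C f) = c * l f" for f g c
      unfolding l_def bp(2) bp(3) by (rule distrib_left, rule mult.left_commute)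
    have ll: "bounded_linear l"
      unfolding l_def by (rule bounded_linear_const_mult[OF bp(4)])
    have split: "ARBop m W z f = Q1 f + l f *\<^sub>C a" for f
    proof (rule l2_eqI)
      obtain D where D: "kernel_bounded (\<lambda>x y. Amat (W x) ** green m z x y ** Bmat (W y)) D"
        using kernels_bounded(3)[OF oc pot] by blast
      show "AE x in lborel. rep_l2 (ARBop m W z f) x = rep_l2 (Q1 f + l f *\<^sub>C a) x"
        using kernel_op_rep(2)[OF D, of f] kernel_op_rep(2)[OF D1, of f] rep_add[of "Q1 f" "l f *\<^sub>C a"]
          rep_scaleC[of "l f" a] rep_abs_l2[OF af, folded a_def]
        unfolding ARBop_def[symmetric] Q1_def[symmetric]
      proof eventually_elim
        case (elim x)
        let ?k = "- of_real (S / (8 * m)) :: complex"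
        have pw: "(Amat (W x) ** green m z x y ** Bmat (W y)) *v v
          = (Amat (W x) ** K1 x y ** Bmat (W y)) *v v + (?k * dot2 (cf y) v) *s af x" for y v
        proof -
          have "green m z x y = K1 x y + G0 x y" by (simp add: K1_def)
          then have "(Amat (W x) ** green m z x y ** Bmat (W y)) *v v
            = Amat (W x) *v (K1 x y *v (Bmat (W y) *v v)) + Amat (W x) *v (G0 x y *v (Bmat (W y) *v v))"
            by (simp add: matrix_vector_mul_assoc[symmetric] matrix_vector_mult_add_rdistrib matrix_vector_simps)
          moreover have "Amat (W x) *v (G0 x y *v (Bmat (W y) *v v)) = (?k * dot2 (cf y) v) *s af x"
            unfolding G0_v cf_def af_def by (simp only: dot2_simps matrix_vector_simps vector_smult_assoc mult_ac)
          ultimately show ?thesis by (simp add: matrix_vector_mul_assoc[symmetric])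
        qed
        have i1: "integrable lborel (\<lambda>y. (Amat (W x) ** K1 x y ** Bmat (W y)) *v rep_l2 f y)"
          using D1 by (simp add: kernel_bounded_def)
        have bl: "bounded_linear (\<lambda>c::complex. c *s af x)"
          by (rule bounded_linear_intro[of _ "norm (af x)"])
            (simp_all add: norm_smult_vec vector_sadd_rdistrib scaleR_eq_smult_vec scaleR_conv_of_real)
        have i2: "integrable lborel (\<lambda>y. ?k * dot2 (cf y) (rep_l2 f y))" by (intro integrable_mult_right bp(1))
        have "rep_l2 (ARBop m W z f) x = (LINT y|lborel. (Amat (W x) ** K1 x y ** Bmat (W y)) *v rep_l2 f y)
            + (LINT y|lborel. (?k * dot2 (cf y) (rep_l2 f y)) *s af x)"
          unfolding elim(1) pw by (rule Bochner_Integration.integral_add[OF i1 integrable_bounded_linear[OF bl i2]])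
        also have "(LINT y|lborel. (?k * dot2 (cf y) (rep_l2 f y)) *s af x) = l f *s af x"
          unfolding integral_bounded_linear[OF bl i2] by (simp add: l_def b_def pairing_def)
        finally show ?case using elim by simp
      qed
    qed
    have "1 + l (F1 a) = 0"
    proof (rule ccontr)
      assume "1 + l (F1 a) \<noteq> 0"
      from rank_one_inverse[OF Q1l F1 lp ll this] no show False unfolding split[symmetric] by simp
    qed
    then have eq: "b (F1 a) = of_real (4 * m / (4 * (cmod z)\<^sup>2 + m\<^sup>2))"
    proof -
      have "of_real (S / (8 * m)) * b (F1 a) = 1" using \<open>1 + l (F1 a) = 0\<close> by (simp add: l_def)
      then have "b (F1 a) = of_real (8 * m / S)" using S m by (simp add: field_simps)
      also have "8 * m / S = 4 * m / (4 * (cmod z)\<^sup>2 + m\<^sup>2)" using mult_divide_mult_cancel_left[of 2 "4 * m" "4 * (cmod z)\<^sup>2 + m\<^sup>2"] by (simp add: S_def)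
      finally show ?thesis .
    qed
    have main: "b a = W_integral m W z"
    proof -
      have "b a = (LINT x|lborel. dot2 (cf x) (af x))"
        unfolding b_def pairing_def a_def using rep_abs_l2[OF af] by (intro integral_cong_AE) (auto elim!: eventually_mono)
      also have "\<dots> = W_integral m W z"
        unfolding W_integral_def
      proof (rule Bochner_Integration.integral_cong[OF refl])
        fix x
        have "dot2 (cf x) (af x) = (wave m z x * wave m z x) * dot2 u (W x *v u)"
          unfolding cf_def af_def dot2_simps matrix_vector_mul_assoc Bmat_mult_Amat by (simp add: mult_ac)
        also have "dot2 u (W x *v u) = dot2 (lead m z) (W x *v lead m z) / of_real S"
        proof -
          have "complex_of_real S = of_real (sqrt S) * of_real (sqrt S)"
            using S by (simp flip: of_real_mult)
          then show ?thesis using S unfolding leadu by (simp add: dot2_simps matrix_vector_simps)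
        qed
        finally show "dot2 (cf x) (af x) = exp (- 2 * (of_real \<bar>x\<bar> + \<i> * (z - of_real (m\<^sup>2 / (2 * Re z))) * of_real x))
            * frobenius_inner (W x) (map_matrix cnj (Upsilon m z))"
          unfolding wave_square frobenius_Upsilon S_def .
      qed
      finally show ?thesis .
    qed
    have "b (F1 a) - b a = b (F1 a - a)" using bp(4) by (simp add: linear_simps)
    then have "cmod (b (F1 a) - b a) \<le> sqrt (96 * moment W) * norm (F1 a - a)" using bp(5) by simp
    also have "\<dots> \<le> sqrt (96 * moment W) * (2 * q * sqrt (3 / 2 * moment W))"
    proof (rule mult_left_mono[OF _ sq0])
      have "norm (F1 a - a) \<le> q * norm a / (1 - q)" by (rule F1d)
      also have "\<dots> \<le> q * norm a / (1 / 2)" using q by (intro divide_left_mono) auto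
      also have "\<dots> = 2 * q * norm a" by simp
      also have "\<dots> \<le> 2 * q * sqrt (3 / 2 * moment W)" using q an by (intro mult_left_mono) auto
      finally show "norm (F1 a - a) \<le> 2 * q * sqrt (3 / 2 * moment W)" .
    qed
    also have "\<dots> = 24 * (48 * C) * (moment W)\<^sup>2"
    proof -
      have "sqrt (96 * moment W) * sqrt (3 / 2 * moment W) = sqrt ((12 * moment W)\<^sup>2)"
        by (simp only: real_sqrt_mult[symmetric]) (simp add: power2_eq_square)
      also have "\<dots> = 12 * moment W" unfolding real_sqrt_abs using moment_nonneg[of W] by simp
      finally have "sqrt (96 * moment W) * (2 * q * sqrt (3 / 2 * moment W)) = 2 * q * (12 * moment W)"
        by (simp add: mult_ac)
      then show ?thesis by (simp add: q_def power2_eq_square)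
    qed
    finally show "cmod (of_real (4 * m / (4 * (cmod z)\<^sup>2 + m\<^sup>2)) - W_integral m W z) \<le> 24 * (48 * C) * (moment W)\<^sup>2"
      unfolding eq main .
  qed
qed

section \<open>The discrete spectrum\<close>

lemma integrable_nu2:
  fixes V :: "real \<Rightarrow> complex^2^2"
  assumes "integrable nu2 V"
  shows "weighted V"
proof -
  have "V \<in> borel_measurable nu2" using assms by (rule borel_measurable_integrable)
  then have V [measurable]: "V \<in> borel_measurable borel" by (simp add: nu2_def)
  have "integrable lborel (\<lambda>x. (1 + x\<^sup>2) *\<^sub>R V x)"
    using assms unfolding nu2_def by (subst (asm) integrable_density) auto
  then have "integrable lborel (\<lambda>x. 2 * norm ((1 + x\<^sup>2) *\<^sub>R V x))"
    by (intro integrable_mult_right integrable_norm)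
  note i = this
  have w: "(1 + \<bar>x\<bar>)\<^sup>2 \<le> 2 * (1 + x\<^sup>2)" for x :: real
    using zero_le_power2[of "1 - \<bar>x\<bar>"] by (simp add: power2_sum power2_diff)
  have le: "(1 + \<bar>x\<bar>)\<^sup>2 * norm (V x) \<le> 2 * norm ((1 + x\<^sup>2) *\<^sub>R V x)" for x
  proof -
    have "norm ((1 + x\<^sup>2) *\<^sub>R V x) = (1 + x\<^sup>2) * norm (V x)" by simp
    with mult_right_mono[OF w[of x] norm_ge_zero[of "V x"]] show ?thesis
      by (simp only: mult.assoc)
  qed
  have "norm ((1 + \<bar>x\<bar>)\<^sup>2 * norm (V x)) \<le> norm (2 * norm ((1 + x\<^sup>2) *\<^sub>R V x))" for x
  proof -
    have "norm ((1 + \<bar>x\<bar>)\<^sup>2 * norm (V x)) = (1 + \<bar>x\<bar>)\<^sup>2 * norm (V x)" by simp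
    also note le[of x]
    also have "2 * norm ((1 + x\<^sup>2) *\<^sub>R V x) = norm (2 * norm ((1 + x\<^sup>2) *\<^sub>R V x))" by simp
    finally show ?thesis .
  qed
  then have "integrable lborel (\<lambda>x. (1 + \<bar>x\<bar>)\<^sup>2 * norm (V x))"
    by (intro Bochner_Integration.integrable_bound[OF i] AE_I2) simp_all
  then show ?thesis by (simp add: weighted_def)
qed

lemma scaled_potential:
  fixes V :: "real \<Rightarrow> complex^2^2" and e :: complex
  assumes V: "weighted V"
  defines "W \<equiv> \<lambda>x. map_matrix ((*) e) (V x)"
  shows "weighted W" "moment W = cmod e * moment V" "W_integral m W z = e * W_integral m V z"
proof -
  have [measurable]: "V \<in> borel_measurable borel" and i: "integrable lborel (\<lambda>x. (1 + \<bar>x\<bar>)\<^sup>2 * norm (V x))"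
    using V by (simp_all add: weighted_def)
  have nW: "norm (W x) = cmod e * norm (V x)" for x
    by (rule power2_eq_imp_eq)
      (simp_all add: norm_mat2_sq W_def map_matrix_def norm_mult power_mult_distrib algebra_simps)
  have eq: "W = (\<lambda>x. mat2 (e * V x $ 1 $ 1) (e * V x $ 1 $ 2) (e * V x $ 2 $ 1) (e * V x $ 2 $ 2))"
    by (simp add: W_def map_matrix_def fun_eq_iff mat2_eq_iff)
  have [measurable]: "W \<in> borel_measurable borel" unfolding eq by measurable
  have eqn: "(1 + \<bar>x\<bar>)\<^sup>2 * norm (W x) = cmod e * ((1 + \<bar>x\<bar>)\<^sup>2 * norm (V x))" for x
    unfolding nW by (rule mult.left_commute)
  show "weighted W" "moment W = cmod e * moment V"
    unfolding weighted_def moment_def eqn using i by simp_all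
  have f: "frobenius_inner (W x) Y = e * frobenius_inner (V x) Y" for x Y
    by (simp add: frobenius_inner_def W_def map_matrix_def sum_distrib_left mult.assoc)
  show "W_integral m W z = e * W_integral m V z"
    unfolding W_integral_def f by (simp add: mult.left_commute[of _ e])
qed

text \<open>Any point with \<open>\<bar>Im z\<bar> > 1\<close> would do as the admissible point that determines the operator.\<close>

lemma off_cuts_2i: "m > 0 \<Longrightarrow> off_cuts m (2 * \<i>)"
  using not_off_cuts[of m "2 * \<i>"] by auto

theorem theorem5p2:
  fixes m :: real and V :: "real \<Rightarrow> complex^2^2"
  assumes "m > 0" and "integrable nu2 V"
  shows "\<exists>K>0. \<exists>\<epsilon>0>0. \<forall>\<epsilon>::complex. 0 < cmod \<epsilon> \<and> cmod \<epsilon> < \<epsilon>0 \<longrightarrow>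
    discrete_spectrum (L_pert m (\<lambda>x. map_matrix ((*) \<epsilon>) (V x))) \<subseteq>
      {z. \<bar>Im z\<bar> < 1 \<and> Re z \<noteq> 0 \<and>
          (\<exists>W. of_real (4 * m / (4 * (cmod z)\<^sup>2 + m\<^sup>2)) = W \<and>
               cmod (W - \<epsilon> * W_integral m V z) \<le> K * (cmod \<epsilon>)\<^sup>2)}"
proof -
  note m = assms(1)
  have V: "weighted V" by (rule integrable_nu2[OF assms(2)])
  obtain C1 where C1: "C1 > 0" and inv: "\<And>W z. weighted W \<Longrightarrow> 48 * C1 * moment W < 1 \<Longrightarrow> off_cuts m z \<Longrightarrow>
    \<not> (\<bar>Im z\<bar> < 1 \<and> m + 1 \<le> \<bar>Re z\<bar>) \<Longrightarrow> \<exists>F. inverts F (ARBop m W z)"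
    using invertible_away_from_strip[OF m] by blast
  obtain C2 K where C2: "C2 > 0" "K \<ge> 0" and strip: "\<And>W z. weighted W \<Longrightarrow> 48 * C2 * moment W \<le> 1 / 2 \<Longrightarrow> off_cuts m z \<Longrightarrow>
    \<bar>Im z\<bar> < 1 \<Longrightarrow> m + 1 \<le> \<bar>Re z\<bar> \<Longrightarrow> (\<nexists>F. inverts F (ARBop m W z)) \<Longrightarrow>
    cmod (of_real (4 * m / (4 * (cmod z)\<^sup>2 + m\<^sup>2)) - W_integral m W z) \<le> K * (moment W)\<^sup>2"
    using strip_equation[OF m] by blast
  define N where "N = 96 * (C1 + C2) * (moment V + 1)"
  have N: "N > 0" using C1 C2 moment_nonneg[of V] by (simp add: N_def add_nonneg_pos)
  have pos: "0 < K * (moment V)\<^sup>2 + 1" "0 < 1 / N" using C2(2) N by (simp_all add: add_nonneg_pos)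
  show ?thesis
  proof (rule exI[of _ "K * (moment V)\<^sup>2 + 1"], rule conjI[OF pos(1)], rule exI[of _ "1 / N"], rule conjI[OF pos(2)],
      intro allI impI subsetI)
    fix \<epsilon> :: complex and z
    assume \<epsilon>: "0 < cmod \<epsilon> \<and> cmod \<epsilon> < 1 / N"
    let ?W = "\<lambda>x. map_matrix ((*) \<epsilon>) (V x)"
    assume disc: "z \<in> discrete_spectrum (L_pert m ?W)"
    note W = scaled_potential[OF V, where e = \<epsilon>]
    note pot = weighted_potential(1)[OF W(1)]
    have small: "48 * C1 * moment ?W < 1" "48 * C2 * moment ?W \<le> 1 / 2"
    proof -
      have "cmod \<epsilon> * N < 1" using \<epsilon> N by (simp add: pos_less_divide_eq)
      moreover have "96 * C * (cmod \<epsilon> * moment V) \<le> cmod \<epsilon> * N" if "C = C1 \<or> C = C2" for C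
      proof -
        have "C * moment V \<le> (C1 + C2) * (moment V + 1)"
          using that C1 C2 moment_nonneg[of V] by (intro mult_mono) auto
        then have "cmod \<epsilon> * (96 * (C * moment V)) \<le> cmod \<epsilon> * (96 * ((C1 + C2) * (moment V + 1)))"
          by (intro mult_left_mono) auto
        then show ?thesis by (simp only: N_def mult_ac)
      qed
      ultimately have "96 * C1 * moment ?W < 1" "96 * C2 * moment ?W < 1" unfolding W(2) by fastforce+
      then show "48 * C1 * moment ?W < 1" "48 * C2 * moment ?W \<le> 1 / 2" by linarith+
    qed
    have oc0: "off_cuts m (2 * \<i>)" by (rule off_cuts_2i[OF m])
    obtain F0 where F0: "inverts F0 (ARBop m ?W (2 * \<i>))" using inv[OF W(1) small(1) oc0] by auto
    have "resolvent (L_op m) (2 * \<i>) = graph_of (Blinfun (Rop m (2 * \<i>)))"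
      unfolding resolvent_L_op[OF oc0 m]
      by (rule graph_of_Blinfun[symmetric, OF complex_linearD(1)[OF Rop_complex_linear[OF oc0]]])
    then have z0: "2 * \<i> \<in> resolvent_set (L_op m)" by (auto simp: resolvent_set_def)
    have z0': "- 1 \<in> resolvent_set (Q_op m ?W (2 * \<i>))"
      unfolding factor_graphs(3)[OF oc0 m pot] minus_one_in_resolvent_set_iff using F0 by blast
    note props = L_pert_properties[OF m pot z0 z0']
    note line = lines_in_spectrum[OF m pot oc0 F0 conjunct2[OF props[OF oc0 F0]]]
    obtain r where r: "r > 0" "cball z r \<inter> spectrum (L_pert m ?W) = {z}"
      using disc by (auto simp: discrete_spectrum_def)
    have oc: "off_cuts m z"
    proof (rule ccontr)
      assume "\<not> off_cuts m z"
      then have l: "(Im z = 1 \<or> Im z = -1) \<and> m \<le> \<bar>Re z\<bar>" by (rule not_off_cuts[OF m])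
      \<comment> \<open>A neighbour of \<open>z\<close> on the same line, farther from the imaginary axis.\<close>
      define z' where "z' = z + of_real (r * (if 0 \<le> Re z then 1 else -1))"
      have "z' \<in> spectrum (L_pert m ?W)" using l r(1) by (intro line) (auto simp: z'_def)
      moreover have "z' \<in> cball z r" using r(1) by (simp add: z'_def dist_norm)
      ultimately have "z' = z" using r(2) by blast
      then show False using r(1) by (simp add: z'_def split: if_splits)
    qed
    have "z \<in> spectrum (L_pert m ?W)" using r by blast
    then have no: "\<nexists>F. inverts F (ARBop m ?W z)"
      using props[OF oc] by (auto simp: spectrum_def)
    then have s: "\<bar>Im z\<bar> < 1" "m + 1 \<le> \<bar>Re z\<bar>" using inv[OF W(1) small(1) oc] by blast+
    have "cmod (of_real (4 * m / (4 * (cmod z)\<^sup>2 + m\<^sup>2)) - \<epsilon> * W_integral m V z) \<le> K * (moment ?W)\<^sup>2"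
      using strip[OF W(1) small(2) oc s no] unfolding W(3) .
    also have "\<dots> = (K * (moment V)\<^sup>2) * (cmod \<epsilon>)\<^sup>2" unfolding W(2) by (simp add: power_mult_distrib mult_ac)
    also have "\<dots> \<le> (K * (moment V)\<^sup>2 + 1) * (cmod \<epsilon>)\<^sup>2" by (intro mult_right_mono) auto
    finally show "z \<in> {z. \<bar>Im z\<bar> < 1 \<and> Re z \<noteq> 0 \<and>
          (\<exists>W. of_real (4 * m / (4 * (cmod z)\<^sup>2 + m\<^sup>2)) = W \<and>
               cmod (W - \<epsilon> * W_integral m V z) \<le> (K * (moment V)\<^sup>2 + 1) * (cmod \<epsilon>)\<^sup>2)}"
      using s m by auto
  qed
qed

end
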